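(* (a) For any $J\in\mathrm{MC}_{nd}(C)$, the image $\mathrm{im}(\tilde f_{J,x_0}:\mathrm{Sh}(\mathrm H_C)\to\mathcal O_{hol}(\tilde C))$ is independent of $x_0\in\tilde C$ (it is denoted $\mathcal H_C(J)$). (b) Let $(J,x_0)\in\mathrm{MC}_{nd}(C)\times\tilde C$. The map $f_{J,x_0}:\mathrm{Sh}(\mathrm H_C)\otimes\mathcal O(C)\to\mathcal O_{hol}(\tilde C)$, $a\otimes f\mapsto p^*(f)\cdot\tilde f_{J,x_0}(a)$, induces an algebra isomorphism $f_{J,x_0}:\mathrm{Sh}(\mathrm H_C)\otimes\mathcal O(C)\to A_C$.
   Context: The base field is $\mathbb C$. $C$ is a smooth connected complex affine algebraic curve, also viewed as a Riemann surface; $p:\tilde C\to C$ is a universal cover; $\mathcal O(C)$ is the algebra of regular functions and $\Omega(C)$ the space of regular (algebraic) differentials on $C$; $\mathrm H_C:=\Omega(C)/d\mathcal O(C)$ (finite dimensional, equal to $\mathrm H^1_{\mathrm{dR}}(C)$). $\mathcal O_{hol}(\tilde C)$ is the algebra of holomorphic functions on $\tilde C$; $p^*:\mathcal O(C)\to\mathcal O_{hol}(\tilde C)$ is injective. Shuffle algebra: for a vector space $V$, $\mathrm{Sh}(V)=\oplus_{n\ge0}V^{\otimes n}$ with the commutative shuffle product; $v_1\otimes\cdots\otimes v_n$ is written $[v_1|\cdots|v_n]$. Maurer-Cartan elements: $\mathfrak g$ is the free Lie algebra on $\mathrm H_C^*$, graded with $\mathrm H_C^*$ in degree 1, and $\hat{\mathfrak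 g}=\prod_{n\ge1}\mathfrak g[n]$. A Maurer-Cartan element is any $J\in\Omega(C)\hat\otimes\hat{\mathfrak g}:=\prod_{n\geq1}\Omega(C)\otimes\mathfrak g[n]$. It is non-degenerate iff the image of its degree 1 component under $\Omega(C)\otimes\mathrm H_C^*\to\mathrm H_C\otimes\mathrm H_C^*$ is the identity element. $\mathrm{MC}_{nd}(C)$ is the set of non-degenerate ones. For $(J,x_0)\in\mathrm{MC}_{nd}(C)\times\tilde C$, $\mathbf L_{J,x_0}:\tilde C\to\exp(\hat{\mathfrak g})$ (the group of group-like elements of $(U\mathfrak g)^\wedge=\prod_{n\geq0}(\mathrm H_C^* )^{\otimes n}$) is the unique smooth function (it is in fact holomorphic) such that $d\mathbf L_{J,x_0}=\mathbf L_{J,x_0}\cdot J$ ($J$ being pulled back to $\tilde C$) and $\mathbf L_{J,x_0}(x_0)=1$. The pairing $\langle\,,\rangle:\mathrm{Sh}(\mathrm H_C)\times(U\mathfrak g)^\wedge\to\mathbb C$ is the degree-wise duality between $\mathrm H_C^{\otimes n}$ and $(\mathrm H_C^* )^{\otimes n}$. One sets $\tilde f_{J,x_0}(a):=(\tilde C\ni x\mapsto\langle a,\mathbf L_{J,x_0}(x)\rangle)$ for $a\in\mathrm{Sh}(\mathrm H_C)$. A stable subalgebra (SSA) of $\mathcal O_{hol}(\tilde C)$ is a unital subalgebra $A$ such that for any $f\in A$, $\omega\in\Omega(C)$, $z_0\in\tilde C$, the function $z\mapsto\int_{z_0}^z f\,p^*\omega$ belongs to $A$. $A_C$ is the intersection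 of all SSAs of $\mathcal O_{hol}(\tilde C)$ (the minimal stable subalgebra). *)

theory Defs
  imports
    "HOL-Analysis.Analysis"
    "HOL-Algebra.QuotRing"
    "HOL-Algebra.Module"
    "HOL-Algebra.Subrings"
    "HOL-Library.Poly_Mapping"
begin

section \<open>Vector spaces and algebras over the complex numbers\<close>

text \<open>
  A complex vector space or algebra is a record of type \<open>(complex, 'v) module\<close>, a module over
  the ring record \<open>complex_ring\<close>.  For vector spaces that are not algebras the fields
  \<open>mult\<close> and \<open>one\<close> carry no meaning.
\<close>

definition complex_ring :: "complex ring" where
  "complex_ring = \<lparr>carrier = UNIV, mult = (*), one = 1, zero = 0, add = (+)\<rparr>"

definition lin_span :: "(complex, 'v) module \<Rightarrow> 'v set \<Rightarrow> 'v set" where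
  "lin_span M S = \<Inter>{N. submodule N complex_ring M \<and> S \<subseteq> N}"

text \<open>
  The quotient of \<open>M\<close> by a subspace \<open>N\<close>; the product is the one of the quotient ring
  \<open>M Quot N\<close>.
\<close>

definition quot_alg :: "(complex, 'v) module \<Rightarrow> 'v set \<Rightarrow> (complex, 'v set) module" where
  "quot_alg M N =
    \<lparr>carrier = a_rcosets\<^bsub>M\<^esub> N, mult = rcoset_mult M N, one = N +>\<^bsub>M\<^esub> \<one>\<^bsub>M\<^esub>,
     zero = N, add = set_add M, smult = (\<lambda>c X. \<Union>x\<in>X. N +>\<^bsub>M\<^esub> (c \<odot>\<^bsub>M\<^esub> x))\<rparr>"

definition alg_iso ::
    "(complex, 'a) module \<Rightarrow> (complex, 'b) module \<Rightarrow> ('a \<Rightarrow> 'b) set" where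
  "alg_iso A B = {F \<in> ring_iso A B. \<forall>c. \<forall>x \<in> carrier A. F (c \<odot>\<^bsub>A\<^esub> x) = c \<odot>\<^bsub>B\<^esub> F x}"

text \<open>
  The vector space with basis \<open>X\<close>, with the bilinear product given by \<open>m\<close> on basis elements
  and with the basis element \<open>e\<close> as unit.
\<close>

definition pm_scale :: "complex \<Rightarrow> ('x \<Rightarrow>\<^sub>0 complex) \<Rightarrow> ('x \<Rightarrow>\<^sub>0 complex)" where
  "pm_scale c = Poly_Mapping.map ((*) c)"

definition free_alg ::
    "'x set \<Rightarrow> 'x \<Rightarrow> ('x \<Rightarrow> 'x \<Rightarrow> ('x \<Rightarrow>\<^sub>0 complex)) \<Rightarrow> (complex, 'x \<Rightarrow>\<^sub>0 complex) module" where
  "free_alg X e m =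
    \<lparr>carrier = {r. Poly_Mapping.keys r \<subseteq> X},
     mult = (\<lambda>r s. \<Sum>x\<in>Poly_Mapping.keys r. \<Sum>y\<in>Poly_Mapping.keys s.
               pm_scale (Poly_Mapping.lookup r x * Poly_Mapping.lookup s y) (m x y)),
     one = Poly_Mapping.single e 1, zero = 0, add = (+), smult = pm_scale\<rparr>"


section \<open>Tensor product of two algebras\<close>

definition tensor_free ::
    "(complex, 'a) module \<Rightarrow> (complex, 'b) module \<Rightarrow> (complex, 'a \<times> 'b \<Rightarrow>\<^sub>0 complex) module" where
  "tensor_free A B = free_alg (carrier A \<times> carrier B) (\<one>\<^bsub>A\<^esub>, \<one>\<^bsub>B\<^esub>)
     (\<lambda>(a, b) (a', b'). Poly_Mapping.single (a \<otimes>\<^bsub>A\<^esub> a', b \<otimes>\<^bsub>B\<^esub> b') 1)"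

definition tensor_rels ::
    "(complex, 'a) module \<Rightarrow> (complex, 'b) module \<Rightarrow> ('a \<times> 'b \<Rightarrow>\<^sub>0 complex) set" where
  "tensor_rels A B = lin_span (tensor_free A B)
    ({Poly_Mapping.single (a \<oplus>\<^bsub>A\<^esub> a', b) 1 - Poly_Mapping.single (a, b) 1
        - Poly_Mapping.single (a', b) 1 | a a' b.
        a \<in> carrier A \<and> a' \<in> carrier A \<and> b \<in> carrier B}
     \<union> {Poly_Mapping.single (a, b \<oplus>\<^bsub>B\<^esub> b') 1 - Poly_Mapping.single (a, b) 1
        - Poly_Mapping.single (a, b') 1 | a b b'.
        a \<in> carrier A \<and> b \<in> carrier B \<and> b' \<in> carrier B}
     \<union> {Poly_Mapping.single (c \<odot>\<^bsub>A\<^esub> a, b) 1 - Poly_Mapping.single (a, b) c | c a b.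
        a \<in> carrier A \<and> b \<in> carrier B}
     \<union> {Poly_Mapping.single (a, c \<odot>\<^bsub>B\<^esub> b) 1 - Poly_Mapping.single (a, b) c | c a b.
        a \<in> carrier A \<and> b \<in> carrier B})"

definition tensor_alg ::
    "(complex, 'a) module \<Rightarrow> (complex, 'b) module
      \<Rightarrow> (complex, ('a \<times> 'b \<Rightarrow>\<^sub>0 complex) set) module" where
  "tensor_alg A B = quot_alg (tensor_free A B) (tensor_rels A B)"

definition pure_tensor ::
    "(complex, 'a) module \<Rightarrow> (complex, 'b) module \<Rightarrow> 'a \<Rightarrow> 'b \<Rightarrow> ('a \<times> 'b \<Rightarrow>\<^sub>0 complex) set" where
  "pure_tensor A B a b =
     tensor_rels A B +>\<^bsub>tensor_free A B\<^esub> Poly_Mapping.single (a, b) 1"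


section \<open>The shuffle algebra of a vector space\<close>

text \<open>
  The shuffles of two words, listed with multiplicity (unlike the set \<open>List.shuffles\<close>).
\<close>

fun shuffle_list :: "'a list \<Rightarrow> 'a list \<Rightarrow> 'a list list" where
  "shuffle_list [] ys = [ys]"
| "shuffle_list xs [] = [xs]"
| "shuffle_list (x # xs) (y # ys) =
     map ((#) x) (shuffle_list xs (y # ys)) @ map ((#) y) (shuffle_list (x # xs) ys)"

text \<open>
  The direct sum of all tensor powers of \<open>V\<close> is the free vector space on the words in the elements
  of \<open>V\<close> modulo multilinearity in each letter; the class of the word \<open>[v1, ..., vn]\<close> is
  the tensor \<open>[v1|...|vn]\<close>.  The relations form an ideal for the shuffle product of words.
\<close>

definition shuffle_free :: "(complex, 'v) module \<Rightarrow> (complex, 'v list \<Rightarrow>\<^sub>0 complex) module" where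
  "shuffle_free V = free_alg (lists (carrier V)) []
     (\<lambda>u v. \<Sum>w\<leftarrow>shuffle_list u v. Poly_Mapping.single w 1)"

definition shuffle_rels :: "(complex, 'v) module \<Rightarrow> ('v list \<Rightarrow>\<^sub>0 complex) set" where
  "shuffle_rels V = lin_span (shuffle_free V)
    ({Poly_Mapping.single (u @ (x \<oplus>\<^bsub>V\<^esub> y) # w) 1 - Poly_Mapping.single (u @ x # w) 1
        - Poly_Mapping.single (u @ y # w) 1 | u x y w.
        u \<in> lists (carrier V) \<and> w \<in> lists (carrier V) \<and> x \<in> carrier V \<and> y \<in> carrier V}
     \<union> {Poly_Mapping.single (u @ (c \<odot>\<^bsub>V\<^esub> x) # w) 1 - Poly_Mapping.single (u @ x # w) c | c u x w.
        u \<in> lists (carrier V) \<and> w \<in> lists (carrier V) \<and> x \<in> carrier V})"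

definition Sh :: "(complex, 'v) module \<Rightarrow> (complex, ('v list \<Rightarrow>\<^sub>0 complex) set) module" where
  "Sh V = quot_alg (shuffle_free V) (shuffle_rels V)"


section \<open>Completed tensor algebra of the dual, and the free Lie algebra on the dual\<close>

text \<open>
  An element of a tensor power of the dual of \<open>V\<close> is identified with the multilinear form on \<open>V\<close>
  that it defines; this embeds the \<open>n\<close>-th tensor power into the functions on words of
  length \<open>n\<close>.  Functions are extended by \<open>0\<close> outside their domain.  A family
  of elements, one in each tensor power, is then a single function on all words.
\<close>

definition dual_space :: "(complex, 'v) module \<Rightarrow> ('v \<Rightarrow> complex) set" where
  "dual_space V = {\<xi>.
     (\<forall>x \<in> carrier V. \<forall>y \<in> carrier V. \<xi> (x \<oplus>\<^bsub>V\<^esub> y) = \<xi> x + \<xi> y) \<and>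
     (\<forall>c. \<forall>x \<in> carrier V. \<xi> (c \<odot>\<^bsub>V\<^esub> x) = c * \<xi> x) \<and>
     (\<forall>x. x \<notin> carrier V \<longrightarrow> \<xi> x = 0)}"

definition word_form :: "('v \<Rightarrow> complex) list \<Rightarrow> 'v list \<Rightarrow> complex" where
  "word_form \<xi>s hs =
     (if length hs = length \<xi>s then \<Prod>i<length hs. (\<xi>s ! i) (hs ! i) else 0)"

definition dual_tensor_power :: "(complex, 'v) module \<Rightarrow> nat \<Rightarrow> ('v list \<Rightarrow> complex) set" where
  "dual_tensor_power V n = {\<phi>. \<exists>(m::nat) c \<xi>.
     (\<forall>k<m. length (\<xi> k) = n \<and> set (\<xi> k) \<subseteq> dual_space V) \<and>
     \<phi> = (\<lambda>hs. \<Sum>k<m. c k * word_form (\<xi> k) hs)}"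

definition completed_tensor_alg :: "(complex, 'v) module \<Rightarrow> ('v list \<Rightarrow> complex) set" where
  "completed_tensor_alg V =
     {\<phi>. \<forall>n. (\<lambda>hs. if length hs = n then \<phi> hs else 0) \<in> dual_tensor_power V n}"

text \<open>The product that extends concatenation of tensors.\<close>

definition conc :: "('v list \<Rightarrow> complex) \<Rightarrow> ('v list \<Rightarrow> complex) \<Rightarrow> 'v list \<Rightarrow> complex" where
  "conc \<phi> \<psi> hs = (\<Sum>k\<le>length hs. \<phi> (take k hs) * \<psi> (drop k hs))"

text \<open>
  The coproduct for which the elements of the dual of \<open>V\<close> are primitive sends \<open>\<phi>\<close> to
  \<open>(u, v) \<mapsto> (\<Sum>w\<leftarrow>shuffle_list u v. \<phi> w)\<close>, so the last clause says that
  \<open>\<phi>\<close> is group-like.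
\<close>

definition group_likes :: "(complex, 'v) module \<Rightarrow> ('v list \<Rightarrow> complex) set" where
  "group_likes V = {\<phi> \<in> completed_tensor_alg V. \<phi> [] = 1 \<and>
     (\<forall>u \<in> lists (carrier V). \<forall>v \<in> lists (carrier V).
        (\<Sum>w\<leftarrow>shuffle_list u v. \<phi> w) = \<phi> u * \<phi> v)}"

text \<open>
  The homogeneous components of the free Lie algebra on the dual of \<open>V\<close>, realised as
  the Lie subalgebra of the tensor algebra generated by degree one.
\<close>

inductive free_lie :: "(complex, 'v) module \<Rightarrow> nat \<Rightarrow> ('v list \<Rightarrow> complex) \<Rightarrow> bool"
  for V :: "(complex, 'v) module" where
  gen: "\<xi> \<in> dual_space V \<Longrightarrow> free_lie V 1 (word_form [\<xi>])"
| zero: "free_lie V n (\<lambda>_. 0)"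
| add: "free_lie V n \<phi> \<Longrightarrow> free_lie V n \<psi> \<Longrightarrow> free_lie V n (\<lambda>hs. \<phi> hs + \<psi> hs)"
| scale: "free_lie V n \<phi> \<Longrightarrow> free_lie V n (\<lambda>hs. c * \<phi> hs)"
| bracket: "free_lie V m \<phi> \<Longrightarrow> free_lie V n \<psi> \<Longrightarrow>
     free_lie V (m + n) (\<lambda>hs. conc \<phi> \<psi> hs - conc \<psi> \<phi> hs)"

text \<open>
  Pairing of an element of the shuffle algebra, a set of representatives,
  with an element of the completed tensor algebra.
\<close>

definition pairing :: "('v list \<Rightarrow>\<^sub>0 complex) set \<Rightarrow> ('v list \<Rightarrow> complex) \<Rightarrow> complex" where
  "pairing a \<phi> =
     (THE c. \<forall>r\<in>a. c = (\<Sum>w\<in>Poly_Mapping.keys r. Poly_Mapping.lookup r w * \<phi> w))"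


section \<open>Smooth affine curves\<close>

inductive_set poly_funs :: "(complex ^ 'n \<Rightarrow> complex) set" where
  const: "(\<lambda>_. c) \<in> poly_funs"
| coord: "(\<lambda>x. x $ i) \<in> poly_funs"
| add: "P \<in> poly_funs \<Longrightarrow> Q \<in> poly_funs \<Longrightarrow> (\<lambda>x. P x + Q x) \<in> poly_funs"
| mult: "P \<in> poly_funs \<Longrightarrow> Q \<in> poly_funs \<Longrightarrow> (\<lambda>x. P x * Q x) \<in> poly_funs"

definition dir_deriv :: "(complex ^ 'n \<Rightarrow> complex) \<Rightarrow> complex ^ 'n \<Rightarrow> complex ^ 'n \<Rightarrow> complex" where
  "dir_deriv P x v = deriv (\<lambda>t. P (x + t *s v)) 0"

definition tangent_space :: "(complex ^ 'n) set \<Rightarrow> complex ^ 'n \<Rightarrow> (complex ^ 'n) set" where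
  "tangent_space C x =
     {v. \<forall>P \<in> poly_funs. (\<forall>y\<in>C. P y = 0) \<longrightarrow> dir_deriv P x v = 0}"

text \<open>
  The tangent space is taken with respect to the full vanishing ideal of \<open>C\<close>, so it is \<open>0\<close> at
  an isolated point, and its dimension is at least the local dimension of \<open>C\<close>
  with equality exactly at smooth points.  Hence the last clause says that
  \<open>C\<close> is smooth of pure dimension one.
\<close>

definition smooth_affine_curve :: "(complex ^ 'n) set \<Rightarrow> bool" where
  "smooth_affine_curve C \<longleftrightarrow>
     (\<exists>F \<subseteq> poly_funs. C = {x. \<forall>P\<in>F. P x = 0}) \<and>
     C \<noteq> {} \<and> connected C \<and>
     (\<forall>x\<in>C. vec.dim (tangent_space C x) = 1)"

text \<open>
  Functions on \<open>C\<close> and its covers, as well as differentials, are extended by \<open>0\<close>.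
\<close>

definition fun_alg :: "'x set \<Rightarrow> ('x \<Rightarrow> complex) set \<Rightarrow> (complex, 'x \<Rightarrow> complex) module" where
  "fun_alg S A =
    \<lparr>carrier = A, mult = (\<lambda>f g x. f x * g x), one = (\<lambda>x. if x \<in> S then 1 else 0),
     zero = (\<lambda>_. 0), add = (\<lambda>f g x. f x + g x), smult = (\<lambda>c f x. c * f x)\<rparr>"

definition regular_funs :: "(complex ^ 'n) set \<Rightarrow> (complex ^ 'n \<Rightarrow> complex) set" where
  "regular_funs C = {\<lambda>x. if x \<in> C then P x else 0 | P. P \<in> poly_funs}"

abbreviation O_alg :: "(complex ^ 'n) set \<Rightarrow> (complex, complex ^ 'n \<Rightarrow> complex) module" where
  "O_alg C \<equiv> fun_alg C (regular_funs C)"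

text \<open>
  A differential on \<open>C\<close> assigns to each point a linear form on the tangent space there.  As \<open>C\<close> is
  smooth and closed in affine space, the regular differentials are the restrictions to \<open>C\<close> of the
  polynomial one-forms \<open>\<Sum>i. P i dx_i\<close>.
\<close>

type_synonym 'n differential = "complex ^ 'n \<Rightarrow> complex ^ 'n \<Rightarrow> complex"

definition regular_diffs :: "(complex ^ 'n) set \<Rightarrow> 'n differential set" where
  "regular_diffs C =
     {\<lambda>x v. if x \<in> C \<and> v \<in> tangent_space C x then \<Sum>i\<in>UNIV. P i x * v $ i else 0
      | P. \<forall>i. P i \<in> poly_funs}"

definition exact_diffs :: "(complex ^ 'n) set \<Rightarrow> 'n differential set" where
  "exact_diffs C =
     {\<lambda>x v. if x \<in> C \<and> v \<in> tangent_space C x then dir_deriv P x v else 0 | P. P \<in> poly_funs}"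

definition diff_space :: "(complex ^ 'n) set \<Rightarrow> (complex, 'n differential) module" where
  "diff_space C =
    \<lparr>carrier = regular_diffs C, mult = undefined, one = undefined, zero = (\<lambda>_ _. 0),
     add = (\<lambda>\<omega> \<eta> x v. \<omega> x v + \<eta> x v), smult = (\<lambda>c \<omega> x v. c * \<omega> x v)\<rparr>"

definition H_space :: "(complex ^ 'n) set \<Rightarrow> (complex, 'n differential set) module" where
  "H_space C = quot_alg (diff_space C) (exact_diffs C)"


section \<open>The universal cover\<close>

definition universal_cover ::
    "'u::topological_space set \<Rightarrow> ('u \<Rightarrow> complex ^ 'n) \<Rightarrow> (complex ^ 'n) set \<Rightarrow> bool" where
  "universal_cover U p C \<longleftrightarrow> covering_space U p C \<and> simply_connected U"

text \<open>The velocity at \<open>t\<close> of the curve \<open>p \<circ> \<phi>\<close> in affine space.\<close>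

definition velocity :: "('u \<Rightarrow> complex ^ 'n) \<Rightarrow> (complex \<Rightarrow> 'u) \<Rightarrow> complex \<Rightarrow> complex ^ 'n" where
  "velocity p \<phi> t = (\<chi> i. deriv (\<lambda>s. p (\<phi> s) $ i) t)"

text \<open>
  The inverses of the charts of the Riemann surface \<open>U\<close>, with the complex structure pulled back from
  the submanifold \<open>C\<close> of affine space.
\<close>

definition local_param ::
    "'u::topological_space set \<Rightarrow> ('u \<Rightarrow> complex ^ 'n) \<Rightarrow> complex set \<Rightarrow> (complex \<Rightarrow> 'u) \<Rightarrow> bool" where
  "local_param U p D \<phi> \<longleftrightarrow>
     open D \<and> openin (top_of_set U) (\<phi> ` D) \<and> (\<exists>\<psi>. homeomorphism D (\<phi> ` D) \<phi> \<psi>) \<and>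
     (\<forall>i. (\<lambda>t. p (\<phi> t) $ i) holomorphic_on D) \<and> (\<forall>t\<in>D. velocity p \<phi> t \<noteq> 0)"

definition hol_funs ::
    "'u::topological_space set \<Rightarrow> ('u \<Rightarrow> complex ^ 'n) \<Rightarrow> ('u \<Rightarrow> complex) set" where
  "hol_funs U p = {f. (\<forall>x. x \<notin> U \<longrightarrow> f x = 0) \<and>
     (\<forall>D \<phi>. local_param U p D \<phi> \<longrightarrow> (\<lambda>t. f (\<phi> t)) holomorphic_on D)}"

abbreviation O_hol ::
    "'u::topological_space set \<Rightarrow> ('u \<Rightarrow> complex ^ 'n) \<Rightarrow> (complex, 'u \<Rightarrow> complex) module" where
  "O_hol U p \<equiv> fun_alg U (hol_funs U p)"

definition pullback ::
    "'u set \<Rightarrow> ('u \<Rightarrow> complex ^ 'n) \<Rightarrow> (complex ^ 'n \<Rightarrow> complex) \<Rightarrow> 'u \<Rightarrow> complex" where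
  "pullback U p f = (\<lambda>z. if z \<in> U then f (p z) else 0)"

text \<open>
  The integral of \<open>f p\<^sup>*\<omega>\<close> from \<open>z0\<close> to \<open>z\<close>: the common value of the line integrals along all
  piecewise \<open>C1\<close> paths.
\<close>

definition cover_integral ::
    "'u::topological_space set \<Rightarrow> ('u \<Rightarrow> complex ^ 'n) \<Rightarrow> ('u \<Rightarrow> complex) \<Rightarrow> 'n differential
      \<Rightarrow> 'u \<Rightarrow> 'u \<Rightarrow> complex" where
  "cover_integral U p f \<omega> z0 z = (THE c. \<forall>\<gamma>.
     path \<gamma> \<and> path_image \<gamma> \<subseteq> U \<and> pathstart \<gamma> = z0 \<and> pathfinish \<gamma> = z \<and> valid_path (p \<circ> \<gamma>) \<longrightarrow>
     ((\<lambda>t. f (\<gamma> t) * \<omega> (p (\<gamma> t)) (vector_derivative (p \<circ> \<gamma>) (at t within {0..1})))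
        has_integral c) {0..1})"

definition stable_subalgebra ::
    "(complex ^ 'n) set \<Rightarrow> 'u::topological_space set \<Rightarrow> ('u \<Rightarrow> complex ^ 'n)
      \<Rightarrow> ('u \<Rightarrow> complex) set \<Rightarrow> bool" where
  "stable_subalgebra C U p A \<longleftrightarrow>
     subring A (O_hol U p) \<and> submodule A complex_ring (O_hol U p) \<and>
     (\<forall>f\<in>A. \<forall>\<omega>\<in>regular_diffs C. \<forall>z0\<in>U.
        (\<lambda>z. if z \<in> U then cover_integral U p f \<omega> z0 z else 0) \<in> A)"

definition min_stable_subalgebra ::
    "(complex ^ 'n) set \<Rightarrow> 'u::topological_space set \<Rightarrow> ('u \<Rightarrow> complex ^ 'n)
      \<Rightarrow> (complex, 'u \<Rightarrow> complex) module" where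
  "min_stable_subalgebra C U p = (O_hol U p)\<lparr>carrier := \<Inter>{A. stable_subalgebra C U p A}\<rparr>"


section \<open>Maurer-Cartan elements and their generating series\<close>

text \<open>
  With elements of the free Lie algebra viewed as functions on words, an element of the tensor
  product of the differentials with its degree \<open>n\<close> component is a function from
  words of length \<open>n\<close> to differentials.
\<close>

definition MC :: "(complex ^ 'n) set \<Rightarrow> ('n differential set list \<Rightarrow> 'n differential) set" where
  "MC C = {J. J [] = (\<lambda>_ _. 0) \<and>
     (\<forall>n\<ge>1. \<exists>(m::nat) \<omega> \<phi>.
        (\<forall>k<m. \<omega> k \<in> regular_diffs C \<and> free_lie (H_space C) n (\<phi> k)) \<and>
        (\<forall>hs. length hs = n \<longrightarrow> J hs = (\<lambda>x v. \<Sum>k<m. \<omega> k x v * \<phi> k hs)))}"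

text \<open>
  Elements of the tensor product of \<open>H\<close> and its dual are viewed as endomorphisms of \<open>H\<close>.
\<close>

definition MC_nd :: "(complex ^ 'n) set \<Rightarrow> ('n differential set list \<Rightarrow> 'n differential) set" where
  "MC_nd C = {J \<in> MC C. \<forall>h \<in> carrier (H_space C).
     exact_diffs C +>\<^bsub>diff_space C\<^esub> J [h] = h}"

text \<open>
  The equation \<open>dL = L J\<close>, read in local parametrisations.  It forces the
  coefficients of \<open>L\<close> to be complex differentiable, hence smooth.
\<close>

definition solves_MC ::
    "(complex ^ 'n) set \<Rightarrow> 'u::topological_space set \<Rightarrow> ('u \<Rightarrow> complex ^ 'n)
      \<Rightarrow> ('n differential set list \<Rightarrow> 'n differential) \<Rightarrow> 'u
      \<Rightarrow> ('u \<Rightarrow> 'n differential set list \<Rightarrow> complex) \<Rightarrow> bool" where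
  "solves_MC C U p J x0 L \<longleftrightarrow>
     (\<forall>x\<in>U. L x \<in> group_likes (H_space C)) \<and>
     (\<forall>x. x \<notin> U \<longrightarrow> L x = (\<lambda>_. 0)) \<and>
     (\<forall>D \<phi> t hs. local_param U p D \<phi> \<and> t \<in> D \<longrightarrow>
        ((\<lambda>s. L (\<phi> s) hs) has_field_derivative
           (\<Sum>k\<le>length hs. L (\<phi> t) (take k hs) * J (drop k hs) (p (\<phi> t)) (velocity p \<phi> t))) (at t)) \<and>
     L x0 = (\<lambda>hs. if hs = [] then 1 else 0)"

definition L_series ::
    "(complex ^ 'n) set \<Rightarrow> 'u::topological_space set \<Rightarrow> ('u \<Rightarrow> complex ^ 'n)
      \<Rightarrow> ('n differential set list \<Rightarrow> 'n differential) \<Rightarrow> 'u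
      \<Rightarrow> 'u \<Rightarrow> 'n differential set list \<Rightarrow> complex" where
  "L_series C U p J x0 = (THE L. solves_MC C U p J x0 L)"

definition f_tilde ::
    "(complex ^ 'n) set \<Rightarrow> 'u::topological_space set \<Rightarrow> ('u \<Rightarrow> complex ^ 'n)
      \<Rightarrow> ('n differential set list \<Rightarrow> 'n differential) \<Rightarrow> 'u
      \<Rightarrow> ('n differential set list \<Rightarrow>\<^sub>0 complex) set \<Rightarrow> 'u \<Rightarrow> complex" where
  "f_tilde C U p J x0 a = (\<lambda>x. if x \<in> U then pairing a (L_series C U p J x0 x) else 0)"

end

theory Submission imports Defs "HOL-Complex_Analysis.Complex_Analysis" "HOL-Library.Function_Algebras"
  "HOL-Computational_Algebra.Fundamental_Theorem_Algebra"
begin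

no_notation fps_nth (infixl "$" 75)

text \<open>
  The coefficients of \<open>L\<close> are the iterated integrals of the components of \<open>J\<close>, and \<open>L\<close> being
  group-like makes them multiplicative for the shuffle product.  A change of base point multiplies
  \<open>L\<close> on the left by a constant group-like element, which acts on the shuffle algebra through
  deconcatenation and does not change the image.  Since every regular differential is, modulo exact
  ones, a combination of degree 1 components of \<open>J\<close>, integration by parts shows that the
  \<open>\<O>(C)\<close>-span of the coefficients is stable under integration; conversely, its elements are
  obtained from regular functions by successive integrations.  The coefficients at words in a basis
  of \<open>H\<^sub>C\<close> are linearly independent over \<open>\<O>(C)\<close>: in a relation of minimal leading
  part, the leading coefficients form an ideal stable under all derivations; as \<open>\<O>(C)\<close> is
  differentially simple this ideal is \<open>0\<close> or contains \<open>1\<close>, and in the latter case differentiating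
  the relation exhibits a nontrivial combination of basis classes as exact.
\<close>

section \<open>Quotients of modules over the complex numbers\<close>

text \<open>The curve is known only through its equations and the dimension of its tangent spaces,
  and \<open>U\<close> only as a topological space with a covering map. Charts come from the inverse
  function theorem for equations with prescribed gradients; connectedness excludes isolated points.
  Primitives on \<open>U\<close> are glued from local ones, which requires integration along
  homotopies that are merely continuous. The identity theorem on the connected cover takes the place
  of irreducibility.

  \<open>J\<close> may have components in every degree, so differentiating or integrating a
  coefficient produces further terms with shorter words; hence the inductions on word length. Its
  degree 1 component is a finite sum representing every class, which yields a finite basis of the
  cohomology.

  A stable ideal that is nonzero on the curve has no common zero, and the weak Nullstellensatz turns
  this into the presence of 1. Injectivity on the tensor product, a quotient of a free space on
  pairs, is tested on normal forms: sums over words in the basis, each tensored with one regular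
  function.\<close>

lemma cring_complex_ring: "cring complex_ring"
  by (unfold_locales)
     (auto simp: complex_ring_def algebra_simps Units_def intro: exI[of _ "- _"] add.right_inverse add.left_inverse)

lemma complex_ring_simps [simp]:
  "carrier complex_ring = UNIV" "mult complex_ring = (*)" "one complex_ring = 1"
  "zero complex_ring = 0" "add complex_ring = (+)"
  by (simp_all add: complex_ring_def)

context
  fixes M :: "(complex, 'v) module" and N
  assumes M: "module complex_ring M" and N: "submodule N complex_ring M"
begin

interpretation module complex_ring M by (rule M)

lemma quot_abelian_subgroup: "abelian_subgroup N M"
proof -
  have "subgroup N (add_monoid M)" using N by (simp add: submodule_def)
  then show ?thesis
    by (intro abelian_subgroupI3) (auto simp: additive_subgroup_def abelian_group_axioms)
qed

interpretation abelian_subgroup N M by (rule quot_abelian_subgroup)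

lemma quot_carrier: "carrier (quot_alg M N) = {N +>\<^bsub>M\<^esub> x | x. x \<in> carrier M}"
  by (auto simp: quot_alg_def A_RCOSETS_def RCOSETS_def a_r_coset_def)

lemma quot_rep_mem: "x \<in> carrier M \<Longrightarrow> x \<in> N +>\<^bsub>M\<^esub> x"
  using a_rcos_self by blast

lemma quot_class_eqI:
  assumes "x \<in> carrier M" "y \<in> N +>\<^bsub>M\<^esub> x" shows "N +>\<^bsub>M\<^esub> y = N +>\<^bsub>M\<^esub> x"
  using a_repr_independence[of y N x] assms a_subgroup by auto

lemma quot_class_add:
  assumes "n \<in> N" "x \<in> carrier M" shows "N +>\<^bsub>M\<^esub> (n \<oplus>\<^bsub>M\<^esub> x) = N +>\<^bsub>M\<^esub> x"
  using assms by (intro quot_class_eqI) (auto simp: a_r_coset_def')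

lemma quot_class_eqD:
  assumes "x \<in> carrier M" "N +>\<^bsub>M\<^esub> x = N +>\<^bsub>M\<^esub> y" "y \<in> carrier M"
  shows "\<exists>n\<in>N. x = n \<oplus>\<^bsub>M\<^esub> y"
  using quot_rep_mem[OF assms(1)] assms by (auto simp: a_r_coset_def')

lemma quot_mem_carrier: "x \<in> carrier M \<Longrightarrow> y \<in> N +>\<^bsub>M\<^esub> x \<Longrightarrow> y \<in> carrier M"
  using a_subset by (auto simp: a_r_coset_def')

lemma quot_add:
  "x \<in> carrier M \<Longrightarrow> y \<in> carrier M \<Longrightarrow>
    (N +>\<^bsub>M\<^esub> x) \<oplus>\<^bsub>quot_alg M N\<^esub> (N +>\<^bsub>M\<^esub> y) = N +>\<^bsub>M\<^esub> (x \<oplus>\<^bsub>M\<^esub> y)"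
  using a_rcos_sum by (simp add: quot_alg_def)

text \<open>Scalar multiplication in \<open>quot_alg\<close> is a union over all representatives; it
  is one coset because each representative yields the same one.\<close>

lemma quot_smult:
  assumes x: "x \<in> carrier M"
  shows "c \<odot>\<^bsub>quot_alg M N\<^esub> (N +>\<^bsub>M\<^esub> x) = N +>\<^bsub>M\<^esub> (c \<odot>\<^bsub>M\<^esub> x)"
proof -
  have "N +>\<^bsub>M\<^esub> (c \<odot>\<^bsub>M\<^esub> y) = N +>\<^bsub>M\<^esub> (c \<odot>\<^bsub>M\<^esub> x)" if y: "y \<in> N +>\<^bsub>M\<^esub> x" for y
  proof -
    obtain n where n: "n \<in> N" "y = n \<oplus>\<^bsub>M\<^esub> x" using y by (auto simp: a_r_coset_def')
    have "n \<in> carrier M" using n a_subset by auto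
    then have "c \<odot>\<^bsub>M\<^esub> y = c \<odot>\<^bsub>M\<^esub> n \<oplus>\<^bsub>M\<^esub> c \<odot>\<^bsub>M\<^esub> x" using n x by (simp add: smult_r_distr)
    moreover have "c \<odot>\<^bsub>M\<^esub> n \<in> N" using submodule.smult_closed[OF N] n by simp
    ultimately show ?thesis using x by (simp add: quot_class_add)
  qed
  moreover have "x \<in> N +>\<^bsub>M\<^esub> x" using x by (rule quot_rep_mem)
  ultimately have "(\<Union>y\<in>N +>\<^bsub>M\<^esub> x. N +>\<^bsub>M\<^esub> (c \<odot>\<^bsub>M\<^esub> y)) = N +>\<^bsub>M\<^esub> (c \<odot>\<^bsub>M\<^esub> x)"
    by (intro SUP_eq_const) blast+
  then show ?thesis by (simp add: quot_alg_def)
qed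

end

lemma lin_span_superset: "S \<subseteq> lin_span M S"
  by (auto simp: lin_span_def)

lemma lin_span_least: "submodule N complex_ring M \<Longrightarrow> S \<subseteq> N \<Longrightarrow> lin_span M S \<subseteq> N"
  by (auto simp: lin_span_def)

text \<open>\<open>S\<close> lies in the carrier, so the carrier itself is one of the submodules
  that are intersected.\<close>

lemma submodule_lin_span:
  assumes M: "module complex_ring M" and S: "S \<subseteq> carrier M"
  shows "submodule (lin_span M S) complex_ring M"
proof -
  interpret module complex_ring M by (rule M)
  have C: "submodule (carrier M) complex_ring M" by (rule carrier_is_submodule)
  have Z: "\<zero>\<^bsub>M\<^esub> \<in> N" if "submodule N complex_ring M" for N
    using subgroup.one_closed[of N "add_monoid M"] that by (simp add: submodule_def)
  show ?thesis
    unfolding lin_span_def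
  proof (rule submoduleI)
    show "\<Inter> {N. submodule N complex_ring M \<and> S \<subseteq> N} \<subseteq> carrier M" using C S by blast
  next
    show "\<zero>\<^bsub>M\<^esub> \<in> \<Inter> {N. submodule N complex_ring M \<and> S \<subseteq> N}" using Z by auto
  next
    fix a assume "a \<in> \<Inter> {N. submodule N complex_ring M \<and> S \<subseteq> N}"
    then show "\<ominus>\<^bsub>M\<^esub> a \<in> \<Inter> {N. submodule N complex_ring M \<and> S \<subseteq> N}"
      using submoduleE(3) by auto
  next
    fix a b assume "a \<in> \<Inter> {N. submodule N complex_ring M \<and> S \<subseteq> N}"
      "b \<in> \<Inter> {N. submodule N complex_ring M \<and> S \<subseteq> N}"
    then show "a \<oplus>\<^bsub>M\<^esub> b \<in> \<Inter> {N. submodule N complex_ring M \<and> S \<subseteq> N}"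
      using submoduleE(5) by auto
  next
    fix a x assume "x \<in> \<Inter> {N. submodule N complex_ring M \<and> S \<subseteq> N}"
    then show "a \<odot>\<^bsub>M\<^esub> x \<in> \<Inter> {N. submodule N complex_ring M \<and> S \<subseteq> N}"
      using submoduleE(4) by auto
  qed
qed

section \<open>Finitely supported functions\<close>

lemma lookup_pm_scale [simp]: "Poly_Mapping.lookup (pm_scale c r) x = c * Poly_Mapping.lookup r x"
  by (simp add: pm_scale_def Poly_Mapping.map.rep_eq when_def)

lemma keys_pm_scale: "Poly_Mapping.keys (pm_scale c r) \<subseteq> Poly_Mapping.keys r"
  by (auto simp: in_keys_iff)

lemma pm_scale_single [simp]: "pm_scale c (Poly_Mapping.single x d) = Poly_Mapping.single x (c * d)"
  by (rule poly_mapping_eqI) (simp add: lookup_single when_def)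

lemma pm_scale_algebra:
  "pm_scale c (r + s) = pm_scale c r + pm_scale c s"
  "pm_scale (c + d) r = pm_scale c r + pm_scale d r"
  "pm_scale (c * d) r = pm_scale c (pm_scale d r)"
  "pm_scale 1 r = r" "pm_scale c 0 = 0" "pm_scale 0 r = 0"
  "pm_scale c (r - s) = pm_scale c r - pm_scale c s"
  "pm_scale (-1) r = - r"
  by (rule poly_mapping_eqI, simp add: lookup_add lookup_minus algebra_simps)+

lemma pm_scale_sum: "pm_scale c (sum f A) = (\<Sum>i\<in>A. pm_scale c (f i))"
  by (induction A rule: infinite_finite_induct) (simp_all add: pm_scale_algebra)

lemma free_alg_simps [simp]:
  "carrier (free_alg X e m) = {r. Poly_Mapping.keys r \<subseteq> X}"
  "add (free_alg X e m) = (+)" "zero (free_alg X e m) = 0" "smult (free_alg X e m) = pm_scale"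
  "one (free_alg X e m) = Poly_Mapping.single e 1"
  by (simp_all add: free_alg_def)

lemma module_free_alg: "module complex_ring (free_alg X e m)"
proof (rule module.intro)
  show "cring complex_ring" by (rule cring_complex_ring)
  show "abelian_group (free_alg X e m)"
  proof (rule abelian_groupI)
    fix x assume "x \<in> carrier (free_alg X e m)"
    then show "\<exists>y\<in>carrier (free_alg X e m). y \<oplus>\<^bsub>free_alg X e m\<^esub> x = \<zero>\<^bsub>free_alg X e m\<^esub>"
      by (intro bexI[of _ "-x"]) (auto simp: keys_def)
  qed (use keys_add in \<open>fastforce simp: add_ac\<close>)+
  show "module_axioms complex_ring (free_alg X e m)"
    using keys_pm_scale by (unfold_locales) (fastforce simp: pm_scale_algebra)+
qed

lemma a_inv_free_alg: "r \<in> carrier (free_alg X e m) \<Longrightarrow> a_inv (free_alg X e m) r = - r"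
proof -
  interpret module complex_ring "free_alg X e m" by (rule module_free_alg)
  assume r: "r \<in> carrier (free_alg X e m)"
  then have "- r \<in> carrier (free_alg X e m)" by (auto simp: keys_def)
  then show ?thesis using minus_equality[of "-r" r] r by simp
qed

text \<open>This is the sum inside \<open>pairing\<close>; evaluations of shuffle classes and of
  tensors are both instances of it.\<close>

definition lin_ext :: "('x \<Rightarrow> complex) \<Rightarrow> ('x \<Rightarrow>\<^sub>0 complex) \<Rightarrow> complex" where
  "lin_ext t r = (\<Sum>x\<in>Poly_Mapping.keys r. Poly_Mapping.lookup r x * t x)"

lemma lin_ext_superset:
  "finite S \<Longrightarrow> Poly_Mapping.keys r \<subseteq> S \<Longrightarrow> lin_ext t r = (\<Sum>x\<in>S. Poly_Mapping.lookup r x * t x)"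
  unfolding lin_ext_def by (rule sum.mono_neutral_left) (auto simp: in_keys_iff)

lemma lin_ext_add [simp]: "lin_ext t (r + s) = lin_ext t r + lin_ext t s"
proof -
  let ?S = "Poly_Mapping.keys r \<union> Poly_Mapping.keys s"
  have "Poly_Mapping.keys (r + s) \<subseteq> ?S" by (rule keys_add)
  then show ?thesis
    by (simp add: lin_ext_superset[of ?S] lookup_add algebra_simps sum.distrib)
qed

lemma lin_ext_scale [simp]: "lin_ext t (pm_scale c r) = c * lin_ext t r"
  using keys_pm_scale[of c r]
  by (simp add: lin_ext_superset[of "Poly_Mapping.keys r"] sum_distrib_left mult_ac)

lemma lin_ext_0 [simp]: "lin_ext t 0 = 0"
  by (simp add: lin_ext_def)

lemma lin_ext_uminus [simp]: "lin_ext t (- r) = - lin_ext t r"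
  using lin_ext_scale[of t "-1" r] by (simp add: pm_scale_algebra)

lemma lin_ext_diff [simp]: "lin_ext t (r - s) = lin_ext t r - lin_ext t s"
  using lin_ext_add[of t r "-s"] by simp

lemma lin_ext_single [simp]: "lin_ext t (Poly_Mapping.single x c) = c * t x"
  by (simp add: lin_ext_def)

lemma lin_ext_sum [simp]: "lin_ext t (sum f A) = (\<Sum>i\<in>A. lin_ext t (f i))"
  by (induction A rule: infinite_finite_induct) simp_all

lemma lin_ext_sum_list [simp]: "lin_ext t (sum_list rs) = (\<Sum>r\<leftarrow>rs. lin_ext t r)"
  by (induction rs) simp_all

text \<open>Serves the shuffle product and the product of tensors alike: an evaluation is
  multiplicative once it is so on the basis elements that occur.\<close>

lemma lin_ext_mult:
  assumes "\<And>x y. x \<in> Poly_Mapping.keys r \<Longrightarrow> y \<in> Poly_Mapping.keys s \<Longrightarrow> lin_ext t (m x y) = t x * t y"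
  shows "lin_ext t (r \<otimes>\<^bsub>free_alg X e m\<^esub> s) = lin_ext t r * lin_ext t s"
  using assms by (simp add: free_alg_def lin_ext_def[of t r] lin_ext_def[of t s] sum_product mult_ac)

lemma poly_mapping_sum_single:
  "(\<Sum>x\<in>Poly_Mapping.keys r. Poly_Mapping.single x (Poly_Mapping.lookup r x)) = r"
  by (rule poly_mapping_eqI)
     (auto simp: lookup_sum lookup_single when_def in_keys_iff sum.delta' cong: if_cong)

lemma lin_ext_vanishes_lin_span:
  assumes "S \<subseteq> carrier (free_alg X e m)" "\<And>s. s \<in> S \<Longrightarrow> lin_ext t s = 0" "r \<in> lin_span (free_alg X e m) S"
  shows "lin_ext t r = 0"
proof -
  interpret module complex_ring "free_alg X e m" by (rule module_free_alg)
  let ?K = "{r \<in> carrier (free_alg X e m). lin_ext t r = 0}"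
  have "submodule ?K complex_ring (free_alg X e m)"
  proof (rule submoduleI)
    fix a assume "a \<in> ?K" then show "\<ominus>\<^bsub>free_alg X e m\<^esub> a \<in> ?K"
      using a_inv_free_alg[of a X e m] by (auto simp: keys_def)
  qed (auto dest!: subsetD[OF keys_add] subsetD[OF keys_pm_scale])
  then have "lin_span (free_alg X e m) S \<subseteq> ?K" using assms by (intro lin_span_least) auto
  then show ?thesis using assms by auto
qed

text \<open>This makes evaluation on a class at a \<open>SOME\<close>-chosen representative well defined.\<close>

lemma lin_ext_class:
  assumes "S \<subseteq> carrier (free_alg X e m)" "\<And>s. s \<in> S \<Longrightarrow> lin_ext t s = 0"
    and "y \<in> lin_span (free_alg X e m) S +>\<^bsub>free_alg X e m\<^esub> x"
  shows "lin_ext t y = lin_ext t x"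
  using assms lin_ext_vanishes_lin_span[of S X e m t] by (auto simp: a_r_coset_def')

section \<open>Shuffles, deconcatenation and group-like series\<close>

abbreviation sh :: "('v list \<Rightarrow> complex) \<Rightarrow> 'v list \<Rightarrow> 'v list \<Rightarrow> complex" where
  "sh \<phi> u v \<equiv> (\<Sum>w\<leftarrow>shuffle_list u v. \<phi> w)"

lemma shuffle_list_Nil_right [simp]: "shuffle_list u [] = [u]"
  by (cases u) auto

lemma length_shuffle_list: "w \<in> set (shuffle_list u v) \<Longrightarrow> length w = length u + length v"
  by (induction u v arbitrary: w rule: shuffle_list.induct) auto

lemma set_shuffle_list: "w \<in> set (shuffle_list u v) \<Longrightarrow> set w = set u \<union> set v"
proof (induction u v arbitrary: w rule: shuffle_list.induct)
  case (3 x xs y ys)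
  from "3.prems" consider w' where "w = x # w'" "w' \<in> set (shuffle_list xs (y # ys))"
    | w' where "w = y # w'" "w' \<in> set (shuffle_list (x # xs) ys)"
    by auto
  then show ?case using "3.IH" by cases fastforce+
qed auto

lemma conc_Nil [simp]: "conc \<phi> \<psi> [] = \<phi> [] * \<psi> []"
  by (simp add: conc_def)

lemma conc_Cons: "conc \<phi> \<psi> (x # w) = \<phi> [] * \<psi> (x # w) + conc (\<lambda>w. \<phi> (x # w)) \<psi> w"
  by (simp add: conc_def sum.atMost_Suc_shift del: sum.atMost_Suc)

text \<open>Compatibility of shuffle and deconcatenation: cutting a shuffle of \<open>u\<close> and
  \<open>v\<close> cuts \<open>u\<close> and \<open>v\<close> separately, and prefixes and suffixes
  are shuffled independently. The induction generalises over \<phi> because removing the first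
  letter replaces \<phi> by a translate.\<close>

lemma sh_conc:
  "sh (conc \<phi> \<psi>) u v =
     (\<Sum>i\<le>length u. \<Sum>j\<le>length v. sh \<phi> (take i u) (take j v) * sh \<psi> (drop i u) (drop j v))"
proof (induction u v arbitrary: \<phi> rule: shuffle_list.induct)
  case (1 ys)
  then show ?case by (simp add: conc_def)
next
  case (2 v va)
  then show ?case by (simp add: conc_def del: take_Suc_Cons drop_Suc_Cons sum.atMost_Suc)
next
  case (3 x u y v)
  \<comment> \<open>The cut before the first letter gives the term with \<open>\<phi> []\<close>;
    the other cuts come after a first letter \<open>x\<close> or \<open>y\<close> and are covered by
    the induction hypotheses for the translates of \<phi>.\<close>
  have "sh (conc \<phi> \<psi>) (x # u) (y # v) = \<phi> [] * sh \<psi> (x # u) (y # v)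
      + sh (conc (\<lambda>w. \<phi> (x # w)) \<psi>) u (y # v) + sh (conc (\<lambda>w. \<phi> (y # w)) \<psi>) (x # u) v"
    by (simp add: o_def conc_Cons sum_list_addf sum_list_const_mult algebra_simps)
  also have "\<dots> = (\<Sum>i\<le>length (x # u). \<Sum>j\<le>length (y # v).
      sh \<phi> (take i (x # u)) (take j (y # v)) * sh \<psi> (drop i (x # u)) (drop j (y # v)))"
    unfolding 3
    by (simp add: sum.atMost_Suc_shift sum.distrib sum_distrib_left algebra_simps o_def del: sum.atMost_Suc)
  finally show ?case .
qed

lemma free_lie_Nil: "free_lie V n \<phi> \<Longrightarrow> \<phi> [] = 0"
  by (induction rule: free_lie.induct) (simp_all add: word_form_def)

text \<open>The easy half of Ree's theorem: Lie elements are primitive for the coproduct dual to the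
  shuffle product, so they vanish on proper shuffles.\<close>

lemma free_lie_sh:
  assumes "free_lie V n \<phi>" "u \<noteq> []" "v \<noteq> []" shows "sh \<phi> u v = 0"
  using assms
proof (induction arbitrary: u v rule: free_lie.induct)
  case (gen \<xi>)
  have "word_form [\<xi>] w = 0" if "w \<in> set (shuffle_list u v)" for w
    using length_shuffle_list[OF that] gen by (cases u; cases v) (auto simp: word_form_def)
  then have "map (word_form [\<xi>]) (shuffle_list u v) = map (\<lambda>_. 0) (shuffle_list u v)"
    by (intro map_cong) auto
  then show ?case by (simp only: sum_list_0)
next
  case (add n \<phi> \<psi>)
  then show ?case by (simp add: sum_list_addf)
next
  case (scale n \<phi> c)
  then show ?case by (simp add: sum_list_const_mult)
next
  case (bracket m \<phi> n \<psi>)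
  \<comment> \<open>Only the two cuts survive that give all of \<open>u\<close> to one factor and
    all of \<open>v\<close> to the other. The result is symmetric in \<phi> and \<psi>, so the
    commutator vanishes.\<close>
  have *: "sh (conc \<phi> \<psi>) u v = \<phi> u * \<psi> v + \<phi> v * \<psi> u"
    if \<phi>: "\<phi> [] = 0" "\<And>u v. u \<noteq> [] \<Longrightarrow> v \<noteq> [] \<Longrightarrow> sh \<phi> u v = 0"
      and \<psi>: "\<psi> [] = 0" "\<And>u v. u \<noteq> [] \<Longrightarrow> v \<noteq> [] \<Longrightarrow> sh \<psi> u v = 0"
    for \<phi> \<psi>
  proof -
    have "(\<Sum>j\<le>length v. sh \<phi> (take i u) (take j v) * sh \<psi> (drop i u) (drop j v)) =
        (if i = length u then \<phi> u * \<psi> v else 0) + (if i = 0 then \<phi> v * \<psi> u else 0)"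
      (is "?l = ?r") if i: "i \<le> length u" for i
    proof -
      have "sh \<phi> (take i u) (take j v) * sh \<psi> (drop i u) (drop j v) =
          (if j = 0 \<and> i = length u then \<phi> u * \<psi> v else 0) + (if j = length v \<and> i = 0 then \<phi> v * \<psi> u else 0)"
        if "j \<le> length v" for j
      proof -
        consider "i = 0" "j = 0" | "i = 0" "j \<noteq> 0" "j \<noteq> length v" | "i = 0" "j \<noteq> 0" "j = length v"
          | "i \<noteq> 0" "j \<noteq> 0" | "i \<noteq> 0" "j = 0" "i = length u" | "i \<noteq> 0" "j = 0" "i \<noteq> length u"
          by blast
        then show ?thesis
          using i that \<phi> \<psi> \<open>u \<noteq> []\<close> \<open>v \<noteq> []\<close> by cases auto
      qed
      then have "?l = (\<Sum>j\<le>length v. (if j = 0 \<and> i = length u then \<phi> u * \<psi> v else 0)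
          + (if j = length v \<and> i = 0 then \<phi> v * \<psi> u else 0))"
        by (intro sum.cong) auto
      also have "\<dots> = ?r"
        by (cases "i = length u"; cases "i = 0") (simp_all add: sum.distrib)
      finally show ?thesis .
    qed
    then have "sh (conc \<phi> \<psi>) u v = (\<Sum>i\<le>length u.
        (if i = length u then \<phi> u * \<psi> v else 0) + (if i = 0 then \<phi> v * \<psi> u else 0))"
      unfolding sh_conc by (intro sum.cong) auto
    then show ?thesis by (simp add: sum.distrib)
  qed
  have z: "\<phi> [] = 0" "\<psi> [] = 0" using bracket.hyps by (simp_all add: free_lie_Nil)
  show ?case
    unfolding sum_list_subtractf
    using *[OF z(1) bracket.IH(1) z(2) bracket.IH(2)] *[OF z(2) bracket.IH(2) z(1) bracket.IH(1)]
    by (simp add: mult.commute)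
qed simp

section \<open>Products of linear forms and tensor powers of the dual\<close>

lemma word_form_Cons [simp]: "word_form (\<xi> # \<xi>s) (h # hs) = \<xi> h * word_form \<xi>s hs"
  by (simp add: word_form_def prod.lessThan_Suc_shift del: prod.lessThan_Suc)

lemma word_form_Nil [simp]: "word_form [] hs = (if hs = [] then 1 else 0)" "word_form (\<xi> # \<xi>s) [] = 0"
  by (auto simp: word_form_def)

lemma conc_word_form: "conc (word_form \<xi>s) (word_form \<eta>s) hs = word_form (\<xi>s @ \<eta>s) hs"
proof (induction \<xi>s arbitrary: hs)
  case Nil
  show ?case
    by (cases hs) (simp_all add: conc_def sum.atMost_Suc_shift del: sum.atMost_Suc)
next
  case (Cons \<xi> \<xi>s)
  show ?case
  proof (cases hs)
    case (Cons h t)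
    then show ?thesis
      using Cons.IH[of t] by (simp add: conc_Cons) (simp add: conc_def sum_distrib_left[symmetric] mult.assoc)
  qed simp
qed

text \<open>Frees the decomposition from the index set of an initial segment of the naturals, so
  that sums and products can be indexed by disjoint unions and pairs.\<close>

lemma dual_tensor_powerI:
  assumes "finite I" "\<And>k. k \<in> I \<Longrightarrow> length (\<xi> k) = n \<and> set (\<xi> k) \<subseteq> dual_space V"
    and "\<And>hs. \<phi> hs = (\<Sum>k\<in>I. c k * word_form (\<xi> k) hs)"
  shows "\<phi> \<in> dual_tensor_power V n"
proof -
  obtain g where g: "bij_betw g {0..<card I} I" using ex_bij_betw_nat_finite[OF assms(1)] by blast
  have "\<phi> = (\<lambda>hs. \<Sum>k<card I. c (g k) * word_form (\<xi> (g k)) hs)"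
    using sum.reindex_bij_betw[OF g, of "\<lambda>k. c k * word_form (\<xi> k) _"] assms(3)
    by (intro ext) (simp add: atLeast0LessThan)
  moreover have "g k \<in> I" if "k < card I" for k using g that by (auto simp: bij_betw_def)
  ultimately show ?thesis
    unfolding dual_tensor_power_def using assms(2)
    by (intro CollectI exI[of _ "card I"] exI[of _ "\<lambda>k. c (g k)"] exI[of _ "\<lambda>k. \<xi> (g k)"]) simp
qed

lemma dual_tensor_powerE:
  assumes "\<phi> \<in> dual_tensor_power V n"
  obtains m :: nat and c \<xi> where "\<And>k. k < m \<Longrightarrow> length (\<xi> k) = n \<and> set (\<xi> k) \<subseteq> dual_space V"
    "\<And>hs. \<phi> hs = (\<Sum>k<m. c k * word_form (\<xi> k) hs)"
proof -
  from assms obtain m :: nat and c \<xi> where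
    "(\<forall>k<m. length (\<xi> k) = n \<and> set (\<xi> k) \<subseteq> dual_space V) \<and> \<phi> = (\<lambda>hs. \<Sum>k<m. c k * word_form (\<xi> k) hs)"
    unfolding dual_tensor_power_def by blast
  then show thesis using that[of m \<xi> c] by simp
qed

lemma dual_tensor_power_zero: "(\<lambda>_. 0) \<in> dual_tensor_power V n"
  by (rule dual_tensor_powerI[of "{}"]) auto

lemma dual_tensor_power_add:
  assumes "\<phi> \<in> dual_tensor_power V n" "\<psi> \<in> dual_tensor_power V n"
  shows "(\<lambda>hs. \<phi> hs + \<psi> hs) \<in> dual_tensor_power V n"
proof -
  obtain m c \<xi> where 1: "\<And>k. k < (m::nat) \<Longrightarrow> length (\<xi> k) = n \<and> set (\<xi> k) \<subseteq> dual_space V"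
    "\<And>hs. \<phi> hs = (\<Sum>k<m. c k * word_form (\<xi> k) hs)" by (rule dual_tensor_powerE[OF assms(1)]) blast
  obtain m' c' \<xi>' where 2: "\<And>k. k < (m'::nat) \<Longrightarrow> length (\<xi>' k) = n \<and> set (\<xi>' k) \<subseteq> dual_space V"
    "\<And>hs. \<psi> hs = (\<Sum>k<m'. c' k * word_form (\<xi>' k) hs)" by (rule dual_tensor_powerE[OF assms(2)]) blast
  show ?thesis
    by (rule dual_tensor_powerI[of "{..<m} <+> {..<m'}" "case_sum \<xi> \<xi>'" _ _ _ "case_sum c c'"])
       (use 1 2 in \<open>fastforce simp: sum.Plus\<close>)+
qed

lemma dual_tensor_power_scale:
  assumes "\<phi> \<in> dual_tensor_power V n" shows "(\<lambda>hs. a * \<phi> hs) \<in> dual_tensor_power V n"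
proof -
  obtain m c \<xi> where 1: "\<And>k. k < (m::nat) \<Longrightarrow> length (\<xi> k) = n \<and> set (\<xi> k) \<subseteq> dual_space V"
    "\<And>hs. \<phi> hs = (\<Sum>k<m. c k * word_form (\<xi> k) hs)" by (rule dual_tensor_powerE[OF assms(1)]) blast
  show ?thesis
    by (rule dual_tensor_powerI[of "{..<m}" \<xi> _ _ _ "\<lambda>k. a * c k"])
       (use 1 in \<open>auto simp: sum_distrib_left mult_ac\<close>)
qed

lemma dual_tensor_power_sum:
  assumes "\<And>i. i \<in> I \<Longrightarrow> \<phi> i \<in> dual_tensor_power V n"
  shows "(\<lambda>hs. \<Sum>i\<in>I. c i * \<phi> i hs) \<in> dual_tensor_power V n"
  using assms
proof (induction I rule: infinite_finite_induct)
  case (insert i I)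
  then show ?case
    using dual_tensor_power_add[OF dual_tensor_power_scale[of "\<phi> i" V n "c i"], of "\<lambda>hs. \<Sum>i\<in>I. c i * \<phi> i hs"]
    by simp
qed (simp_all add: dual_tensor_power_zero)

lemma dual_tensor_power_conc:
  assumes "\<phi> \<in> dual_tensor_power V n" "\<psi> \<in> dual_tensor_power V n'"
  shows "conc \<phi> \<psi> \<in> dual_tensor_power V (n + n')"
proof -
  obtain m c \<xi> where 1: "\<And>k. k < (m::nat) \<Longrightarrow> length (\<xi> k) = n \<and> set (\<xi> k) \<subseteq> dual_space V"
    "\<And>hs. \<phi> hs = (\<Sum>k<m. c k * word_form (\<xi> k) hs)" by (rule dual_tensor_powerE[OF assms(1)]) blast
  obtain m' c' \<xi>' where 2: "\<And>k. k < (m'::nat) \<Longrightarrow> length (\<xi>' k) = n' \<and> set (\<xi>' k) \<subseteq> dual_space V"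
    "\<And>hs. \<psi> hs = (\<Sum>k<m'. c' k * word_form (\<xi>' k) hs)" by (rule dual_tensor_powerE[OF assms(2)]) blast
  have *: "conc \<phi> \<psi> hs = (\<Sum>(k,k')\<in>{..<m} \<times> {..<m'}. c k * c' k' * conc (word_form (\<xi> k)) (word_form (\<xi>' k')) hs)" for hs
  proof -
    have "conc \<phi> \<psi> hs = (\<Sum>i\<le>length hs. \<Sum>(k,k')\<in>{..<m} \<times> {..<m'}.
        c k * c' k' * (word_form (\<xi> k) (take i hs) * word_form (\<xi>' k') (drop i hs)))"
      unfolding conc_def 1(2) 2(2)
      by (simp only: sum_product sum.cartesian_product) (simp add: mult_ac case_prod_unfold)
    also have "\<dots> = (\<Sum>(k,k')\<in>{..<m} \<times> {..<m'}. \<Sum>i\<le>length hs.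
        c k * c' k' * (word_form (\<xi> k) (take i hs) * word_form (\<xi>' k') (drop i hs)))"
      by (subst sum.swap) (simp add: case_prod_unfold)
    finally show ?thesis by (simp add: conc_def sum_distrib_left case_prod_unfold)
  qed
  show ?thesis
    by (rule dual_tensor_powerI[of "{..<m} \<times> {..<m'}" "\<lambda>(k,k'). \<xi> k @ \<xi>' k'" _ _ _ "\<lambda>(k,k'). c k * c' k'"])
       (use 1(1) 2(1) in \<open>fastforce simp: * conc_word_form case_prod_unfold\<close>)+
qed

lemma free_lie_dual_tensor_power: "free_lie V n \<phi> \<Longrightarrow> \<phi> \<in> dual_tensor_power V n"
proof (induction rule: free_lie.induct)
  case (gen \<xi>)
  then show ?case by (intro dual_tensor_powerI[of "{()}" "\<lambda>_. [\<xi>]" _ _ _ "\<lambda>_. 1"]) auto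
next
  case (bracket m \<phi> n \<psi>)
  have "(\<lambda>hs. conc \<phi> \<psi> hs + (-1) * conc \<psi> \<phi> hs) \<in> dual_tensor_power V (m + n)"
    using bracket dual_tensor_power_conc[of \<psi> V n \<phi> m] dual_tensor_power_conc[of \<phi> V m \<psi> n]
    by (intro dual_tensor_power_add dual_tensor_power_scale) (simp_all add: add.commute)
  then show ?case by simp
qed (auto intro: dual_tensor_power_zero dual_tensor_power_add dual_tensor_power_scale)

text \<open>The first two clauses say that the linear extension of \<phi> kills the generators of
  \<open>shuffle_rels\<close>, so that it descends to shuffle classes; the third records the
  extension by zero.\<close>

definition multilinear :: "(complex, 'v) module \<Rightarrow> ('v list \<Rightarrow> complex) \<Rightarrow> bool" where
  "multilinear V \<phi> \<longleftrightarrow>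
    (\<forall>u x y w. x \<in> carrier V \<longrightarrow> y \<in> carrier V \<longrightarrow>
       \<phi> (u @ (x \<oplus>\<^bsub>V\<^esub> y) # w) = \<phi> (u @ x # w) + \<phi> (u @ y # w)) \<and>
    (\<forall>u c x w. x \<in> carrier V \<longrightarrow> \<phi> (u @ (c \<odot>\<^bsub>V\<^esub> x) # w) = c * \<phi> (u @ x # w)) \<and>
    (\<forall>w. w \<notin> lists (carrier V) \<longrightarrow> \<phi> w = 0)"

lemma multilinear_word_form:
  assumes "set \<xi>s \<subseteq> dual_space V" shows "multilinear V (word_form \<xi>s)"
proof -
  have "word_form \<xi>s (u @ (x \<oplus>\<^bsub>V\<^esub> y) # w) = word_form \<xi>s (u @ x # w) + word_form \<xi>s (u @ y # w)"
    "word_form \<xi>s (u @ (c \<odot>\<^bsub>V\<^esub> x) # w) = c * word_form \<xi>s (u @ x # w)"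
    if "x \<in> carrier V" "y \<in> carrier V" for u x y w c
    using assms
    by (induction \<xi>s arbitrary: u; case_tac u; auto simp: dual_space_def that algebra_simps)+
  moreover have "word_form \<xi>s w = 0" if "w \<notin> lists (carrier V)" for w
    using assms that
  proof (induction \<xi>s arbitrary: w)
    case (Cons a \<xi>s)
    then show ?case by (cases w) (auto simp: dual_space_def)
  qed auto
  ultimately show ?thesis unfolding multilinear_def by auto
qed

lemma multilinear_dual_tensor_power:
  assumes "\<phi> \<in> dual_tensor_power V n" shows "multilinear V \<phi>"
proof -
  obtain m c \<xi> where 1: "\<And>k. k < (m::nat) \<Longrightarrow> length (\<xi> k) = n \<and> set (\<xi> k) \<subseteq> dual_space V"
    "\<And>hs. \<phi> hs = (\<Sum>k<m. c k * word_form (\<xi> k) hs)" by (rule dual_tensor_powerE[OF assms]) blast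
  have "multilinear V (word_form (\<xi> k))" if "k < m" for k
    using 1(1)[OF that] by (intro multilinear_word_form) auto
  then show ?thesis
    unfolding multilinear_def 1(2)
    by (simp add: sum_distrib_left sum.distrib[symmetric] algebra_simps)
qed

text \<open>Each identity involves words of a single length only, so it can be read off in the
  component of that degree.\<close>

lemma multilinear_completed:
  assumes "\<phi> \<in> completed_tensor_alg V" shows "multilinear V \<phi>"
proof -
  have "multilinear V (\<lambda>hs. if length hs = n then \<phi> hs else 0)" for n
    using assms by (intro multilinear_dual_tensor_power) (auto simp: completed_tensor_alg_def)
  note ml = this[unfolded multilinear_def]
  show ?thesis
    unfolding multilinear_def
  proof (intro conjI allI impI)
    fix u x y w assume "x \<in> carrier V" "y \<in> carrier V"
    then show "\<phi> (u @ (x \<oplus>\<^bsub>V\<^esub> y) # w) = \<phi> (u @ x # w) + \<phi> (u @ y # w)"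
      using conjunct1[OF ml[of "length u + Suc (length w)"], rule_format, of x y u w] by simp
  next
    fix u c x w assume "x \<in> carrier V"
    then show "\<phi> (u @ (c \<odot>\<^bsub>V\<^esub> x) # w) = c * \<phi> (u @ x # w)"
      using conjunct1[OF conjunct2[OF ml[of "length u + Suc (length w)"]], rule_format, of x u c w] by simp
  next
    fix w assume "w \<notin> lists (carrier V)"
    then show "\<phi> w = 0" using conjunct2[OF conjunct2[OF ml[of "length w"]], rule_format, of w] by simp
  qed
qed

lemma dual_tensor_power_length:
  "\<phi> \<in> dual_tensor_power V n \<Longrightarrow> length hs \<noteq> n \<Longrightarrow> \<phi> hs = 0"
  by (erule dual_tensor_powerE) (simp add: word_form_def)

section \<open>Polynomial functions\<close>

lemma poly_funs_uminus: "P \<in> poly_funs \<Longrightarrow> (\<lambda>x. - P x) \<in> poly_funs"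
  using poly_funs.mult[OF poly_funs.const[of "-1"]] by simp

lemma poly_funs_diff: "P \<in> poly_funs \<Longrightarrow> Q \<in> poly_funs \<Longrightarrow> (\<lambda>x. P x - Q x) \<in> poly_funs"
  using poly_funs.add[OF _ poly_funs_uminus] by fastforce

lemma poly_funs_sum: "(\<And>i. i \<in> I \<Longrightarrow> P i \<in> poly_funs) \<Longrightarrow> (\<lambda>x. \<Sum>i\<in>I. P i x) \<in> poly_funs"
  by (induction I rule: infinite_finite_induct) (auto intro: poly_funs.intros)

lemma poly_funs_prod: "(\<And>i. i \<in> I \<Longrightarrow> P i \<in> poly_funs) \<Longrightarrow> (\<lambda>x. \<Prod>i\<in>I. P i x) \<in> poly_funs"
  by (induction I rule: infinite_finite_induct) (auto intro: poly_funs.intros)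

lemma poly_funs_det:
  assumes "\<And>i j. M i j \<in> poly_funs" shows "(\<lambda>x. det (\<chi> i j. M i j x)) \<in> poly_funs"
  unfolding det_def by (auto intro!: poly_funs_sum poly_funs_prod poly_funs.intros assms)

lemma poly_funs_poly: "Q \<in> poly_funs \<Longrightarrow> (\<lambda>x. poly R (Q x)) \<in> poly_funs"
  by (induction R) (auto intro: poly_funs.intros)

text \<open>One gradient \<open>G\<close> has to serve two chain rules, the complex one along curves
  and the real Frechet derivative that the inverse function theorem asks for; both are therefore
  carried through the same induction.\<close>

lemma poly_funs_gradient:
  fixes P :: "complex ^ 'n \<Rightarrow> complex"
  assumes "P \<in> poly_funs"
  shows "\<exists>G. (\<forall>i. G i \<in> poly_funs) \<and>
    (\<forall>\<gamma> t w. (\<forall>i. ((\<lambda>s. \<gamma> s $ i) has_field_derivative w $ i) (at t)) \<longrightarrow>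
       ((\<lambda>s. P (\<gamma> s)) has_field_derivative (\<Sum>i\<in>UNIV. G i (\<gamma> t) * w $ i)) (at t)) \<and>
    (\<forall>x. (P has_derivative (\<lambda>v. \<Sum>i\<in>UNIV. G i x * v $ i)) (at x))"
  using assms
proof induction
  case (const c)
  show ?case by (intro exI[of _ "\<lambda>_ _. 0"]) (auto intro: poly_funs.const)
next
  case (coord i)
  have "(\<Sum>j\<in>UNIV. (if j = i then 1 else 0) * v $ j) = v $ i" for v :: "complex ^ 'n"
    by (subst sum.cong[OF refl, of _ _ "\<lambda>j. if j = i then v $ j else 0"]) auto
  then show ?case
    by (intro exI[of _ "\<lambda>j _. if j = i then 1 else 0"])
       (auto intro: poly_funs.const bounded_linear.has_derivative[OF bounded_linear_vec_nth] has_derivative_ident)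
next
  case (add P Q)
  then obtain G H where
    "(\<forall>i. G i \<in> poly_funs) \<and>
    (\<forall>\<gamma> t w. (\<forall>i. ((\<lambda>s. \<gamma> s $ i) has_field_derivative w $ i) (at t)) \<longrightarrow>
       ((\<lambda>s. P (\<gamma> s)) has_field_derivative (\<Sum>i\<in>UNIV. G i (\<gamma> t) * w $ i)) (at t)) \<and>
    (\<forall>x. (P has_derivative (\<lambda>v. \<Sum>i\<in>UNIV. G i x * v $ i)) (at x))"
    "(\<forall>i. H i \<in> poly_funs) \<and>
    (\<forall>\<gamma> t w. (\<forall>i. ((\<lambda>s. \<gamma> s $ i) has_field_derivative w $ i) (at t)) \<longrightarrow>
       ((\<lambda>s. Q (\<gamma> s)) has_field_derivative (\<Sum>i\<in>UNIV. H i (\<gamma> t) * w $ i)) (at t)) \<and>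
    (\<forall>x. (Q has_derivative (\<lambda>v. \<Sum>i\<in>UNIV. H i x * v $ i)) (at x))"
    by blast
  note GH = this
  show ?case
  proof (intro exI[of _ "\<lambda>i x. G i x + H i x"] conjI allI impI)
    show "(\<lambda>x. G i x + H i x) \<in> poly_funs" for i using GH by (auto intro: poly_funs.add)
  next
    fix \<gamma> :: "complex \<Rightarrow> complex ^ 'n" and t and w :: "complex ^ 'n" assume "\<forall>i. ((\<lambda>s. \<gamma> s $ i) has_field_derivative w $ i) (at (t::complex))"
    then show "((\<lambda>s. P (\<gamma> s) + Q (\<gamma> s)) has_field_derivative (\<Sum>i\<in>UNIV. (G i (\<gamma> t) + H i (\<gamma> t)) * w $ i)) (at t)"
      using GH by (auto simp: distrib_right sum.distrib intro!: DERIV_add)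
  next
    show "((\<lambda>x. P x + Q x) has_derivative (\<lambda>v. \<Sum>i\<in>UNIV. (G i x + H i x) * v $ i)) (at x)" for x
      using GH by (auto simp: distrib_right sum.distrib intro!: has_derivative_add)
  qed
next
  case (mult P Q)
  then obtain G H where
    "(\<forall>i. G i \<in> poly_funs) \<and>
    (\<forall>\<gamma> t w. (\<forall>i. ((\<lambda>s. \<gamma> s $ i) has_field_derivative w $ i) (at t)) \<longrightarrow>
       ((\<lambda>s. P (\<gamma> s)) has_field_derivative (\<Sum>i\<in>UNIV. G i (\<gamma> t) * w $ i)) (at t)) \<and>
    (\<forall>x. (P has_derivative (\<lambda>v. \<Sum>i\<in>UNIV. G i x * v $ i)) (at x))"
    "(\<forall>i. H i \<in> poly_funs) \<and>
    (\<forall>\<gamma> t w. (\<forall>i. ((\<lambda>s. \<gamma> s $ i) has_field_derivative w $ i) (at t)) \<longrightarrow>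
       ((\<lambda>s. Q (\<gamma> s)) has_field_derivative (\<Sum>i\<in>UNIV. H i (\<gamma> t) * w $ i)) (at t)) \<and>
    (\<forall>x. (Q has_derivative (\<lambda>v. \<Sum>i\<in>UNIV. H i x * v $ i)) (at x))"
    by blast
  note GH = this
  show ?case
  proof (intro exI[of _ "\<lambda>i x. G i x * Q x + P x * H i x"] conjI allI impI)
    show "(\<lambda>x. G i x * Q x + P x * H i x) \<in> poly_funs" for i
      using GH mult.hyps by (auto intro!: poly_funs.add poly_funs.mult)
  next
    fix \<gamma> :: "complex \<Rightarrow> complex ^ 'n" and t and w :: "complex ^ 'n" assume "\<forall>i. ((\<lambda>s. \<gamma> s $ i) has_field_derivative w $ i) (at (t::complex))"
    then have "((\<lambda>s. P (\<gamma> s)) has_field_derivative (\<Sum>i\<in>UNIV. G i (\<gamma> t) * w $ i)) (at t)"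
      "((\<lambda>s. Q (\<gamma> s)) has_field_derivative (\<Sum>i\<in>UNIV. H i (\<gamma> t) * w $ i)) (at t)"
      using GH by auto
    from DERIV_mult[OF this]
    show "((\<lambda>s. P (\<gamma> s) * Q (\<gamma> s)) has_field_derivative
        (\<Sum>i\<in>UNIV. (G i (\<gamma> t) * Q (\<gamma> t) + P (\<gamma> t) * H i (\<gamma> t)) * w $ i)) (at t)"
      by (simp add: algebra_simps sum.distrib[symmetric] sum_distrib_left sum_distrib_right)
  next
    fix x
    have "(P has_derivative (\<lambda>v. \<Sum>i\<in>UNIV. G i x * v $ i)) (at x)"
      "(Q has_derivative (\<lambda>v. \<Sum>i\<in>UNIV. H i x * v $ i)) (at x)"
      using GH by auto
    from has_derivative_mult[OF this]
    show "((\<lambda>x. P x * Q x) has_derivative (\<lambda>v. \<Sum>i\<in>UNIV. (G i x * Q x + P x * H i x) * v $ i)) (at x)"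
      by (rule has_derivative_eq_rhs)
         (simp add: fun_eq_iff algebra_simps sum.distrib[symmetric] sum_distrib_left sum_distrib_right)
  qed
qed

definition grad :: "'n \<Rightarrow> (complex ^ 'n \<Rightarrow> complex) \<Rightarrow> complex ^ 'n \<Rightarrow> complex" where
  "grad i P x = dir_deriv P x (axis i 1)"

lemma
  fixes P :: "complex ^ 'n \<Rightarrow> complex"
  assumes "P \<in> poly_funs"
  shows poly_funs_grad: "grad i P \<in> poly_funs"
    and dir_deriv_grad: "dir_deriv P x v = (\<Sum>i\<in>UNIV. grad i P x * v $ i)"
    and poly_funs_has_derivative: "(P has_derivative (\<lambda>v. \<Sum>i\<in>UNIV. grad i P x * v $ i)) (at x)"
    and poly_funs_chain: "(\<And>i. ((\<lambda>s. \<gamma> s $ i) has_field_derivative w $ i) (at t)) \<Longrightarrow>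
       ((\<lambda>s. P (\<gamma> s)) has_field_derivative dir_deriv P (\<gamma> t) w) (at t)"
proof -
  obtain G where G: "\<And>i. G i \<in> poly_funs"
    "\<And>\<gamma> t w. (\<And>i. ((\<lambda>s. \<gamma> s $ i) has_field_derivative w $ i) (at t)) \<Longrightarrow>
       ((\<lambda>s. P (\<gamma> s)) has_field_derivative (\<Sum>i\<in>UNIV. G i (\<gamma> t) * w $ i)) (at t)"
    "\<And>x. (P has_derivative (\<lambda>v. \<Sum>i\<in>UNIV. G i x * v $ i)) (at x)"
    using poly_funs_gradient[OF assms] by blast
  have D: "dir_deriv P x v = (\<Sum>i\<in>UNIV. G i x * v $ i)" for x v
  proof -
    have "((\<lambda>t. P (x + t *s v)) has_field_derivative (\<Sum>i\<in>UNIV. G i (x + 0 *s v) * v $ i)) (at 0)"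
      by (rule G(2)) (auto intro!: derivative_eq_intros)
    then show ?thesis unfolding dir_deriv_def by (simp add: DERIV_imp_deriv)
  qed
  have "(\<Sum>j\<in>UNIV. G j x * axis i 1 $ j) = (\<Sum>j\<in>UNIV. if j = i then G j x else 0)" for i x
    by (intro sum.cong) (auto simp: axis_def)
  then have gr: "grad i P = G i" for i by (auto simp: grad_def D)
  show "grad i P \<in> poly_funs" "dir_deriv P x v = (\<Sum>i\<in>UNIV. grad i P x * v $ i)"
    "(P has_derivative (\<lambda>v. \<Sum>i\<in>UNIV. grad i P x * v $ i)) (at x)"
    using G D by (simp_all add: gr)
  show "((\<lambda>s. P (\<gamma> s)) has_field_derivative dir_deriv P (\<gamma> t) w) (at t)"
    if "\<And>i. ((\<lambda>s. \<gamma> s $ i) has_field_derivative w $ i) (at t)"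
    using G(2)[OF that] by (simp add: D)
qed

lemma dir_deriv_linear:
  assumes "P \<in> poly_funs"
  shows "dir_deriv P x (v + w) = dir_deriv P x v + dir_deriv P x w" "dir_deriv P x (c *s v) = c * dir_deriv P x v"
  using assms by (simp_all add: dir_deriv_grad algebra_simps sum.distrib sum_distrib_left)

lemma dir_deriv_simps:
  assumes "P \<in> poly_funs" "Q \<in> poly_funs"
  shows "dir_deriv (\<lambda>x. P x + Q x) x v = dir_deriv P x v + dir_deriv Q x v"
    and "dir_deriv (\<lambda>x. P x * Q x) x v = dir_deriv P x v * Q x + P x * dir_deriv Q x v"
    and "dir_deriv (\<lambda>x. c) x v = 0"
    and "dir_deriv (\<lambda>x. x $ i) x v = v $ i"
proof -
  have 1: "((\<lambda>t. P (x + t *s v)) has_field_derivative dir_deriv P x v) (at 0)" if "P \<in> poly_funs" for P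
  proof -
    have "((\<lambda>t. (x + t *s v) $ i) has_field_derivative v $ i) (at 0)" for i
      by (auto intro!: derivative_eq_intros)
    from poly_funs_chain[OF that, of "\<lambda>t. x + t *s v", OF this] show ?thesis by simp
  qed
  have 2: "((\<lambda>t. x $ i + t * v $ i) has_field_derivative v $ i) (at 0)"
    by (auto intro!: derivative_eq_intros)
  show "dir_deriv (\<lambda>x. P x + Q x) x v = dir_deriv P x v + dir_deriv Q x v"
    "dir_deriv (\<lambda>x. P x * Q x) x v = dir_deriv P x v * Q x + P x * dir_deriv Q x v"
    "dir_deriv (\<lambda>x. c) x v = 0" "dir_deriv (\<lambda>x. x $ i) x v = v $ i"
    using DERIV_add[OF 1[OF assms(1)] 1[OF assms(2)]] DERIV_mult[OF 1[OF assms(1)] 1[OF assms(2)]] 2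
    by (simp_all add: dir_deriv_def DERIV_imp_deriv algebra_simps)
qed

lemma poly_funs_continuous: "P \<in> poly_funs \<Longrightarrow> continuous_on S P"
  by (meson continuous_at_imp_continuous_on has_derivative_continuous poly_funs_has_derivative)

lemma poly_funs_holomorphic:
  assumes "P \<in> poly_funs" "\<And>i. (\<lambda>t. \<gamma> t $ i) holomorphic_on D"
  shows "(\<lambda>t. P (\<gamma> t)) holomorphic_on D"
  using assms(1) by induction (auto intro!: holomorphic_intros assms(2))

text \<open>Shows that \<open>P\<close> minus its value at \<open>a\<close> lies in the ideal
  generated by the differences of the coordinates from those of \<open>a\<close>. In the
  Nullstellensatz this evaluates every polynomial modulo a maximal ideal.\<close>

lemma poly_funs_expansion:
  fixes P :: "complex ^ 'n \<Rightarrow> complex"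
  assumes "P \<in> poly_funs"
  shows "\<exists>G. (\<forall>i. G i \<in> poly_funs) \<and> (\<forall>x. P x - P a = (\<Sum>i\<in>UNIV. G i x * (x $ i - a $ i)))"
  using assms
proof induction
  case (const c)
  then show ?case by (intro exI[of _ "\<lambda>_ _. 0"]) (auto intro: poly_funs.const)
next
  case (coord i)
  have "(\<Sum>j\<in>UNIV. (if j = i then 1 else 0) * v $ j) = v $ i" for v :: "complex ^ 'n"
    by (subst sum.cong[OF refl, of _ _ "\<lambda>j. if j = i then v $ j else 0"]) auto
  from this[of "_ - a"] show ?case
    by (intro exI[of _ "\<lambda>j _. if j = i then 1 else 0"]) (auto intro: poly_funs.const)
next
  case (add P Q)
  then obtain G H where GH: "\<And>i. G i \<in> poly_funs" "\<And>x. P x - P a = (\<Sum>i\<in>UNIV. G i x * (x $ i - a $ i))"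
    "\<And>i. H i \<in> poly_funs" "\<And>x. Q x - Q a = (\<Sum>i\<in>UNIV. H i x * (x $ i - a $ i))" by blast
  have "P x + Q x - (P a + Q a) = (\<Sum>i\<in>UNIV. (G i x + H i x) * (x $ i - a $ i))" for x
  proof -
    have "P x + Q x - (P a + Q a) = (P x - P a) + (Q x - Q a)" by simp
    then show ?thesis unfolding GH(2) GH(4) by (simp add: distrib_right sum.distrib)
  qed
  with GH show ?case by (intro exI[of _ "\<lambda>i x. G i x + H i x"]) (auto intro: poly_funs.add)
next
  case (mult P Q)
  then obtain G H where GH: "\<And>i. G i \<in> poly_funs" "\<And>x. P x - P a = (\<Sum>i\<in>UNIV. G i x * (x $ i - a $ i))"
    "\<And>i. H i \<in> poly_funs" "\<And>x. Q x - Q a = (\<Sum>i\<in>UNIV. H i x * (x $ i - a $ i))" by blast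
  have "P x * Q x - P a * Q a = (\<Sum>i\<in>UNIV. (G i x * Q x + P a * H i x) * (x $ i - a $ i))" for x
  proof -
    have "P x * Q x - P a * Q a = (P x - P a) * Q x + P a * (Q x - Q a)" by (simp add: algebra_simps)
    also have "\<dots> = (\<Sum>i\<in>UNIV. (G i x * Q x + P a * H i x) * (x $ i - a $ i))"
      unfolding GH(2) GH(4) by (simp add: algebra_simps sum.distrib[symmetric] sum_distrib_left sum_distrib_right)
    finally show ?thesis .
  qed
  with GH mult.hyps show ?case
    by (intro exI[of _ "\<lambda>i x. G i x * Q x + P a * H i x"]) (auto intro!: poly_funs.intros)
qed

section \<open>The weak Nullstellensatz\<close>

definition poly_ideal :: "(complex ^ 'n \<Rightarrow> complex) set \<Rightarrow> bool" where
  "poly_ideal I \<longleftrightarrow> I \<subseteq> poly_funs \<and> (\<lambda>_. 0) \<in> I \<and> (\<forall>P\<in>I. \<forall>Q\<in>I. (\<lambda>x. P x + Q x) \<in> I) \<and>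
     (\<forall>P\<in>I. \<forall>Q\<in>poly_funs. (\<lambda>x. Q x * P x) \<in> I)"

lemma poly_idealD:
  assumes "poly_ideal I"
  shows "P \<in> I \<Longrightarrow> P \<in> poly_funs" "(\<lambda>_. 0) \<in> I" "P \<in> I \<Longrightarrow> Q \<in> I \<Longrightarrow> (\<lambda>x. P x + Q x) \<in> I"
    "P \<in> I \<Longrightarrow> Q \<in> poly_funs \<Longrightarrow> (\<lambda>x. Q x * P x) \<in> I" "P \<in> I \<Longrightarrow> Q \<in> I \<Longrightarrow> (\<lambda>x. P x - Q x) \<in> I"
proof -
  show "P \<in> I \<Longrightarrow> P \<in> poly_funs" "(\<lambda>_. 0) \<in> I" and *: "P \<in> I \<Longrightarrow> Q \<in> I \<Longrightarrow> (\<lambda>x. P x + Q x) \<in> I" 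
    and **: "P \<in> I \<Longrightarrow> Q \<in> poly_funs \<Longrightarrow> (\<lambda>x. Q x * P x) \<in> I" for P Q
    using assms by (auto simp: poly_ideal_def)
  show "P \<in> I \<Longrightarrow> Q \<in> I \<Longrightarrow> (\<lambda>x. P x - Q x) \<in> I"
    using *[OF _ **[OF _ poly_funs.const[of "-1"]], of P Q] by simp
qed

lemma poly_ideal_sum:
  "poly_ideal I \<Longrightarrow> (\<And>k. k \<in> K \<Longrightarrow> P k \<in> I) \<Longrightarrow> (\<lambda>x. \<Sum>k\<in>K. P k x) \<in> I"
  by (induction K rule: infinite_finite_induct) (auto intro: poly_idealD)

text \<open>Zorn's lemma. The last conclusion is the form in which maximality is used: elements
  outside \<mm> are invertible modulo \<mm>.\<close>

lemma poly_ideal_maximal: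
  fixes I :: "(complex ^ 'n \<Rightarrow> complex) set"
  assumes I: "poly_ideal I" "(\<lambda>_. 1) \<notin> I"
  obtains \<mm> where "poly_ideal \<mm>" "I \<subseteq> \<mm>" "(\<lambda>_. 1) \<notin> \<mm>"
    "\<And>P. P \<in> poly_funs \<Longrightarrow> P \<notin> \<mm> \<Longrightarrow> \<exists>Q\<in>poly_funs. (\<lambda>x. Q x * P x - 1) \<in> \<mm>"
proof -
  let ?A = "{J. poly_ideal J \<and> I \<subseteq> J \<and> (\<lambda>_. 1) \<notin> J}"
  have "\<exists>M\<in>?A. \<forall>X\<in>?A. M \<subseteq> X \<longrightarrow> X = M"
  proof (rule subset_Zorn_nonempty)
    show "?A \<noteq> {}" using I by blast
    fix \<C> assume \<C>: "\<C> \<noteq> {}" "subset.chain ?A \<C>"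
    then have ch: "\<And>J. J \<in> \<C> \<Longrightarrow> poly_ideal J \<and> I \<subseteq> J \<and> (\<lambda>_. 1) \<notin> J" "\<And>J J'. J \<in> \<C> \<Longrightarrow> J' \<in> \<C> \<Longrightarrow> J \<subseteq> J' \<or> J' \<subseteq> J"
      by (auto simp: subset.chain_def)
    have "(\<lambda>x. P x + Q x) \<in> \<Union>\<C>" if PQ: "P \<in> \<Union>\<C>" "Q \<in> \<Union>\<C>" for P Q
    proof -
      obtain J J' where J: "J \<in> \<C>" "J' \<in> \<C>" "P \<in> J" "Q \<in> J'" using PQ by blast
      then consider "P \<in> J'" | "Q \<in> J" using ch(2) by blast
      then show ?thesis using J ch(1) poly_idealD(3) by cases blast+
    qed
    moreover have "(\<lambda>x. Q x * P x) \<in> \<Union>\<C>" if "P \<in> \<Union>\<C>" "Q \<in> poly_funs" for P Q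
      using that ch(1) poly_idealD(4) by blast
    moreover have "\<Union>\<C> \<subseteq> poly_funs" using ch(1) poly_idealD(1) by blast
    moreover have "(\<lambda>_. 0) \<in> \<Union>\<C>" using \<C>(1) ch(1) poly_idealD(2) by blast
    ultimately have "poly_ideal (\<Union>\<C>)" unfolding poly_ideal_def by blast
    moreover have "I \<subseteq> \<Union>\<C>" using \<C>(1) ch(1) by blast
    moreover have "(\<lambda>_. 1) \<notin> \<Union>\<C>" using ch(1) by blast
    ultimately show "\<Union>\<C> \<in> ?A" by blast
  qed
  then obtain \<mm> where \<mm>: "poly_ideal \<mm>" "I \<subseteq> \<mm>" "(\<lambda>_. 1) \<notin> \<mm>"
    and max: "\<And>J. poly_ideal J \<Longrightarrow> I \<subseteq> J \<Longrightarrow> (\<lambda>_. 1) \<notin> J \<Longrightarrow> \<mm> \<subseteq> J \<Longrightarrow> J = \<mm>" by auto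
  note m = poly_idealD[OF \<mm>(1)]
  have "\<exists>Q\<in>poly_funs. (\<lambda>x. Q x * P x - 1) \<in> \<mm>" if P: "P \<in> poly_funs" "P \<notin> \<mm>" for P
  proof -
    \<comment> \<open>The ideal generated by \<mm> and \<open>P\<close>. By maximality it contains
      1, which is the desired congruence.\<close>
    let ?J = "{\<lambda>x. M x + Q x * P x | M Q. M \<in> \<mm> \<and> Q \<in> poly_funs}"
    have sub: "\<mm> \<subseteq> ?J"
    proof
      fix M assume "M \<in> \<mm>"
      then show "M \<in> ?J" by (intro CollectI exI[of _ M] exI[of _ "\<lambda>_. 0"]) (auto intro: poly_funs.const)
    qed
    have "poly_ideal ?J"
      unfolding poly_ideal_def
    proof (intro conjI ballI)
      show "?J \<subseteq> poly_funs" using m(1) P by (auto intro!: poly_funs.intros)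
      show "(\<lambda>_. 0) \<in> ?J" using sub m(2) by blast
    next
      fix A B :: "complex ^ 'n \<Rightarrow> complex" assume "A \<in> ?J" "B \<in> ?J"
      then obtain M Q M' Q' where "A = (\<lambda>x. M x + Q x * P x)" "B = (\<lambda>x. M' x + Q' x * P x)"
        "M \<in> \<mm>" "M' \<in> \<mm>" "Q \<in> poly_funs" "Q' \<in> poly_funs" by blast
      then show "(\<lambda>x. A x + B x) \<in> ?J"
        by (intro CollectI exI[of _ "\<lambda>x. M x + M' x"] exI[of _ "\<lambda>x. Q x + Q' x"])
           (auto simp: algebra_simps intro: m(3) poly_funs.add)
    next
      fix A B :: "complex ^ 'n \<Rightarrow> complex" assume "A \<in> ?J" "B \<in> poly_funs"
      then obtain M Q where "A = (\<lambda>x. M x + Q x * P x)" "M \<in> \<mm>" "Q \<in> poly_funs" by blast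
      with \<open>B \<in> poly_funs\<close> show "(\<lambda>x. B x * A x) \<in> ?J"
        by (intro CollectI exI[of _ "\<lambda>x. B x * M x"] exI[of _ "\<lambda>x. B x * Q x"])
           (auto simp: algebra_simps intro: m(4) poly_funs.mult)
    qed
    moreover have "P \<in> ?J"
      by (intro CollectI exI[of _ "\<lambda>_. 0"] exI[of _ "\<lambda>_. 1"]) (auto intro: poly_funs.const m(2))
    ultimately have "(\<lambda>_. 1) \<in> ?J" using max[of ?J] sub \<mm>(2) P(2) by blast
    then obtain M Q where MQ: "(\<lambda>_. 1) = (\<lambda>x. M x + Q x * P x)" "M \<in> \<mm>" "Q \<in> poly_funs" by blast
    have "Q x * P x - 1 = (- 1) * M x" for x
    proof -
      have "1 = M x + Q x * P x" using MQ(1) by (rule fun_cong)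
      then have "Q x * P x - 1 = Q x * P x - (M x + Q x * P x)" by (rule arg_cong)
      then show ?thesis by simp
    qed
    then show ?thesis using MQ m(4)[OF MQ(2) poly_funs.const[of "-1"]] by (intro bexI[of _ Q]) auto
  qed
  with \<mm> show thesis using that by blast
qed

interpretation cfun: vector_space "\<lambda>(c::complex) (f :: 'a \<Rightarrow> complex) x. c * f x"
  by unfold_locales (auto simp: algebra_simps)

text \<open>Provides a countable spanning set, to be played off against the uncountably many scalars
  in the next lemma.\<close>

lemma poly_funs_span_monomials:
  fixes P :: "complex ^ 'n \<Rightarrow> complex"
  assumes "P \<in> poly_funs"
  shows "P \<in> cfun.span (range (\<lambda>(e :: 'n \<Rightarrow> nat) x. \<Prod>i\<in>UNIV. x $ i ^ e i))" (is "P \<in> cfun.span ?M")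
  using assms
proof induction
  case (const c)
  have "(\<lambda>x. \<Prod>i\<in>UNIV. x $ i ^ (0::nat)) \<in> ?M" by (rule range_eqI[of _ _ "\<lambda>_. 0"]) simp
  then have "(\<lambda>x. c * (\<Prod>i\<in>UNIV. x $ i ^ (0::nat))) \<in> cfun.span ?M"
    by (intro cfun.span_scale cfun.span_base)
  then show ?case by simp
next
  case (coord i)
  have "(\<Prod>j\<in>UNIV. x $ j ^ (if j = i then 1 else 0)) = x $ i" for x :: "complex ^ 'n"
    by (subst prod.cong[OF refl, of _ _ "\<lambda>j. if j = i then x $ j else 1"]) auto
  then have "(\<lambda>x::complex ^ 'n. x $ i) \<in> ?M" by (intro range_eqI[of _ _ "\<lambda>j. if j = i then 1 else 0"]) auto
  then show ?case by (rule cfun.span_base)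
next
  case (add P Q)
  then show ?case using cfun.span_add[of P ?M Q] by (simp add: plus_fun_def)
next
  case (mult P Q)
  have mm: "(\<lambda>x. a x * b x) \<in> ?M" if ab: "a \<in> ?M" "b \<in> ?M" for a b
  proof -
    obtain e e' where "a = (\<lambda>x. \<Prod>i\<in>UNIV. x $ i ^ e i)" "b = (\<lambda>x. \<Prod>i\<in>UNIV. x $ i ^ e' i)"
      using ab by blast
    then show ?thesis
      by (intro range_eqI[of _ _ "\<lambda>i. e i + e' i"]) (auto simp: power_add prod.distrib)
  qed
  have 1: "(\<lambda>x. a x * q x) \<in> cfun.span ?M" if a: "a \<in> ?M" and q: "q \<in> cfun.span ?M" for a q
    using q
  proof (induction rule: cfun.span_induct_alt)
    case base
    then show ?case using cfun.span_zero[of ?M] by (simp add: zero_fun_def)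
  next
    case (step c b y)
    have "(\<lambda>x. c * (a x * b x)) \<in> cfun.span ?M" using mm[OF a] step by (intro cfun.span_scale cfun.span_base)
    from cfun.span_add[OF this step(2)] show ?case by (simp add: plus_fun_def algebra_simps)
  qed
  show ?case using mult.IH(1)
  proof (induction rule: cfun.span_induct_alt)
    case base
    then show ?case using cfun.span_zero[of ?M] by (simp add: zero_fun_def)
  next
    case (step c b y)
    have "(\<lambda>x. c * (b x * Q x)) \<in> cfun.span ?M" using 1[OF step(1) mult.IH(2)] by (rule cfun.span_scale)
    from cfun.span_add[OF this step(2)] show ?case by (simp add: plus_fun_def algebra_simps)
  qed
qed

text \<open>
  In a residue field in which \<open>x $ i\<close> differs from every scalar \<open>c\<close>, the inverses of the
  \<open>x $ i - c\<close> form an uncountable family in a space of countable dimension.  A linear relation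
  between them gives a nonzero polynomial relation for \<open>x $ i\<close>, which is impossible over an
  algebraically closed field.
\<close>

lemma poly_ideal_coordinate:
  fixes \<mm> :: "(complex ^ 'n \<Rightarrow> complex) set"
  assumes \<mm>: "poly_ideal \<mm>" "(\<lambda>_. 1) \<notin> \<mm>"
    and inv: "\<And>P. P \<in> poly_funs \<Longrightarrow> P \<notin> \<mm> \<Longrightarrow> \<exists>Q\<in>poly_funs. (\<lambda>x. Q x * P x - 1) \<in> \<mm>"
  shows "\<exists>c. (\<lambda>x. x $ i - c) \<in> \<mm>"
proof (rule ccontr)
  assume no: "\<nexists>c. (\<lambda>x. x $ i - c) \<in> \<mm>"
  note m = poly_idealD[OF \<mm>(1)]
  have Xc: "(\<lambda>x. x $ i - c) \<in> poly_funs" for c by (intro poly_funs_diff poly_funs.intros)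
  have "\<forall>c. \<exists>Q\<in>poly_funs. (\<lambda>x. Q x * (x $ i - c) - 1) \<in> \<mm>" using inv[OF Xc] no by blast
  then obtain q where q: "\<And>c. q c \<in> poly_funs" "\<And>c. (\<lambda>x. q c x * (x $ i - c) - 1) \<in> \<mm>" by metis
  \<comment> \<open>The factor has the inverse \<open>q c\<close> modulo \<mm>, so it can be
    cancelled.\<close>
  have cancel: "Q \<in> \<mm>" if "Q \<in> poly_funs" "(\<lambda>x. (x $ i - c) * Q x) \<in> \<mm>" for Q c
  proof -
    have "(\<lambda>x. q c x * ((x $ i - c) * Q x)) \<in> \<mm>" "(\<lambda>x. Q x * (q c x * (x $ i - c) - 1)) \<in> \<mm>"
      using m(4)[OF that(2) q(1)] m(4)[OF q(2) that(1)] by auto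
    from m(5)[OF this] show ?thesis by (simp add: algebra_simps)
  qed
  \<comment> \<open>A polynomial over the complex numbers splits into linear factors; they are
    cancelled one at a time until a nonzero constant would lie in \<mm>.\<close>
  have noroot: "(\<lambda>x. poly R (x $ i)) \<notin> \<mm>" if "R \<noteq> 0" for R :: "complex Polynomial.poly"
    using that
  proof (induction "Polynomial.degree R" arbitrary: R rule: less_induct)
    case less
    show ?case
    proof
      assume R: "(\<lambda>x. poly R (x $ i)) \<in> \<mm>"
      show False
      proof (cases "Polynomial.degree R = 0")
        case True
        then obtain a where a: "R = [:a:]" by (rule degree_eq_zeroE)
        then have "(\<lambda>x. (1/a) * poly R (x $ i)) \<in> \<mm>" using m(4)[OF R poly_funs.const[of "1/a"]] by simp
        then show False using a less.prems \<mm>(2) by simp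
      next
        case False
        then obtain r where "poly R r = 0" using alg_closed_imp_poly_has_root[of R] by auto
        then obtain Q where Q: "R = [:-r, 1:] * Q" by (auto simp: poly_eq_0_iff_dvd elim: dvdE)
        then have "Q \<noteq> 0" using less.prems by auto
        then have "Polynomial.degree Q < Polynomial.degree R"
          using degree_mult_eq[of "[:-r, 1:]" Q] by (simp add: Q)
        moreover have "(\<lambda>x. poly Q (x $ i)) \<in> \<mm>"
        proof (rule cancel)
          show "(\<lambda>x. (x $ i - r) * poly Q (x $ i)) \<in> \<mm>" using R unfolding Q by (simp add: algebra_simps)
        qed (intro poly_funs_poly poly_funs.coord)
        ultimately show False using less.hyps[of Q] \<open>Q \<noteq> 0\<close> by simp
      qed
    qed
  qed
  have inj: "inj q"
  proof (rule injI, rule ccontr)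
    fix c d assume cd: "q c = q d" "c \<noteq> d"
    from m(5)[OF q(2)[of c] q(2)[of d]] cd(1) have "(\<lambda>x. (d - c) * q d x) \<in> \<mm>" by (simp add: algebra_simps)
    from m(4)[OF this poly_funs.const[of "1/(d-c)"]] have "q d \<in> \<mm>" using cd(2) by simp
    from m(5)[OF m(4)[OF this Xc[of d]] q(2)[of d]] show False using \<mm>(2) by (simp add: mult.commute)
  qed
  let ?M = "range (\<lambda>(e :: 'n \<Rightarrow> nat) x. \<Prod>i\<in>UNIV. x $ i ^ e i)"
  have "\<exists>T. finite T \<and> T \<subseteq> ?M \<and> q c \<in> cfun.span T" for c
  proof -
    obtain T r where T: "finite T" "T \<subseteq> ?M" "q c = (\<Sum>a\<in>T. (\<lambda>x. r a * a x))"
      using poly_funs_span_monomials[OF q(1)[of c]] unfolding cfun.span_explicit by blast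
    have "q c \<in> cfun.span T" unfolding T(3) by (intro cfun.span_sum cfun.span_scale cfun.span_base)
    then show ?thesis using T by blast
  qed
  then have "\<forall>c. \<exists>T. finite T \<and> T \<subseteq> ?M \<and> q c \<in> cfun.span T" by (intro allI)
  from choice[OF this] obtain T where T: "\<And>c. finite (T c)" "\<And>c. T c \<subseteq> ?M" "\<And>c. q c \<in> cfun.span (T c)"
    by blast
  \<comment> \<open>Uncountably many scalars are sent to countably many finite sets of monomials, so
    some fibre is infinite. On it the injective family \<open>q\<close> lies in one
    finite-dimensional span, hence is linearly dependent.\<close>
  have "\<exists>c. infinite (T -` {T c})"
  proof (rule ccontr)
    assume "\<nexists>c. infinite (T -` {T c})"
    moreover have "countable (range T)"
    proof (rule countable_subset)
      show "range T \<subseteq> {A. finite A \<and> A \<subseteq> ?M}" using T by auto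
      show "countable {A. finite A \<and> A \<subseteq> ?M}" by (intro countable_Collect_finite_subset) auto
    qed
    ultimately have "countable (\<Union>S\<in>range T. T -` {S})" by (intro countable_UN) (auto intro: countable_finite)
    moreover have "(\<Union>S\<in>range T. T -` {S}) = (UNIV :: complex set)" by auto
    ultimately show False using uncountable_UNIV_complex by simp
  qed
  then obtain c0 where c0: "infinite (T -` {T c0})" by blast
  have "cfun.dependent (q ` (T -` {T c0}))"
  proof (rule ccontr)
    assume "\<not> cfun.dependent (q ` (T -` {T c0}))"
    moreover have "q ` (T -` {T c0}) \<subseteq> cfun.span (T c0)"
    proof (rule image_subsetI)
      fix c assume "c \<in> T -` {T c0}"
      then show "q c \<in> cfun.span (T c0)" using T(3)[of c] by simp
    qed
    ultimately have "finite (q ` (T -` {T c0}))" using cfun.independent_span_bound[OF T(1)] by blast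
    then show False using c0 inj by (meson finite_imageD inj_on_subset subset_UNIV)
  qed
  then obtain S u v where S: "finite S" "S \<subseteq> q ` (T -` {T c0})" "(\<Sum>v\<in>S. (\<lambda>x. u v * v x)) = 0" "v \<in> S" "u v \<noteq> 0"
    unfolding cfun.dependent_explicit by blast
  define A where "A = q -` S"
  have qA: "q ` A = S" using S(2) by (auto simp: A_def)
  have finA: "finite A" unfolding A_def using S(1) inj by (rule finite_vimageI)
  obtain a where a: "a \<in> A" "v = q a" using S(4) qA by blast
  have rel: "(\<Sum>c\<in>A. u (q c) * q c x) = 0" for x
  proof -
    have "(\<Sum>c\<in>A. u (q c) * q c x) = (\<Sum>v\<in>S. u v * v x)"
      unfolding qA[symmetric] using inj by (subst sum.reindex) (auto intro: inj_on_subset)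
    also have "\<dots> = (\<Sum>v\<in>S. (\<lambda>x. u v * v x)) x" by (induction S rule: infinite_finite_induct) auto
    finally show ?thesis using S(3) by (simp add: zero_fun_def)
  qed
  \<comment> \<open>The sum of the fractions u / (X - c) with denominators cleared. It is nonzero
    because at \<open>a\<close> only the summand \<open>c = a\<close> survives.\<close>
  define R where "R = (\<Sum>c\<in>A. Polynomial.smult (u (q c)) (\<Prod>d\<in>A - {c}. [:-d, 1:]))"
  have "poly R a = (\<Sum>c\<in>A. if c = a then u (q a) * (\<Prod>d\<in>A - {a}. a - d) else 0)"
    unfolding R_def poly_sum
  proof (rule sum.cong[OF refl])
    fix c assume "c \<in> A"
    have "(\<Prod>d\<in>A - {c}. a - d) = 0" if "c \<noteq> a" using that a(1) finA by (intro prod_zero) auto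
    then show "poly (Polynomial.smult (u (q c)) (\<Prod>d\<in>A - {c}. [:- d, 1:])) a = (if c = a then u (q a) * (\<Prod>d\<in>A - {a}. a - d) else 0)"
      by (auto simp: poly_prod)
  qed
  also have "\<dots> = u (q a) * (\<Prod>d\<in>A - {a}. a - d)" using a(1) finA by simp
  finally have "poly R a \<noteq> 0" using S(5) a finA by auto
  then have "R \<noteq> 0" by auto
  moreover have "(\<lambda>x. poly R (x $ i)) \<in> \<mm>"
  proof -
    \<comment> \<open>Each congruence of \<open>q c\<close> times its denominator with 1 is
      multiplied by the complementary product; summing and using the linear relation leaves the
      negative of \<open>R\<close>.\<close>
    let ?g = "\<lambda>c x. u (q c) * (\<Prod>d\<in>A - {c}. x $ i - d)"
    have "(\<lambda>x. \<Sum>c\<in>A. ?g c x * (q c x * (x $ i - c) - 1)) \<in> \<mm>"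
      using Xc by (intro poly_ideal_sum[OF \<mm>(1)] m(4)[OF q(2)] poly_funs.intros poly_funs_prod)
    moreover have "(\<Sum>c\<in>A. ?g c x * (q c x * (x $ i - c) - 1)) = - poly R (x $ i)" for x
    proof -
      have "?g c x * (q c x * (x $ i - c) - 1) = (\<Prod>d\<in>A. x $ i - d) * (u (q c) * q c x) - ?g c x" if "c \<in> A" for c
        unfolding prod.remove[OF finA that] by (simp add: algebra_simps)
      then have "(\<Sum>c\<in>A. ?g c x * (q c x * (x $ i - c) - 1)) = (\<Prod>d\<in>A. x $ i - d) * (\<Sum>c\<in>A. u (q c) * q c x) - (\<Sum>c\<in>A. ?g c x)"
        by (simp add: sum_subtractf sum_distrib_left)
      then show ?thesis by (simp add: rel R_def poly_sum poly_prod)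
    qed
    ultimately have "(\<lambda>x. - poly R (x $ i)) \<in> \<mm>" by simp
    from m(4)[OF this poly_funs.const[of "-1"]] show ?thesis by simp
  qed
  ultimately show False using noroot by blast
qed

text \<open>Modulo a maximal ideal above \<open>I\<close> every coordinate is a scalar. Hence every
  element of the ideal vanishes at the point with these coordinates, since otherwise its value there
  would be an invertible constant in the ideal.\<close>

theorem weak_Nullstellensatz:
  fixes I :: "(complex ^ 'n \<Rightarrow> complex) set"
  assumes I: "poly_ideal I" and nz: "\<And>x. \<exists>P\<in>I. P x \<noteq> 0"
  shows "(\<lambda>_. 1) \<in> I"
proof (rule ccontr)
  assume "(\<lambda>_. 1) \<notin> I"
  then obtain \<mm> where \<mm>: "poly_ideal \<mm>" "I \<subseteq> \<mm>" "(\<lambda>_. 1) \<notin> \<mm>"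
    "\<And>P. P \<in> poly_funs \<Longrightarrow> P \<notin> \<mm> \<Longrightarrow> \<exists>Q\<in>poly_funs. (\<lambda>x. Q x * P x - 1) \<in> \<mm>"
    using poly_ideal_maximal[OF I] by blast
  note m = poly_idealD[OF \<mm>(1)]
  have "\<forall>i. \<exists>c. (\<lambda>x. x $ i - c) \<in> \<mm>" using poly_ideal_coordinate[OF \<mm>(1,3,4)] by blast
  then obtain c where c: "\<And>i. (\<lambda>x. x $ i - c i) \<in> \<mm>" by metis
  obtain P where P: "P \<in> I" "P (\<chi> i. c i) \<noteq> 0" using nz by blast
  then have "P \<in> \<mm>" using \<mm>(2) by blast
  obtain G where G: "\<And>i. G i \<in> poly_funs" "\<And>x. P x - P (\<chi> i. c i) = (\<Sum>i\<in>UNIV. G i x * (x $ i - (\<chi> i. c i) $ i))"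
    using poly_funs_expansion[OF m(1)[OF \<open>P \<in> \<mm>\<close>]] by blast
  have "(\<lambda>x. P x - P (\<chi> i. c i)) \<in> \<mm>"
    unfolding G(2) using c G(1) by (intro poly_ideal_sum[OF \<mm>(1)] m(4)) simp_all
  from m(5)[OF \<open>P \<in> \<mm>\<close> this] have "(\<lambda>_. P (\<chi> i. c i)) \<in> \<mm>" by simp
  from m(4)[OF this poly_funs.const[of "1 / P (\<chi> i. c i)"]] show False using \<mm>(3) P(2) by simp
qed

section \<open>Local structure of a smooth affine curve\<close>

definition vanishing :: "(complex ^ 'n) set \<Rightarrow> (complex ^ 'n \<Rightarrow> complex) set" where
  "vanishing C = {P \<in> poly_funs. \<forall>y\<in>C. P y = 0}"

lemma vanishingD: "P \<in> vanishing C \<Longrightarrow> P \<in> poly_funs" "P \<in> vanishing C \<Longrightarrow> y \<in> C \<Longrightarrow> P y = 0"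
  by (auto simp: vanishing_def)

lemma tangent_space_iff:
  "v \<in> tangent_space C x \<longleftrightarrow> (\<forall>P\<in>vanishing C. (\<Sum>i\<in>UNIV. grad i P x * v $ i) = 0)"
  by (auto simp: tangent_space_def vanishing_def dir_deriv_grad)

lemma tangent_space_scale: "v \<in> tangent_space C x \<Longrightarrow> c *s v \<in> tangent_space C x"
  by (auto simp: tangent_space_def dir_deriv_linear)

text \<open>A linear map that kills \<open>S\<close> and not \<open>c\<close> exists by extending a
  basis; a row of its matrix is the functional.\<close>

lemma vec_separation:
  fixes c :: "complex ^ 'n"
  assumes "vec.subspace S" "c \<notin> S"
  shows "\<exists>w. (\<forall>g\<in>S. (\<Sum>i\<in>UNIV. g $ i * w $ i) = 0) \<and> (\<Sum>i\<in>UNIV. c $ i * w $ i) \<noteq> 0"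
proof -
  obtain B where B: "B \<subseteq> S" "vec.independent B" "S \<subseteq> vec.span B" using vec.basis_exists[of S] by metis
  have spanB: "vec.span B = S" using B assms(1) by (simp add: vec.span_minimal subset_antisym)
  have "c \<notin> vec.span B" using assms(2) spanB by simp
  then have "vec.independent (insert c B)" using B(2) by (simp add: vec.independent_insert)
  from vec.linear_independent_extend[OF this, of "\<lambda>x. if x = c then vec 1 else (0 :: complex ^ 'n)"]
  obtain g where g: "Vector_Spaces.linear (*s) (*s) g"
    "\<forall>x\<in>insert c B. g x = (if x = c then (vec 1 :: complex ^ 'n) else 0)"
    by metis
  have "c \<notin> B" using \<open>c \<notin> vec.span B\<close> vec.span_base by blast
  then have "vec.span B \<subseteq> {x. g x = 0}"
    using g by (intro vec.span_minimal vec.linear_subspace_kernel) auto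
  then have gS: "g x = 0" if "x \<in> S" for x using that spanB by auto
  \<comment> \<open>Any row will do, because \<open>g c\<close> is the vector with all entries
    1.\<close>
  define i :: 'n where "i = undefined"
  have rep: "g x $ i = (\<Sum>j\<in>UNIV. x $ j * (matrix g $ i $ j))" for x
  proof -
    have "g x = matrix g *v x" using matrix_works[OF g(1), of x] by simp
    then show ?thesis by (simp add: matrix_vector_mult_def mult.commute)
  qed
  have "\<forall>x\<in>S. (\<Sum>j\<in>UNIV. x $ j * (matrix g $ i) $ j) = 0"
    using gS by (simp add: rep[symmetric])
  moreover have "(\<Sum>j\<in>UNIV. c $ j * (matrix g $ i) $ j) \<noteq> 0"
    using g(2) by (simp add: rep[symmetric])
  ultimately show ?thesis by blast
qed

lemma bounded_linear_matrix_mult: "bounded_linear (\<lambda>w. (A :: complex ^ 'n ^ 'm) *v w)"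
  unfolding linear_conv_bounded_linear[symmetric]
  by (rule linearI) (simp_all add: vec_eq_iff matrix_vector_mult_def scaleR_sum_right distrib_left sum.distrib)

lemma has_derivative_vec_lambda:
  fixes f :: "'a::real_normed_vector \<Rightarrow> 'n::finite \<Rightarrow> 'b::euclidean_space"
  assumes "\<And>i. ((\<lambda>x. f x i) has_derivative (\<lambda>h. f' h i)) (at a within S)"
  shows "((\<lambda>x. \<chi> i. f x i) has_derivative (\<lambda>h. \<chi> i. f' h i)) (at a within S)"
  by (subst has_derivative_componentwise_within)
     (auto simp: Basis_vec_def inner_axis intro!: has_derivative_inner_left assms)

locale curve =
  fixes C :: "(complex ^ 'n) set"
  assumes smooth: "smooth_affine_curve C"
begin

lemma connected_C: "connected C" and nonempty_C: "C \<noteq> {}"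
  using smooth by (auto simp: smooth_affine_curve_def)

lemma subspace_tangent_space: "vec.subspace (tangent_space C x)"
proof (rule vec.subspaceI)
  show "0 \<in> tangent_space C x" by (simp add: tangent_space_def dir_deriv_grad)
qed (auto simp: tangent_space_def dir_deriv_linear)

lemma tangent_space_line:
  assumes "x \<in> C"
  obtains v where "v \<noteq> 0" "tangent_space C x = range (\<lambda>c. c *s v)"
proof -
  have "vec.dim (tangent_space C x) = 1" using smooth assms by (auto simp: smooth_affine_curve_def)
  then obtain B where B: "B \<subseteq> tangent_space C x" "vec.independent B" "tangent_space C x \<subseteq> vec.span B" "card B = 1"
    using vec.basis_exists[of "tangent_space C x"] by metis
  then obtain v where v: "B = {v}" by (auto simp: card_1_singleton_iff)
  have "vec.span B = tangent_space C x"
    using B subspace_tangent_space by (simp add: vec.span_minimal subset_antisym)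
  then have "tangent_space C x = range (\<lambda>c. c *s v)" by (simp add: v vec.span_singleton)
  moreover have "v \<noteq> 0" using B(2) v vec.dependent_zero by auto
  ultimately show thesis using that by blast
qed

text \<open>Duality: the gradients at \<open>x\<close> of equations of \<open>C\<close> form a
  subspace whose annihilator is the tangent space by definition, so a covector killing the tangent
  line belongs to it.\<close>

lemma gradient_prescribed:
  assumes v: "tangent_space C x = range (\<lambda>c. c *s v)" and c: "(\<Sum>i\<in>UNIV. c $ i * v $ i) = 0"
  obtains P where "P \<in> vanishing C" "\<And>i. grad i P x = c $ i"
proof -
  define S where "S = {\<chi> i. grad i P x | P. P \<in> vanishing C}"
  have gr: "grad i (\<lambda>x. P x + Q x) x = grad i P x + grad i Q x" if "P \<in> poly_funs" "Q \<in> poly_funs" for i P Q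
    using dir_deriv_simps(1)[OF that] by (simp add: grad_def)
  have gs: "grad i (\<lambda>x. a * P x) x = a * grad i P x" if "P \<in> poly_funs" for i a P
    using dir_deriv_simps(2)[OF poly_funs.const that] dir_deriv_simps(3)[OF that that] by (simp add: grad_def)
  have "vec.subspace S"
  proof (rule vec.subspaceI)
    have "grad i (\<lambda>_. 0) x = 0" for i :: 'n using gs[OF poly_funs.const, of i 0 0] by simp
    then show "0 \<in> S" unfolding S_def
      by (intro CollectI exI[of _ "\<lambda>_. 0"]) (auto simp: vanishing_def poly_funs.const vec_eq_iff)
  next
    fix a b assume "a \<in> S" "b \<in> S"
    then obtain P Q where "a = (\<chi> i. grad i P x)" "b = (\<chi> i. grad i Q x)" "P \<in> vanishing C" "Q \<in> vanishing C"
      by (auto simp: S_def)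
    then show "a + b \<in> S" unfolding S_def
      by (intro CollectI exI[of _ "\<lambda>x. P x + Q x"]) (auto simp: vanishing_def poly_funs.add vec_eq_iff gr)
  next
    fix k a assume "a \<in> S"
    then obtain P where "a = (\<chi> i. grad i P x)" "P \<in> vanishing C" by (auto simp: S_def)
    then show "k *s a \<in> S" unfolding S_def
      by (intro CollectI exI[of _ "\<lambda>x. k * P x"]) (auto simp: vanishing_def poly_funs.intros vec_eq_iff gs)
  qed
  have "c \<in> S"
  proof (rule ccontr)
    assume "c \<notin> S"
    then obtain w where w: "\<forall>g\<in>S. (\<Sum>i\<in>UNIV. g $ i * w $ i) = 0" "(\<Sum>i\<in>UNIV. c $ i * w $ i) \<noteq> 0"
      using vec_separation[OF \<open>vec.subspace S\<close>] by blast
    then have "w \<in> tangent_space C x" unfolding tangent_space_iff S_def by fastforce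
    then obtain k where "w = k *s v" using v by auto
    then have "(\<Sum>i\<in>UNIV. c $ i * w $ i) = k * (\<Sum>i\<in>UNIV. c $ i * v $ i)" by (simp add: sum_distrib_left mult_ac)
    then show False using w c by simp
  qed
  then show thesis using that by (auto simp: S_def)
qed

text \<open>The Jacobian matrix of the map that keeps coordinate \<open>i0\<close> and has the
  equations \<open>P j\<close> as its other components; \<open>chart_exists\<close> inverts this
  map.\<close>

definition jacobian :: "'n \<Rightarrow> ('n \<Rightarrow> complex ^ 'n \<Rightarrow> complex) \<Rightarrow> complex ^ 'n \<Rightarrow> complex ^ 'n ^ 'n" where
  "jacobian i0 P z = (\<chi> j k. if j = i0 then (if k = i0 then 1 else 0) else grad k (P j) z)"

lemma jacobian_mult: "(jacobian i0 P z *v w) $ j = (if j = i0 then w $ i0 else \<Sum>k\<in>UNIV. grad k (P j) z * w $ k)"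
proof (cases "j = i0")
  case True
  have "(\<Sum>k\<in>UNIV. (if k = i0 then 1 else 0) * w $ k) = (\<Sum>k\<in>UNIV. if k = i0 then w $ k else 0)"
    by (intro sum.cong) auto
  then show ?thesis using True by (simp add: jacobian_def matrix_vector_mult_def)
qed (simp add: jacobian_def matrix_vector_mult_def)

text \<open>If \<open>v\<close> spans the tangent line and its entry at \<open>i0\<close> is
  nonzero, the covectors v(i0) e(j) - v(j) e(i0) kill \<open>v\<close> and are therefore gradients
  of equations. Together with e(i0) they are linearly independent.\<close>

lemma local_equations:
  assumes "x \<in> C"
  obtains i0 P where "\<And>j. j \<noteq> i0 \<Longrightarrow> P j \<in> vanishing C" "det (jacobian i0 P x) \<noteq> 0"
proof -
  obtain v where v: "v \<noteq> 0" "tangent_space C x = range (\<lambda>c. c *s v)" using tangent_space_line[OF assms] .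
  obtain i0 where i0: "v $ i0 \<noteq> 0" using v(1) by (auto simp: vec_eq_iff)
  have "\<exists>Q. Q \<in> vanishing C \<and> (\<forall>k. grad k Q x = (if k = j then v $ i0 else 0) - (if k = i0 then v $ j else 0))" for j
  proof -
    let ?c = "\<chi> k. (if k = j then v $ i0 else 0) - (if k = i0 then v $ j else 0)"
    have "(\<Sum>k\<in>UNIV. ?c $ k * v $ k) = (\<Sum>k\<in>UNIV. (if k = j then v $ i0 * v $ k else 0) - (if k = i0 then v $ j * v $ k else 0))"
      by (intro sum.cong) (auto simp: algebra_simps)
    also have "\<dots> = 0" by (simp add: sum_subtractf)
    finally show ?thesis using gradient_prescribed[OF v(2), of ?c] by (metis (no_types, lifting) vec_lambda_beta)
  qed
  then obtain P where P: "\<And>j. P j \<in> vanishing C"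
    "\<And>j k. grad k (P j) x = (if k = j then v $ i0 else 0) - (if k = i0 then v $ j else 0)" by metis
  have "w = 0" if w: "jacobian i0 P x *v w = 0" for w
  proof -
    have 0: "w $ i0 = 0" using arg_cong[OF w, of "\<lambda>u. u $ i0"] by (simp add: jacobian_mult)
    have "w $ j = 0" for j
    proof (cases "j = i0")
      case False
      have "(\<Sum>k\<in>UNIV. grad k (P j) x * w $ k) = (\<Sum>k\<in>UNIV. (if k = j then v $ i0 * w $ k else 0) - (if k = i0 then v $ j * w $ k else 0))"
        by (intro sum.cong) (auto simp: P(2) algebra_simps)
      also have "\<dots> = v $ i0 * w $ j" using 0 by (simp add: sum_subtractf)
      finally show ?thesis using arg_cong[OF w, of "\<lambda>u. u $ j"] False i0 by (simp add: jacobian_mult)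
    qed (simp add: 0)
    then show ?thesis by (simp add: vec_eq_iff)
  qed
  then have "invertible (jacobian i0 P x)"
    by (simp add: invertible_left_inverse matrix_left_invertible_ker)
  then have "det (jacobian i0 P x) \<noteq> 0" by (simp add: invertible_det_nz)
  with P(1) show thesis using that by blast
qed

text \<open>On a single point the coordinates minus their values are equations, so the tangent space
  would be 0 instead of a line.\<close>

lemma not_singleton: "C \<noteq> {x}"
proof
  assume C: "C = {x}"
  obtain v where v: "v \<noteq> 0" "tangent_space C x = range (\<lambda>c. c *s v)" using tangent_space_line[of x] C by blast
  have "v \<in> tangent_space C x" unfolding v(2) by (metis rangeI vec.scale_one)
  have "v $ i = 0" for i
  proof -
    let ?P = "\<lambda>z. z $ i + - x $ i"
    have P: "?P \<in> poly_funs" by (intro poly_funs.intros)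
    then have "dir_deriv ?P x v = 0" using \<open>v \<in> tangent_space C x\<close> C by (auto simp: tangent_space_def)
    moreover have "dir_deriv ?P x v = v $ i"
      by (simp only: dir_deriv_simps(1)[OF poly_funs.coord poly_funs.const] dir_deriv_simps(3)[OF P P]
          dir_deriv_simps(4)[OF P P] add_0_right)
    ultimately show ?thesis by simp
  qed
  then show False using v(1) by (simp add: vec_eq_iff)
qed

text \<open>Near \<open>x\<close> the inverse function theorem turns the chosen equations into an
  arc with parameter \<open>x $ i0\<close> that contains the nearby points of \<open>C\<close>. That
  conversely the arc lies in \<open>C\<close> is the substance of the proof.\<close>

lemma chart_exists:
  assumes x: "x \<in> C"
  obtains i0 r \<gamma> where "r > 0" "\<gamma> (x $ i0) = x" "\<And>t. t \<in> ball (x $ i0) r \<Longrightarrow> \<gamma> t \<in> C"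
    "\<And>t. t \<in> ball (x $ i0) r \<Longrightarrow> \<gamma> t $ i0 = t"
    "\<And>i. (\<lambda>t. \<gamma> t $ i) holomorphic_on ball (x $ i0) r"
    "openin (top_of_set C) (\<gamma> ` ball (x $ i0) r)"
proof -
  obtain i0 P where P: "\<And>j. j \<noteq> i0 \<Longrightarrow> P j \<in> vanishing C" and det: "det (jacobian i0 P x) \<noteq> 0"
    by (rule local_equations[OF x]) blast
  define \<Phi> where "\<Phi> z = (\<chi> j. if j = i0 then z $ i0 else P j z)" for z
  define f' where "f' z = Blinfun (\<lambda>w. jacobian i0 P z *v w)" for z
  have f': "blinfun_apply (f' z) = (\<lambda>w. jacobian i0 P z *v w)" for z
    unfolding f'_def by (rule bounded_linear_Blinfun_apply[OF bounded_linear_matrix_mult])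
  have der: "(\<Phi> has_derivative blinfun_apply (f' z)) (at z)" for z
  proof -
    have "((\<lambda>z. if j = i0 then z $ i0 else P j z) has_derivative
        (\<lambda>w. if j = i0 then w $ i0 else \<Sum>k\<in>UNIV. grad k (P j) z * w $ k)) (at z)" for j
      using poly_funs_has_derivative[OF vanishingD(1)[OF P]]
      by (cases "j = i0") (auto intro: bounded_linear.has_derivative[OF bounded_linear_vec_nth] has_derivative_ident)
    then have "((\<lambda>z. \<chi> j. if j = i0 then z $ i0 else P j z) has_derivative
        (\<lambda>w. \<chi> j. if j = i0 then w $ i0 else \<Sum>k\<in>UNIV. grad k (P j) z * w $ k)) (at z)"
      by (rule has_derivative_vec_lambda)
    moreover have "(\<lambda>w. \<chi> j. if j = i0 then w $ i0 else \<Sum>k\<in>UNIV. grad k (P j) z * w $ k) = blinfun_apply (f' z)"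
      by (simp add: f' fun_eq_iff vec_eq_iff jacobian_mult)
    ultimately show ?thesis by (simp add: \<Phi>_def[abs_def])
  qed
  have cont: "continuous_on UNIV f'"
  proof (rule continuous_on_blinfun_componentwise)
    fix b :: "complex ^ 'n"
    have "continuous_on UNIV (\<lambda>z. (if j = i0 then b $ i0 else \<Sum>k\<in>UNIV. grad k (P j) z * b $ k))" for j
      using poly_funs_continuous[OF poly_funs_grad[OF vanishingD(1)[OF P]]]
      by (cases "j = i0") (auto intro!: continuous_intros)
    then have "continuous_on UNIV (\<lambda>z. \<chi> j. (if j = i0 then b $ i0 else \<Sum>k\<in>UNIV. grad k (P j) z * b $ k))"
      by (rule continuous_on_vec_lambda)
    moreover have "(\<lambda>z. \<chi> j. (if j = i0 then b $ i0 else \<Sum>k\<in>UNIV. grad k (P j) z * b $ k)) = (\<lambda>z. blinfun_apply (f' z) b)"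
      by (simp add: f' fun_eq_iff vec_eq_iff jacobian_mult)
    ultimately show "continuous_on UNIV (\<lambda>z. blinfun_apply (f' z) b)" by (simp only:)
  qed
  obtain A where A: "A ** jacobian i0 P x = mat 1"
    using det by (auto simp: invertible_det_nz[symmetric] invertible_left_inverse)
  have inv1: "Blinfun (\<lambda>w. A *v w) o\<^sub>L f' x = id_blinfun"
    by (rule blinfun_eqI) (simp add: f' bounded_linear_Blinfun_apply[OF bounded_linear_matrix_mult] matrix_vector_mul_assoc A)
  obtain U' V g g' where g: "open U'" "x \<in> U'" "open V" "\<Phi> x \<in> V" "homeomorphism U' V \<Phi> g"
    "\<And>y. y \<in> V \<Longrightarrow> (g has_derivative (g' y)) (at y)"
    "\<And>y. y \<in> V \<Longrightarrow> g' y = inv_into UNIV (blinfun_apply (f' (g y)))"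
    "\<And>y. y \<in> V \<Longrightarrow> bij (blinfun_apply (f' (g y)))"
    by (rule inverse_function_theorem[OF open_UNIV der cont UNIV_I inv1]) (rule that; assumption)
  \<comment> \<open>The embedding of the coordinate axis \<open>i0\<close>. Points of
    \<open>C\<close> are sent to this axis by \<Phi>, since the \<open>P j\<close> vanish on
    \<open>C\<close>; the arc \<gamma> is the axis pulled back by the local inverse.\<close>
  define \<eta> :: "complex \<Rightarrow> complex ^ 'n" where "\<eta> t = axis i0 t" for t
  define \<gamma> where "\<gamma> t = g (\<eta> t)" for t
  have \<Phi>C: "\<Phi> z = \<eta> (z $ i0)" if "z \<in> C" for z
    using that vanishingD(2)[OF P] by (auto simp: \<Phi>_def \<eta>_def vec_eq_iff axis_def)
  have lin\<eta>: "\<eta> (s + t) = \<eta> s + \<eta> t" "\<eta> (c *\<^sub>R t) = c *\<^sub>R \<eta> t" "\<eta> t = t *s \<eta> 1" for s t c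
    by (auto simp: \<eta>_def axis_def vec_eq_iff)
  have bl\<eta>: "bounded_linear \<eta>"
    unfolding linear_conv_bounded_linear[symmetric] by (rule linearI) (auto simp: lin\<eta>(1,2))
  have "open (\<eta> -` V)"
    using g(3) bl\<eta> by (intro open_vimage) (auto simp: linear_continuous_on)
  moreover have "x $ i0 \<in> \<eta> -` V" using g(4) \<Phi>C[OF x] by simp
  ultimately obtain r where r: "r > 0" "ball (x $ i0) r \<subseteq> \<eta> -` V" by (meson open_contains_ball)
  have hom: "\<And>z. z \<in> U' \<Longrightarrow> g (\<Phi> z) = z" "\<And>y. y \<in> V \<Longrightarrow> \<Phi> (g y) = y" "\<And>y. y \<in> V \<Longrightarrow> g y \<in> U'"
    using g(5) by (auto simp: homeomorphism_def)
  have \<gamma>: "\<gamma> t $ i0 = t" "\<gamma> t \<in> U'" if "t \<in> ball (x $ i0) r" for t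
  proof -
    have V: "\<eta> t \<in> V" using that r by auto
    show "\<gamma> t \<in> U'" using hom(3)[OF V] by (simp add: \<gamma>_def)
    have "\<Phi> (\<gamma> t) $ i0 = t" unfolding \<gamma>_def hom(2)[OF V] by (simp add: \<eta>_def)
    then show "\<gamma> t $ i0 = t" by (simp add: \<Phi>_def)
  qed
  have \<gamma>C: "\<gamma> (z $ i0) = z" if "z \<in> C" "z \<in> U'" for z
    using hom(1)[OF that(2)] \<Phi>C[OF that(1)] by (simp add: \<gamma>_def)
  have hol: "(\<lambda>t. \<gamma> t $ i) holomorphic_on ball (x $ i0) r" for i
    unfolding holomorphic_on_open[OF open_ball]
  proof
    fix t assume "t \<in> ball (x $ i0) r"
    then have V: "\<eta> t \<in> V" using r by auto
    have "(\<eta> has_derivative \<eta>) (at t)" by (rule bounded_linear_imp_has_derivative[OF bl\<eta>])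
    from diff_chain_at[OF this g(6)[OF V]]
    have "(\<gamma> has_derivative (g' (\<eta> t) \<circ> \<eta>)) (at t)" by (simp add: \<gamma>_def[abs_def] o_def)
    then have "((\<lambda>t. \<gamma> t $ i) has_derivative (\<lambda>s. (g' (\<eta> t) \<circ> \<eta>) s $ i)) (at t)"
      by (rule bounded_linear.has_derivative[OF bounded_linear_vec_nth])
    \<comment> \<open>The inverse function theorem yields a real derivative. It is complex linear
      because it inverts multiplication by a complex matrix.\<close>
    moreover have "(\<lambda>s. (g' (\<eta> t) \<circ> \<eta>) s $ i) = (*) (g' (\<eta> t) (\<eta> 1) $ i)"
    proof
      fix s
      let ?M = "jacobian i0 P (g (\<eta> t))"
      have bij: "bij (\<lambda>w. ?M *v w)" using g(8)[OF V] by (simp add: f')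
      have g't: "g' (\<eta> t) = inv_into UNIV (\<lambda>w. ?M *v w)" using g(7)[OF V] by (simp add: f')
      have "?M *v (s *s g' (\<eta> t) (\<eta> 1)) = s *s \<eta> 1"
        unfolding g't using surj_f_inv_f[OF bij_is_surj[OF bij], of "\<eta> 1"] by (simp add: vec.scale)
      then have "g' (\<eta> t) (s *s \<eta> 1) = s *s g' (\<eta> t) (\<eta> 1)"
        using inv_f_f[OF bij_is_inj[OF bij], of "s *s g' (\<eta> t) (\<eta> 1)"] by (simp add: g't)
      then show "(g' (\<eta> t) \<circ> \<eta>) s $ i = g' (\<eta> t) (\<eta> 1) $ i * s"
        by (simp add: lin\<eta>(3)[of s])
    qed
    ultimately show "\<exists>d. ((\<lambda>t. \<gamma> t $ i) has_field_derivative d) (at t)"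
      unfolding has_field_derivative_def by auto
  qed
  obtain F where F: "F \<subseteq> poly_funs" "C = {x. \<forall>P\<in>F. P x = 0}"
    using smooth by (auto simp: smooth_affine_curve_def)
  \<comment> \<open>If a defining equation were not identically zero on the arc, its zero at the
    centre would be isolated. Then \<open>x\<close> would be open and closed in the connected set
    \<open>C\<close>, which is not a single point.\<close>
  have zero: "Q (\<gamma> t) = 0" if Q: "Q \<in> F" and t: "t \<in> ball (x $ i0) r" for Q t
  proof (rule ccontr)
    assume nz: "Q (\<gamma> t) \<noteq> 0"
    have "Q (\<gamma> (x $ i0)) = 0" using \<gamma>C[OF x g(2)] x F(2) Q by auto
    moreover have "(\<lambda>t. Q (\<gamma> t)) holomorphic_on ball (x $ i0) r" using F(1) Q hol by (auto intro: poly_funs_holomorphic)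
    ultimately obtain e where e: "0 < e" "ball (x $ i0) e \<subseteq> ball (x $ i0) r"
      "\<And>z. z \<in> ball (x $ i0) e - {x $ i0} \<Longrightarrow> Q (\<gamma> z) \<noteq> 0"
      using isolated_zeros[of "\<lambda>t. Q (\<gamma> t)" "ball (x $ i0) r" "x $ i0" t] t nz r(1) by (metis centre_in_ball connected_ball open_ball)
    have "z = x" if "z \<in> C" "z \<in> U'" "z $ i0 \<in> ball (x $ i0) e" for z
    proof -
      have "Q (\<gamma> (z $ i0)) = 0" using \<gamma>C[OF that(1,2)] that(1) F(2) Q by auto
      then have "z $ i0 = x $ i0" using e(3) that(3) by blast
      then show ?thesis using \<gamma>C[OF that(1,2)] \<gamma>C[OF x g(2)] by metis
    qed
    then have "C \<inter> (U' \<inter> (\<lambda>z. z $ i0) -` ball (x $ i0) e) = {x}" using x g(2) e(1) by auto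
    moreover have "open (U' \<inter> (\<lambda>z. z $ i0) -` ball (x $ i0) e)"
      using g(1) by (intro open_Int open_vimage) (auto intro!: continuous_intros)
    ultimately have "openin (top_of_set C) {x}" by (metis openin_open)
    moreover have "closedin (top_of_set C) {x}" using x by (simp add: closedin_closed_eq closedin_singleton)
    ultimately have "C = {x}" using connected_C by (metis connected_clopen insert_not_empty)
    then show False using not_singleton by blast
  qed
  have inC: "\<gamma> t \<in> C" if "t \<in> ball (x $ i0) r" for t using zero that F(2) by auto
  have "\<gamma> ` ball (x $ i0) r = C \<inter> (U' \<inter> (\<lambda>z. z $ i0) -` ball (x $ i0) r)"
  proof (intro equalityI subsetI)
    fix z assume "z \<in> C \<inter> (U' \<inter> (\<lambda>z. z $ i0) -` ball (x $ i0) r)"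
    then show "z \<in> \<gamma> ` ball (x $ i0) r" using \<gamma>C[of z] by (metis IntD1 IntD2 imageI vimageD)
  qed (use \<gamma> inC in auto)
  moreover have "open (U' \<inter> (\<lambda>z. z $ i0) -` ball (x $ i0) r)"
    using g(1) by (intro open_Int open_vimage) (auto intro!: continuous_intros)
  ultimately have "openin (top_of_set C) (\<gamma> ` ball (x $ i0) r)" by (metis openin_open)
  then show thesis using that[of r \<gamma> i0] r(1) \<gamma>C[OF x g(2)] inC \<gamma>(1) hol by blast
qed

end

section \<open>Charts and differentials on the universal cover\<close>

locale curve_cover = curve C for C :: "(complex ^ 'n) set" +
  fixes U :: "'u::topological_space set" and p :: "'u \<Rightarrow> complex ^ 'n"
  assumes cover: "universal_cover U p C"
begin

lemma covering: "covering_space U p C" and simply_connected_U: "simply_connected U"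
  using cover by (auto simp: universal_cover_def)

lemma continuous_p: "continuous_on U p" and image_p: "p ` U = C"
  using covering by (auto simp: covering_space_def)

lemma p_in_C: "z \<in> U \<Longrightarrow> p z \<in> C"
  using image_p by auto

lemma nonempty_U: "U \<noteq> {}"
  using image_p nonempty_C by auto

text \<open>\<open>simply_connected\<close> makes any two loops freely homotopic. For two constant
  loops the image of the homotopy is a connected set containing both points.\<close>

lemma connected_U: "connected U"
proof -
  have "\<exists>T. T \<subseteq> U \<and> connected T \<and> a \<in> T \<and> b \<in> T" if "a \<in> U" "b \<in> U" for a b
  proof -
    have "homotopic_loops U (\<lambda>_. a) (\<lambda>_. b)"
      using simply_connected_U that
      by (simp add: simply_connected_def path_def pathfinish_def pathstart_def path_image_def image_subset_iff)
    then obtain h where h: "continuous_on ({0..1::real} \<times> {0..1::real}) h" "h \<in> ({0..1} \<times> {0..1}) \<rightarrow> U"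
      "\<forall>x\<in>{0..1}. h (0, x) = a" "\<forall>x\<in>{0..1}. h (1, x) = b"
      unfolding homotopic_loops by auto
    let ?T = "h ` ({0..1} \<times> {0..1})"
    have "connected ?T"
      using h(1) by (intro connected_continuous_image connected_Times) auto
    moreover have "?T \<subseteq> U" using h(2) by blast
    moreover have "h (0, 0) \<in> ?T" "h (1, 0) \<in> ?T" by auto
    moreover have "h (0, 0) = a" "h (1, 0) = b" using h(3,4) by auto
    ultimately show ?thesis by metis
  qed
  note ex = this
  show ?thesis
    unfolding connected_iff_connected_component
  proof (intro ballI)
    fix a b assume "a \<in> U" "b \<in> U"
    from ex[OF this] obtain T where "T \<subseteq> U" "connected T" "a \<in> T" "b \<in> T" by (elim exE conjE)
    then show "connected_component U a b" unfolding connected_component_def by (intro exI[of _ T] conjI)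
  qed
qed

text \<open>Charts whose parameter is a coordinate of affine space. Their inverse is the globally
  defined continuous function taking \<open>z\<close> to \<open>p z $ i\<close>, which makes
  transitions between charts explicit.\<close>

definition std_chart :: "'n \<Rightarrow> complex set \<Rightarrow> (complex \<Rightarrow> 'u) \<Rightarrow> bool" where
  "std_chart i D \<phi> \<longleftrightarrow> local_param U p D \<phi> \<and> (\<forall>t\<in>D. p (\<phi> t) $ i = t)"

lemma local_paramD:
  assumes "local_param U p D \<phi>"
  shows "open D" "openin (top_of_set U) (\<phi> ` D)" "continuous_on D \<phi>"
    "\<And>i. (\<lambda>t. p (\<phi> t) $ i) holomorphic_on D" "\<And>t. t \<in> D \<Longrightarrow> velocity p \<phi> t \<noteq> 0"
    "\<And>t. t \<in> D \<Longrightarrow> \<phi> t \<in> U"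
  using assms by (auto simp: local_param_def homeomorphism_def dest: openin_imp_subset)

lemma local_param_derivative:
  assumes "local_param U p D \<phi>" "t \<in> D"
  shows "((\<lambda>s. p (\<phi> s) $ i) has_field_derivative velocity p \<phi> t $ i) (at t)"
  using holomorphic_derivI[OF local_paramD(4)[OF assms(1)] local_paramD(1)[OF assms(1)] assms(2)]
  by (simp add: velocity_def)

lemma poly_derivative:
  assumes "local_param U p D \<phi>" "t \<in> D" "P \<in> poly_funs"
  shows "((\<lambda>s. P (p (\<phi> s))) has_field_derivative dir_deriv P (p (\<phi> t)) (velocity p \<phi> t)) (at t)"
  by (rule poly_funs_chain[OF assms(3)]) (rule local_param_derivative[OF assms(1,2)])

lemma velocity_tangent:
  assumes "local_param U p D \<phi>" "t \<in> D"
  shows "velocity p \<phi> t \<in> tangent_space C (p (\<phi> t))"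
  unfolding tangent_space_def
proof (intro CollectI ballI impI)
  fix P assume P: "P \<in> poly_funs" "\<forall>y\<in>C. P y = 0"
  have "((\<lambda>s. P (p (\<phi> s))) has_field_derivative 0) (at t)"
  proof (rule has_field_derivative_transform_within_open[of "\<lambda>_. 0"])
    show "0 = P (p (\<phi> s))" if "s \<in> D" for s
      using P(2) p_in_C[OF local_paramD(6)[OF assms(1) that]] by simp
  qed (use assms local_paramD(1) in auto)
  then show "dir_deriv P (p (\<phi> t)) (velocity p \<phi> t) = 0"
    using poly_derivative[OF assms P(1)] DERIV_unique by blast
qed

lemma tangent_velocity:
  assumes "local_param U p D \<phi>" "t \<in> D" "v \<in> tangent_space C (p (\<phi> t))"
  shows "\<exists>c. v = c *s velocity p \<phi> t"
proof -
  obtain w where w: "w \<noteq> 0" "tangent_space C (p (\<phi> t)) = range (\<lambda>c. c *s w)"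
    using tangent_space_line[OF p_in_C[OF local_paramD(6)[OF assms(1,2)]]] by metis
  obtain a b where ab: "velocity p \<phi> t = a *s w" "v = b *s w"
    using velocity_tangent[OF assms(1,2)] assms(3) w(2) by auto
  then have "a \<noteq> 0" using local_paramD(5)[OF assms(1,2)] by auto
  then have "v = (b / a) *s velocity p \<phi> t" unfolding ab by (simp add: vec_eq_iff)
  then show ?thesis by blast
qed

text \<open>A chart of the curve is composed with a local section of the covering.\<close>

lemma std_chart_exists:
  assumes z: "z \<in> U" and W: "openin (top_of_set U) W" "z \<in> W"
  obtains i r \<phi> where "r > 0" "std_chart i (ball (p z $ i) r) \<phi>" "\<phi> (p z $ i) = z" "\<phi> ` ball (p z $ i) r \<subseteq> W"
proof -
  have pz: "p z \<in> C" using z by (rule p_in_C)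
  obtain i r \<gamma> where \<gamma>: "r > 0" "\<gamma> (p z $ i) = p z" "\<And>t. t \<in> ball (p z $ i) r \<Longrightarrow> \<gamma> t \<in> C"
    "\<And>t. t \<in> ball (p z $ i) r \<Longrightarrow> \<gamma> t $ i = t" "\<And>j. (\<lambda>t. \<gamma> t $ j) holomorphic_on ball (p z $ i) r"
    "openin (top_of_set C) (\<gamma> ` ball (p z $ i) r)"
    by (rule chart_exists[OF pz]) (rule that; assumption)
  obtain T v where T: "p z \<in> T" "openin (top_of_set C) T" "\<Union>v = U \<inter> p -` T"
    "\<And>u. u \<in> v \<Longrightarrow> openin (top_of_set U) u" "\<And>u. u \<in> v \<Longrightarrow> \<exists>q. homeomorphism u T p q"
  proof -
    have "\<exists>T. p z \<in> T \<and> openin (top_of_set C) T \<and> (\<exists>v. \<Union>v = U \<inter> p -` T \<and>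
        (\<forall>u\<in>v. openin (top_of_set U) u) \<and> pairwise disjnt v \<and> (\<forall>u\<in>v. \<exists>q. homeomorphism u T p q))"
      using covering pz unfolding covering_space_def by blast
    then show thesis using that by (elim exE conjE) simp
  qed
  obtain u where u: "u \<in> v" "z \<in> u" using T(1,3) z by blast
  obtain q where "homeomorphism u T p q" using T(5)[OF u(1)] by blast
  then have q: "continuous_on T q" "\<And>y. y \<in> T \<Longrightarrow> q y \<in> u" "\<And>y. y \<in> T \<Longrightarrow> p (q y) = y" "\<And>y. y \<in> u \<Longrightarrow> q (p y) = y"
    "\<And>y. y \<in> u \<Longrightarrow> p y \<in> T"
    by (auto simp: homeomorphism_def)
  have uU: "openin (top_of_set U) u" "u \<subseteq> U" using T(4)[OF u(1)] openin_imp_subset by auto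
  \<comment> \<open>In the sheet \<open>u\<close> the section \<open>q\<close> inverts
    \<open>p\<close>; intersecting with \<open>W\<close> adds the required smallness.\<close>
  let ?W = "u \<inter> W"
  have "openin (top_of_set U) ?W" using uU(1) W(1) by (rule openin_Int)
  then have "openin (top_of_set u) ?W" using uU by (metis inf_le1 openin_subset_trans)
  then have "openin (top_of_set T) (T \<inter> q -` ?W)"
    using q by (intro continuous_openin_preimage) auto
  then have "openin (top_of_set C) (T \<inter> q -` ?W)" using T(2) openin_trans by blast
  moreover have cont\<gamma>: "continuous_on (ball (p z $ i) r) \<gamma>"
    using continuous_on_vec_lambda[of _ "\<lambda>j t. \<gamma> t $ j", OF holomorphic_on_imp_continuous_on[OF \<gamma>(5)]] by simp
  ultimately have "openin (top_of_set (ball (p z $ i) r)) (ball (p z $ i) r \<inter> \<gamma> -` (T \<inter> q -` ?W))"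
    using \<gamma>(3) by (intro continuous_openin_preimage) auto
  then have "open (ball (p z $ i) r \<inter> \<gamma> -` (T \<inter> q -` ?W))" by (metis open_ball openin_open_eq)
  moreover have "p z $ i \<in> ball (p z $ i) r \<inter> \<gamma> -` (T \<inter> q -` ?W)"
    using \<gamma>(1,2) T(1) q(4)[OF u(2)] u(2) W(2) by simp
  ultimately obtain e where e: "e > 0" "ball (p z $ i) e \<subseteq> ball (p z $ i) r \<inter> \<gamma> -` (T \<inter> q -` ?W)"
    by (meson openE)
  let ?B = "ball (p z $ i) e"
  define \<phi> where "\<phi> t = q (\<gamma> t)" for t
  have e': "t \<in> ball (p z $ i) r" "\<gamma> t \<in> T" "\<phi> t \<in> u" "\<phi> t \<in> W" if "t \<in> ?B" for t
    using e(2) that by (auto simp: \<phi>_def)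
  have p\<phi>: "p (\<phi> t) = \<gamma> t" if "t \<in> ?B" for t using e'[OF that] q(3) by (simp add: \<phi>_def)
  have p\<phi>i: "p (\<phi> t) $ i = t" if "t \<in> ?B" for t using p\<phi>[OF that] \<gamma>(4)[OF e'(1)[OF that]] by simp
  have hol: "(\<lambda>t. p (\<phi> t) $ j) holomorphic_on ?B" for j
  proof (rule holomorphic_transform)
    show "(\<lambda>t. \<gamma> t $ j) holomorphic_on ?B" by (rule holomorphic_on_subset[OF \<gamma>(5)]) (use e(2) in auto)
  qed (use p\<phi> in auto)
  \<comment> \<open>The smaller arc is cut out of an open arc by a condition on coordinate
    \<open>i\<close>, so it is open in \<open>C\<close>; its preimage within the sheet is then open
    in \<open>U\<close>.\<close>
  have "\<gamma> ` ?B = \<gamma> ` ball (p z $ i) r \<inter> (C \<inter> (\<lambda>z. z $ i) -` ?B)"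
    using \<gamma>(3,4) e'(1) by (auto simp: image_iff) 
  moreover have "openin (top_of_set C) (C \<inter> (\<lambda>z. z $ i) -` ?B)"
    by (intro continuous_openin_preimage_gen) (auto intro!: continuous_intros)
  ultimately have "openin (top_of_set C) (\<gamma> ` ?B)" using \<gamma>(6) by (metis openin_Int)
  then have "openin (top_of_set U) (U \<inter> p -` (\<gamma> ` ?B))"
    using continuous_p p_in_C by (intro continuous_openin_preimage) auto
  then have "openin (top_of_set U) (u \<inter> (U \<inter> p -` (\<gamma> ` ?B)))" using uU(1) by blast
  moreover have "\<phi> ` ?B = u \<inter> (U \<inter> p -` (\<gamma> ` ?B))"
  proof (intro equalityI subsetI)
    fix y assume "y \<in> u \<inter> (U \<inter> p -` (\<gamma> ` ?B))"
    then obtain t where t: "y \<in> u" "t \<in> ?B" "p y = \<gamma> t" by auto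
    then have "\<phi> t = y" using q(4)[OF t(1)] by (simp add: \<phi>_def)
    then show "y \<in> \<phi> ` ?B" using t(2) by blast
  next
    fix y assume "y \<in> \<phi> ` ?B"
    then obtain t where "t \<in> ?B" "y = \<phi> t" by blast
    then show "y \<in> u \<inter> (U \<inter> p -` (\<gamma> ` ?B))" using e'(3)[of t] p\<phi>[of t] uU(2) by auto
  qed
  ultimately have op: "openin (top_of_set U) (\<phi> ` ?B)" by simp
  have cont: "continuous_on ?B \<phi>"
    unfolding \<phi>_def by (rule continuous_on_compose2[OF q(1) continuous_on_subset[OF cont\<gamma>]]) (use e(2) in auto)
  have "homeomorphism ?B (\<phi> ` ?B) \<phi> (\<lambda>y. p y $ i)"
  proof (rule homeomorphismI)
    show "continuous_on (\<phi> ` ?B) (\<lambda>y. p y $ i)"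
      by (intro continuous_intros continuous_on_subset[OF continuous_p] openin_imp_subset[OF op])
  qed (use cont p\<phi>i in auto)
  moreover have "velocity p \<phi> t \<noteq> 0" if "t \<in> ?B" for t
  proof -
    have "((\<lambda>s. p (\<phi> s) $ i) has_field_derivative 1) (at t)"
      by (rule has_field_derivative_transform_within_open[OF DERIV_ident open_ball that]) (use p\<phi>i in auto)
    then have "velocity p \<phi> t $ i = 1" by (simp add: velocity_def DERIV_imp_deriv)
    then show ?thesis by auto
  qed
  ultimately have "local_param U p ?B \<phi>" using op hol by (auto simp: local_param_def)
  then have "std_chart i ?B \<phi>" using p\<phi>i by (simp add: std_chart_def)
  moreover have "\<phi> (p z $ i) = z" using \<gamma>(2) q(4)[OF u(2)] by (simp add: \<phi>_def)
  ultimately show thesis using that[OF e(1)] e'(4) by blast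
qed

lemma std_chart_exists':
  assumes "z \<in> U"
  obtains i r \<phi> where "r > 0" "std_chart i (ball (p z $ i) r) \<phi>" "\<phi> (p z $ i) = z"
  by (rule std_chart_exists[OF assms openin_subtopology_self assms]) (rule that; assumption)

text \<open>Into a standard chart the transition map is a coordinate of \<open>p\<close> composed
  with \<phi>, which is holomorphic by the definition of \<open>local_param\<close>.\<close>

lemma chart_transition:
  assumes \<phi>: "local_param U p D \<phi>" and \<psi>: "std_chart i D' \<psi>" and t: "t \<in> D" "\<phi> t \<in> \<psi> ` D'"
  obtains E where "open E" "t \<in> E" "E \<subseteq> D" "\<And>s. s \<in> E \<Longrightarrow> p (\<phi> s) $ i \<in> D' \<and> \<phi> s = \<psi> (p (\<phi> s) $ i)"
proof -
  have \<psi>': "local_param U p D' \<psi>" "\<And>t. t \<in> D' \<Longrightarrow> p (\<psi> t) $ i = t" using \<psi> by (auto simp: std_chart_def)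
  have "openin (top_of_set D) (D \<inter> \<phi> -` (\<psi> ` D'))"
    using local_paramD[OF \<phi>] local_paramD(2)[OF \<psi>'(1)] by (intro continuous_openin_preimage) auto
  then have "open (D \<inter> \<phi> -` (\<psi> ` D'))" using local_paramD(1)[OF \<phi>] by (metis openin_open_eq)
  moreover have "p (\<phi> s) $ i \<in> D' \<and> \<phi> s = \<psi> (p (\<phi> s) $ i)" if "s \<in> D \<inter> \<phi> -` (\<psi> ` D')" for s
    using that \<psi>'(2) by auto
  ultimately show thesis using that[of "D \<inter> \<phi> -` (\<psi> ` D')"] t by auto
qed

lemma velocity_transition:
  assumes \<phi>: "local_param U p D \<phi>" and \<psi>: "std_chart i D' \<psi>" and t: "t \<in> D" "\<phi> t \<in> \<psi> ` D'"
  shows "velocity p \<phi> t = (velocity p \<phi> t $ i) *s velocity p \<psi> (p (\<phi> t) $ i)"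
proof -
  obtain E where E: "open E" "t \<in> E" "E \<subseteq> D" "\<And>s. s \<in> E \<Longrightarrow> p (\<phi> s) $ i \<in> D' \<and> \<phi> s = \<psi> (p (\<phi> s) $ i)"
    by (rule chart_transition[OF assms]) (rule that; assumption)
  have \<psi>': "local_param U p D' \<psi>" using \<psi> by (auto simp: std_chart_def)
  have "velocity p \<phi> t $ j = velocity p \<phi> t $ i * velocity p \<psi> (p (\<phi> t) $ i) $ j" for j
  proof -
    have "((\<lambda>s. p (\<psi> (p (\<phi> s) $ i)) $ j) has_field_derivative
        velocity p \<psi> (p (\<phi> t) $ i) $ j * velocity p \<phi> t $ i) (at t)"
      using E(4)[OF E(2)] by (intro DERIV_chain2[OF local_param_derivative[OF \<psi>'] local_param_derivative[OF \<phi> t(1)]]) auto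
    then have "((\<lambda>s. p (\<phi> s) $ j) has_field_derivative
        velocity p \<psi> (p (\<phi> t) $ i) $ j * velocity p \<phi> t $ i) (at t)"
      by (rule has_field_derivative_transform_within_open[OF _ E(1,2)]) (use E(4) in auto)
    then show ?thesis using DERIV_unique[OF local_param_derivative[OF \<phi> t(1)]] by (simp add: mult.commute)
  qed
  then show ?thesis unfolding vec_eq_iff vector_smult_component by blast
qed

text \<open>\<open>dform g \<beta>\<close> says that \<open>dg\<close> is the form taking the value \<open>\<beta> z v\<close> at \<open>z\<close>
  on the tangent vector that \<open>p\<close> maps to \<open>v\<close>.\<close>

definition dform :: "('u \<Rightarrow> complex) \<Rightarrow> ('u \<Rightarrow> complex ^ 'n \<Rightarrow> complex) \<Rightarrow> bool" where
  "dform g \<beta> \<longleftrightarrow> (\<forall>D \<phi> t. local_param U p D \<phi> \<and> t \<in> D \<longrightarrow>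
     ((\<lambda>s. g (\<phi> s)) has_field_derivative \<beta> (\<phi> t) (velocity p \<phi> t)) (at t))"

lemma dformD:
  "dform g \<beta> \<Longrightarrow> local_param U p D \<phi> \<Longrightarrow> t \<in> D \<Longrightarrow>
    ((\<lambda>s. g (\<phi> s)) has_field_derivative \<beta> (\<phi> t) (velocity p \<phi> t)) (at t)"
  by (auto simp: dform_def)

text \<open>Allows a differential to be verified in one standard chart: homogeneity of \<beta>
  absorbs the factor by which velocities change.\<close>

lemma derivative_change_chart:
  assumes \<psi>: "std_chart i D' \<psi>" "s0 \<in> D'"
    and der: "((\<lambda>s. g (\<psi> s)) has_field_derivative \<beta> (velocity p \<psi> s0)) (at s0)"
    and hom: "\<And>v c. v \<in> tangent_space C (p (\<psi> s0)) \<Longrightarrow> \<beta> (c *s v) = c * \<beta> v"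
    and \<phi>: "local_param U p D \<phi>" "t \<in> D" "\<phi> t = \<psi> s0"
  shows "((\<lambda>s. g (\<phi> s)) has_field_derivative \<beta> (velocity p \<phi> t)) (at t)"
proof -
  have \<psi>': "local_param U p D' \<psi>" "p (\<psi> s0) $ i = s0" using \<psi> by (auto simp: std_chart_def)
  have im: "\<phi> t \<in> \<psi> ` D'" using \<psi>(2) \<phi>(3) by (metis imageI)
  obtain E where E: "open E" "t \<in> E" "E \<subseteq> D" "\<And>s. s \<in> E \<Longrightarrow> p (\<phi> s) $ i \<in> D' \<and> \<phi> s = \<psi> (p (\<phi> s) $ i)"
    by (rule chart_transition[OF \<phi>(1) \<psi>(1) \<phi>(2) im]) (rule that; assumption)
  have s0: "p (\<phi> t) $ i = s0" using \<phi>(3) \<psi>'(2) by simp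
  have "((\<lambda>s. g (\<psi> (p (\<phi> s) $ i))) has_field_derivative
      \<beta> (velocity p \<psi> s0) * velocity p \<phi> t $ i) (at t)"
    by (rule DERIV_chain2[OF _ local_param_derivative[OF \<phi>(1,2)]]) (simp add: s0 der)
  moreover have "\<beta> (velocity p \<phi> t) = \<beta> ((velocity p \<phi> t $ i) *s velocity p \<psi> s0)"
    by (rule arg_cong[OF velocity_transition[OF \<phi>(1) \<psi>(1) \<phi>(2) im, unfolded s0]])
  moreover have "\<dots> = velocity p \<phi> t $ i * \<beta> (velocity p \<psi> s0)"
    by (rule hom[OF velocity_tangent[OF \<psi>'(1) \<psi>(2)]])
  ultimately have "((\<lambda>s. g (\<psi> (p (\<phi> s) $ i))) has_field_derivative \<beta> (velocity p \<phi> t)) (at t)"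
    by (simp only: mult.commute)
  then show ?thesis
    by (rule has_field_derivative_transform_within_open[OF _ E(1,2)]) (use E(4) in auto)
qed

text \<open>Agreement on tangent vectors suffices because velocities of charts are tangent;
  differentials are 0 on all other vectors by convention.\<close>

lemma dform_cong:
  assumes "dform g \<beta>" "\<And>z. z \<in> U \<Longrightarrow> g z = g' z"
    "\<And>z v. z \<in> U \<Longrightarrow> v \<in> tangent_space C (p z) \<Longrightarrow> \<beta> z v = \<beta>' z v"
  shows "dform g' \<beta>'"
  unfolding dform_def
proof (intro allI impI, elim conjE)
  fix D \<phi> t assume \<phi>: "local_param U p D \<phi>" "t \<in> D"
  have "((\<lambda>s. g (\<phi> s)) has_field_derivative \<beta>' (\<phi> t) (velocity p \<phi> t)) (at t)"
    using dformD[OF assms(1) \<phi>] assms(3)[OF local_paramD(6)[OF \<phi>] velocity_tangent[OF \<phi>]] by simp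
  then show "((\<lambda>s. g' (\<phi> s)) has_field_derivative \<beta>' (\<phi> t) (velocity p \<phi> t)) (at t)"
    by (rule has_field_derivative_transform_within_open[OF _ local_paramD(1)[OF \<phi>(1)] \<phi>(2)])
       (use assms(2) local_paramD(6)[OF \<phi>(1)] in auto)
qed

lemma dform_const: "dform (\<lambda>_. c) (\<lambda>_ _. 0)"
  by (simp add: dform_def)

lemma dform_add: "dform g \<beta> \<Longrightarrow> dform h \<gamma> \<Longrightarrow> dform (\<lambda>z. g z + h z) (\<lambda>z v. \<beta> z v + \<gamma> z v)"
  by (auto simp: dform_def intro!: DERIV_add)

lemma dform_diff: "dform g \<beta> \<Longrightarrow> dform h \<gamma> \<Longrightarrow> dform (\<lambda>z. g z - h z) (\<lambda>z v. \<beta> z v - \<gamma> z v)"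
  by (auto simp: dform_def intro!: DERIV_diff)

lemma dform_mult:
  "dform g \<beta> \<Longrightarrow> dform h \<gamma> \<Longrightarrow> dform (\<lambda>z. g z * h z) (\<lambda>z v. \<beta> z v * h z + \<gamma> z v * g z)"
  by (auto simp: dform_def intro!: DERIV_mult)

lemma dform_cmult: "dform g \<beta> \<Longrightarrow> dform (\<lambda>z. c * g z) (\<lambda>z v. c * \<beta> z v)"
  by (auto simp: dform_def intro!: DERIV_cmult)

lemma dform_sum:
  "(\<And>k. k \<in> K \<Longrightarrow> dform (g k) (\<beta> k)) \<Longrightarrow> dform (\<lambda>z. \<Sum>k\<in>K. g k z) (\<lambda>z v. \<Sum>k\<in>K. \<beta> k z v)"
  by (induction K rule: infinite_finite_induct) (auto intro: dform_const dform_add)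

lemma dform_poly: "P \<in> poly_funs \<Longrightarrow> dform (\<lambda>z. P (p z)) (\<lambda>z v. dir_deriv P (p z) v)"
  by (auto simp: dform_def intro: poly_derivative)

lemma dform_hol_funs: "dform g \<beta> \<Longrightarrow> (\<And>z. z \<notin> U \<Longrightarrow> g z = 0) \<Longrightarrow> g \<in> hol_funs U p"
  unfolding hol_funs_def
  by (auto simp: holomorphic_on_open local_paramD(1) dest: dformD)

lemma dform_zero_constant:
  assumes "dform g (\<lambda>_ _. 0)" "a \<in> U" "b \<in> U" shows "g a = g b"
proof (rule connected_equivalence_relation[OF connected_U assms(2,3), of "\<lambda>x y. g x = g y"])
  fix z assume z: "z \<in> U"
  obtain i r \<phi> where \<phi>: "r > 0" "std_chart i (ball (p z $ i) r) \<phi>" "\<phi> (p z $ i) = z"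
    by (rule std_chart_exists'[OF z]) (rule that; assumption)
  then have lp: "local_param U p (ball (p z $ i) r) \<phi>" by (simp add: std_chart_def)
  have "\<exists>c. \<forall>t\<in>ball (p z $ i) r. g (\<phi> t) = c"
    using dformD[OF assms(1) lp]
    by (intro has_field_derivative_zero_constant) (auto intro: has_field_derivative_at_within)
  then obtain c where c: "\<And>t. t \<in> ball (p z $ i) r \<Longrightarrow> g (\<phi> t) = c" by blast
  have "z \<in> \<phi> ` ball (p z $ i) r" using \<phi>(1,3) by (metis centre_in_ball imageI)
  moreover have "g y = c" if "y \<in> \<phi> ` ball (p z $ i) r" for y using that c by blast
  ultimately show "\<exists>T. openin (top_of_set U) T \<and> z \<in> T \<and> (\<forall>y\<in>T. g z = g y)"
    using local_paramD(2)[OF lp] by (intro exI[of _ "\<phi> ` ball (p z $ i) r"]) auto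
qed auto

lemma dform_unique:
  assumes "dform g \<beta>" "dform h \<beta>" "a \<in> U" "g a = h a" "z \<in> U" shows "g z = h z"
  using dform_zero_constant[of "\<lambda>z. g z - h z", OF _ assms(3,5)] dform_diff[OF assms(1,2)] assms(4) by simp

text \<open>Identity theorem on the connected surface: in a disc chart the function vanishes near
  one point exactly if it vanishes near every other one, so this property is locally
  constant.\<close>

lemma hol_identity:
  assumes f: "f \<in> hol_funs U p" and W: "openin (top_of_set U) W" "w \<in> W" "\<And>z. z \<in> W \<Longrightarrow> f z = 0"
    and b: "b \<in> U"
  shows "f b = 0"
proof -
  let ?V = "\<lambda>z. \<exists>T. openin (top_of_set U) T \<and> z \<in> T \<and> (\<forall>y\<in>T. f y = 0)"
  have "?V w \<longleftrightarrow> ?V b"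
  proof (rule connected_equivalence_relation[OF connected_U _ b, of w "\<lambda>x y. ?V x \<longleftrightarrow> ?V y"])
    show "w \<in> U" using W openin_imp_subset by blast
    fix z assume z: "z \<in> U"
    obtain i r \<phi> where \<phi>: "r > 0" "std_chart i (ball (p z $ i) r) \<phi>" "\<phi> (p z $ i) = z"
      by (rule std_chart_exists'[OF z]) (rule that; assumption)
    let ?B = "ball (p z $ i) r"
    have lp: "local_param U p ?B \<phi>" using \<phi> by (simp add: std_chart_def)
    \<comment> \<open>An open set of zeros inside the disc has a limit point there, so analytic
      continuation spreads the zeros over the disc.\<close>
    have all: "\<forall>y\<in>\<phi> ` ?B. f y = 0" if y: "y \<in> \<phi> ` ?B" "?V y" for y
    proof -
      obtain T where T: "openin (top_of_set U) T" "y \<in> T" "\<forall>y\<in>T. f y = 0" using y(2) by blast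
      obtain t where t: "t \<in> ?B" "y = \<phi> t" using y(1) by blast
      have "openin (top_of_set ?B) (?B \<inter> \<phi> -` T)"
        using local_paramD[OF lp] T(1) by (intro continuous_openin_preimage) auto
      then have op: "open (?B \<inter> \<phi> -` T)" by (metis open_ball openin_open_eq)
      have "t \<in> ?B \<inter> \<phi> -` T" using t T(2) by simp
      then have "t \<in> interior (?B \<inter> \<phi> -` T)" unfolding interior_open[OF op] .
      then have "t islimpt (?B \<inter> \<phi> -` T)" by (rule interior_limit_point)
      moreover have "(\<lambda>t. f (\<phi> t)) holomorphic_on ?B" using f lp by (auto simp: hol_funs_def)
      ultimately have "f (\<phi> s) = 0" if "s \<in> ?B" for s
        using T(3) t(1) that
        by (intro analytic_continuation[of "\<lambda>t. f (\<phi> t)" ?B "?B \<inter> \<phi> -` T" t s]) auto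
      then show ?thesis by blast
    qed
    show "\<exists>T. openin (top_of_set U) T \<and> z \<in> T \<and> (\<forall>y\<in>T. ?V z \<longleftrightarrow> ?V y)"
    proof (intro exI[of _ "\<phi> ` ?B"] conjI ballI)
      show "openin (top_of_set U) (\<phi> ` ?B)" by (rule local_paramD(2)[OF lp])
      show zB: "z \<in> \<phi> ` ?B" using \<phi>(1,3) by (metis centre_in_ball imageI)
      show "?V z \<longleftrightarrow> ?V y" if "y \<in> \<phi> ` ?B" for y
        using all[OF that] all[OF zB] local_paramD(2)[OF lp] zB that by blast
    qed
  qed auto
  then show ?thesis using W by blast
qed

end

section \<open>Gluing local primitives on a simply connected space\<close>

text \<open>
  \<open>\<P> W g\<close> stands for: \<open>g\<close> is a primitive on the open set \<open>W\<close> of a fixed closed form.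
\<close>

locale primitive_system =
  fixes U :: "'u::topological_space set" and \<P> :: "'u set \<Rightarrow> ('u \<Rightarrow> complex) \<Rightarrow> bool"
  assumes prim_open: "\<P> W g \<Longrightarrow> openin (top_of_set U) W"
    and prim_exists: "z \<in> U \<Longrightarrow> \<exists>W g. \<P> W g \<and> z \<in> W"
    and prim_diff: "\<P> W g \<Longrightarrow> \<P> W' g' \<Longrightarrow> z \<in> W \<Longrightarrow> z \<in> W' \<Longrightarrow>
      \<exists>V c. openin (top_of_set U) V \<and> z \<in> V \<and> V \<subseteq> W \<inter> W' \<and> (\<forall>y\<in>V. g y = g' y + c)"
begin

text \<open>A continuous substitute for integrating the closed form along \<open>h\<close>: locally
  a primitive composed with \<open>h\<close>, up to a constant. It applies to homotopies, for which
  only continuity is known.\<close>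

definition lift :: "('b::topological_space \<Rightarrow> 'u) \<Rightarrow> 'b set \<Rightarrow> ('b \<Rightarrow> complex) \<Rightarrow> bool" where
  "lift h S H \<longleftrightarrow> (\<forall>x\<in>S. \<exists>W g c N. \<P> W g \<and> open N \<and> x \<in> N \<and> h ` (S \<inter> N) \<subseteq> W \<and>
     (\<forall>y\<in>S \<inter> N. H y = g (h y) + c))"

lemma liftE:
  assumes "lift h S H" "x \<in> S"
  obtains W g c N where "\<P> W g" "open N" "x \<in> N" "h ` (S \<inter> N) \<subseteq> W" "\<And>y. y \<in> S \<inter> N \<Longrightarrow> H y = g (h y) + c"
proof -
  from assms(1)[unfolded lift_def, rule_format, OF assms(2)]
  obtain W g c N where N: "\<P> W g" "open N" "x \<in> N" "h ` (S \<inter> N) \<subseteq> W" "\<forall>y\<in>S \<inter> N. H y = g (h y) + c"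
    by (elim exE conjE)
  show thesis by (rule that[OF N(1-4)]) (use N(5) in blast)
qed

lemma prim_diffE:
  assumes "\<P> W g" "\<P> W' g'" "z \<in> W" "z \<in> W'"
  obtains V c where "openin (top_of_set U) V" "z \<in> V" "V \<subseteq> W \<inter> W'" "\<And>y. y \<in> V \<Longrightarrow> g y = g' y + c"
proof -
  from prim_diff[OF assms] obtain V c where V: "openin (top_of_set U) V" "z \<in> V" "V \<subseteq> W \<inter> W'" "\<forall>y\<in>V. g y = g' y + c"
    by (elim exE conjE)
  show thesis by (rule that[OF V(1-3)]) (use V(4) in blast)
qed

lemma preimage_open:
  assumes "continuous_on S h" "h ` S \<subseteq> U" "openin (top_of_set U) W"
  obtains N where "open N" "S \<inter> h -` W = S \<inter> N"
proof -
  have "openin (top_of_set S) (S \<inter> h -` W)" using assms by (intro continuous_openin_preimage) auto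
  then show thesis using that by (auto simp: openin_open)
qed

lemma lift_compose:
  assumes "lift h S H" "continuous_on S' k" "k ` S' \<subseteq> S" "\<And>x. x \<in> S' \<Longrightarrow> h' x = h (k x)"
  shows "lift h' S' (\<lambda>x. H (k x))"
  unfolding lift_def
proof
  fix x assume x: "x \<in> S'"
  then have "k x \<in> S" using assms(3) by blast
  from assms(1) this obtain W g c N where N: "\<P> W g" "open N" "k x \<in> N" "h ` (S \<inter> N) \<subseteq> W"
    "\<And>y. y \<in> S \<inter> N \<Longrightarrow> H y = g (h y) + c" by (rule liftE) (rule that; assumption)
  obtain N' where N': "open N'" "N' \<inter> S' = k -` N \<inter> S'"
    using assms(2) N(2) by (auto simp: continuous_on_open_invariant)
  show "\<exists>W g c N. \<P> W g \<and> open N \<and> x \<in> N \<and> h' ` (S' \<inter> N) \<subseteq> W \<and> (\<forall>y\<in>S' \<inter> N. H (k y) = g (h' y) + c)"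
  proof (intro exI[of _ W] exI[of _ g] exI[of _ c] exI[of _ N'] conjI ballI)
    show "x \<in> N'" using N' x N(3) by blast
    have in': "k y \<in> S \<inter> N" if "y \<in> S' \<inter> N'" for y using that N'(2) assms(3) by blast
    show "h' ` (S' \<inter> N') \<subseteq> W"
    proof (rule image_subsetI)
      fix y assume y: "y \<in> S' \<inter> N'"
      have "h (k y) \<in> W" using N(4) in'[OF y] by blast
      then show "h' y \<in> W" using assms(4)[of y] y by simp
    qed
    show "H (k y) = g (h' y) + c" if "y \<in> S' \<inter> N'" for y using N(5)[OF in'[OF that]] assms(4)[of y] that by simp
  qed (use N N' in auto)
qed

lemma lift_subset: "lift h S H \<Longrightarrow> T \<subseteq> S \<Longrightarrow> lift h T H"
  using lift_compose[of h S H T "\<lambda>x. x" h] by (simp add: continuous_on_id)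

lemma lift_add_const:
  assumes "lift h S H" shows "lift h S (\<lambda>x. H x + a)"
  unfolding lift_def
proof
  fix x assume "x \<in> S"
  from assms this obtain W g c N where N: "\<P> W g" "open N" "x \<in> N" "h ` (S \<inter> N) \<subseteq> W"
    "\<And>y. y \<in> S \<inter> N \<Longrightarrow> H y = g (h y) + c" by (rule liftE) (rule that; assumption)
  then show "\<exists>W g c N. \<P> W g \<and> open N \<and> x \<in> N \<and> h ` (S \<inter> N) \<subseteq> W \<and> (\<forall>y\<in>S \<inter> N. H y + a = g (h y) + c)"
    by (intro exI[of _ W] exI[of _ g] exI[of _ "c + a"] exI[of _ N]) (auto simp: add.assoc)
qed

lemma lift_primitive:
  assumes "\<P> W g" "h ` S \<subseteq> W" shows "lift h S (\<lambda>x. g (h x))"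
  unfolding lift_def
  using assms by (intro ballI exI[of _ W] exI[of _ g] exI[of _ 0] exI[of _ UNIV]) auto

text \<open>Primitives near \<open>h x\<close> differ by a constant, so the difference of two lifts
  is locally constant.\<close>

lemma lift_unique:
  assumes S: "connected S" and h: "continuous_on S h" "h ` S \<subseteq> U" and l: "lift h S H" "lift h S H'"
    and ab: "a \<in> S" "b \<in> S"
  shows "H a - H' a = H b - H' b"
proof (rule connected_equivalence_relation[OF S ab, of "\<lambda>x y. H x - H' x = H y - H' y"])
  fix x assume x: "x \<in> S"
  from l(1) x obtain W g c N where N: "\<P> W g" "open N" "x \<in> N" "h ` (S \<inter> N) \<subseteq> W"
    "\<And>y. y \<in> S \<inter> N \<Longrightarrow> H y = g (h y) + c" by (rule liftE) (rule that; assumption)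
  from l(2) x obtain W' g' c' N' where N': "\<P> W' g'" "open N'" "x \<in> N'" "h ` (S \<inter> N') \<subseteq> W'"
    "\<And>y. y \<in> S \<inter> N' \<Longrightarrow> H' y = g' (h y) + c'" by (rule liftE) (rule that; assumption)
  have hx: "h x \<in> W" "h x \<in> W'" using x N N' by auto
  obtain V d where V: "openin (top_of_set U) V" "h x \<in> V" "\<And>y. y \<in> V \<Longrightarrow> g y = g' y + d"
    by (rule prim_diffE[OF N(1) N'(1) hx]) (rule that; assumption)
  obtain M where M: "open M" "S \<inter> h -` V = S \<inter> M" by (rule preimage_open[OF h V(1)])
  have diff: "H y - H' y = d + c - c'" if "y \<in> S \<inter> (N \<inter> N' \<inter> M)" for y
  proof -
    have "h y \<in> V" using that M(2) by blast
    then show ?thesis using N(5)[of y] N'(5)[of y] V(3)[of "h y"] that by simp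
  qed
  have xT: "x \<in> S \<inter> (N \<inter> N' \<inter> M)" using x N(3) N'(3) V(2) M(2) by blast
  show "\<exists>T. openin (top_of_set S) T \<and> x \<in> T \<and> (\<forall>y\<in>T. H x - H' x = H y - H' y)"
  proof (intro exI[of _ "S \<inter> (N \<inter> N' \<inter> M)"] conjI ballI)
    show "openin (top_of_set S) (S \<inter> (N \<inter> N' \<inter> M))" using N(2) N'(2) M(1) by (intro openin_open_Int open_Int)
  qed (use diff xT in auto)
qed auto

text \<open>Connectedness of the overlap makes a single constant suffice to match the two lifts.
  Closedness lets a point outside one piece have a neighbourhood avoiding that piece.\<close>

lemma lift_glue:
  assumes cl: "closed S" "closed S'" and conn: "connected (S \<inter> S')"
    and h: "continuous_on (S \<union> S') h" "h ` (S \<union> S') \<subseteq> U" and l: "lift h S H" "lift h S' H'"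
  shows "\<exists>K. lift h (S \<union> S') K"
proof -
  have hS: "continuous_on (S \<inter> S') h" "h ` (S \<inter> S') \<subseteq> U"
    using h by (auto intro: continuous_on_subset)
  have lI: "lift h (S \<inter> S') H" "lift h (S \<inter> S') H'"
    by (rule lift_subset[OF l(1)], simp) (rule lift_subset[OF l(2)], simp)
  obtain a where a: "\<And>x. x \<in> S \<inter> S' \<Longrightarrow> H x = H' x + a"
  proof (cases "S \<inter> S' = {}")
    case False
    then obtain x0 where x0: "x0 \<in> S \<inter> S'" by blast
    have "H x = H' x + (H x0 - H' x0)" if "x \<in> S \<inter> S'" for x
      using lift_unique[OF conn hS lI that x0] by (simp add: algebra_simps)
    then show thesis using that by blast
  qed (use that in auto)
  define H'' where "H'' = (\<lambda>x. H' x + a)"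
  have l'': "lift h S' H''" unfolding H''_def by (rule lift_add_const[OF l(2)])
  have agree: "H x = H'' x" if "x \<in> S" "x \<in> S'" for x using a that by (simp add: H''_def)
  define K where "K x = (if x \<in> S then H x else H'' x)" for x
  have K: "x \<in> S \<Longrightarrow> K x = H x" "x \<in> S' \<Longrightarrow> K x = H'' x" for x using agree by (auto simp: K_def)
  have one: "\<exists>W g c N. \<P> W g \<and> open N \<and> x \<in> N \<and> h ` ((A \<union> B) \<inter> N) \<subseteq> W \<and> (\<forall>y\<in>(A \<union> B) \<inter> N. K y = g (h y) + c)"
    if A: "lift h A HA" "x \<in> A" "x \<notin> B" "closed B" "\<And>y. y \<in> A \<Longrightarrow> K y = HA y" for A B HA x
  proof -
    from A(1,2) obtain W g c N where N: "\<P> W g" "open N" "x \<in> N" "h ` (A \<inter> N) \<subseteq> W"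
      "\<And>y. y \<in> A \<inter> N \<Longrightarrow> HA y = g (h y) + c" by (rule liftE) (rule that; assumption)
    show ?thesis
      using N A(3-5)
      by (intro exI[of _ W] exI[of _ g] exI[of _ c] exI[of _ "N - B"]) (auto simp: open_Diff)
  qed
  have "lift h (S \<union> S') K"
    unfolding lift_def
  proof
    fix x assume "x \<in> S \<union> S'"
    then consider "x \<in> S" "x \<notin> S'" | "x \<in> S'" "x \<notin> S" | "x \<in> S" "x \<in> S'" by blast
    then show "\<exists>W g c N. \<P> W g \<and> open N \<and> x \<in> N \<and> h ` ((S \<union> S') \<inter> N) \<subseteq> W \<and> (\<forall>y\<in>(S \<union> S') \<inter> N. K y = g (h y) + c)"
    proof cases
      case 1 then show ?thesis using one[OF l(1) _ _ cl(2)] K(1) by blast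
    next
      case 2 then show ?thesis using one[OF l'' _ _ cl(1)] K(2) by (metis Un_commute)
    next
      case 3
      from l(1) 3(1) obtain W g c N where N: "\<P> W g" "open N" "x \<in> N" "h ` (S \<inter> N) \<subseteq> W"
        "\<And>y. y \<in> S \<inter> N \<Longrightarrow> H y = g (h y) + c" by (rule liftE) (rule that; assumption)
      from l'' 3(2) obtain W' g' c' N' where N': "\<P> W' g'" "open N'" "x \<in> N'" "h ` (S' \<inter> N') \<subseteq> W'"
        "\<And>y. y \<in> S' \<inter> N' \<Longrightarrow> H'' y = g' (h y) + c'" by (rule liftE) (rule that; assumption)
      have hx: "h x \<in> W" "h x \<in> W'" using 3 N N' by auto
      obtain V d where V: "openin (top_of_set U) V" "h x \<in> V" "V \<subseteq> W \<inter> W'" "\<And>y. y \<in> V \<Longrightarrow> g y = g' y + d"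
        by (rule prim_diffE[OF N(1) N'(1) hx]) (rule that; assumption)
      obtain M where M: "open M" "(S \<union> S') \<inter> h -` V = (S \<union> S') \<inter> M" by (rule preimage_open[OF h V(1)])
      \<comment> \<open>At \<open>x\<close> itself both lifts agree, which fixes the constant
        between the two local primitives on all of \<open>V\<close>.\<close>
      have c: "d + c = c'" using N(5)[of x] N'(5)[of x] V(4)[OF V(2)] agree[OF 3] 3 N(3) N'(3) by simp
      have hV: "h y \<in> V" if "y \<in> S \<union> S'" "y \<in> M" for y using M(2) that by blast
      show ?thesis
      proof (intro exI[of _ W] exI[of _ g] exI[of _ c] exI[of _ "N \<inter> N' \<inter> M"] conjI ballI)
        show "\<P> W g" by (rule N(1))
        show "open (N \<inter> N' \<inter> M)" using N(2) N'(2) M(1) by (intro open_Int)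
        have "x \<in> M" using 3(1) V(2) M(2) by blast
        then show "x \<in> N \<inter> N' \<inter> M" using N(3) N'(3) by simp
        show "h ` ((S \<union> S') \<inter> (N \<inter> N' \<inter> M)) \<subseteq> W" using hV V(3) by blast
        show "K y = g (h y) + c" if "y \<in> (S \<union> S') \<inter> (N \<inter> N' \<inter> M)" for y
        proof (cases "y \<in> S")
          case True
          then show ?thesis using that N(5)[of y] K(1) by simp
        next
          case False
          then have "K y = g' (h y) + c'" using that N'(5)[of y] K(2) by auto
          then show ?thesis using V(4)[OF hV[of y]] that c by (simp add: algebra_simps)
        qed
      qed
    qed
  qed
  then show ?thesis by blast
qed

text \<open>Compactness by bisection, twice: the second coordinate is bisected to obtain a lift over
  a thin full-height strip around each \<open>s\<close>, then the first to cover the square.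
  Adjacent rectangles meet in a segment, so \<open>glue\<close> applies.\<close>

lemma lift_square:
  fixes h :: "real \<times> real \<Rightarrow> 'u"
  assumes h: "continuous_on ({0..1} \<times> {0..1}) h" "h ` ({0..1} \<times> {0..1}) \<subseteq> U"
  shows "\<exists>H. lift h ({0..1} \<times> {0..1}) H"
proof -
  let ?Q = "{0..1::real} \<times> {0..1::real}"
  have sub: "continuous_on S h \<and> h ` S \<subseteq> U" if "S \<subseteq> ?Q" for S
    using h that by (meson continuous_on_subset image_mono order_trans)
  have local: "\<exists>d>0. \<forall>S. S \<subseteq> ?Q \<inter> ball x d \<longrightarrow> (\<exists>H. lift h S H)" if x: "x \<in> ?Q" for x
  proof -
    have "h x \<in> U" using h(2) x by blast
    then obtain W g where W: "\<P> W g" "h x \<in> W" using prim_exists by blast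
    obtain N where N: "open N" "?Q \<inter> h -` W = ?Q \<inter> N" by (rule preimage_open[OF h prim_open[OF W(1)]])
    have "x \<in> N" using N(2) W(2) x by blast
    then obtain d where d: "d > 0" "ball x d \<subseteq> N" using N(1) openE by blast
    have "lift h S (\<lambda>x. g (h x))" if "S \<subseteq> ?Q \<inter> ball x d" for S
    proof (rule lift_primitive[OF W(1)])
      have "S \<subseteq> ?Q \<inter> N" using that d(2) by blast
      then show "h ` S \<subseteq> W" unfolding N(2)[symmetric] by blast
    qed
    then show ?thesis using d(1) by blast
  qed
  have glue: "\<exists>K. lift h (?Q \<inter> (A \<union> A')) K"
    if "closed A" "closed A'" "convex (A \<inter> A')" "lift h (?Q \<inter> A) H" "lift h (?Q \<inter> A') H'" for A A' H H'
  proof -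
    have eq: "?Q \<inter> (A \<union> A') = ?Q \<inter> A \<union> ?Q \<inter> A'" "?Q \<inter> A \<inter> (?Q \<inter> A') = ?Q \<inter> (A \<inter> A')" by blast+
    show ?thesis
      unfolding eq(1)
    proof (rule lift_glue[OF _ _ _ _ _ that(4,5)])
      show "connected (?Q \<inter> A \<inter> (?Q \<inter> A'))" unfolding eq(2)
        by (intro convex_connected convex_Int convex_Times that(3)) auto
    qed (use sub[of "?Q \<inter> A \<union> ?Q \<inter> A'"] that in \<open>auto intro: closed_Int closed_Times\<close>)
  qed
  have strip: "\<exists>d>0. \<exists>H. lift h (?Q \<inter> ({s-d..s+d} \<times> {0..1})) H" if s: "s \<in> {0..1}" for s
  proof (rule Bolzano[of 0 1 "\<lambda>a b. \<exists>d>0. \<exists>H. lift h (?Q \<inter> ({s-d..s+d} \<times> {a..b})) H"])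
    fix a b c :: real
    assume "\<exists>d>0. \<exists>H. lift h (?Q \<inter> ({s-d..s+d} \<times> {a..b})) H" "\<exists>d>0. \<exists>H. lift h (?Q \<inter> ({s-d..s+d} \<times> {b..c})) H"
      and abc: "a \<le> b" "b \<le> c"
    then obtain d H d' H' where d: "d > 0" "d' > 0" "lift h (?Q \<inter> ({s-d..s+d} \<times> {a..b})) H"
      "lift h (?Q \<inter> ({s-d'..s+d'} \<times> {b..c})) H'" by blast
    \<comment> \<open>The lifts over the two halves may live on strips of different width.\<close>
    define e where "e = min d d'"
    have r: "lift h (?Q \<inter> ({s-e..s+e} \<times> {a..b})) H" "lift h (?Q \<inter> ({s-e..s+e} \<times> {b..c})) H'"
      by (rule lift_subset[OF d(3)], force simp: e_def) (rule lift_subset[OF d(4)], force simp: e_def)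
    have "{s-e..s+e} \<times> {a..b} \<inter> {s-e..s+e} \<times> {b..c} = {s-e..s+e} \<times> {b}" using abc by auto
    then have "\<exists>K. lift h (?Q \<inter> ({s-e..s+e} \<times> {a..b} \<union> {s-e..s+e} \<times> {b..c})) K"
      by (intro glue[OF _ _ _ r]) (auto intro: closed_Times convex_Times)
    moreover have "{s-e..s+e} \<times> {a..b} \<union> {s-e..s+e} \<times> {b..c} = {s-e..s+e} \<times> {a..c}" using abc by auto
    ultimately show "\<exists>d>0. \<exists>H. lift h (?Q \<inter> ({s-d..s+d} \<times> {a..c})) H" using d(1,2) by (intro exI[of _ e]) (auto simp: e_def)
  next
    fix t :: real assume "0 \<le> t" "t \<le> 1"
    then obtain d where d: "d > 0" "\<And>S. S \<subseteq> ?Q \<inter> ball (s, t) d \<Longrightarrow> \<exists>H. lift h S H"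
      using local[of "(s, t)"] s by auto
    \<comment> \<open>Both coordinates deviate from (s, t) by at most d/4, so the sum of the
      deviations bounds the distance by less than d.\<close>
    have "\<exists>H. lift h (?Q \<inter> ({s-d/4..s+d/4} \<times> {a..b})) H" if "a \<le> t" "t \<le> b" "b - a < d/4" for a b
    proof (rule d(2), rule subsetI)
      fix x assume x: "x \<in> ?Q \<inter> ({s-d/4..s+d/4} \<times> {a..b})"
      have "dist (s, t) x \<le> \<bar>s - fst x\<bar> + \<bar>t - snd x\<bar>"
        by (cases x) (simp add: dist_Pair_Pair dist_real_def sqrt_sum_squares_le_sum_abs)
      also have "\<dots> < d" using x that d(1) by (cases x) (auto simp: abs_if)
      finally show "x \<in> ?Q \<inter> ball (s, t) d" using x by auto
    qed
    then show "\<exists>da>0. \<forall>a b. a \<le> t \<and> t \<le> b \<and> b - a < da \<longrightarrow> (\<exists>d>0. \<exists>H. lift h (?Q \<inter> ({s-d..s+d} \<times> {a..b})) H)"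
      using d(1) by (intro exI[of _ "d/4"]) (meson divide_pos_pos zero_less_numeral)
  qed simp
  have "\<exists>H. lift h (?Q \<inter> ({0..1} \<times> {0..1})) H"
  proof (rule Bolzano[of 0 1 "\<lambda>a b. \<exists>H. lift h (?Q \<inter> ({a..b} \<times> {0..1})) H"])
    fix a b c :: real
    assume "\<exists>H. lift h (?Q \<inter> ({a..b} \<times> {0..1})) H" "\<exists>H. lift h (?Q \<inter> ({b..c} \<times> {0..1})) H"
      and abc: "a \<le> b" "b \<le> c"
    then obtain H H' where r: "lift h (?Q \<inter> ({a..b} \<times> {0..1})) H" "lift h (?Q \<inter> ({b..c} \<times> {0..1})) H'" by blast
    have "{a..b} \<times> {0..1::real} \<inter> {b..c} \<times> {0..1} = {b} \<times> {0..1}" using abc by auto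
    then have "\<exists>K. lift h (?Q \<inter> ({a..b} \<times> {0..1} \<union> {b..c} \<times> {0..1})) K"
      by (intro glue[OF _ _ _ r]) (auto intro: closed_Times convex_Times)
    moreover have "{a..b} \<times> {0..1::real} \<union> {b..c} \<times> {0..1} = {a..c} \<times> {0..1}" using abc by auto
    ultimately show "\<exists>H. lift h (?Q \<inter> ({a..c} \<times> {0..1})) H" by simp
  next
    fix s :: real assume "0 \<le> s" "s \<le> 1"
    then obtain d H where d: "d > 0" "lift h (?Q \<inter> ({s-d..s+d} \<times> {0..1})) H" using strip[of s] by auto
    have "\<exists>H. lift h (?Q \<inter> ({a..b} \<times> {0..1})) H" if "a \<le> s" "s \<le> b" "b - a < d" for a b
      by (intro exI[of _ H] lift_subset[OF d(2)]) (use that in auto)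
    then show "\<exists>d>0. \<forall>a b. a \<le> s \<and> s \<le> b \<and> b - a < d \<longrightarrow> (\<exists>H. lift h (?Q \<inter> ({a..b} \<times> {0..1})) H)"
      using d(1) by blast
  qed simp
  then show ?thesis by simp
qed

text \<open>The path is viewed as a homotopy that is constant in the first variable, so the argument
  for the square covers it too.\<close>

lemma lift_path:
  fixes \<gamma> :: "real \<Rightarrow> 'u"
  assumes "path \<gamma>" "path_image \<gamma> \<subseteq> U" shows "\<exists>\<Gamma>. lift \<gamma> {0..1} \<Gamma>"
proof -
  have "continuous_on ({0..1::real} \<times> {0..1}) (\<lambda>x. \<gamma> (snd x))"
    using assms(1) unfolding path_def by (rule continuous_on_compose2) (auto intro: continuous_intros)
  moreover have "(\<lambda>x. \<gamma> (snd x)) ` ({0..1::real} \<times> {0..1}) \<subseteq> U" using assms(2) by (auto simp: path_image_def)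
  ultimately obtain H where "lift (\<lambda>x. \<gamma> (snd x)) ({0..1::real} \<times> {0..1}) H" using lift_square by blast
  then have "lift \<gamma> {0..1} (\<lambda>t. H (0, t))"
    by (rule lift_compose[where k = "\<lambda>t. (0, t)"]) (auto intro!: continuous_intros)
  then show ?thesis by blast
qed

lemma lift_path_unique:
  fixes \<gamma> :: "real \<Rightarrow> 'u"
  assumes "path \<gamma>" "path_image \<gamma> \<subseteq> U" "lift \<gamma> {0..1} \<Gamma>" "lift \<gamma> {0..1} \<Gamma>'"
  shows "\<Gamma> 1 - \<Gamma> 0 = \<Gamma>' 1 - \<Gamma>' 0"
  using lift_unique[of "{0..1}" \<gamma> \<Gamma> \<Gamma>' 0 1] assms by (auto simp: path_def path_image_def algebra_simps)

text \<open>Monodromy: the increment around the homotopy square cancels, since two opposite edges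
  map to the same path and the edge at time 1 is constant.\<close>

lemma lift_loop:
  fixes \<gamma> :: "real \<Rightarrow> 'u"
  assumes sc: "simply_connected U" and \<gamma>: "path \<gamma>" "path_image \<gamma> \<subseteq> U" "\<gamma> 0 = \<gamma> 1" and l: "lift \<gamma> {0..1} \<Gamma>"
  shows "\<Gamma> 0 = \<Gamma> 1"
proof -
  have "\<gamma> 0 \<in> U" using \<gamma>(2) by (auto simp: path_image_def)
  then have "homotopic_loops U \<gamma> (\<lambda>_. \<gamma> 0)"
    using sc[unfolded simply_connected_def, rule_format, of \<gamma> "\<lambda>_. \<gamma> 0"] \<gamma>
    by (auto simp: path_def pathfinish_def pathstart_def path_image_def)
  then obtain h :: "real \<times> real \<Rightarrow> 'u" where h: "continuous_on ({0..1} \<times> {0..1}) h" "h \<in> ({0..1} \<times> {0..1}) \<rightarrow> U"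
    "\<forall>x\<in>{0..1}. h (0, x) = \<gamma> x" "\<forall>x\<in>{0..1}. h (1, x) = \<gamma> 0"
    "\<forall>t\<in>{0..1}. pathfinish (h \<circ> Pair t) = pathstart (h \<circ> Pair t)"
    unfolding homotopic_loops by auto
  have hU: "h ` ({0..1} \<times> {0..1}) \<subseteq> U" using h(2) by blast
  obtain H where H: "lift h ({0..1} \<times> {0..1}) H" using lift_square[OF h(1) hU] by blast
  \<comment> \<open>The track of the base point. Every stage of the homotopy is a loop, so both
    edges \<open>h (t, 0)\<close> and \<open>h (t, 1)\<close> follow it.\<close>
  define \<sigma> where "\<sigma> t = h (t, 0)" for t
  have s1: "lift \<sigma> {0..1} (\<lambda>t. H (t, 0))"
    by (rule lift_compose[OF H]) (auto intro!: continuous_intros simp: \<sigma>_def)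
  have s2: "lift \<sigma> {0..1} (\<lambda>t. H (t, 1))"
    by (rule lift_compose[OF H]) (use h(5) in \<open>auto intro!: continuous_intros simp: \<sigma>_def pathfinish_def pathstart_def\<close>)
  have \<sigma>: "path \<sigma>" "path_image \<sigma> \<subseteq> U"
    unfolding path_def \<sigma>_def path_image_def
    using hU by (auto intro!: continuous_on_compose2[OF h(1)] continuous_intros)
  have g: "lift \<gamma> {0..1} (\<lambda>x. H (0, x))"
    by (rule lift_compose[OF H]) (use h(3) in \<open>auto intro!: continuous_intros\<close>)
  have k: "lift (\<lambda>_. \<gamma> 0) {0..1} (\<lambda>x. H (1, x))"
    by (rule lift_compose[OF H]) (use h(4) in \<open>auto intro!: continuous_intros\<close>)
  obtain W w where W: "\<P> W w" "\<gamma> 0 \<in> W" using prim_exists[OF \<open>\<gamma> 0 \<in> U\<close>] by blast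
  have k': "lift (\<lambda>_::real. \<gamma> 0) {0..1} (\<lambda>_. w (\<gamma> 0))"
    by (rule lift_primitive[OF W(1)]) (use W(2) in auto)
  have "H (1, 1) - H (1, 0) = w (\<gamma> 0) - w (\<gamma> 0)"
    by (rule lift_path_unique[OF _ _ k k']) (use \<open>\<gamma> 0 \<in> U\<close> in \<open>auto simp: path_def path_image_def\<close>)
  moreover have "H (1, 0) - H (0, 0) = H (1, 1) - H (0, 1)" by (rule lift_path_unique[OF \<sigma> s1 s2])
  moreover have "\<Gamma> 1 - \<Gamma> 0 = H (0, 1) - H (0, 0)" by (rule lift_path_unique[OF \<gamma>(1,2) l g])
  ultimately show ?thesis by (simp add: algebra_simps)
qed

lemma lift_join:
  fixes \<gamma> \<sigma> :: "real \<Rightarrow> 'u"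
  assumes "lift (\<gamma> +++ \<sigma>) {0..1} \<Lambda>" "pathfinish \<gamma> = pathstart \<sigma>"
  shows "lift \<gamma> {0..1} (\<lambda>t. \<Lambda> (t/2))" "lift \<sigma> {0..1} (\<lambda>t. \<Lambda> ((t+1)/2))"
proof -
  show "lift \<gamma> {0..1} (\<lambda>t. \<Lambda> (t/2))"
    by (rule lift_compose[OF assms(1)]) (auto simp: joinpaths_def intro!: continuous_intros)
  \<comment> \<open>At parameter 1/2 \<open>joinpaths\<close> takes the value of its first path, so
    the case t = 0 relies on matching endpoints.\<close>
  have "\<sigma> 0 = \<gamma> 1" using assms(2) by (simp add: pathfinish_def pathstart_def)
  then have "\<sigma> t = (\<gamma> +++ \<sigma>) ((t + 1) / 2)" if "t \<in> {0..1}" for t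
    using that by (cases "t = 0") (auto simp: joinpaths_def field_simps)
  then show "lift \<sigma> {0..1} (\<lambda>t. \<Lambda> ((t+1)/2))"
    by (intro lift_compose[OF assms(1)]) (auto intro!: continuous_intros)
qed

text \<open>The primitive at \<open>z\<close> is the increment of a lift along some path from a
  fixed point to \<open>z\<close>. Prolonging that path inside the domain of a local primitive shows
  that the two differ by a constant nearby.\<close>

theorem global_primitive:
  assumes sc: "simply_connected U"
    and pc: "\<And>y z. y \<in> U \<Longrightarrow> z \<in> U \<Longrightarrow> \<exists>\<gamma>. path \<gamma> \<and> path_image \<gamma> \<subseteq> U \<and> pathstart \<gamma> = y \<and> pathfinish \<gamma> = z"
    and lpc: "\<And>z W. openin (top_of_set U) W \<Longrightarrow> z \<in> W \<Longrightarrow> \<exists>V. openin (top_of_set U) V \<and> z \<in> V \<and> V \<subseteq> W \<and>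
      (\<forall>y\<in>V. \<exists>\<sigma>. path \<sigma> \<and> path_image \<sigma> \<subseteq> W \<and> pathstart \<sigma> = z \<and> pathfinish \<sigma> = y)"
  shows "\<exists>G. \<forall>z\<in>U. \<exists>W g V c. \<P> W g \<and> openin (top_of_set U) V \<and> z \<in> V \<and> V \<subseteq> W \<and> (\<forall>y\<in>V. G y = g y + c)"
proof (cases "U = {}")
  case False
  then obtain a where a: "a \<in> U" by blast
  have "\<forall>z\<in>U. \<exists>\<gamma> \<Gamma>. path \<gamma> \<and> path_image \<gamma> \<subseteq> U \<and> pathstart \<gamma> = a \<and> pathfinish \<gamma> = z \<and> lift \<gamma> {0..1} \<Gamma>"
    using pc[OF a] lift_path by blast
  then obtain \<gamma> where "\<forall>z\<in>U. \<exists>\<Gamma>. path (\<gamma> z) \<and> path_image (\<gamma> z) \<subseteq> U \<and> pathstart (\<gamma> z) = a \<and> pathfinish (\<gamma> z) = z \<and> lift (\<gamma> z) {0..1} \<Gamma>"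
    by (rule bchoice[THEN exE])
  then obtain \<Gamma> where \<gamma>: "\<And>z. z \<in> U \<Longrightarrow> path (\<gamma> z)" "\<And>z. z \<in> U \<Longrightarrow> path_image (\<gamma> z) \<subseteq> U"
    "\<And>z. z \<in> U \<Longrightarrow> pathstart (\<gamma> z) = a" "\<And>z. z \<in> U \<Longrightarrow> pathfinish (\<gamma> z) = z"
    "\<And>z. z \<in> U \<Longrightarrow> lift (\<gamma> z) {0..1} (\<Gamma> z)"
    by (rule bchoice[THEN exE]) blast
  define G where "G z = \<Gamma> z 1 - \<Gamma> z 0" for z
  \<comment> \<open>Independence of the path: following one path and returning along the other is a
    loop, whose increment is 0.\<close>
  have G: "\<Delta> 1 - \<Delta> 0 = G z"
    if \<delta>: "path \<delta>" "path_image \<delta> \<subseteq> U" "pathstart \<delta> = a" "pathfinish \<delta> = z" "lift \<delta> {0..1} \<Delta>" for \<delta> \<Delta> z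
  proof -
    have z: "z \<in> U" using \<delta>(2,4) pathfinish_in_path_image by blast
    let ?\<rho> = "reversepath (\<gamma> z)"
    have \<rho>: "path ?\<rho>" "path_image ?\<rho> \<subseteq> U" "pathstart ?\<rho> = z" "pathfinish ?\<rho> = a" using \<gamma>[OF z] by auto
    have j: "path (\<delta> +++ ?\<rho>)" "path_image (\<delta> +++ ?\<rho>) \<subseteq> U" using \<delta> \<rho> by (auto simp: path_image_join)
    obtain \<Lambda> where \<Lambda>: "lift (\<delta> +++ ?\<rho>) {0..1} \<Lambda>" using lift_path[OF j] by blast
    have "(\<delta> +++ ?\<rho>) 0 = (\<delta> +++ ?\<rho>) 1"
      using \<delta>(3) \<rho>(4) by (metis pathfinish_def pathfinish_join pathstart_def pathstart_join)
    then have 0: "\<Lambda> 0 = \<Lambda> 1" by (rule lift_loop[OF sc j _ \<Lambda>])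
    note lj = lift_join[OF \<Lambda>, unfolded \<delta>(4) \<rho>(3), OF refl]
    have 1: "\<Delta> 1 - \<Delta> 0 = \<Lambda> (1/2) - \<Lambda> (0/2)" by (rule lift_path_unique[OF \<delta>(1,2,5) lj(1)])
    have "lift (\<gamma> z) {0..1} (\<lambda>t. \<Lambda> (((1-t)+1)/2))"
      by (rule lift_compose[OF lj(2)]) (auto simp: reversepath_def intro!: continuous_intros)
    from lift_path_unique[OF \<gamma>(1,2,5)[OF z] this] 0 1 show ?thesis by (simp add: G_def)
  qed
  show ?thesis
  proof (intro exI[of _ G] ballI)
    fix z assume z: "z \<in> U"
    obtain W g where W: "\<P> W g" "z \<in> W" using prim_exists[OF z] by blast
    obtain V where V: "openin (top_of_set U) V" "z \<in> V" "V \<subseteq> W"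
      "\<And>y. y \<in> V \<Longrightarrow> \<exists>\<sigma>. path \<sigma> \<and> path_image \<sigma> \<subseteq> W \<and> pathstart \<sigma> = z \<and> pathfinish \<sigma> = y"
      using lpc[OF prim_open[OF W(1)] W(2)] by blast
    have WU: "W \<subseteq> U" using prim_open[OF W(1)] openin_imp_subset by blast
    have "G y = g y + (G z - g z)" if y: "y \<in> V" for y
    proof -
      obtain \<sigma> where \<sigma>: "path \<sigma>" "path_image \<sigma> \<subseteq> W" "pathstart \<sigma> = z" "pathfinish \<sigma> = y" using V(4)[OF y] by blast
      have j: "path (\<gamma> z +++ \<sigma>)" "path_image (\<gamma> z +++ \<sigma>) \<subseteq> U" "pathstart (\<gamma> z +++ \<sigma>) = a" "pathfinish (\<gamma> z +++ \<sigma>) = y"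
        using \<gamma>[OF z] \<sigma> WU by (auto simp: path_image_join)
      obtain \<Lambda> where \<Lambda>: "lift (\<gamma> z +++ \<sigma>) {0..1} \<Lambda>" using lift_path[OF j(1,2)] by blast
      note lj = lift_join[OF \<Lambda>, unfolded \<gamma>(4)[OF z] \<sigma>(3), OF refl]
      have "\<Lambda> 1 - \<Lambda> 0 = G y" by (rule G[OF j \<Lambda>])
      moreover have "\<Lambda> (1/2) - \<Lambda> (0/2) = G z" by (rule G[OF \<gamma>(1-4)[OF z] lj(1)])
      moreover have "lift \<sigma> {0..1} (\<lambda>t. g (\<sigma> t))"
        by (rule lift_primitive[OF W(1)]) (use \<sigma>(2) in \<open>auto simp: path_image_def\<close>)
      from lift_path_unique[OF \<sigma>(1) _ lj(2) this]
      have "\<Lambda> 1 - \<Lambda> (1/2) = g y - g z"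
        using \<sigma> WU by (auto simp: pathstart_def pathfinish_def)
      ultimately show ?thesis by (simp add: algebra_simps)
    qed
    then show "\<exists>W g V c. \<P> W g \<and> openin (top_of_set U) V \<and> z \<in> V \<and> V \<subseteq> W \<and> (\<forall>y\<in>V. G y = g y + c)"
      using W V by blast
  qed
qed auto

end

section \<open>Integration on the universal cover\<close>

lemma regular_diffs_scale:
  assumes "\<omega> \<in> regular_diffs C" "v \<in> tangent_space C x" shows "\<omega> x (c *s v) = c * \<omega> x v"
  using assms tangent_space_scale[OF assms(2), of c] by (auto simp: regular_diffs_def sum_distrib_left mult_ac)

lemma has_vector_derivative_vec_nth:
  fixes f :: "real \<Rightarrow> complex ^ 'n"
  assumes "(f has_vector_derivative v) F" shows "((\<lambda>t. f t $ i) has_vector_derivative v $ i) F"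
  using bounded_linear.has_vector_derivative[OF bounded_linear_vec_nth assms] .

lemma has_vector_derivative_vec:
  fixes f :: "real \<Rightarrow> complex ^ 'n"
  assumes "\<And>i. ((\<lambda>t. f t $ i) has_vector_derivative v $ i) (at t)"
  shows "(f has_vector_derivative v) (at t)"
proof -
  have "((\<lambda>t. \<chi> i. f t $ i) has_derivative (\<lambda>h. \<chi> i. h *\<^sub>R v $ i)) (at t)"
    by (rule has_derivative_vec_lambda) (use assms in \<open>simp add: has_vector_derivative_def\<close>)
  moreover have "(\<lambda>h. \<chi> i. h *\<^sub>R v $ i) = (\<lambda>h. h *\<^sub>R v)" by (simp add: fun_eq_iff vec_eq_iff)
  ultimately show ?thesis by (simp add: has_vector_derivative_def)
qed

section \<open>Smooth paths and primitives on the cover\<close>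

context curve_cover
begin

lemma local_param_path:
  assumes lp: "local_param U p D \<phi>" and st: "closed_segment s t \<subseteq> D"
  shows "path (\<phi> \<circ> linepath s t)" "path_image (\<phi> \<circ> linepath s t) \<subseteq> \<phi> ` D"
    "pathstart (\<phi> \<circ> linepath s t) = \<phi> s" "pathfinish (\<phi> \<circ> linepath s t) = \<phi> t"
    "valid_path (p \<circ> (\<phi> \<circ> linepath s t))"
proof -
  have im: "linepath s t x \<in> D" if "x \<in> {0..1}" for x using st that linepath_in_path by blast
  show "path (\<phi> \<circ> linepath s t)"
    unfolding path_def using im local_paramD(3)[OF lp]
    by (intro continuous_on_compose) (auto intro: continuous_on_subset continuous_on_linepath)
  show "path_image (\<phi> \<circ> linepath s t) \<subseteq> \<phi> ` D" using im by (auto simp: path_image_def)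
  show "pathstart (\<phi> \<circ> linepath s t) = \<phi> s" "pathfinish (\<phi> \<circ> linepath s t) = \<phi> t"
    by (simp_all add: pathstart_def pathfinish_def linepath_def)
  have "(p \<circ> (\<phi> \<circ> linepath s t)) C1_differentiable_on {0..1}"
    unfolding C1_differentiable_on_def
  proof (intro exI[of _ "\<lambda>x. (t - s) *s velocity p \<phi> (linepath s t x)"] conjI ballI)
    fix x :: real assume x: "x \<in> {0..1}"
    show "(p \<circ> (\<phi> \<circ> linepath s t) has_vector_derivative (t - s) *s velocity p \<phi> (linepath s t x)) (at x)"
    proof (rule has_vector_derivative_vec)
      fix i
      have "(((\<lambda>u. p (\<phi> u) $ i) \<circ> linepath s t) has_vector_derivative
          (t - s) * velocity p \<phi> (linepath s t x) $ i) (at x)"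
        by (rule field_vector_diff_chain_at[OF has_vector_derivative_linepath_within local_param_derivative[OF lp im[OF x]]])
      then show "((\<lambda>x. (p \<circ> (\<phi> \<circ> linepath s t)) x $ i) has_vector_derivative
          ((t - s) *s velocity p \<phi> (linepath s t x)) $ i) (at x)"
        by (simp only: o_def vector_smult_component)
    qed
  next
    have "continuous_on D (\<lambda>u. velocity p \<phi> u $ i)" for i
      unfolding velocity_def
      using holomorphic_on_imp_continuous_on[OF holomorphic_deriv[OF local_paramD(4)[OF lp] local_paramD(1)[OF lp]]] by simp
    from continuous_on_mult_left[OF continuous_on_compose2[OF this continuous_on_linepath[of "{0..1}" s t]]]
    have "continuous_on {0..1} (\<lambda>x. (t - s) * velocity p \<phi> (linepath s t x) $ i)" for i
      using im by blast
    then have "continuous_on {0..1} (\<lambda>x. \<chi> i. (t - s) * velocity p \<phi> (linepath s t x) $ i)"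
      by (rule continuous_on_vec_lambda)
    moreover have "(\<lambda>x. \<chi> i. (t - s) * velocity p \<phi> (linepath s t x) $ i) = (\<lambda>x. (t - s) *s velocity p \<phi> (linepath s t x))"
      by (simp only: fun_eq_iff vec_eq_iff vec_lambda_beta vector_smult_component simp_thms)
    ultimately show "continuous_on {0..1} (\<lambda>x. (t - s) *s velocity p \<phi> (linepath s t x))" by (simp only:)
  qed
  then show "valid_path (p \<circ> (\<phi> \<circ> linepath s t))"
    unfolding valid_path_def by (rule C1_differentiable_imp_piecewise)
qed

lemma ball_chart_path:
  assumes "std_chart i (ball c r) \<phi>" "x \<in> \<phi> ` ball c r" "y \<in> \<phi> ` ball c r"
  obtains \<sigma> where "path \<sigma>" "path_image \<sigma> \<subseteq> \<phi> ` ball c r" "pathstart \<sigma> = x" "pathfinish \<sigma> = y" "valid_path (p \<circ> \<sigma>)"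
proof -
  obtain s t where st: "s \<in> ball c r" "t \<in> ball c r" "x = \<phi> s" "y = \<phi> t" using assms(2,3) by blast
  have "closed_segment s t \<subseteq> ball c r" using st convex_ball by (simp add: closed_segment_subset)
  moreover have "local_param U p (ball c r) \<phi>" using assms(1) by (simp add: std_chart_def)
  ultimately show thesis
    using local_param_path[of "ball c r" \<phi> s t] st(3,4) that[of "\<phi> \<circ> linepath s t"] by simp
qed

text \<open>\<open>cover_integral\<close> quantifies over paths with
  \<open>valid_path (p \<circ> \<gamma>)\<close>, so such paths must exist. Being joined by one is
  an equivalence relation with open classes, because discs in charts contain segments.\<close>

lemma smooth_path_exists:
  assumes "a \<in> U" "b \<in> U"
  shows "\<exists>\<gamma>. path \<gamma> \<and> path_image \<gamma> \<subseteq> U \<and> pathstart \<gamma> = a \<and> pathfinish \<gamma> = b \<and> valid_path (p \<circ> \<gamma>)"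
proof (rule connected_equivalence_relation[OF connected_U assms, of
      "\<lambda>a b. \<exists>\<gamma>. path \<gamma> \<and> path_image \<gamma> \<subseteq> U \<and> pathstart \<gamma> = a \<and> pathfinish \<gamma> = b \<and> valid_path (p \<circ> \<gamma>)"])
  fix x y assume "\<exists>\<gamma>. path \<gamma> \<and> path_image \<gamma> \<subseteq> U \<and> pathstart \<gamma> = x \<and> pathfinish \<gamma> = y \<and> valid_path (p \<circ> \<gamma>)"
  then obtain \<gamma> where "path \<gamma>" "path_image \<gamma> \<subseteq> U" "pathstart \<gamma> = x" "pathfinish \<gamma> = y" "valid_path (p \<circ> \<gamma>)"
    by (elim exE conjE)
  then show "\<exists>\<gamma>. path \<gamma> \<and> path_image \<gamma> \<subseteq> U \<and> pathstart \<gamma> = y \<and> pathfinish \<gamma> = x \<and> valid_path (p \<circ> \<gamma>)"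
    by (intro exI[of _ "reversepath \<gamma>"]) (auto simp: path_compose_reversepath intro: valid_path_imp_reverse)
next
  fix x y z assume "\<exists>\<gamma>. path \<gamma> \<and> path_image \<gamma> \<subseteq> U \<and> pathstart \<gamma> = x \<and> pathfinish \<gamma> = y \<and> valid_path (p \<circ> \<gamma>)"
    "\<exists>\<gamma>. path \<gamma> \<and> path_image \<gamma> \<subseteq> U \<and> pathstart \<gamma> = y \<and> pathfinish \<gamma> = z \<and> valid_path (p \<circ> \<gamma>)"
  then obtain \<gamma> \<sigma> where "path \<gamma>" "path_image \<gamma> \<subseteq> U" "pathstart \<gamma> = x" "pathfinish \<gamma> = y" "valid_path (p \<circ> \<gamma>)"
    "path \<sigma>" "path_image \<sigma> \<subseteq> U" "pathstart \<sigma> = y" "pathfinish \<sigma> = z" "valid_path (p \<circ> \<sigma>)"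
    by (elim exE conjE)
  then show "\<exists>\<gamma>. path \<gamma> \<and> path_image \<gamma> \<subseteq> U \<and> pathstart \<gamma> = x \<and> pathfinish \<gamma> = z \<and> valid_path (p \<circ> \<gamma>)"
    by (intro exI[of _ "\<gamma> +++ \<sigma>"])
       (auto simp: path_compose_join path_image_join pathstart_compose pathfinish_compose intro: valid_path_join)
next
  fix z assume z: "z \<in> U"
  obtain i r \<phi> where \<phi>: "r > 0" "std_chart i (ball (p z $ i) r) \<phi>" "\<phi> (p z $ i) = z"
    by (rule std_chart_exists'[OF z]) (rule that; assumption)
  let ?W = "\<phi> ` ball (p z $ i) r"
  have zW: "z \<in> ?W" using \<phi>(1,3) by (metis centre_in_ball imageI)
  have op: "openin (top_of_set U) ?W" using \<phi>(2) local_paramD(2) by (auto simp: std_chart_def)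
  have "\<exists>\<gamma>. path \<gamma> \<and> path_image \<gamma> \<subseteq> U \<and> pathstart \<gamma> = z \<and> pathfinish \<gamma> = y \<and> valid_path (p \<circ> \<gamma>)" if y: "y \<in> ?W" for y
  proof -
    obtain \<sigma> where "path \<sigma>" "path_image \<sigma> \<subseteq> ?W" "pathstart \<sigma> = z" "pathfinish \<sigma> = y" "valid_path (p \<circ> \<sigma>)"
      by (rule ball_chart_path[OF \<phi>(2) zW y]) (rule that; assumption)
    then show ?thesis using openin_imp_subset[OF op] by blast
  qed
  then show "\<exists>T. openin (top_of_set U) T \<and> z \<in> T \<and> (\<forall>y\<in>T. \<exists>\<gamma>. path \<gamma> \<and> path_image \<gamma> \<subseteq> U \<and> pathstart \<gamma> = z \<and> pathfinish \<gamma> = y \<and> valid_path (p \<circ> \<gamma>))"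
    using op zW by blast
qed

text \<open>A holomorphic form on a disc has a primitive and two primitives differ by a constant on
  discs, which is all that \<open>primitive_system\<close> asks for.\<close>

theorem primitive_exists:
  assumes f: "f \<in> hol_funs U p" and \<omega>: "\<omega> \<in> regular_diffs C"
  obtains F where "dform F (\<lambda>z v. f z * \<omega> (p z) v)"
proof -
  let ?\<beta> = "\<lambda>z v. f z * \<omega> (p z) v"
  \<comment> \<open>The derivative is prescribed in every chart, so that two primitives can be
    compared in whatever disc chart lies in both domains.\<close>
  define \<P> where "\<P> W g \<longleftrightarrow> openin (top_of_set U) W \<and> (\<forall>D \<phi> t. local_param U p D \<phi> \<and> t \<in> D \<and> \<phi> t \<in> W \<longrightarrow>
     ((\<lambda>s. g (\<phi> s)) has_field_derivative ?\<beta> (\<phi> t) (velocity p \<phi> t)) (at t))" for W g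
  have \<P>D: "((\<lambda>s. g (\<phi> s)) has_field_derivative ?\<beta> (\<phi> t) (velocity p \<phi> t)) (at t)"
    if "\<P> W g" "local_param U p D \<phi>" "t \<in> D" "\<phi> t \<in> W" for W g D \<phi> t
    using that by (auto simp: \<P>_def)
  have hom: "?\<beta> z (c *s v) = c * ?\<beta> z v" if "v \<in> tangent_space C (p z)" for z v c
    using regular_diffs_scale[OF \<omega> that] by simp
  interpret primitive_system U \<P>
  proof
    show "openin (top_of_set U) W" if "\<P> W g" for W g using that by (simp add: \<P>_def)
  next
    fix z assume z: "z \<in> U"
    obtain i r \<phi> where \<phi>: "r > 0" "std_chart i (ball (p z $ i) r) \<phi>" "\<phi> (p z $ i) = z"
      by (rule std_chart_exists'[OF z]) (rule that; assumption)
    let ?B = "ball (p z $ i) r"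
    have lp: "local_param U p ?B \<phi>" and pi: "\<And>t. t \<in> ?B \<Longrightarrow> p (\<phi> t) $ i = t" using \<phi>(2) by (auto simp: std_chart_def)
    obtain P where P: "\<And>i. P i \<in> poly_funs"
      "\<omega> = (\<lambda>x v. if x \<in> C \<and> v \<in> tangent_space C x then \<Sum>i\<in>UNIV. P i x * v $ i else 0)"
      using \<omega> unfolding regular_diffs_def by blast
    have "(\<lambda>t. f (\<phi> t)) holomorphic_on ?B" using f lp by (simp add: hol_funs_def)
    moreover have "(\<lambda>t. P j (p (\<phi> t))) holomorphic_on ?B" for j
      by (rule poly_funs_holomorphic[OF P(1) local_paramD(4)[OF lp]])
    moreover have "(\<lambda>t. velocity p \<phi> t $ j) holomorphic_on ?B" for j
      unfolding velocity_def using holomorphic_deriv[OF local_paramD(4)[OF lp] open_ball] by simp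
    ultimately have "(\<lambda>t. f (\<phi> t) * (\<Sum>j\<in>UNIV. P j (p (\<phi> t)) * velocity p \<phi> t $ j)) holomorphic_on ?B"
      by (intro holomorphic_on_mult holomorphic_on_sum)
    then obtain F where F: "\<And>t. t \<in> ?B \<Longrightarrow>
        (F has_field_derivative f (\<phi> t) * (\<Sum>j\<in>UNIV. P j (p (\<phi> t)) * velocity p \<phi> t $ j)) (at t within ?B)"
      by (rule holomorphic_convex_primitive'[OF convex_ball open_ball]) blast
    \<comment> \<open>The primitive \<open>F\<close> in the parameter becomes a function on
      \<open>U\<close> by inserting the coordinate that inverts the standard chart.\<close>
    have "\<P> (\<phi> ` ?B) (\<lambda>z. F (p z $ i))"
      unfolding \<P>_def
    proof (intro conjI allI impI)
      show "openin (top_of_set U) (\<phi> ` ?B)" by (rule local_paramD(2)[OF lp])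
      fix D \<psi> t assume "local_param U p D \<psi> \<and> t \<in> D \<and> \<psi> t \<in> \<phi> ` ?B"
      then have \<psi>: "local_param U p D \<psi>" "t \<in> D" "\<psi> t \<in> \<phi> ` ?B" by auto
      then obtain s where s: "s \<in> ?B" "\<psi> t = \<phi> s" by blast
      have "(F has_field_derivative ?\<beta> (\<phi> s) (velocity p \<phi> s)) (at s)"
        using F[OF s(1)] p_in_C[OF local_paramD(6)[OF lp s(1)]] velocity_tangent[OF lp s(1)]
        by (simp add: P(2) at_within_open[OF s(1) open_ball])
      then have "((\<lambda>s. F (p (\<phi> s) $ i)) has_field_derivative ?\<beta> (\<phi> s) (velocity p \<phi> s)) (at s)"
        by (rule has_field_derivative_transform_within_open[OF _ open_ball s(1)]) (simp add: pi)
      then show "((\<lambda>s. F (p (\<psi> s) $ i)) has_field_derivative ?\<beta> (\<psi> t) (velocity p \<psi> t)) (at t)"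
        unfolding s(2)
        by (rule derivative_change_chart[where \<beta> = "?\<beta> (\<phi> s)", OF \<phi>(2) s(1) _ _ \<psi>(1,2) s(2)]) (rule hom)
    qed
    moreover have "z \<in> \<phi> ` ?B" using \<phi>(1,3) by (metis centre_in_ball imageI)
    ultimately show "\<exists>W g. \<P> W g \<and> z \<in> W" by blast
  next
    fix W g W' g' z assume W: "\<P> W g" "\<P> W' g'" "z \<in> W" "z \<in> W'"
    have op: "openin (top_of_set U) (W \<inter> W')" using W(1,2) by (auto simp: \<P>_def)
    have zU: "z \<in> U" using W(1,3) openin_imp_subset by (auto simp: \<P>_def)
    obtain i r \<phi> where \<phi>: "r > 0" "std_chart i (ball (p z $ i) r) \<phi>" "\<phi> (p z $ i) = z" "\<phi> ` ball (p z $ i) r \<subseteq> W \<inter> W'"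
      by (rule std_chart_exists[OF zU op IntI[OF W(3,4)]]) (rule that; assumption)
    let ?B = "ball (p z $ i) r"
    have lp: "local_param U p ?B \<phi>" using \<phi>(2) by (simp add: std_chart_def)
    have "((\<lambda>t. g (\<phi> t) - g' (\<phi> t)) has_field_derivative 0) (at t within ?B)" if t: "t \<in> ?B" for t
    proof -
      have "\<phi> t \<in> W" "\<phi> t \<in> W'" using \<phi>(4) t by auto
      then show ?thesis
        using DERIV_diff[OF \<P>D[OF W(1) lp t] \<P>D[OF W(2) lp t]] by (simp add: has_field_derivative_at_within)
    qed
    from has_field_derivative_zero_constant[OF convex_ball this]
    obtain c where c: "\<forall>t\<in>?B. g (\<phi> t) - g' (\<phi> t) = c" by blast
    show "\<exists>V c. openin (top_of_set U) V \<and> z \<in> V \<and> V \<subseteq> W \<inter> W' \<and> (\<forall>y\<in>V. g y = g' y + c)"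
    proof (intro exI[of _ "\<phi> ` ?B"] exI[of _ c] conjI ballI)
      show "openin (top_of_set U) (\<phi> ` ?B)" by (rule local_paramD(2)[OF lp])
      show "z \<in> \<phi> ` ?B" using \<phi>(1,3) by (metis centre_in_ball imageI)
      show "g y = g' y + c" if "y \<in> \<phi> ` ?B" for y using that c by (auto simp: algebra_simps)
    qed (rule \<phi>(4))
  qed
  have "\<exists>G. \<forall>z\<in>U. \<exists>W g V c. \<P> W g \<and> openin (top_of_set U) V \<and> z \<in> V \<and> V \<subseteq> W \<and> (\<forall>y\<in>V. G y = g y + c)"
  proof (rule global_primitive[OF simply_connected_U])
    fix y z assume "y \<in> U" "z \<in> U"
    then show "\<exists>\<gamma>. path \<gamma> \<and> path_image \<gamma> \<subseteq> U \<and> pathstart \<gamma> = y \<and> pathfinish \<gamma> = z" using smooth_path_exists by metis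
  next
    fix z W assume W: "openin (top_of_set U) W" "z \<in> W"
    have zU: "z \<in> U" using W openin_imp_subset by blast
    obtain i r \<phi> where \<phi>: "r > 0" "std_chart i (ball (p z $ i) r) \<phi>" "\<phi> (p z $ i) = z" "\<phi> ` ball (p z $ i) r \<subseteq> W"
      by (rule std_chart_exists[OF zU W]) (rule that; assumption)
    let ?V = "\<phi> ` ball (p z $ i) r"
    have zV: "z \<in> ?V" using \<phi>(1,3) by (metis centre_in_ball imageI)
    have op: "openin (top_of_set U) ?V" using \<phi>(2) local_paramD(2) by (auto simp: std_chart_def)
    have "\<exists>\<sigma>. path \<sigma> \<and> path_image \<sigma> \<subseteq> W \<and> pathstart \<sigma> = z \<and> pathfinish \<sigma> = y" if y: "y \<in> ?V" for y
    proof -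
      obtain \<sigma> where "path \<sigma>" "path_image \<sigma> \<subseteq> ?V" "pathstart \<sigma> = z" "pathfinish \<sigma> = y" "valid_path (p \<circ> \<sigma>)"
        by (rule ball_chart_path[OF \<phi>(2) zV y]) (rule that; assumption)
      then show ?thesis using \<phi>(4) by blast
    qed
    then show "\<exists>V. openin (top_of_set U) V \<and> z \<in> V \<and> V \<subseteq> W \<and>
      (\<forall>y\<in>V. \<exists>\<sigma>. path \<sigma> \<and> path_image \<sigma> \<subseteq> W \<and> pathstart \<sigma> = z \<and> pathfinish \<sigma> = y)"
      using op zV \<phi>(4) by blast
  qed
  then obtain G where G: "\<And>z. z \<in> U \<Longrightarrow> \<exists>W g V c. \<P> W g \<and> openin (top_of_set U) V \<and> z \<in> V \<and> V \<subseteq> W \<and> (\<forall>y\<in>V. G y = g y + c)"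
    by blast
  have "dform G ?\<beta>"
    unfolding dform_def
  proof (intro allI impI, elim conjE)
    fix D \<phi> t assume \<phi>: "local_param U p D \<phi>" "t \<in> D"
    obtain W g V c where W: "\<P> W g" "openin (top_of_set U) V" "\<phi> t \<in> V" "V \<subseteq> W" "\<forall>y\<in>V. G y = g y + c"
      using G[OF local_paramD(6)[OF \<phi>]] by (elim exE conjE)
    have "openin (top_of_set D) (D \<inter> \<phi> -` V)"
      using local_paramD[OF \<phi>(1)] W(2) by (intro continuous_openin_preimage) auto
    then have op: "open (D \<inter> \<phi> -` V)" using local_paramD(1)[OF \<phi>(1)] by (metis openin_open_eq)
    have "\<phi> t \<in> W" using W(3,4) by blast
    then have "((\<lambda>s. g (\<phi> s) + c) has_field_derivative ?\<beta> (\<phi> t) (velocity p \<phi> t) + 0) (at t)"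
      by (intro DERIV_add \<P>D[OF W(1) \<phi>] DERIV_const)
    then have "((\<lambda>s. g (\<phi> s) + c) has_field_derivative ?\<beta> (\<phi> t) (velocity p \<phi> t)) (at t)" by simp
    then show "((\<lambda>s. G (\<phi> s)) has_field_derivative ?\<beta> (\<phi> t) (velocity p \<phi> t)) (at t)"
      by (rule has_field_derivative_transform_within_open[OF _ op]) (use \<phi>(2) W(3,5) in auto)
  qed
  then show thesis by (rule that)
qed

text \<open>The fundamental theorem of calculus for \<open>F\<close> along \<gamma>. The path itself
  is only continuous in \<open>U\<close>, but near each time it is a standard chart applied to a
  coordinate of \<open>p \<circ> \<gamma>\<close>, which is differentiable off a finite set.\<close>

lemma integral_along_path:
  assumes F: "dform F (\<lambda>z v. f z * \<omega> (p z) v)" and \<omega>: "\<omega> \<in> regular_diffs C"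
    and \<gamma>: "path \<gamma>" "path_image \<gamma> \<subseteq> U" "valid_path (p \<circ> \<gamma>)"
  shows "((\<lambda>t. f (\<gamma> t) * \<omega> (p (\<gamma> t)) (vector_derivative (p \<circ> \<gamma>) (at t within {0..1})))
        has_integral (F (\<gamma> 1) - F (\<gamma> 0))) {0..1}"
proof -
  obtain S where S: "finite S" "(p \<circ> \<gamma>) C1_differentiable_on ({0..1} - S)"
    using \<gamma>(3) by (auto simp: valid_path_def piecewise_C1_differentiable_on_def)
  obtain V where V: "\<And>t. t \<in> {0..1} - S \<Longrightarrow> (p \<circ> \<gamma> has_vector_derivative V t) (at t)"
    using S(2) unfolding C1_differentiable_on_def by blast
  have \<gamma>U: "\<gamma> t \<in> U" if "t \<in> {0..1}" for t using \<gamma>(2) that by (auto simp: path_image_def)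
  have c\<gamma>: "continuous_on {0..1} \<gamma>" using \<gamma>(1) by (simp add: path_def)
  have nbhd: "\<exists>i r \<phi> N. std_chart i (ball (p (\<gamma> t) $ i) r) \<phi> \<and> r > 0 \<and> \<phi> (p (\<gamma> t) $ i) = \<gamma> t \<and> open N \<and> t \<in> N \<and>
      (\<forall>s\<in>{0..1} \<inter> N. p (\<gamma> s) $ i \<in> ball (p (\<gamma> t) $ i) r \<and> \<phi> (p (\<gamma> s) $ i) = \<gamma> s)" if t: "t \<in> {0..1}" for t
  proof -
    obtain i r \<phi> where \<phi>: "r > 0" "std_chart i (ball (p (\<gamma> t) $ i) r) \<phi>" "\<phi> (p (\<gamma> t) $ i) = \<gamma> t"
      by (rule std_chart_exists'[OF \<gamma>U[OF t]]) (rule that; assumption)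
    let ?B = "ball (p (\<gamma> t) $ i) r"
    have pi: "\<And>t. t \<in> ?B \<Longrightarrow> p (\<phi> t) $ i = t" and op: "openin (top_of_set U) (\<phi> ` ?B)"
      using \<phi>(2) local_paramD(2) by (auto simp: std_chart_def)
    have "openin (top_of_set {0..1}) ({0..1} \<inter> \<gamma> -` (\<phi> ` ?B))"
      using \<gamma>U by (intro continuous_openin_preimage[OF c\<gamma> _ op]) auto
    then obtain N where N: "open N" "{0..1} \<inter> \<gamma> -` (\<phi> ` ?B) = {0..1} \<inter> N" by (auto simp: openin_open)
    have "\<gamma> t \<in> \<phi> ` ?B" using \<phi>(1,3) by (metis centre_in_ball imageI)
    then have "t \<in> N" using t N(2) by blast
    moreover have "p (\<gamma> s) $ i \<in> ?B \<and> \<phi> (p (\<gamma> s) $ i) = \<gamma> s" if "s \<in> {0..1} \<inter> N" for s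
    proof -
      have "\<gamma> s \<in> \<phi> ` ?B" using that N(2) by blast
      then show ?thesis using pi by auto
    qed
    ultimately show ?thesis using \<phi> N(1) by blast
  qed
  show ?thesis
  proof (rule fundamental_theorem_of_calculus_interior_strong[OF S(1), of 0 1 "\<lambda>t. F (\<gamma> t)"])
    fix t :: real assume t: "t \<in> {0<..<1} - S"
    then have t': "t \<in> {0..1}" "t \<in> {0..1} - S" by auto
    obtain i r \<phi> N where N: "std_chart i (ball (p (\<gamma> t) $ i) r) \<phi>" "r > 0" "\<phi> (p (\<gamma> t) $ i) = \<gamma> t" "open N" "t \<in> N"
      "\<forall>s\<in>{0..1} \<inter> N. p (\<gamma> s) $ i \<in> ball (p (\<gamma> t) $ i) r \<and> \<phi> (p (\<gamma> s) $ i) = \<gamma> s"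
      using nbhd[OF t'(1)] by (elim exE conjE)
    define s0 where "s0 = p (\<gamma> t) $ i"
    have lp: "local_param U p (ball s0 r) \<phi>" "s0 \<in> ball s0 r" using N(1,2) by (auto simp: std_chart_def s0_def)
    have \<phi>s0: "\<phi> s0 = \<gamma> t" using N(3) by (simp add: s0_def)
    let ?N = "{0<..<1} \<inter> N"
    have oN: "open ?N" "t \<in> ?N" using N(4,5) t by auto
    have pd: "((\<lambda>s. p (\<gamma> s) $ j) has_vector_derivative V t $ j) (at t)" for j
      using has_vector_derivative_vec_nth[OF V[OF t'(2)], of j] by (simp add: o_def)
    have chain: "((\<lambda>s. g (\<gamma> s)) has_vector_derivative V t $ i * d) (at t)"
      if g: "((\<lambda>s. g (\<phi> s)) has_field_derivative d) (at s0)" for g :: "'u \<Rightarrow> complex" and d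
    proof -
      have "(((\<lambda>s. g (\<phi> s)) \<circ> (\<lambda>s. p (\<gamma> s) $ i)) has_vector_derivative V t $ i * d) (at t)"
        by (rule field_vector_diff_chain_at[OF pd]) (use g in \<open>simp add: s0_def\<close>)
      then show ?thesis
        by (rule has_vector_derivative_transform_within_open[OF _ oN]) (use N(6) in auto)
    qed
    \<comment> \<open>The chain rule for coordinate \<open>j\<close> of \<open>p\<close> itself: the
      velocity of the path is a multiple of the velocity of the chart.\<close>
    have "V t $ j = V t $ i * velocity p \<phi> s0 $ j" for j
      using vector_derivative_unique_at[OF pd chain[OF local_param_derivative[OF lp]]] .
    then have "V t = (V t $ i) *s velocity p \<phi> s0" unfolding vec_eq_iff vector_smult_component by blast
    then have "\<omega> (p (\<gamma> t)) (V t) = \<omega> (p (\<gamma> t)) ((V t $ i) *s velocity p \<phi> s0)" by (rule arg_cong)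
    also have "\<dots> = V t $ i * \<omega> (p (\<gamma> t)) (velocity p \<phi> s0)"
      using velocity_tangent[OF lp] by (intro regular_diffs_scale[OF \<omega>]) (simp add: \<phi>s0)
    finally have \<omega>V: "\<omega> (p (\<gamma> t)) (V t) = V t $ i * \<omega> (p (\<gamma> t)) (velocity p \<phi> s0)" .
    have "vector_derivative (p \<circ> \<gamma>) (at t within {0..1}) = V t"
      using V[OF t'(2)] t'(1) by (intro vector_derivative_at_within_ivl) auto
    moreover have "((\<lambda>t. F (\<gamma> t)) has_vector_derivative f (\<gamma> t) * \<omega> (p (\<gamma> t)) (V t)) (at t)"
      using chain[OF dformD[OF F lp]] by (simp add: \<omega>V \<phi>s0 mult_ac)
    ultimately show "((\<lambda>t. F (\<gamma> t)) has_vector_derivative f (\<gamma> t) * \<omega> (p (\<gamma> t)) (vector_derivative (p \<circ> \<gamma>) (at t within {0..1}))) (at t)"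
      by simp
  next
    show "continuous_on {0..1} (\<lambda>t. F (\<gamma> t))"
      unfolding continuous_on_eq_continuous_within
    proof
      fix t :: real assume t: "t \<in> {0..1}"
      obtain i r \<phi> N where N: "std_chart i (ball (p (\<gamma> t) $ i) r) \<phi>" "r > 0" "\<phi> (p (\<gamma> t) $ i) = \<gamma> t" "open N" "t \<in> N"
        "\<forall>s\<in>{0..1} \<inter> N. p (\<gamma> s) $ i \<in> ball (p (\<gamma> t) $ i) r \<and> \<phi> (p (\<gamma> s) $ i) = \<gamma> s"
        using nbhd[OF t] by (elim exE conjE)
      let ?B = "ball (p (\<gamma> t) $ i) r"
      have lp: "local_param U p ?B \<phi>" using N(1) by (simp add: std_chart_def)
      have "continuous_on ?B (\<lambda>s. F (\<phi> s))"
        using dformD[OF F lp] by (meson DERIV_isCont continuous_at_imp_continuous_on)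
      moreover have "continuous_on ({0..1} \<inter> N) (\<lambda>s. p (\<gamma> s) $ i)"
        by (intro continuous_intros continuous_on_compose2[OF continuous_p, of _ \<gamma>] continuous_on_subset[OF c\<gamma>]) (use \<gamma>U in auto)
      ultimately have "continuous_on ({0..1} \<inter> N) (\<lambda>s. F (\<phi> (p (\<gamma> s) $ i)))"
        using N(6) by (intro continuous_on_compose2[of ?B "\<lambda>s. F (\<phi> s)" "{0..1} \<inter> N" "\<lambda>s. p (\<gamma> s) $ i"]) auto
      then have "continuous_on ({0..1} \<inter> N) (\<lambda>s. F (\<gamma> s))"
        by (rule continuous_on_eq) (use N(6) in auto)
      then have "continuous (at t within {0..1} \<inter> N) (\<lambda>s. F (\<gamma> s))"
        using t N(5) by (simp add: continuous_on_eq_continuous_within)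
      moreover have "at t within {0..1} \<inter> N = at t within {0..1}"
        by (rule at_within_nhd[OF N(5,4)]) auto
      ultimately show "continuous (at t within {0..1}) (\<lambda>t. F (\<gamma> t))" by simp
    qed
  qed simp
qed

text \<open>An admissible path exists, so the universally quantified condition behind THE has only
  one solution.\<close>

lemma cover_integral_eq:
  assumes F: "dform F (\<lambda>z v. f z * \<omega> (p z) v)" and \<omega>: "\<omega> \<in> regular_diffs C" and z: "z0 \<in> U" "z \<in> U"
  shows "cover_integral U p f \<omega> z0 z = F z - F z0"
  unfolding cover_integral_def
proof (rule the_equality)
  show "\<forall>\<gamma>. path \<gamma> \<and> path_image \<gamma> \<subseteq> U \<and> pathstart \<gamma> = z0 \<and> pathfinish \<gamma> = z \<and> valid_path (p \<circ> \<gamma>) \<longrightarrow>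
     ((\<lambda>t. f (\<gamma> t) * \<omega> (p (\<gamma> t)) (vector_derivative (p \<circ> \<gamma>) (at t within {0..1}))) has_integral F z - F z0) {0..1}"
    using integral_along_path[OF F \<omega>] by (auto simp: pathstart_def pathfinish_def)
next
  fix c assume c: "\<forall>\<gamma>. path \<gamma> \<and> path_image \<gamma> \<subseteq> U \<and> pathstart \<gamma> = z0 \<and> pathfinish \<gamma> = z \<and> valid_path (p \<circ> \<gamma>) \<longrightarrow>
     ((\<lambda>t. f (\<gamma> t) * \<omega> (p (\<gamma> t)) (vector_derivative (p \<circ> \<gamma>) (at t within {0..1}))) has_integral c) {0..1}"
  obtain \<gamma> where \<gamma>: "path \<gamma>" "path_image \<gamma> \<subseteq> U" "pathstart \<gamma> = z0" "pathfinish \<gamma> = z" "valid_path (p \<circ> \<gamma>)"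
    using smooth_path_exists[OF z] by (elim exE conjE)
  then show "c = F z - F z0"
    using integral_along_path[OF F \<omega> \<gamma>(1,2,5)] c[rule_format, of \<gamma>] has_integral_unique
    by (auto simp: pathstart_def pathfinish_def)
qed

definition primitive :: "('u \<Rightarrow> complex) \<Rightarrow> 'n differential \<Rightarrow> 'u \<Rightarrow> 'u \<Rightarrow> complex" where
  "primitive f \<omega> z0 = (\<lambda>z. if z \<in> U then cover_integral U p f \<omega> z0 z else 0)"

lemma primitive_eq:
  assumes "dform F (\<lambda>z v. f z * \<omega> (p z) v)" "\<omega> \<in> regular_diffs C" "z0 \<in> U"
  shows "primitive f \<omega> z0 = (\<lambda>z. if z \<in> U then F z - F z0 else 0)"
  using cover_integral_eq[OF assms] by (auto simp: primitive_def fun_eq_iff)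

lemma
  assumes "f \<in> hol_funs U p" "\<omega> \<in> regular_diffs C" "z0 \<in> U"
  shows dform_primitive: "dform (primitive f \<omega> z0) (\<lambda>z v. f z * \<omega> (p z) v)"
    and primitive_base: "primitive f \<omega> z0 z0 = 0"
    and primitive_outside: "z \<notin> U \<Longrightarrow> primitive f \<omega> z0 z = 0"
proof -
  obtain F where F: "dform F (\<lambda>z v. f z * \<omega> (p z) v)" by (rule primitive_exists[OF assms(1,2)])
  have eq: "primitive f \<omega> z0 = (\<lambda>z. if z \<in> U then F z - F z0 else 0)" by (rule primitive_eq[OF F assms(2,3)])
  have "dform (\<lambda>z. F z - F z0) (\<lambda>z v. f z * \<omega> (p z) v)"
    using dform_diff[OF F dform_const[of "F z0"]] by simp
  then show "dform (primitive f \<omega> z0) (\<lambda>z v. f z * \<omega> (p z) v)"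
    by (rule dform_cong) (simp_all add: eq)
  show "primitive f \<omega> z0 z0 = 0" "z \<notin> U \<Longrightarrow> primitive f \<omega> z0 z = 0" using assms(3) by (simp_all add: eq)
qed

end

section \<open>Regular differentials and the first de Rham cohomology\<close>

lemma regular_diffsE:
  assumes "\<omega> \<in> regular_diffs C"
  obtains P where "\<And>i. P i \<in> poly_funs"
    "\<And>x v. \<omega> x v = (if x \<in> C \<and> v \<in> tangent_space C x then \<Sum>i\<in>UNIV. P i x * v $ i else 0)"
proof -
  obtain P where "\<omega> = (\<lambda>x v. if x \<in> C \<and> v \<in> tangent_space C x then \<Sum>i\<in>UNIV. P i x * v $ i else 0)"
    "\<forall>i. P i \<in> poly_funs" using assms unfolding regular_diffs_def by blast
  then show thesis using that[of P] by simp
qed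

lemma regular_diffsI:
  assumes "\<And>i. P i \<in> poly_funs"
    "\<And>x v. \<omega> x v = (if x \<in> C \<and> v \<in> tangent_space C x then \<Sum>i\<in>UNIV. P i x * v $ i else 0)"
  shows "\<omega> \<in> regular_diffs C"
  unfolding regular_diffs_def using assms by (intro CollectI exI[of _ P]) (auto simp: fun_eq_iff)

lemma regular_diffs_zero: "(\<lambda>_ _. 0) \<in> regular_diffs C"
  by (rule regular_diffsI[of "\<lambda>_ _. 0"]) (auto intro: poly_funs.const)

lemma regular_diffs_add:
  assumes "\<omega> \<in> regular_diffs C" "\<eta> \<in> regular_diffs C" shows "(\<lambda>x v. \<omega> x v + \<eta> x v) \<in> regular_diffs C"
proof -
  obtain P where P: "\<And>i. P i \<in> poly_funs"
    "\<And>x v. \<omega> x v = (if x \<in> C \<and> v \<in> tangent_space C x then \<Sum>i\<in>UNIV. P i x * v $ i else 0)"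
    by (rule regular_diffsE[OF assms(1)]) (rule that; assumption)
  obtain Q where Q: "\<And>i. Q i \<in> poly_funs"
    "\<And>x v. \<eta> x v = (if x \<in> C \<and> v \<in> tangent_space C x then \<Sum>i\<in>UNIV. Q i x * v $ i else 0)"
    by (rule regular_diffsE[OF assms(2)]) (rule that; assumption)
  show ?thesis
    by (rule regular_diffsI[of "\<lambda>i x. P i x + Q i x"])
       (simp_all add: P Q poly_funs.add distrib_right sum.distrib)
qed

lemma regular_diffs_mult:
  assumes "\<omega> \<in> regular_diffs C" "Q \<in> poly_funs" shows "(\<lambda>x v. Q x * \<omega> x v) \<in> regular_diffs C"
proof -
  obtain P where P: "\<And>i. P i \<in> poly_funs"
    "\<And>x v. \<omega> x v = (if x \<in> C \<and> v \<in> tangent_space C x then \<Sum>i\<in>UNIV. P i x * v $ i else 0)"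
    by (rule regular_diffsE[OF assms(1)]) (rule that; assumption)
  show ?thesis
    by (rule regular_diffsI[of "\<lambda>i x. Q x * P i x"])
       (simp_all add: P poly_funs.mult[OF assms(2)] sum_distrib_left mult.assoc)
qed

lemma regular_diffs_cmult: "\<omega> \<in> regular_diffs C \<Longrightarrow> (\<lambda>x v. c * \<omega> x v) \<in> regular_diffs C"
  by (rule regular_diffs_mult[OF _ poly_funs.const])

lemma regular_diffs_sum:
  assumes "\<And>k. k \<in> K \<Longrightarrow> \<omega> k \<in> regular_diffs C"
  shows "(\<lambda>x v. \<Sum>k\<in>K. c k * \<omega> k x v) \<in> regular_diffs C"
  using assms
proof (induction K rule: infinite_finite_induct)
  case (insert k K)
  then show ?case
    using regular_diffs_add[OF regular_diffs_cmult[of "\<omega> k" C "c k"], of "\<lambda>x v. \<Sum>k\<in>K. c k * \<omega> k x v"] by simp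
qed (simp_all add: regular_diffs_zero)

definition dpoly :: "(complex ^ 'n) set \<Rightarrow> (complex ^ 'n \<Rightarrow> complex) \<Rightarrow> 'n differential" where
  "dpoly C P = (\<lambda>x v. if x \<in> C \<and> v \<in> tangent_space C x then dir_deriv P x v else 0)"

lemma exact_diffs_dpoly: "exact_diffs C = dpoly C ` poly_funs"
  by (auto simp: exact_diffs_def dpoly_def)

lemma dpoly_regular: "P \<in> poly_funs \<Longrightarrow> dpoly C P \<in> regular_diffs C"
  by (rule regular_diffsI[of "\<lambda>i. grad i P"]) (auto simp: dpoly_def poly_funs_grad dir_deriv_grad)

lemma dpoly_add: "P \<in> poly_funs \<Longrightarrow> Q \<in> poly_funs \<Longrightarrow> dpoly C (\<lambda>x. P x + Q x) = (\<lambda>x v. dpoly C P x v + dpoly C Q x v)"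
  by (simp add: dpoly_def fun_eq_iff dir_deriv_simps)

lemma dpoly_cmult:
  assumes P: "P \<in> poly_funs" shows "dpoly C (\<lambda>x. c * P x) = (\<lambda>x v. c * dpoly C P x v)"
proof -
  have "dir_deriv (\<lambda>x. c * P x) x v = c * dir_deriv P x v" for x v
    using dir_deriv_simps(2)[OF poly_funs.const[of c] P] dir_deriv_simps(3)[OF P P, of c] by simp
  then show ?thesis by (simp add: dpoly_def fun_eq_iff)
qed

lemma dpoly_zero: "dpoly C (\<lambda>_. 0) = (\<lambda>_ _. 0)"
  using dpoly_cmult[OF poly_funs.const[of 0], of C 0] by simp

lemma diff_space_simps [simp]:
  "carrier (diff_space C) = regular_diffs C" "zero (diff_space C) = (\<lambda>_ _. 0)"
  "add (diff_space C) = (\<lambda>\<omega> \<eta> x v. \<omega> x v + \<eta> x v)" "smult (diff_space C) = (\<lambda>c \<omega> x v. c * \<omega> x v)"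
  by (simp_all add: diff_space_def)

lemma module_diff_space: "module complex_ring (diff_space C)"
proof (rule module.intro)
  show "cring complex_ring" by (rule cring_complex_ring)
  show "abelian_group (diff_space C)"
  proof (rule abelian_groupI)
    fix \<omega> assume "\<omega> \<in> carrier (diff_space C)"
    then show "\<exists>\<eta>\<in>carrier (diff_space C). \<eta> \<oplus>\<^bsub>diff_space C\<^esub> \<omega> = \<zero>\<^bsub>diff_space C\<^esub>"
      using regular_diffs_cmult[of \<omega> C "-1"] by (intro bexI[of _ "\<lambda>x v. -1 * \<omega> x v"]) auto
  qed (auto simp: regular_diffs_add regular_diffs_zero add_ac)
  show "module_axioms complex_ring (diff_space C)"
  proof (rule module_axioms.intro)
    fix c \<omega> assume "\<omega> \<in> carrier (diff_space C)"
    then show "c \<odot>\<^bsub>diff_space C\<^esub> \<omega> \<in> carrier (diff_space C)"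
      unfolding diff_space_simps by (rule regular_diffs_cmult)
  qed (simp_all only: diff_space_simps complex_ring_simps distrib_left distrib_right mult.assoc mult_1)
qed

lemma submodule_exact_diffs: "submodule (exact_diffs C) complex_ring (diff_space C)"
proof -
  interpret module complex_ring "diff_space C" by (rule module_diff_space)
  show ?thesis
    unfolding exact_diffs_dpoly
  proof (rule submoduleI)
    fix \<omega> assume "\<omega> \<in> dpoly C ` poly_funs"
    then obtain P where P: "P \<in> poly_funs" "\<omega> = dpoly C P" by blast
    have m: "dpoly C (\<lambda>x. (-1) * P x) = (\<lambda>x v. (-1) * \<omega> x v)" using P dpoly_cmult[OF P(1), of C "-1"] by simp
    have P': "(\<lambda>x. (-1) * P x) \<in> poly_funs" using P by (intro poly_funs.intros)
    have "\<ominus>\<^bsub>diff_space C\<^esub> \<omega> = (\<lambda>x v. (-1) * \<omega> x v)"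
      by (rule minus_equality) (use P dpoly_regular[OF P(1), of C] dpoly_regular[OF P', of C] m in auto)
    then show "\<ominus>\<^bsub>diff_space C\<^esub> \<omega> \<in> dpoly C ` poly_funs" using m P' by (metis imageI)
  next
    fix a b assume "a \<in> dpoly C ` poly_funs" "b \<in> dpoly C ` poly_funs"
    then obtain P Q where "P \<in> poly_funs" "Q \<in> poly_funs" "a = dpoly C P" "b = dpoly C Q" by blast
    then show "a \<oplus>\<^bsub>diff_space C\<^esub> b \<in> dpoly C ` poly_funs"
      using dpoly_add[of P Q C] by (auto intro!: image_eqI[of _ _ "\<lambda>x. P x + Q x"] poly_funs.add)
  next
    fix c a assume "a \<in> dpoly C ` poly_funs"
    then obtain P where "P \<in> poly_funs" "a = dpoly C P" by blast
    then show "c \<odot>\<^bsub>diff_space C\<^esub> a \<in> dpoly C ` poly_funs"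
      using dpoly_cmult[of P C c] by (auto intro!: image_eqI[of _ _ "\<lambda>x. c * P x"] poly_funs.intros)
  next
    show "\<zero>\<^bsub>diff_space C\<^esub> \<in> dpoly C ` poly_funs" 
      using imageI[OF poly_funs.const[of 0], of "dpoly C"] by (simp only: dpoly_zero diff_space_simps)
  qed (auto simp: dpoly_regular)
qed

definition de_rham :: "(complex ^ 'n) set \<Rightarrow> 'n differential \<Rightarrow> 'n differential set" where
  "de_rham C \<omega> = exact_diffs C +>\<^bsub>diff_space C\<^esub> \<omega>"

lemma carrier_H: "carrier (H_space C) = de_rham C ` regular_diffs C"
  using quot_carrier[OF module_diff_space submodule_exact_diffs, of C]
  by (auto simp: H_space_def de_rham_def)

lemma de_rham_add:
  "\<omega> \<in> regular_diffs C \<Longrightarrow> \<eta> \<in> regular_diffs C \<Longrightarrow>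
    de_rham C \<omega> \<oplus>\<^bsub>H_space C\<^esub> de_rham C \<eta> = de_rham C (\<lambda>x v. \<omega> x v + \<eta> x v)"
  using quot_add[OF module_diff_space submodule_exact_diffs, of \<omega> C \<eta>] by (simp add: H_space_def de_rham_def)

lemma de_rham_smult:
  "\<omega> \<in> regular_diffs C \<Longrightarrow> c \<odot>\<^bsub>H_space C\<^esub> de_rham C \<omega> = de_rham C (\<lambda>x v. c * \<omega> x v)"
  using quot_smult[OF module_diff_space submodule_exact_diffs, of \<omega> C c] by (simp add: H_space_def de_rham_def)

lemma de_rham_eqD:
  assumes "\<omega> \<in> regular_diffs C" "\<eta> \<in> regular_diffs C" "de_rham C \<omega> = de_rham C \<eta>"
  obtains P where "P \<in> poly_funs" "\<omega> = (\<lambda>x v. dpoly C P x v + \<eta> x v)"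
proof -
  have "\<exists>n\<in>exact_diffs C. \<omega> = n \<oplus>\<^bsub>diff_space C\<^esub> \<eta>"
    by (rule quot_class_eqD[OF module_diff_space submodule_exact_diffs]) (use assms in \<open>auto simp: de_rham_def\<close>)
  then show thesis using that by (auto simp: exact_diffs_dpoly)
qed

lemma de_rham_add_exact:
  assumes "P \<in> poly_funs" "\<omega> \<in> regular_diffs C"
  shows "de_rham C (\<lambda>x v. dpoly C P x v + \<omega> x v) = de_rham C \<omega>"
  using quot_class_add[OF module_diff_space submodule_exact_diffs, of "dpoly C P" C \<omega>] assms
  by (auto simp: de_rham_def exact_diffs_dpoly)

section \<open>The series \<open>L\<close>\<close>

lemma MC_expansion:
  assumes "J \<in> MC C" "n \<ge> 1"
  obtains m :: nat and \<omega> \<phi> where "\<And>k. k < m \<Longrightarrow> \<omega> k \<in> regular_diffs C" "\<And>k. k < m \<Longrightarrow> free_lie (H_space C) n (\<phi> k)"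
    "\<And>hs x v. length hs = n \<Longrightarrow> J hs x v = (\<Sum>k<m. \<omega> k x v * \<phi> k hs)"
proof -
  have "\<exists>(m::nat) \<omega> \<phi>. (\<forall>k<m. \<omega> k \<in> regular_diffs C \<and> free_lie (H_space C) n (\<phi> k)) \<and>
        (\<forall>hs. length hs = n \<longrightarrow> J hs = (\<lambda>x v. \<Sum>k<m. \<omega> k x v * \<phi> k hs))"
    using assms unfolding MC_def by blast
  then obtain m :: nat and \<omega> \<phi> where m: "\<forall>k<m. \<omega> k \<in> regular_diffs C \<and> free_lie (H_space C) n (\<phi> k)"
    "\<forall>hs. length hs = n \<longrightarrow> J hs = (\<lambda>x v. \<Sum>k<m. \<omega> k x v * \<phi> k hs)" by (elim exE conjE)
  show thesis by (rule that[of m \<omega> \<phi>]) (use m in auto)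
qed

locale mc_curve = curve_cover C U p for C :: "(complex ^ 'n) set" and U :: "'u::topological_space set" and p +
  fixes J :: "'n differential set list \<Rightarrow> 'n differential"
  assumes J: "J \<in> MC_nd C"
begin

lemma J_MC: "J \<in> MC C" using J by (simp add: MC_nd_def)

lemma J_Nil [simp]: "J [] = (\<lambda>_ _. 0)" using J_MC by (simp add: MC_def)

lemma J_regular: "J hs \<in> regular_diffs C"
proof (cases "hs = []")
  case False
  then have "length hs \<ge> 1" by (cases hs) auto
  then obtain m \<omega> \<phi> where
    m: "\<And>k. k < (m::nat) \<Longrightarrow> \<omega> k \<in> regular_diffs C"
    "\<And>hs' x v. length hs' = length hs \<Longrightarrow> J hs' x v = (\<Sum>k<m. \<omega> k x v * \<phi> k hs')"
    by (rule MC_expansion[OF J_MC]) (rule that; assumption)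
  have "J hs = (\<lambda>x v. \<Sum>k<m. \<phi> k hs * \<omega> k x v)" using m(2)[of hs] by (simp add: fun_eq_iff mult.commute)
  then show ?thesis using regular_diffs_sum[of "{..<m}" \<omega> C] m(1) by simp
qed (simp add: regular_diffs_zero)

text \<open>Evaluated at a tangent vector, \<open>J\<close> is in each degree a combination of Lie
  elements. This is the infinitesimal form of \<open>L\<close> being group-like.\<close>

lemma J_sh: 
  assumes "u \<noteq> []" "v \<noteq> []" shows "sh (\<lambda>w. J w x \<xi>) u v = 0"
proof -
  have "length u + length v \<ge> 1" using assms by (cases u) auto
  then obtain m \<omega> \<phi> where
    m: "\<And>k. k < (m::nat) \<Longrightarrow> free_lie (H_space C) (length u + length v) (\<phi> k)"
    "\<And>hs x v'. length hs = length u + length v \<Longrightarrow> J hs x v' = (\<Sum>k<m. \<omega> k x v' * \<phi> k hs)"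
    by (rule MC_expansion[OF J_MC]) (rule that; assumption)
  have "sh (\<lambda>w. J w x \<xi>) u v = sh (\<lambda>w. \<Sum>k<m. \<omega> k x \<xi> * \<phi> k w) u v"
    by (intro arg_cong[of _ _ sum_list] map_cong refl) (use m(2) length_shuffle_list in blast)
  also have "\<dots> = (\<Sum>k<m. sh (\<lambda>w. \<omega> k x \<xi> * \<phi> k w) u v)"
    by (induction "shuffle_list u v") (simp_all add: sum_list_sum_nth sum.swap[of _ "{0..<length (shuffle_list u v)}"])
  also have "\<dots> = 0"
    using free_lie_sh[OF m(1) assms] by (simp add: sum_list_const_mult)
  finally show ?thesis .
qed

text \<open>Non-degeneracy gives \<open>J [h]\<close> the class \<open>h\<close>, so for the class
  of \<omega> it differs from \<omega> by an exact differential.\<close>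

lemma J_nondegenerate:
  assumes "\<omega> \<in> regular_diffs C"
  obtains P where "P \<in> poly_funs" "\<omega> = (\<lambda>x v. dpoly C P x v + J [de_rham C \<omega>] x v)"
proof -
  have "de_rham C \<omega> \<in> carrier (H_space C)" using assms carrier_H by blast
  then have "de_rham C (J [de_rham C \<omega>]) = de_rham C \<omega>"
    using J by (simp add: MC_nd_def de_rham_def)
  from de_rham_eqD[OF assms J_regular this[symmetric]] show thesis using that by blast
qed

text \<open>As \<open>J [] = 0\<close>, the equation dL = L J is triangular in the word length and
  is solved by successive integration from \<open>x0\<close>. The value at the empty word is the
  unit of the functions on \<open>U\<close> extended by 0.\<close>

function coeff :: "'u \<Rightarrow> 'n differential set list \<Rightarrow> 'u \<Rightarrow> complex" where
  "coeff x0 hs = (if hs = [] then (\<lambda>z. if z \<in> U then 1 else 0)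
     else (\<lambda>z. \<Sum>k<length hs. primitive (coeff x0 (take k hs)) (J (drop k hs)) x0 z))"
  by pat_completeness auto
termination by (relation "Wellfounded.measure (\<lambda>(x0, hs). length hs)") auto

declare coeff.simps [simp del]

lemma coeff_Nil: "coeff x0 [] = (\<lambda>z. if z \<in> U then 1 else 0)"
  by (simp add: coeff.simps)

lemma coeff_properties:
  assumes x0: "x0 \<in> U"
  shows "coeff x0 hs \<in> hol_funs U p \<and>
    dform (coeff x0 hs) (\<lambda>z v. \<Sum>k<length hs. coeff x0 (take k hs) z * J (drop k hs) (p z) v) \<and>
    coeff x0 hs x0 = (if hs = [] then 1 else 0) \<and> (\<forall>z. z \<notin> U \<longrightarrow> coeff x0 hs z = 0)"
proof (induction "length hs" arbitrary: hs rule: less_induct)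
  case less
  show ?case
  proof (cases "hs = []")
    case True
    have "dform (\<lambda>z. if z \<in> U then 1 else 0) (\<lambda>z v. 0)"
      by (rule dform_cong[OF dform_const[of 1]]) auto
    then show ?thesis using True x0 dform_hol_funs by (auto simp: coeff_Nil)
  next
    case False
    have eq: "coeff x0 hs = (\<lambda>z. \<Sum>k<length hs. primitive (coeff x0 (take k hs)) (J (drop k hs)) x0 z)"
      using False by (subst coeff.simps) simp
    have hol: "coeff x0 (take k hs) \<in> hol_funs U p" if "k < length hs" for k
      using less.hyps[of "take k hs"] that by simp
    have d: "dform (coeff x0 hs) (\<lambda>z v. \<Sum>k<length hs. coeff x0 (take k hs) z * J (drop k hs) (p z) v)"
      unfolding eq using hol x0 by (intro dform_sum dform_primitive J_regular) auto
    moreover have z: "coeff x0 hs z = 0" if "z \<notin> U" for z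
      unfolding eq using that hol x0 by (intro sum.neutral) (auto intro: primitive_outside J_regular)
    moreover have "coeff x0 hs x0 = 0"
      unfolding eq using hol x0 by (intro sum.neutral) (auto intro: primitive_base J_regular)
    ultimately show ?thesis using False dform_hol_funs[OF d] by simp
  qed
qed

lemma coeff_hol: "x0 \<in> U \<Longrightarrow> coeff x0 hs \<in> hol_funs U p"
  and coeff_dform: "x0 \<in> U \<Longrightarrow> dform (coeff x0 hs) (\<lambda>z v. \<Sum>k<length hs. coeff x0 (take k hs) z * J (drop k hs) (p z) v)"
  and coeff_base: "x0 \<in> U \<Longrightarrow> coeff x0 hs x0 = (if hs = [] then 1 else 0)"
  and coeff_outside: "x0 \<in> U \<Longrightarrow> z \<notin> U \<Longrightarrow> coeff x0 hs z = 0"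
  using coeff_properties by auto

text \<open>Coefficientwise form of \<open>dM = M J\<close>; the summand \<open>k = length hs\<close> vanishes because \<open>J [] = 0\<close>.\<close>

definition solution :: "('n differential set list \<Rightarrow> 'u \<Rightarrow> complex) \<Rightarrow> bool" where
  "solution M \<longleftrightarrow> (\<forall>hs. dform (M hs) (\<lambda>z v. \<Sum>k<length hs. M (take k hs) z * J (drop k hs) (p z) v))"

lemma solution_coeff: "x0 \<in> U \<Longrightarrow> solution (coeff x0)"
  using coeff_dform by (simp add: solution_def)

text \<open>Once all shorter words agree, the differentials of the two coefficients agree, and so do
  their values at \<open>a\<close>.\<close>

lemma solution_unique:
  assumes "solution M" "solution M'" "a \<in> U" "\<And>hs. M hs a = M' hs a" "z \<in> U"
  shows "M hs z = M' hs z"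
  using assms(5)
proof (induction "length hs" arbitrary: hs z rule: less_induct)
  case less
  have "dform (M' hs) (\<lambda>z v. \<Sum>k<length hs. M' (take k hs) z * J (drop k hs) (p z) v)"
    using assms(2) by (simp add: solution_def)
  then have 2: "dform (M' hs) (\<lambda>z v. \<Sum>k<length hs. M (take k hs) z * J (drop k hs) (p z) v)"
    by (rule dform_cong) (use less.hyps in \<open>auto intro!: sum.cong\<close>)
  have 1: "dform (M hs) (\<lambda>z v. \<Sum>k<length hs. M (take k hs) z * J (drop k hs) (p z) v)"
    using assms(1) by (simp add: solution_def)
  show ?case by (rule dform_unique[OF 1 2 assms(3,4) less.prems])
qed

lemma dform_sum_list:
  "(\<And>k. k \<in> set ks \<Longrightarrow> dform (g k) (\<beta> k)) \<Longrightarrow> dform (\<lambda>z. \<Sum>k\<leftarrow>ks. g k z) (\<lambda>z v. \<Sum>k\<leftarrow>ks. \<beta> k z v)"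
  by (induction ks) (auto intro: dform_const dform_add)

lemma conc_J: "conc \<phi> (\<lambda>w. J w x v) hs = (\<Sum>k<length hs. \<phi> (take k hs) * J (drop k hs) x v)"
  by (simp add: conc_def lessThan_Suc_atMost[symmetric])

text \<open>For nonempty words both sides are 0 at \<open>x0\<close>, so it suffices to compare
  differentials. In the expansion of the left one, cuts leaving nonempty suffixes of both words
  vanish by \<open>J_sh\<close>; the rest is the product rule, by induction on the total
  length.\<close>

lemma coeff_sh:
  assumes x0: "x0 \<in> U" and z: "z \<in> U"
  shows "sh (\<lambda>w. coeff x0 w z) u v = coeff x0 u z * coeff x0 v z"
  using z
proof (induction "length u + length v" arbitrary: u v z rule: less_induct)
  case less
  consider "u = []" | "v = []" | "u \<noteq> []" "v \<noteq> []" by blast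
  then show ?case
  proof cases
    case 3
    have d: "dform (coeff x0 w) (\<lambda>z \<xi>. conc (\<lambda>w. coeff x0 w z) (\<lambda>w. J w (p z) \<xi>) w)" for w
      using coeff_dform[OF x0, of w] by (simp add: conc_J)
    have "dform (\<lambda>z. sh (\<lambda>w. coeff x0 w z) u v) (\<lambda>z \<xi>. sh (conc (\<lambda>w. coeff x0 w z) (\<lambda>w. J w (p z) \<xi>)) u v)"
      by (rule dform_sum_list) (rule d)
    then have 1: "dform (\<lambda>z. sh (\<lambda>w. coeff x0 w z) u v)
       (\<lambda>z \<xi>. conc (\<lambda>w. coeff x0 w z) (\<lambda>w. J w (p z) \<xi>) u * coeff x0 v z + conc (\<lambda>w. coeff x0 w z) (\<lambda>w. J w (p z) \<xi>) v * coeff x0 u z)"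
    proof (rule dform_cong[OF _ refl])
      fix z \<xi> assume z: "z \<in> U"
      let ?L = "\<lambda>w. coeff x0 w z" and ?J = "\<lambda>w. J w (p z) \<xi>"
      let ?a = "\<lambda>i j. sh ?L (take i u) (take j v) * sh ?J (drop i u) (drop j v)"
      have 0: "?a i j = 0" if "i < length u" "j < length v" for i j
        using that by (simp add: J_sh)
      have IH: "sh ?L u' v' = ?L u' * ?L v'" if "length u' + length v' < length u + length v" for u' v'
        using less.hyps[OF that z] .
      \<comment> \<open>If \<open>J\<close> receives a nonempty suffix of \<open>u\<close>, it can
        receive nothing of \<open>v\<close>.\<close>
      have in1: "(\<Sum>j\<le>length v. ?a i j) = ?a i (length v)" if "i < length u" for i
      proof -
        have "(\<Sum>j<length v. ?a i j) = 0" using 0[OF that] by (intro sum.neutral) blast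
        then show ?thesis by (simp only: lessThan_Suc_atMost[symmetric] sum.lessThan_Suc add_0)
      qed
      \<comment> \<open>The cut at the end of both words contributes \<open>J []\<close>, which is
        0.\<close>
      have in2: "(\<Sum>j\<le>length v. ?a (length u) j) = (\<Sum>j<length v. ?a (length u) j)"
        by (simp add: lessThan_Suc_atMost[symmetric])
      have "sh (conc ?L ?J) u v = (\<Sum>i\<le>length u. \<Sum>j\<le>length v. ?a i j)" by (rule sh_conc)
      also have "\<dots> = (\<Sum>i<length u. \<Sum>j\<le>length v. ?a i j) + (\<Sum>j\<le>length v. ?a (length u) j)"
        by (simp only: lessThan_Suc_atMost[symmetric, of "length u"] sum.lessThan_Suc)
      also have "(\<Sum>i<length u. \<Sum>j\<le>length v. ?a i j) = (\<Sum>i<length u. ?a i (length v))"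
        by (intro sum.cong refl in1) simp
      also note in2
      also have "(\<Sum>i<length u. ?a i (length v)) = (\<Sum>i<length u. ?L (take i u) * ?L v * ?J (drop i u))"
        by (intro sum.cong refl) (simp add: IH)
      also have "(\<Sum>j<length v. ?a (length u) j) = (\<Sum>j<length v. ?L u * ?L (take j v) * ?J (drop j v))"
        by (intro sum.cong refl) (simp add: IH)
      finally show "sh (conc ?L ?J) u v = conc ?L ?J u * ?L v + conc ?L ?J v * ?L u"
        by (simp add: conc_J sum_distrib_left sum_distrib_right mult_ac)
    qed
    have 2: "dform (\<lambda>z. coeff x0 u z * coeff x0 v z)
       (\<lambda>z \<xi>. conc (\<lambda>w. coeff x0 w z) (\<lambda>w. J w (p z) \<xi>) u * coeff x0 v z + conc (\<lambda>w. coeff x0 w z) (\<lambda>w. J w (p z) \<xi>) v * coeff x0 u z)"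
      by (rule dform_mult[OF d d])
    have "map (\<lambda>w. coeff x0 w x0) (shuffle_list u v) = map (\<lambda>_. 0) (shuffle_list u v)"
      using 3 x0 by (intro map_cong) (auto simp: coeff_base dest!: length_shuffle_list)
    then have "sh (\<lambda>w. coeff x0 w x0) u v = 0" by (simp only: sum_list_0)
    also have "\<dots> = coeff x0 u x0 * coeff x0 v x0" using 3 x0 by (simp add: coeff_base)
    finally show ?thesis by (intro dform_unique[OF 1 2 x0 _ less.prems])
  qed (use less.prems in \<open>simp_all add: coeff_Nil\<close>)
qed

text \<open>Membership in the completed tensor algebra asks for finite sums of products of linear
  forms, which is more than multilinearity. The recursion for \<open>coeff\<close> is therefore
  followed with functions of \<open>z\<close> and forms on words kept apart.\<close>

lemma coeff_separable:
  assumes x0: "x0 \<in> U"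
  shows "\<exists>(K::nat) c \<psi>. (\<forall>k<K. c k \<in> hol_funs U p \<and> \<psi> k \<in> dual_tensor_power (H_space C) n) \<and>
    (\<forall>hs. length hs = n \<longrightarrow> (\<forall>z\<in>U. coeff x0 hs z = (\<Sum>k<K. c k z * \<psi> k hs)))"
proof (induction n rule: less_induct)
  case (less n)
  show ?case
  proof (cases "n = 0")
    case True
    have "(\<lambda>hs. if hs = [] then 1 else 0) \<in> dual_tensor_power (H_space C) 0"
      by (rule dual_tensor_powerI[of "{()}" "\<lambda>_. []" _ _ _ "\<lambda>_. 1"]) auto
    then show ?thesis using True coeff_hol[OF x0, of "[]"]
      by (intro exI[of _ "1::nat"] exI[of _ "\<lambda>_. coeff x0 []"] exI[of _ "\<lambda>_ hs. if hs = [] then 1 else 0"]) (auto simp: coeff_Nil)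
  next
    case False
    \<comment> \<open>Number of terms, functions and forms are packed into one triple, so that a
      single choice covers all prefix lengths \<open>j\<close>.\<close>
    have "\<forall>j\<in>{..<n}. \<exists>S. case S of (K::nat, c, \<psi>) \<Rightarrow> (\<forall>k<K. c k \<in> hol_funs U p \<and> \<psi> k \<in> dual_tensor_power (H_space C) j) \<and>
      (\<forall>hs. length hs = j \<longrightarrow> (\<forall>z\<in>U. coeff x0 hs z = (\<Sum>k<K. c k z * \<psi> k hs)))"
      using less by simp
    from bchoice[OF this] obtain S where S: "\<forall>j\<in>{..<n}. case S j of (K::nat, c, \<psi>) \<Rightarrow>
       (\<forall>k<K. c k \<in> hol_funs U p \<and> \<psi> k \<in> dual_tensor_power (H_space C) j) \<and>
      (\<forall>hs. length hs = j \<longrightarrow> (\<forall>z\<in>U. coeff x0 hs z = (\<Sum>k<K. c k z * \<psi> k hs)))"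
      by (elim exE)
    define K c \<psi> where "K j = fst (S j)" and "c j = fst (snd (S j))" and "\<psi> j = snd (snd (S j))" for j
    have c: "c j k \<in> hol_funs U p" "\<psi> j k \<in> dual_tensor_power (H_space C) j" if "j < n" "k < K j" for j k
      using S[rule_format, of j] that by (auto simp: K_def c_def \<psi>_def case_prod_unfold)
    have cs: "coeff x0 hs z = (\<Sum>k<K j. c j k z * \<psi> j k hs)" if "j < n" "length hs = j" "z \<in> U" for j hs z
      using S[rule_format, of j] that by (auto simp: K_def c_def \<psi>_def case_prod_unfold)
    have "\<forall>j\<in>{..<n}. \<exists>T. case T of (m::nat, \<omega>, \<phi>) \<Rightarrow> (\<forall>k<m. \<omega> k \<in> regular_diffs C \<and> free_lie (H_space C) (n - j) (\<phi> k)) \<and>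
        (\<forall>hs x v. length hs = n - j \<longrightarrow> J hs x v = (\<Sum>k<m. \<omega> k x v * \<phi> k hs))"
    proof
      fix j assume "j \<in> {..<n}"
      then have "n - j \<ge> 1" by auto
      then obtain m \<omega> \<phi> where
        "\<And>k. k < (m::nat) \<Longrightarrow> \<omega> k \<in> regular_diffs C" "\<And>k. k < m \<Longrightarrow> free_lie (H_space C) (n - j) (\<phi> k)"
        "\<And>hs x v. length hs = n - j \<Longrightarrow> J hs x v = (\<Sum>k<m. \<omega> k x v * \<phi> k hs)"
        by (rule MC_expansion[OF J_MC]) (rule that; assumption)
      then show "\<exists>T. case T of (m::nat, \<omega>, \<phi>) \<Rightarrow> (\<forall>k<m. \<omega> k \<in> regular_diffs C \<and> free_lie (H_space C) (n - j) (\<phi> k)) \<and>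
        (\<forall>hs x v. length hs = n - j \<longrightarrow> J hs x v = (\<Sum>k<m. \<omega> k x v * \<phi> k hs))"
        by (intro exI[of _ "(m, \<omega>, \<phi>)"]) simp
    qed
    from bchoice[OF this] obtain T where T: "\<forall>j\<in>{..<n}. case T j of (m::nat, \<omega>, \<phi>) \<Rightarrow>
        (\<forall>k<m. \<omega> k \<in> regular_diffs C \<and> free_lie (H_space C) (n - j) (\<phi> k)) \<and>
        (\<forall>hs x v. length hs = n - j \<longrightarrow> J hs x v = (\<Sum>k<m. \<omega> k x v * \<phi> k hs))"
      by (elim exE)
    define m \<omega> \<phi> where "m j = fst (T j)" and "\<omega> j = fst (snd (T j))" and "\<phi> j = snd (snd (T j))" for j
    have \<omega>: "\<omega> j l \<in> regular_diffs C" "\<phi> j l \<in> dual_tensor_power (H_space C) (n - j)" if "j < n" "l < m j" for j l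
      using T[rule_format, of j] that by (auto simp: m_def \<omega>_def \<phi>_def case_prod_unfold intro: free_lie_dual_tensor_power)
    have Js: "J hs x v = (\<Sum>l<m j. \<omega> j l x v * \<phi> j l hs)" if "j < n" "length hs = n - j" for j hs x v
      using T[rule_format, of j] that by (auto simp: m_def \<omega>_def \<phi>_def case_prod_unfold)
    \<comment> \<open>One summand for each cut \<open>j\<close>, each term \<open>k\<close> of the
      prefix of length \<open>j\<close> and each term \<open>l\<close> of \<open>J\<close> in degree
      \<open>n - j\<close>.\<close>
    define I where "I = (SIGMA j:{..<n}. {..<K j} \<times> {..<m j})"
    define c' where "c' = (\<lambda>(j, k, l). primitive (c j k) (\<omega> j l) x0)"
    define \<psi>' where "\<psi>' = (\<lambda>(j, k, l). conc (\<psi> j k) (\<phi> j l))"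
    have finI: "finite I" by (simp add: I_def)
    have I': "c' i \<in> hol_funs U p \<and> \<psi>' i \<in> dual_tensor_power (H_space C) n" if iI: "i \<in> I" for i
    proof -
      obtain j k l where i: "i = (j, k, l)" "j < n" "k < K j" "l < m j" using iI by (auto simp: I_def)
      have "c' i \<in> hol_funs U p" unfolding i c'_def prod.case
        by (rule dform_hol_funs[OF dform_primitive[OF c(1) \<omega>(1) x0]]) (use i c(1) \<omega>(1) x0 primitive_outside in auto)
      moreover have "\<psi>' i \<in> dual_tensor_power (H_space C) (j + (n - j))" unfolding i \<psi>'_def prod.case
        using i c(2) \<omega>(2) by (intro dual_tensor_power_conc) auto
      ultimately show ?thesis using i(2) by simp
    qed
    have \<psi>': "\<psi>' (j, k, l) hs = \<psi> j k (take j hs) * \<phi> j l (drop j hs)"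
      if "j < n" "k < K j" "l < m j" "length hs = n" for j k l hs
    proof -
      \<comment> \<open>\<open>\<psi> j k\<close> is supported on words of length \<open>j\<close>,
        so only the cut at \<open>j\<close> survives.\<close>
      have "conc (\<psi> j k) (\<phi> j l) hs = (\<Sum>i\<le>length hs. if i = j then \<psi> j k (take j hs) * \<phi> j l (drop j hs) else 0)"
        unfolding conc_def
        using dual_tensor_power_length[OF c(2)[OF that(1,2)]] that(4) by (intro sum.cong) auto
      then show ?thesis using that by (simp add: \<psi>'_def)
    qed
    have main: "coeff x0 hs z = (\<Sum>i\<in>I. c' i z * \<psi>' i hs)" if hs: "length hs = n" and z: "z \<in> U" for hs z
    proof (rule dform_unique[where g = "coeff x0 hs" and h = "\<lambda>z. \<Sum>i\<in>I. c' i z * \<psi>' i hs", OF coeff_dform[OF x0] _ x0 _ z])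
      have "dform (\<lambda>z. \<Sum>i\<in>I. \<psi>' i hs * c' i z) (\<lambda>z v. \<Sum>i\<in>I. \<psi>' i hs * (case i of (j, k, l) \<Rightarrow> c j k z * \<omega> j l (p z) v))"
        by (intro dform_sum dform_cmult) (use c(1) \<omega>(1) x0 dform_primitive in \<open>auto simp: c'_def I_def\<close>)
      then show "dform (\<lambda>z. \<Sum>i\<in>I. c' i z * \<psi>' i hs) (\<lambda>z v. \<Sum>k<length hs. coeff x0 (take k hs) z * J (drop k hs) (p z) v)"
      proof (rule dform_cong)
        fix z v assume z: "z \<in> U"
        have "(\<Sum>i\<in>I. \<psi>' i hs * (case i of (j, k, l) \<Rightarrow> c j k z * \<omega> j l (p z) v)) =
            (\<Sum>j<n. \<Sum>k<K j. \<Sum>l<m j. \<psi>' (j, k, l) hs * (c j k z * \<omega> j l (p z) v))"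
          unfolding I_def by (simp add: sum.cartesian_product sum.Sigma case_prod_unfold)
        also have "\<dots> = (\<Sum>j<n. coeff x0 (take j hs) z * J (drop j hs) (p z) v)"
        proof (rule sum.cong[OF refl])
          fix j assume j: "j \<in> {..<n}"
          have "coeff x0 (take j hs) z * J (drop j hs) (p z) v =
              (\<Sum>k<K j. c j k z * \<psi> j k (take j hs)) * (\<Sum>l<m j. \<omega> j l (p z) v * \<phi> j l (drop j hs))"
            using j hs z by (simp add: cs[of j] Js[of j])
          also have "\<dots> = (\<Sum>k<K j. \<Sum>l<m j. \<psi>' (j, k, l) hs * (c j k z * \<omega> j l (p z) v))"
            unfolding sum_product using j hs by (intro sum.cong refl) (simp add: \<psi>')
          finally show "(\<Sum>k<K j. \<Sum>l<m j. \<psi>' (j, k, l) hs * (c j k z * \<omega> j l (p z) v)) =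
             coeff x0 (take j hs) z * J (drop j hs) (p z) v" by simp
        qed
        finally show "(\<Sum>i\<in>I. \<psi>' i hs * (case i of (j, k, l) \<Rightarrow> c j k z * \<omega> j l (p z) v)) =
          (\<Sum>k<length hs. coeff x0 (take k hs) z * J (drop k hs) (p z) v)" using hs by simp
      qed (simp add: mult.commute)
      have "c' i x0 = 0" if "i \<in> I" for i
        using that c(1) \<omega>(1) x0 primitive_base by (auto simp: c'_def I_def)
      then show "coeff x0 hs x0 = (\<Sum>i\<in>I. c' i x0 * \<psi>' i hs)"
        using False hs x0 by (auto simp: coeff_base)
    qed
    obtain g where g: "bij_betw g {0..<card I} I" using ex_bij_betw_nat_finite[OF finI] by blast
    have re: "(\<Sum>k<card I. c' (g k) z * \<psi>' (g k) hs) = (\<Sum>i\<in>I. c' i z * \<psi>' i hs)" for z hs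
      using sum.reindex_bij_betw[OF g, of "\<lambda>i. c' i z * \<psi>' i hs"] by (simp add: atLeast0LessThan)
    have gI: "g k \<in> I" if "k < card I" for k using g that by (auto simp: bij_betw_def)
    show ?thesis
      by (intro exI[of _ "card I"] exI[of _ "\<lambda>k. c' (g k)"] exI[of _ "\<lambda>k. \<psi>' (g k)"])
         (use I' gI main re in auto)
  qed
qed

lemma coeff_group_like:
  assumes x0: "x0 \<in> U" and z: "z \<in> U"
  shows "(\<lambda>hs. coeff x0 hs z) \<in> group_likes (H_space C)"
proof -
  have "(\<lambda>hs. if length hs = n then coeff x0 hs z else 0) \<in> dual_tensor_power (H_space C) n" for n
  proof -
    obtain K :: nat and c \<psi> where K0: "\<forall>k<K. c k \<in> hol_funs U p \<and> \<psi> k \<in> dual_tensor_power (H_space C) n"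
      "\<forall>hs. length hs = n \<longrightarrow> (\<forall>z\<in>U. coeff x0 hs z = (\<Sum>k<K. c k z * \<psi> k hs))"
      using coeff_separable[OF x0, of n] by (elim exE conjE)
    have K: "\<And>k. k < K \<Longrightarrow> \<psi> k \<in> dual_tensor_power (H_space C) n"
      "\<And>hs. length hs = n \<Longrightarrow> coeff x0 hs z = (\<Sum>k<K. c k z * \<psi> k hs)"
      using K0 z by auto
    have "(\<lambda>hs. \<Sum>k<K. c k z * \<psi> k hs) \<in> dual_tensor_power (H_space C) n"
      using K(1) by (intro dual_tensor_power_sum) auto
    moreover have "(\<Sum>k<K. c k z * \<psi> k hs) = (if length hs = n then coeff x0 hs z else 0)" for hs
      using K(2)[of hs] dual_tensor_power_length[OF K(1)] by (auto intro!: sum.neutral)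
    ultimately show ?thesis by simp
  qed
  then show ?thesis using coeff_sh[OF x0 z] z by (auto simp: group_likes_def completed_tensor_alg_def coeff_Nil)
qed

lemma solves_MC_coeff:
  assumes x0: "x0 \<in> U" shows "solves_MC C U p J x0 (\<lambda>z hs. coeff x0 hs z)"
  unfolding solves_MC_def
proof (intro conjI allI impI ballI)
  fix D \<phi> t hs assume "local_param U p D \<phi> \<and> t \<in> D"
  then show "((\<lambda>s. coeff x0 hs (\<phi> s)) has_field_derivative
      (\<Sum>k\<le>length hs. coeff x0 (take k hs) (\<phi> t) * J (drop k hs) (p (\<phi> t)) (velocity p \<phi> t))) (at t)"
    using dformD[OF coeff_dform[OF x0, of hs], of D \<phi> t] by (simp add: lessThan_Suc_atMost[symmetric])
qed (use x0 coeff_group_like coeff_outside coeff_base in \<open>auto simp: fun_eq_iff\<close>)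

lemma L_series_eq:
  assumes x0: "x0 \<in> U" shows "L_series C U p J x0 = (\<lambda>z hs. coeff x0 hs z)"
  unfolding L_series_def
proof (rule the_equality[where P = "solves_MC C U p J x0", OF solves_MC_coeff[OF x0]])
  fix L assume L: "solves_MC C U p J x0 L"
  have "solution (\<lambda>hs z. L z hs)"
    unfolding solution_def dform_def
  proof (intro allI impI, elim conjE)
    fix hs D \<phi> t assume "local_param U p D \<phi>" "t \<in> D"
    then have "((\<lambda>s. L (\<phi> s) hs) has_field_derivative
      (\<Sum>k\<le>length hs. L (\<phi> t) (take k hs) * J (drop k hs) (p (\<phi> t)) (velocity p \<phi> t))) (at t)"
      using L by (simp add: solves_MC_def)
    then show "((\<lambda>s. L (\<phi> s) hs) has_field_derivative
      (\<Sum>k<length hs. L (\<phi> t) (take k hs) * J (drop k hs) (p (\<phi> t)) (velocity p \<phi> t))) (at t)"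
      by (simp add: lessThan_Suc_atMost[symmetric])
  qed
  moreover have "L x0 hs = coeff x0 hs x0" for hs using L x0 by (simp add: solves_MC_def coeff_base)
  ultimately have "L z hs = coeff x0 hs z" if "z \<in> U" for z hs
    using solution_unique[OF _ solution_coeff[OF x0] x0, of "\<lambda>hs z. L z hs"] that by blast
  moreover have "L z hs = coeff x0 hs z" if "z \<notin> U" for z hs
    using L that coeff_outside[OF x0 that] by (simp add: solves_MC_def)
  ultimately show "L = (\<lambda>z hs. coeff x0 hs z)" by blast
qed

text \<open>The right side solves the same equation and has the same values at \<open>x1\<close>,
  where only the empty suffix contributes.\<close>

lemma coeff_change_base:
  assumes x0: "x0 \<in> U" and x1: "x1 \<in> U" and z: "z \<in> U"
  shows "coeff x0 hs z = (\<Sum>k\<le>length hs. coeff x0 (take k hs) x1 * coeff x1 (drop k hs) z)"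
proof -
  define M where "M hs z = (\<Sum>k\<le>length hs. coeff x0 (take k hs) x1 * coeff x1 (drop k hs) z)" for hs z
  have sM: "solution M"
    unfolding solution_def
  proof
    fix hs
    have "dform (M hs) (\<lambda>z v. \<Sum>k\<le>length hs. coeff x0 (take k hs) x1 *
        (\<Sum>j<length (drop k hs). coeff x1 (take j (drop k hs)) z * J (drop j (drop k hs)) (p z) v))"
      unfolding M_def by (intro dform_sum dform_cmult coeff_dform[OF x1])
    then show "dform (M hs) (\<lambda>z v. \<Sum>k<length hs. M (take k hs) z * J (drop k hs) (p z) v)"
    proof (rule dform_cong[OF _ refl])
      fix z v
      let ?n = "length hs"
      let ?a = "\<lambda>k i. coeff x0 (take k hs) x1 * coeff x1 (drop k (take i hs)) z * J (drop i hs) (p z) v"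
      have "(\<Sum>k\<le>?n. coeff x0 (take k hs) x1 *
        (\<Sum>j<length (drop k hs). coeff x1 (take j (drop k hs)) z * J (drop j (drop k hs)) (p z) v)) =
        (\<Sum>k\<le>?n. \<Sum>i\<in>{k..<?n}. ?a k i)"
      proof (rule sum.cong[OF refl])
        fix k assume k: "k \<in> {..?n}"
        \<comment> \<open>The cut \<open>j\<close> inside the suffix \<open>drop k hs\<close> is the
          cut \<open>i = j + k\<close> of the whole word.\<close>
        have "(\<Sum>i\<in>{k..<?n}. ?a k i) = (\<Sum>i\<in>{0+k..<(?n-k)+k}. ?a k i)" using k by simp
        also have "\<dots> = (\<Sum>j\<in>{0..<?n-k}. ?a k (j + k))" by (rule sum.shift_bounds_nat_ivl)
        also have "\<dots> = coeff x0 (take k hs) x1 *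
          (\<Sum>j<length (drop k hs). coeff x1 (take j (drop k hs)) z * J (drop j (drop k hs)) (p z) v)"
          by (simp add: sum_distrib_left atLeast0LessThan mult.assoc take_drop add.commute)
        finally show "coeff x0 (take k hs) x1 *
          (\<Sum>j<length (drop k hs). coeff x1 (take j (drop k hs)) z * J (drop j (drop k hs)) (p z) v) =
          (\<Sum>i\<in>{k..<?n}. ?a k i)" by simp
      qed
      also have "\<dots> = (\<Sum>(k, i)\<in>(SIGMA k:{..?n}. {k..<?n}). ?a k i)" by (simp add: sum.Sigma)
      \<comment> \<open>After exchanging the summations the inner sum over the earlier cuts
        \<open>k\<close> is the coefficient of \<open>M\<close> at \<open>take i hs\<close>.\<close>
      also have "\<dots> = (\<Sum>(i, k)\<in>(SIGMA i:{..<?n}. {..i}). ?a k i)"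
        by (rule sum.reindex_bij_witness[of _ "\<lambda>(i, k). (k, i)" "\<lambda>(k, i). (i, k)"]) auto
      also have "\<dots> = (\<Sum>i<?n. \<Sum>k\<le>i. ?a k i)" by (simp add: sum.Sigma)
      also have "\<dots> = (\<Sum>i<?n. M (take i hs) z * J (drop i hs) (p z) v)"
        by (intro sum.cong refl) (simp add: M_def sum_distrib_right min_def)
      finally show "(\<Sum>k\<le>?n. coeff x0 (take k hs) x1 *
        (\<Sum>j<length (drop k hs). coeff x1 (take j (drop k hs)) z * J (drop j (drop k hs)) (p z) v)) =
        (\<Sum>i<?n. M (take i hs) z * J (drop i hs) (p z) v)" .
    qed
  qed
  have eq: "coeff x0 hs x1 = M hs x1" for hs
  proof -
    have "M hs x1 = (\<Sum>k\<le>length hs. if k = length hs then coeff x0 hs x1 else 0)"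
      unfolding M_def using x1 by (intro sum.cong refl) (auto simp: coeff_base)
    then show ?thesis by simp
  qed
  have "coeff x0 hs z = M hs z" by (rule solution_unique[OF solution_coeff[OF x0] sM x1 eq z])
  then show ?thesis by (simp only: M_def)
qed

end

section \<open>Regular vector fields\<close>

context curve
begin

definition field_at :: "('n \<Rightarrow> complex ^ 'n \<Rightarrow> complex) \<Rightarrow> complex ^ 'n \<Rightarrow> complex ^ 'n" where
  "field_at \<theta> x = (\<chi> i. \<theta> i x)"

definition vector_field :: "('n \<Rightarrow> complex ^ 'n \<Rightarrow> complex) \<Rightarrow> bool" where
  "vector_field \<theta> \<longleftrightarrow> (\<forall>i. \<theta> i \<in> poly_funs) \<and> (\<forall>x\<in>C. field_at \<theta> x \<in> tangent_space C x)"

definition derive_along :: "('n \<Rightarrow> complex ^ 'n \<Rightarrow> complex) \<Rightarrow> (complex ^ 'n \<Rightarrow> complex) \<Rightarrow> complex ^ 'n \<Rightarrow> complex" where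
  "derive_along \<theta> P x = (\<Sum>i\<in>UNIV. grad i P x * \<theta> i x)"

lemma derive_along_poly: "vector_field \<theta> \<Longrightarrow> P \<in> poly_funs \<Longrightarrow> derive_along \<theta> P \<in> poly_funs"
  unfolding derive_along_def[abs_def] vector_field_def
  by (intro poly_funs_sum poly_funs.mult poly_funs_grad) auto

lemma derive_along_eq: "P \<in> poly_funs \<Longrightarrow> derive_along \<theta> P x = dir_deriv P x (field_at \<theta> x)"
  by (simp add: derive_along_def dir_deriv_grad field_at_def)

lemma derive_along_vanishing:
  assumes "vector_field \<theta>" "P \<in> vanishing C" "x \<in> C" shows "derive_along \<theta> P x = 0"
  using assms by (auto simp: derive_along_eq vector_field_def vanishing_def tangent_space_def)

text \<open>A nonzero tangent vector lies in the kernel of the matrix of gradients.\<close>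

lemma det_gradients:
  assumes z: "z \<in> C" and P: "\<And>j. P j \<in> vanishing C"
  shows "det (\<chi> j l. grad l (P j) z) = 0"
proof -
  obtain v where v: "v \<noteq> 0" "tangent_space C z = range (\<lambda>c. c *s v)" by (rule tangent_space_line[OF z])
  have "v \<in> tangent_space C z" unfolding v(2) by (metis rangeI vec.scale_one)
  then have "(\<chi> j l. grad l (P j) z) *v v = 0"
    using P by (auto simp: tangent_space_iff matrix_vector_mult_def vec_eq_iff)
  then have "\<not> invertible (\<chi> j l. grad l (P j) z)"
    using v(1) by (auto simp: invertible_left_inverse matrix_left_invertible_ker)
  then show ?thesis by (simp add: invertible_det_nz)
qed

text \<open>The vector field consists of the cofactors of a row of a Jacobian matrix of equations of \<open>C\<close>.\<close>

lemma vector_field_exists: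
  assumes x: "x \<in> C" obtains \<theta> where "vector_field \<theta>" "field_at \<theta> x \<noteq> 0"
proof -
  obtain i0 P where P: "\<And>j. j \<noteq> i0 \<Longrightarrow> P j \<in> vanishing C" "det (jacobian i0 P x) \<noteq> 0"
    by (rule local_equations[OF x]) (rule that; assumption)
  define \<theta> where "\<theta> k z = det (\<chi> j l. if j = i0 then (if l = k then 1 else 0) else grad l (P j) z)" for k z
  have "\<theta> k \<in> poly_funs" for k
  proof -
    have "(\<lambda>z. if j = i0 then (if l = k then 1 else 0) else grad l (P j) z) \<in> poly_funs" for j l
      using poly_funs_grad[OF vanishingD(1)[OF P(1)]] poly_funs.const by (cases "j = i0") auto
    then show ?thesis unfolding \<theta>_def[abs_def] by (rule poly_funs_det)
  qed
  moreover have "field_at \<theta> z \<in> tangent_space C z" if z: "z \<in> C" for z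
    unfolding tangent_space_iff
  proof
    fix Q assume Q: "Q \<in> vanishing C"
    let ?c = "\<lambda>j. \<chi> l. grad l (P j) z"
    have row: "(\<chi> j l. if j = i0 then (if l = k then 1 else 0) else grad l (P j) z) =
        (\<chi> j. if j = i0 then axis k 1 else ?c j)" for k
      by (auto simp: vec_eq_iff axis_def)
    have ax: "(\<chi> l. grad l Q z) = (\<Sum>k\<in>UNIV. grad k Q z *s axis k 1)"
      by (simp add: vec_eq_iff axis_def if_distrib cong: if_cong)
    \<comment> \<open>Linearity of the determinant in row \<open>i0\<close>: pairing the cofactors
      with the gradient of \<open>Q\<close> puts this gradient into that row, and gradients of
      equations are dependent on \<open>C\<close>.\<close>
    have "(\<Sum>k\<in>UNIV. grad k Q z * field_at \<theta> z $ k) =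
        (\<Sum>k\<in>UNIV. det (\<chi> j. if j = i0 then grad k Q z *s axis k 1 else ?c j))"
      by (simp add: field_at_def \<theta>_def row det_row_mul)
    also have "\<dots> = det (\<chi> j. if j = i0 then (\<Sum>k\<in>UNIV. grad k Q z *s axis k 1) else ?c j)"
      using det_linear_row_sum[of UNIV i0 "\<lambda>_ k. grad k Q z *s axis k 1" ?c] by simp
    also have "\<dots> = det (\<chi> j l. grad l ((P(i0 := Q)) j) z)"
      unfolding ax[symmetric] by (intro arg_cong[of _ _ det]) (auto simp: vec_eq_iff)
    also have "\<dots> = 0" by (rule det_gradients[OF z]) (use P Q in auto)
    finally show "(\<Sum>k\<in>UNIV. grad k Q z * field_at \<theta> z $ k) = 0" .
  qed
  \<comment> \<open>Component \<open>i0\<close> of the field at \<open>x\<close> is the determinant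
    of \<open>jacobian i0 P x\<close> itself.\<close>
  moreover have "field_at \<theta> x $ i0 \<noteq> 0"
    using P(2) by (simp add: field_at_def \<theta>_def jacobian_def)
  ultimately show thesis using that[of \<theta>] unfolding vector_field_def by (metis zero_index)
qed

text \<open>Allows identities between forms to be checked on regular vector fields: tangent spaces
  are lines, so one field that is nonzero at \<open>x\<close> is enough.\<close>

lemma vector_field_spans:
  assumes x: "x \<in> C" and v: "v \<in> tangent_space C x"
  obtains \<theta> c where "vector_field \<theta>" "v = c *s field_at \<theta> x"
proof -
  obtain \<theta> where \<theta>: "vector_field \<theta>" "field_at \<theta> x \<noteq> 0" by (rule vector_field_exists[OF x])
  obtain w where w: "w \<noteq> 0" "tangent_space C x = range (\<lambda>c. c *s w)" by (rule tangent_space_line[OF x])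
  have "field_at \<theta> x \<in> tangent_space C x" using \<theta>(1) x by (auto simp: vector_field_def)
  then obtain a b where ab: "field_at \<theta> x = a *s w" "v = b *s w" using v w(2) by auto
  then have "a \<noteq> 0" using \<theta>(2) by auto
  then have "v = (b / a) *s field_at \<theta> x" unfolding ab by (simp add: vec_eq_iff)
  then show thesis using that[OF \<theta>(1)] by blast
qed

lemma outside_C:
  assumes "x \<notin> C" obtains Q where "Q \<in> vanishing C" "Q x \<noteq> 0"
proof -
  obtain F where F: "F \<subseteq> poly_funs" "C = {x. \<forall>P\<in>F. P x = 0}"
    using smooth unfolding smooth_affine_curve_def by blast
  then obtain Q where "Q \<in> F" "Q x \<noteq> 0" using assms by blast
  moreover have "Q \<in> vanishing C" using F \<open>Q \<in> F\<close> by (auto simp: vanishing_def)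
  ultimately show thesis using that by blast
qed

end

section \<open>Differential simplicity of the coordinate ring\<close>

context curve_cover
begin

lemma std_chart_velocity:
  assumes "std_chart i D \<phi>" "t \<in> D" shows "velocity p \<phi> t $ i = 1"
proof -
  have lp: "local_param U p D \<phi>" and pi: "\<And>t. t \<in> D \<Longrightarrow> p (\<phi> t) $ i = t" using assms(1) by (auto simp: std_chart_def)
  have "((\<lambda>s. p (\<phi> s) $ i) has_field_derivative 1) (at t)"
    by (rule has_field_derivative_transform_within_open[OF DERIV_ident local_paramD(1)[OF lp] assms(2)]) (use pi in auto)
  then show ?thesis using local_param_derivative[OF lp assms(2)] DERIV_unique by blast
qed

lemma pullback_hol:
  assumes P: "P \<in> poly_funs" shows "(\<lambda>z. if z \<in> U then P (p z) else 0) \<in> hol_funs U p"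
  by (rule dform_hol_funs[OF dform_cong[OF dform_poly[OF P]]]) auto

text \<open>
  The coordinate ring has no proper nonzero ideal that is stable under all derivations: a derivation
  that does not vanish at a point lowers the order of vanishing there.
\<close>

theorem differentially_simple:
  assumes I: "poly_ideal I" "vanishing C \<subseteq> I"
    and stable: "\<And>\<theta> P. vector_field \<theta> \<Longrightarrow> P \<in> I \<Longrightarrow> derive_along \<theta> P \<in> I"
    and P0: "P0 \<in> I" "y \<in> C" "P0 y \<noteq> 0"
  shows "(\<lambda>_. 1) \<in> I"
proof (rule weak_Nullstellensatz[OF I(1)])
  fix x
  show "\<exists>P\<in>I. P x \<noteq> 0"
  proof (cases "x \<in> C")
    case False
    obtain Q where "Q \<in> vanishing C" "Q x \<noteq> 0" by (rule outside_C[OF False])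
    then show ?thesis using I(2) by blast
  next
    case True
    then obtain z where z: "z \<in> U" "p z = x" using image_p by blast
    obtain i r \<phi> where \<phi>: "r > 0" "std_chart i (ball (p z $ i) r) \<phi>" "\<phi> (p z $ i) = z"
      by (rule std_chart_exists'[OF z(1)]) (rule that; assumption)
    define t0 where "t0 = p z $ i"
    have lp: "local_param U p (ball t0 r) \<phi>" and t0: "t0 \<in> ball t0 r" and \<phi>t0: "p (\<phi> t0) = x"
      using \<phi> z(2) by (auto simp: std_chart_def t0_def)
    obtain \<theta> where \<theta>: "vector_field \<theta>" "field_at \<theta> x \<noteq> 0" by (rule vector_field_exists[OF True])
    \<comment> \<open>The factor between the field and the velocity of the chart. It is component
      \<open>i\<close> of the field because the velocity of a standard chart has \<open>i\<close>-th
      entry 1.\<close>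
    define \<tau> where "\<tau> t = \<theta> i (p (\<phi> t))" for t
    have hol: "(\<lambda>t. P (p (\<phi> t))) holomorphic_on ball t0 r" if "P \<in> poly_funs" for P
      by (rule poly_funs_holomorphic[OF that local_paramD(4)[OF lp]])
    have hol\<tau>: "\<tau> holomorphic_on ball t0 r"
      unfolding \<tau>_def[abs_def] using \<theta>(1) by (intro hol) (auto simp: vector_field_def)
    have f\<tau>: "field_at \<theta> (p (\<phi> t)) = \<tau> t *s velocity p \<phi> t" if t: "t \<in> ball t0 r" for t
    proof -
      have "field_at \<theta> (p (\<phi> t)) \<in> tangent_space C (p (\<phi> t))"
        using \<theta>(1) p_in_C[OF local_paramD(6)[OF lp t]] by (auto simp: vector_field_def)
      then obtain c where c: "field_at \<theta> (p (\<phi> t)) = c *s velocity p \<phi> t" using tangent_velocity[OF lp t] by blast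
      have "\<tau> t = c"
        using arg_cong[OF c, of "\<lambda>u. u $ i"] std_chart_velocity[OF \<phi>(2)[folded t0_def] t] by (simp add: \<tau>_def field_at_def)
      then show ?thesis using c by simp
    qed
    have \<tau>0: "\<tau> t0 \<noteq> 0" using f\<tau>[OF t0] \<theta>(2) \<phi>t0 by auto
    have low: "\<exists>Q\<in>I. Q x \<noteq> 0"
      if "P \<in> I" "h holomorphic_on ball t0 e" "e > 0" "e \<le> r" "h t0 \<noteq> 0" "\<And>t. t \<in> ball t0 e \<Longrightarrow> P (p (\<phi> t)) = (t - t0) ^ n * h t"
      for P n h e
      using that
    proof (induction n arbitrary: P h)
      case 0
      then have "P x \<noteq> 0" using 0(6)[of t0] \<phi>t0 by simp
      then show ?case using 0 by blast
    next
      case (Suc n)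
      have P: "P \<in> poly_funs" using poly_idealD(1)[OF I(1) Suc.prems(1)] .
      \<comment> \<open>The cofactor left after deriving \<open>(t - t0) ^ Suc n * h t\<close> along
        the field and extracting \<open>(t - t0) ^ n\<close>; at \<open>t0\<close> it is
        \<open>Suc n\<close> times \<tau> times \<open>h\<close>, hence nonzero.\<close>
      define k where "k t = \<tau> t * (of_nat (Suc n) * h t + (t - t0) * deriv h t)" for t
      show ?case
      proof (rule Suc.IH[OF stable[OF \<theta>(1) Suc.prems(1)] _ Suc.prems(3,4)])
        show "k holomorphic_on ball t0 e"
          unfolding k_def[abs_def] using Suc.prems(4)
          by (intro holomorphic_intros holomorphic_deriv Suc.prems(2) open_ball holomorphic_on_subset[OF hol\<tau>]) auto
        show "k t0 \<noteq> 0" using \<tau>0 Suc.prems(5) by (simp add: k_def del: of_nat_Suc)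
        fix t assume t: "t \<in> ball t0 e"
        then have tr: "t \<in> ball t0 r" using Suc.prems(4) by auto
        have "((\<lambda>t. (t - t0) ^ Suc n * h t) has_field_derivative
            of_nat (Suc n) * (t - t0) ^ n * h t + deriv h t * (t - t0) ^ Suc n) (at t)"
          using holomorphic_derivI[OF Suc.prems(2) open_ball t]
          by (auto intro!: derivative_eq_intros simp del: power_Suc of_nat_Suc)
        then have "((\<lambda>t. P (p (\<phi> t))) has_field_derivative
            of_nat (Suc n) * (t - t0) ^ n * h t + deriv h t * (t - t0) ^ Suc n) (at t)"
          by (rule has_field_derivative_transform_within_open[OF _ open_ball t]) (use Suc.prems(6) in auto)
        then have d: "dir_deriv P (p (\<phi> t)) (velocity p \<phi> t) = of_nat (Suc n) * (t - t0) ^ n * h t + deriv h t * (t - t0) ^ Suc n"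
          using poly_derivative[OF lp tr P] DERIV_unique by blast
        show "derive_along \<theta> P (p (\<phi> t)) = (t - t0) ^ n * k t"
          unfolding derive_along_eq[OF P] f\<tau>[OF tr] dir_deriv_linear(2)[OF P] d k_def by (simp add: algebra_simps)
      qed
    qed
    let ?g = "\<lambda>t. P0 (p (\<phi> t))"
    have P0p: "P0 \<in> poly_funs" using poly_idealD(1)[OF I(1) P0(1)] .
    show ?thesis
    proof (cases "P0 x = 0")
      case 0: True
      \<comment> \<open>A constant value would be 0, and the identity theorem would spread it from
        the disc to all of \<open>U\<close>, contradicting \<open>P0 y \<noteq> 0\<close>.\<close>
      have nc: "\<not> ?g constant_on ball t0 r"
      proof
        assume "?g constant_on ball t0 r"
        then have zero: "P0 (p (\<phi> t)) = 0" if "t \<in> ball t0 r" for t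
          using that t0 0 \<phi>t0 unfolding constant_on_def by metis
        obtain y' where y': "y' \<in> U" "p y' = y" using P0(2) image_p by blast
        have "(if y' \<in> U then P0 (p y') else 0) = 0"
        proof (rule hol_identity[OF pullback_hol[OF P0p] local_paramD(2)[OF lp] _ _ y'(1)])
          show "\<phi> t0 \<in> \<phi> ` ball t0 r" using t0 by blast
        qed (use zero in auto)
        then show False using y' P0(3) by simp
      qed
      have g0: "?g t0 = 0" using 0 \<phi>t0 by simp
      obtain h e n where he: "0 < (n::nat)" "0 < e" "ball t0 e \<subseteq> ball t0 r" "h holomorphic_on ball t0 e"
        "\<And>w. w \<in> ball t0 e \<Longrightarrow> ?g w = (w - t0) ^ n * h w" "\<And>w. w \<in> ball t0 e \<Longrightarrow> h w \<noteq> 0"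
        by (rule holomorphic_factor_zero_nonconstant[OF hol[OF P0p] open_ball connected_ball t0 g0 nc]) (rule that; assumption)
      have "e \<le> r" using he(2,3) \<phi>(1) by (simp add: ball_subset_ball_iff)
      then show ?thesis using he t0 by (intro low[OF P0(1) he(4,2) _ _ he(5)]) auto
    qed (use P0(1) in blast)
  qed
qed

text \<open>Both forms are determined on the tangent line by their value at the velocity of a chart,
  which is a derivative of \<open>g\<close>.\<close>

lemma dform_form_unique:
  assumes "dform g \<beta>" "dform g \<beta>'" "z \<in> U" "v \<in> tangent_space C (p z)"
    and "\<And>v c. v \<in> tangent_space C (p z) \<Longrightarrow> \<beta> z (c *s v) = c * \<beta> z v"
    "\<And>v c. v \<in> tangent_space C (p z) \<Longrightarrow> \<beta>' z (c *s v) = c * \<beta>' z v"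
  shows "\<beta> z v = \<beta>' z v"
proof -
  obtain i r \<phi> where \<phi>: "r > 0" "std_chart i (ball (p z $ i) r) \<phi>" "\<phi> (p z $ i) = z"
    by (rule std_chart_exists'[OF assms(3)]) (rule that; assumption)
  let ?t = "p z $ i"
  have lp: "local_param U p (ball ?t r) \<phi>" "?t \<in> ball ?t r" using \<phi> by (auto simp: std_chart_def)
  have "\<beta> z (velocity p \<phi> ?t) = \<beta>' z (velocity p \<phi> ?t)"
    using DERIV_unique[OF dformD[OF assms(1) lp] dformD[OF assms(2) lp]] \<phi>(3) by simp
  moreover obtain c where "v = c *s velocity p \<phi> ?t" using tangent_velocity[OF lp] \<phi>(3) assms(4) by auto
  moreover have "velocity p \<phi> ?t \<in> tangent_space C (p z)" using velocity_tangent[OF lp] \<phi>(3) by simp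
  ultimately show ?thesis using assms(5,6) by simp
qed

text \<open>Pulled back to the connected \<open>U\<close>, the function has differential 0.\<close>

lemma poly_constant:
  assumes P: "P \<in> poly_funs" and d: "\<And>x v. x \<in> C \<Longrightarrow> v \<in> tangent_space C x \<Longrightarrow> dir_deriv P x v = 0"
  shows "\<exists>c. \<forall>x\<in>C. P x = c"
proof -
  have "dform (\<lambda>z. P (p z)) (\<lambda>_ _. 0)"
    by (rule dform_cong[OF dform_poly[OF P]]) (use d p_in_C in auto)
  then have "P (p a) = P (p b)" if "a \<in> U" "b \<in> U" for a b using dform_zero_constant[of "\<lambda>z. P (p z)"] that by blast
  then show ?thesis using image_p by (metis imageE)
qed

end

section \<open>Linear independence over the coordinate ring\<close>

definition words :: "'a set \<Rightarrow> nat \<Rightarrow> 'a list set" where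
  "words B n = {w. set w \<subseteq> B \<and> length w \<le> n}"

lemma finite_words: "finite B \<Longrightarrow> finite (words B n)"
  unfolding words_def by (rule finite_lists_length_le)

context mc_curve
begin

text \<open>A choice of polynomial coefficients of \<open>J w\<close> with respect to the coordinate
  differentials, so that contraction with a vector field stays polynomial.\<close>

definition J_comp :: "'n differential set list \<Rightarrow> 'n \<Rightarrow> complex ^ 'n \<Rightarrow> complex" where
  "J_comp w = (SOME P. (\<forall>i. P i \<in> poly_funs) \<and>
     (\<forall>x\<in>C. \<forall>v\<in>tangent_space C x. J w x v = (\<Sum>i\<in>UNIV. P i x * v $ i)))"

lemma J_comp: "J_comp w i \<in> poly_funs"
  "x \<in> C \<Longrightarrow> v \<in> tangent_space C x \<Longrightarrow> J w x v = (\<Sum>i\<in>UNIV. J_comp w i x * v $ i)"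
proof -
  have "\<exists>P. (\<forall>i. P i \<in> poly_funs) \<and> (\<forall>x\<in>C. \<forall>v\<in>tangent_space C x. J w x v = (\<Sum>i\<in>UNIV. P i x * v $ i))"
    by (rule regular_diffsE[OF J_regular[of w]]) auto
  from someI_ex[OF this] show "J_comp w i \<in> poly_funs"
    "x \<in> C \<Longrightarrow> v \<in> tangent_space C x \<Longrightarrow> J w x v = (\<Sum>i\<in>UNIV. J_comp w i x * v $ i)"
    unfolding J_comp_def by blast+
qed

text \<open>A polynomial representative of the interior product of \<open>J w\<close> with the
  field.\<close>

definition contract :: "('n \<Rightarrow> complex ^ 'n \<Rightarrow> complex) \<Rightarrow> 'n differential set list \<Rightarrow> complex ^ 'n \<Rightarrow> complex" where
  "contract \<theta> w x = (\<Sum>i\<in>UNIV. J_comp w i x * \<theta> i x)"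

lemma contract_poly: "vector_field \<theta> \<Longrightarrow> contract \<theta> w \<in> poly_funs"
  unfolding contract_def[abs_def] vector_field_def by (intro poly_funs_sum poly_funs.mult J_comp(1)) auto

lemma contract_eq: "vector_field \<theta> \<Longrightarrow> x \<in> C \<Longrightarrow> contract \<theta> w x = J w x (field_at \<theta> x)"
  by (simp add: contract_def J_comp(2) vector_field_def field_at_def)

lemma J_scale: "v \<in> tangent_space C x \<Longrightarrow> J w x (c *s v) = c * J w x v"
  by (rule regular_diffs_scale[OF J_regular])

context
  fixes B :: "'n differential set set" and x0
  assumes finB: "finite B" and x0: "x0 \<in> U"
    and indep: "\<And>c. (\<lambda>x v. \<Sum>b\<in>B. c b * J [b] x v) \<in> exact_diffs C \<Longrightarrow> \<forall>b\<in>B. c b = 0"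
begin

text \<open>Elements of the coordinate ring are represented by polynomials, so a relation is trivial
  when all its coefficients lie in \<open>vanishing C\<close>.\<close>

definition relation :: "nat \<Rightarrow> ('n differential set list \<Rightarrow> complex ^ 'n \<Rightarrow> complex) \<Rightarrow> bool" where
  "relation n f \<longleftrightarrow> (\<forall>w. f w \<in> poly_funs) \<and> (\<forall>z\<in>U. (\<Sum>w\<in>words B n. f w (p z) * coeff x0 w z) = 0)"

text \<open>Coefficients of the relation obtained by deriving along \<theta>. Besides the derivative
  of \<open>f u\<close>, the word \<open>u\<close> receives \<open>f (u @ w)\<close> times the
  contraction of \<open>J w\<close>, from the summand of the differential of
  \<open>coeff x0 (u @ w)\<close> cut after \<open>u\<close>.\<close>

definition derived ::
    "nat \<Rightarrow> ('n \<Rightarrow> complex ^ 'n \<Rightarrow> complex) \<Rightarrow> ('n differential set list \<Rightarrow> complex ^ 'n \<Rightarrow> complex)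
      \<Rightarrow> 'n differential set list \<Rightarrow> complex ^ 'n \<Rightarrow> complex" where
  "derived n \<theta> f u x = derive_along \<theta> (f u) x +
     (\<Sum>w | w \<in> words B n \<and> w \<noteq> [] \<and> length u + length w \<le> n. f (u @ w) x * contract \<theta> w x)"

lemma relation_derived:
  assumes rel: "relation n f" and \<theta>: "vector_field \<theta>"
  shows "relation n (derived n \<theta> f)"
  unfolding relation_def
proof (intro conjI allI ballI)
  have f: "f w \<in> poly_funs" for w using rel by (simp add: relation_def)
  show "derived n \<theta> f u \<in> poly_funs" for u
    unfolding derived_def[abs_def]
    using f \<theta> contract_poly derive_along_poly by (intro poly_funs.add poly_funs_sum poly_funs.mult) auto
  fix z assume z: "z \<in> U"
  let ?\<beta> = "\<lambda>z v. \<Sum>w\<in>words B n. dir_deriv (f w) (p z) v * coeff x0 w z +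
      (\<Sum>k<length w. coeff x0 (take k w) z * J (drop k w) (p z) v) * f w (p z)"
  have 1: "dform (\<lambda>z. \<Sum>w\<in>words B n. f w (p z) * coeff x0 w z) ?\<beta>"
    by (intro dform_sum dform_mult dform_poly f coeff_dform x0)
  have 2: "dform (\<lambda>z. \<Sum>w\<in>words B n. f w (p z) * coeff x0 w z) (\<lambda>_ _. 0)"
    by (rule dform_cong[OF dform_const[of 0]]) (use rel in \<open>auto simp: relation_def\<close>)
  let ?v = "field_at \<theta> (p z)"
  have v: "?v \<in> tangent_space C (p z)" using \<theta> p_in_C[OF z] by (auto simp: vector_field_def)
  \<comment> \<open>The relation is the zero function on \<open>U\<close>, so its differential
    vanishes on every tangent vector.\<close>
  have "?\<beta> z ?v = 0"
  proof (rule dform_form_unique[OF 1 2 z v])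
    show "?\<beta> z (c *s v) = c * ?\<beta> z v" if "v \<in> tangent_space C (p z)" for v c
      unfolding sum_distrib_left
      by (intro sum.cong refl)
         (simp add: dir_deriv_linear(2)[OF f] J_scale[OF that] algebra_simps sum_distrib_left sum_distrib_right)
  qed simp
  also have "?\<beta> z ?v = (\<Sum>w\<in>words B n. derive_along \<theta> (f w) (p z) * coeff x0 w z) +
      (\<Sum>w\<in>words B n. \<Sum>k<length w. f w (p z) * contract \<theta> (drop k w) (p z) * coeff x0 (take k w) z)"
    using p_in_C[OF z] \<theta>
    by (simp add: derive_along_eq[OF f] contract_eq sum.distrib sum_distrib_left sum_distrib_right mult_ac)
  also have "(\<Sum>w\<in>words B n. \<Sum>k<length w. f w (p z) * contract \<theta> (drop k w) (p z) * coeff x0 (take k w) z) =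
      (\<Sum>(w, k)\<in>(SIGMA w:words B n. {..<length w}). f w (p z) * contract \<theta> (drop k w) (p z) * coeff x0 (take k w) z)"
    by (simp add: sum.Sigma finite_words finB)
  \<comment> \<open>A word with a cut position is the same as a pair of a prefix and a nonempty
    suffix.\<close>
  also have "\<dots> = (\<Sum>(u, w)\<in>(SIGMA u:words B n. {w. w \<in> words B n \<and> w \<noteq> [] \<and> length u + length w \<le> n}).
      f (u @ w) (p z) * contract \<theta> w (p z) * coeff x0 u z)"
    by (rule sum.reindex_bij_witness[of _ "\<lambda>(u, w). (u @ w, length u)" "\<lambda>(w, k). (take k w, drop k w)"])
       (auto simp: words_def dest: in_set_takeD in_set_dropD)
  also have "\<dots> = (\<Sum>u\<in>words B n. \<Sum>w | w \<in> words B n \<and> w \<noteq> [] \<and> length u + length w \<le> n.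
      f (u @ w) (p z) * contract \<theta> w (p z) * coeff x0 u z)"
    by (simp add: sum.Sigma finite_words finB)
  finally show "(\<Sum>u\<in>words B n. derived n \<theta> f u (p z) * coeff x0 u z) = 0"
    by (simp add: derived_def distrib_right sum.distrib sum_distrib_right)
qed

lemma relation_add: "relation n f \<Longrightarrow> relation n g \<Longrightarrow> relation n (\<lambda>w x. f w x + g w x)"
  by (auto simp: relation_def poly_funs.add distrib_right sum.distrib)

lemma relation_mult: "relation n f \<Longrightarrow> Q \<in> poly_funs \<Longrightarrow> relation n (\<lambda>w x. Q x * f w x)"
  unfolding relation_def
  by (auto simp: poly_funs.mult mult.assoc sum_distrib_left[symmetric])

lemma derived_top: "length u = n \<Longrightarrow> derived n \<theta> f u = derive_along \<theta> (f u)"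
proof -
  assume "length u = n"
  then have "{w. w \<in> words B n \<and> w \<noteq> [] \<and> length u + length w \<le> n} = {}" by auto
  then show ?thesis by (simp only: derived_def[abs_def] sum.empty add_0_right)
qed

text \<open>
  The leading coefficients at \<open>w0\<close> of the relations under consideration form a differential ideal.
  If it were not zero, some relation would have leading coefficient \<open>1\<close>; its derivatives have fewer
  leading terms, hence vanish, and this makes a combination of the classes \<open>b\<close> exact.
\<close>

lemma relation_top:
  assumes IH: "\<And>f. relation n f \<Longrightarrow> (\<And>w. w \<in> words B n \<Longrightarrow> length w = n \<Longrightarrow> w \<notin> T \<Longrightarrow> f w \<in> vanishing C) \<Longrightarrow>
      \<forall>w\<in>words B n. f w \<in> vanishing C"
    and w0: "w0 \<in> words B n" "length w0 = n" "w0 \<notin> T"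
    and f: "relation n f" "\<And>w. w \<in> words B n \<Longrightarrow> length w = n \<Longrightarrow> w \<notin> insert w0 T \<Longrightarrow> f w \<in> vanishing C"
  shows "f w0 \<in> vanishing C"
proof (rule ccontr)
  assume nv: "f w0 \<notin> vanishing C"
  \<comment> \<open>This class of relations is closed under sums, multiples and derivation, which
    makes the coefficients at \<open>w0\<close> a differential ideal.\<close>
  define adm where "adm g \<longleftrightarrow> relation n g \<and>
    (\<forall>w. w \<in> words B n \<longrightarrow> length w = n \<longrightarrow> w \<notin> insert w0 T \<longrightarrow> g w \<in> vanishing C)" for g
  define I where "I = {g w0 | g. adm g}"
  have admf: "adm f" using f by (simp add: adm_def)
  have poly: "g w \<in> poly_funs" if "adm g" for g w using that by (simp add: adm_def relation_def)
  have vadd: "(\<lambda>x. P x + Q x) \<in> vanishing C" if "P \<in> vanishing C" "Q \<in> vanishing C" for P Q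
    using that by (auto simp: vanishing_def poly_funs.add)
  have vmul: "(\<lambda>x. Q x * P x) \<in> vanishing C" if "P \<in> vanishing C" "Q \<in> poly_funs" for P Q
    using that by (auto simp: vanishing_def poly_funs.mult)
  have vzero: "(\<lambda>_. 0) \<in> vanishing C" by (simp add: vanishing_def poly_funs.const)
  \<comment> \<open>A relation concentrated at \<open>w0\<close> with a coefficient that is zero on
    \<open>C\<close> holds trivially; it puts \<open>vanishing C\<close> into the ideal.\<close>
  have admv: "adm (\<lambda>w. if w = w0 then Q else (\<lambda>_. 0))" if "Q \<in> vanishing C" for Q
  proof -
    have "(\<Sum>w\<in>words B n. (if w = w0 then Q else (\<lambda>_. 0)) (p z) * coeff x0 w z) = 0" if "z \<in> U" for z
      using vanishingD(2)[OF \<open>Q \<in> vanishing C\<close> p_in_C[OF that]] by (intro sum.neutral) auto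
    then show ?thesis using that vzero by (auto simp: adm_def relation_def vanishing_def poly_funs.const)
  qed
  have "poly_ideal I"
    unfolding poly_ideal_def
  proof (intro conjI ballI)
    show "I \<subseteq> poly_funs" using poly by (auto simp: I_def)
    show "(\<lambda>_. 0) \<in> I" unfolding I_def using admv[OF vzero] by (intro CollectI exI[of _ "\<lambda>w. if w = w0 then (\<lambda>_. 0) else (\<lambda>_. 0)"]) auto
  next
    fix P Q assume "P \<in> I" "Q \<in> I"
    then obtain g h where "adm g" "adm h" "P = g w0" "Q = h w0" by (auto simp: I_def)
    then show "(\<lambda>x. P x + Q x) \<in> I"
      unfolding I_def by (intro CollectI exI[of _ "\<lambda>w x. g w x + h w x"]) (auto simp: adm_def relation_add vadd)
  next
    fix P Q :: "complex ^ 'n \<Rightarrow> complex" assume "P \<in> I" "Q \<in> poly_funs"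
    then obtain g where "adm g" "P = g w0" by (auto simp: I_def)
    with \<open>Q \<in> poly_funs\<close> show "(\<lambda>x. Q x * P x) \<in> I"
      unfolding I_def by (intro CollectI exI[of _ "\<lambda>w x. Q x * g w x"]) (auto simp: adm_def relation_mult vmul)
  qed
  moreover have "vanishing C \<subseteq> I"
  proof
    fix Q assume "Q \<in> vanishing C"
    from admv[OF this] show "Q \<in> I"
      unfolding I_def by (intro CollectI exI[of _ "\<lambda>w. if w = w0 then Q else (\<lambda>_. 0)"]) auto
  qed
  moreover have admd: "adm (derived n \<theta> g)" if "adm g" "vector_field \<theta>" for g \<theta>
    using that relation_derived[of n g \<theta>] derived_top derive_along_vanishing derive_along_poly poly
    by (auto simp: adm_def vanishing_def)
  moreover have "derive_along \<theta> P \<in> I" if \<theta>: "vector_field \<theta>" and PI: "P \<in> I" for \<theta> P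
  proof -
    obtain g where g: "adm g" "P = g w0" using PI by (auto simp: I_def)
    have "derived n \<theta> g w0 \<in> I" using admd[OF g(1) \<theta>] by (auto simp: I_def)
    then show ?thesis using derived_top[OF w0(2)] g(2) by simp
  qed
  moreover obtain y where "y \<in> C" "f w0 y \<noteq> 0" using nv poly[OF admf] by (auto simp: vanishing_def)
  moreover have "f w0 \<in> I" using admf by (auto simp: I_def)
  ultimately have "(\<lambda>_. 1) \<in> I" using differentially_simple[of I "f w0" y] by blast
  then obtain g where g: "adm g" "g w0 = (\<lambda>_. 1)" by (auto simp: I_def)
  have zero: "derived n \<theta> g w \<in> vanishing C" if \<theta>: "vector_field \<theta>" and w: "w \<in> words B n" for \<theta> w
  proof -
    have a: "adm (derived n \<theta> g)" by (rule admd[OF g(1) \<theta>])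
    have "derived n \<theta> g w0 x = 0" for x
      unfolding derived_top[OF w0(2)] g(2) using derive_along_eq[OF poly_funs.const[of 1], of \<theta> x] dir_deriv_simps(3)[OF poly_funs.const[of 1] poly_funs.const[of 1]] by simp
    then have "derived n \<theta> g w0 \<in> vanishing C" using poly[OF a] by (auto simp: vanishing_def)
    then have "\<forall>w\<in>words B n. derived n \<theta> g w \<in> vanishing C"
      using a by (intro IH) (auto simp: adm_def)
    then show ?thesis using w by blast
  qed
  show False
  proof (cases "w0 = []")
    \<comment> \<open>Here n = 0 and the relation reads 1 = 0 at \<open>x0\<close>.\<close>
    case True
    then have "words B n = {[]}" using w0(2) by (auto simp: words_def)
    then have "\<forall>z\<in>U. g [] (p z) * coeff x0 [] z = 0" using g(1) by (simp add: adm_def relation_def)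
    then show False using x0 g(2) True by (auto simp: coeff_Nil)
  next
    case False
    then obtain u b0 where ub: "w0 = u @ [b0]" by (metis rev_exhaust)
    have n: "n = Suc (length u)" and bB: "b0 \<in> B" and uW: "u \<in> words B n" using w0 ub by (auto simp: words_def)
    have ubW: "u @ [b] \<in> words B n" "length (u @ [b]) = n" if "b \<in> B" for b
      using that uW n by (auto simp: words_def)
    \<comment> \<open>At words of length \<open>n\<close> a derivation acts on the coefficient
      alone. As all derived coefficients vanish on \<open>C\<close>, these coefficients are
      constant.\<close>
    have "\<exists>c. \<forall>x\<in>C. g (u @ [b]) x = c" if b: "b \<in> B" for b
    proof (rule poly_constant[OF poly[OF g(1)]])
      fix x v assume x: "x \<in> C" "v \<in> tangent_space C x"
      obtain \<theta> a where \<theta>: "vector_field \<theta>" "v = a *s field_at \<theta> x" by (rule vector_field_spans[OF x])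
      have "derive_along \<theta> (g (u @ [b])) x = 0"
        using vanishingD(2)[OF zero[OF \<theta>(1) ubW(1)[OF b]] x(1)] derived_top[OF ubW(2)[OF b]] by simp
      then show "dir_deriv (g (u @ [b])) x v = 0"
        using dir_deriv_linear(2)[OF poly[OF g(1)]] by (simp add: \<theta>(2) derive_along_eq[OF poly[OF g(1)]])
    qed
    then have "\<forall>b\<in>B. \<exists>c. \<forall>x\<in>C. g (u @ [b]) x = c" by blast
    from bchoice[OF this] obtain c where c: "\<And>b x. b \<in> B \<Longrightarrow> x \<in> C \<Longrightarrow> g (u @ [b]) x = c b" by blast
    \<comment> \<open>\<open>u\<close> has length \<open>n - 1\<close>, so only a single letter can
      follow it; the components of \<open>J\<close> of higher degree drop out.\<close>
    have one: "{w. w \<in> words B n \<and> w \<noteq> [] \<and> length u + length w \<le> n} = (\<lambda>b. [b]) ` B"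
    proof (intro equalityI subsetI)
      fix w assume "w \<in> {w. w \<in> words B n \<and> w \<noteq> [] \<and> length u + length w \<le> n}"
      then have "length w = 1" "set w \<subseteq> B" using n by (auto simp: words_def le_Suc_eq)
      then show "w \<in> (\<lambda>b. [b]) ` B" by (cases w) auto
    qed (use n in \<open>auto simp: words_def\<close>)
    \<comment> \<open>The derived coefficient at \<open>u\<close>: the combination of the
      \<open>J [b]\<close> is the negative of the differential of \<open>g u\<close>.\<close>
    have sum0: "dir_deriv (g u) x v + (\<Sum>b\<in>B. c b * J [b] x v) = 0" if x: "x \<in> C" "v \<in> tangent_space C x" for x v
    proof -
      obtain \<theta> a where \<theta>: "vector_field \<theta>" "v = a *s field_at \<theta> x" by (rule vector_field_spans[OF x])
      have ft: "field_at \<theta> x \<in> tangent_space C x" using \<theta>(1) x(1) by (auto simp: vector_field_def)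
      have "derived n \<theta> g u x = 0" by (rule vanishingD(2)[OF zero[OF \<theta>(1) uW] x(1)])
      moreover have "derived n \<theta> g u x = dir_deriv (g u) x (field_at \<theta> x) + (\<Sum>b\<in>B. c b * J [b] x (field_at \<theta> x))"
        unfolding derived_def one derive_along_eq[OF poly[OF g(1)]]
        by (subst sum.reindex) (auto intro!: sum.cong simp: inj_on_def c x(1) contract_eq[OF \<theta>(1) x(1)])
      ultimately have "a * (dir_deriv (g u) x (field_at \<theta> x) + (\<Sum>b\<in>B. c b * J [b] x (field_at \<theta> x))) = 0" by simp
      then show ?thesis
        by (simp add: \<theta>(2) dir_deriv_linear(2)[OF poly[OF g(1)]] J_scale[OF ft] distrib_left sum_distrib_left mult.left_commute)
    qed
    have "(\<lambda>x v. \<Sum>b\<in>B. c b * J [b] x v) = dpoly C (\<lambda>x. (-1) * g u x)"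
    proof (intro ext)
      fix x v
      show "(\<Sum>b\<in>B. c b * J [b] x v) = dpoly C (\<lambda>x. (-1) * g u x) x v"
      proof (cases "x \<in> C \<and> v \<in> tangent_space C x")
        case True
        then show ?thesis
          using sum0[of x v] unfolding dpoly_cmult[OF poly[OF g(1)]] by (simp add: dpoly_def add_eq_0_iff)
      next
        case False
        have "J w x v = 0" for w using J_regular[of w] False by (auto simp: regular_diffs_def)
        then show ?thesis using False by (auto simp: dpoly_def)
      qed
    qed
    then have "(\<lambda>x v. \<Sum>b\<in>B. c b * J [b] x v) \<in> exact_diffs C"
      using poly[OF g(1)] poly_funs.mult[OF poly_funs.const[of "-1"]] by (auto simp: exact_diffs_dpoly)
    from indep[OF this] bB have "c b0 = 0" by blast
    moreover obtain x where "x \<in> C" using nonempty_C by blast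
    then have "c b0 = 1" using c[OF bB, of x] g(2) ub by simp
    ultimately show False by simp
  qed
qed

text \<open>Two nested inductions. The inner one enlarges the set \<open>T\<close> of words of
  length \<open>n\<close> at which the coefficient is not yet known to vanish; for empty
  \<open>T\<close> the relation lives on shorter words and the outer induction on \<open>n\<close>
  applies.\<close>

theorem coeff_independent:
  assumes "relation n f" "w \<in> words B n" shows "f w \<in> vanishing C"
proof -
  have step: "\<forall>w\<in>words B n. f w \<in> vanishing C"
    if low: "\<And>m g. n = Suc m \<Longrightarrow> relation m g \<Longrightarrow> \<forall>w\<in>words B m. g w \<in> vanishing C"
      and f: "relation n f" for n f
  proof -
    have "(\<And>w. w \<in> words B n \<Longrightarrow> length w = n \<Longrightarrow> w \<notin> T \<Longrightarrow> f w \<in> vanishing C) \<Longrightarrow> \<forall>w\<in>words B n. f w \<in> vanishing C"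
      if "finite T" "T \<subseteq> {w \<in> words B n. length w = n}" for T
      using that f
    proof (induction T arbitrary: f rule: finite_induct)
      case empty
      show ?case
      proof (cases n)
        case 0
        then show ?thesis using empty.prems(1) by (auto simp: words_def)
      next
        case (Suc m)
        have sub: "words B m \<subseteq> words B n" using Suc by (auto simp: words_def)
        have top: "f w \<in> vanishing C" if "w \<in> words B n" "w \<notin> words B m" for w
          using that Suc empty.prems(1)[of w] by (auto simp: words_def)
        have "relation m f"
          unfolding relation_def
        proof (intro conjI allI ballI)
          show "f w \<in> poly_funs" for w using empty.prems(3) by (simp add: relation_def)
          fix z assume z: "z \<in> U"
          have "(\<Sum>w\<in>words B m. f w (p z) * coeff x0 w z) = (\<Sum>w\<in>words B n. f w (p z) * coeff x0 w z)"
            using sub finite_words[OF finB] vanishingD(2)[OF top p_in_C[OF z]] by (intro sum.mono_neutral_left) auto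
          then show "(\<Sum>w\<in>words B m. f w (p z) * coeff x0 w z) = 0" using empty.prems(3) z by (simp add: relation_def)
        qed
        then show ?thesis using low[OF Suc] top by blast
      qed
    next
      case (insert w0 T)
      have sub: "T \<subseteq> {w \<in> words B n. length w = n}" using insert.prems(2) by auto
      have "f w0 \<in> vanishing C"
        by (rule relation_top[of n T w0 f]) (use insert sub in auto)
      then show ?case using insert.IH[OF _ sub insert.prems(3)] insert.prems(1) by auto
    qed
    from this[of "{w \<in> words B n. length w = n}"] show ?thesis
      using finite_words[OF finB, of n] by auto
  qed
  have main: "relation n f \<Longrightarrow> \<forall>w\<in>words B n. f w \<in> vanishing C" for n f
  proof (induction n arbitrary: f)
    case 0
    then show ?case by (rule step[rotated]) simp
  next
    case (Suc n)
    from Suc.prems show ?case by (rule step[rotated]) (use Suc.IH in simp)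
  qed
  then show ?thesis using assms by blast
qed

end

end

section \<open>The minimal stable subalgebra\<close>

context curve_cover
begin

lemma hol_funs_add: "f \<in> hol_funs U p \<Longrightarrow> g \<in> hol_funs U p \<Longrightarrow> (\<lambda>x. f x + g x) \<in> hol_funs U p"
  by (auto simp: hol_funs_def intro!: holomorphic_on_add)

lemma hol_funs_mult: "f \<in> hol_funs U p \<Longrightarrow> g \<in> hol_funs U p \<Longrightarrow> (\<lambda>x. f x * g x) \<in> hol_funs U p"
  by (auto simp: hol_funs_def intro!: holomorphic_on_mult)

lemma hol_funs_cmult: "f \<in> hol_funs U p \<Longrightarrow> (\<lambda>x. c * f x) \<in> hol_funs U p"
  by (auto simp: hol_funs_def intro!: holomorphic_on_mult)

lemma hol_funs_zero: "(\<lambda>_. 0) \<in> hol_funs U p"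
  by (auto simp: hol_funs_def)

lemma fun_alg_simps [simp]:
  "carrier (fun_alg S A) = A" "mult (fun_alg S A) = (\<lambda>f g x. f x * g x)"
  "one (fun_alg S A) = (\<lambda>x. if x \<in> S then 1 else 0)" "zero (fun_alg S A) = (\<lambda>_. 0)"
  "add (fun_alg S A) = (\<lambda>f g x. f x + g x)" "smult (fun_alg S A) = (\<lambda>c f x. c * f x)"
  by (simp_all add: fun_alg_def)

lemma module_O_hol: "module complex_ring (O_hol U p)"
proof (rule module.intro)
  show "cring complex_ring" by (rule cring_complex_ring)
  show "abelian_group (O_hol U p)"
  proof (rule abelian_groupI)
    fix f assume "f \<in> carrier (O_hol U p)"
    then show "\<exists>g\<in>carrier (O_hol U p). g \<oplus>\<^bsub>O_hol U p\<^esub> f = \<zero>\<^bsub>O_hol U p\<^esub>"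
      using hol_funs_cmult[of f "-1"] by (intro bexI[of _ "\<lambda>x. -1 * f x"]) auto
  qed (auto simp: hol_funs_add hol_funs_zero add_ac)
  show "module_axioms complex_ring (O_hol U p)"
  proof (rule module_axioms.intro)
    fix c f assume "f \<in> carrier (O_hol U p)"
    then show "c \<odot>\<^bsub>O_hol U p\<^esub> f \<in> carrier (O_hol U p)"
      unfolding fun_alg_simps by (rule hol_funs_cmult)
  qed (simp_all only: fun_alg_simps complex_ring_simps distrib_left distrib_right mult.assoc mult_1)
qed

lemma a_inv_O_hol: "f \<in> hol_funs U p \<Longrightarrow> a_inv (O_hol U p) f = (\<lambda>x. -1 * f x)"
proof -
  interpret module complex_ring "O_hol U p" by (rule module_O_hol)
  assume f: "f \<in> hol_funs U p"
  show ?thesis by (rule minus_equality) (use f hol_funs_cmult[OF f, of "-1"] in auto)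
qed

lemma stable_subalgebraI:
  assumes sub: "A \<subseteq> hol_funs U p" and z: "(\<lambda>_. 0) \<in> A" and one: "(\<lambda>x. if x \<in> U then 1 else 0) \<in> A"
    and add: "\<And>f g. f \<in> A \<Longrightarrow> g \<in> A \<Longrightarrow> (\<lambda>x. f x + g x) \<in> A"
    and mult: "\<And>f g. f \<in> A \<Longrightarrow> g \<in> A \<Longrightarrow> (\<lambda>x. f x * g x) \<in> A"
    and cm: "\<And>c f. f \<in> A \<Longrightarrow> (\<lambda>x. c * f x) \<in> A"
    and prim: "\<And>f \<omega> z0. f \<in> A \<Longrightarrow> \<omega> \<in> regular_diffs C \<Longrightarrow> z0 \<in> U \<Longrightarrow> primitive f \<omega> z0 \<in> A"
  shows "stable_subalgebra C U p A"
proof -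
  interpret module complex_ring "O_hol U p" by (rule module_O_hol)
  have "\<ominus>\<^bsub>O_hol U p\<^esub> f \<in> A" if "f \<in> A" for f
    using cm[OF that, of "-1"] a_inv_O_hol[of f] sub that by auto
  then have sm: "submodule A complex_ring (O_hol U p)"
    using sub z add cm by (intro submoduleI) auto
  then have "subgroup A (add_monoid (O_hol U p))" by (simp add: submodule_def)
  moreover have "submonoid A (O_hol U p)"
    by (rule submonoid.intro) (use sub one mult in auto)
  ultimately have "subring A (O_hol U p)" by (rule subring.intro)
  then show ?thesis using sm prim by (simp add: stable_subalgebra_def primitive_def)
qed

lemma stable_subalgebraD:
  assumes A: "stable_subalgebra C U p A"
  shows "A \<subseteq> hol_funs U p" "(\<lambda>_. 0) \<in> A" "(\<lambda>x. if x \<in> U then 1 else 0) \<in> A"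
    and "f \<in> A \<Longrightarrow> g \<in> A \<Longrightarrow> (\<lambda>x. f x + g x) \<in> A"
    and "f \<in> A \<Longrightarrow> g \<in> A \<Longrightarrow> (\<lambda>x. f x * g x) \<in> A"
    and "f \<in> A \<Longrightarrow> (\<lambda>x. c * f x) \<in> A"
    and "f \<in> A \<Longrightarrow> \<omega> \<in> regular_diffs C \<Longrightarrow> z0 \<in> U \<Longrightarrow> primitive f \<omega> z0 \<in> A"
proof -
  have r: "subring A (O_hol U p)" and m: "submodule A complex_ring (O_hol U p)"
    and st: "f \<in> A \<Longrightarrow> \<omega> \<in> regular_diffs C \<Longrightarrow> z0 \<in> U \<Longrightarrow> primitive f \<omega> z0 \<in> A" for f \<omega> z0
    using A by (auto simp: stable_subalgebra_def primitive_def)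
  have g: "subgroup A (add_monoid (O_hol U p))" and mon: "submonoid A (O_hol U p)"
    using r by (simp_all add: subring_def)
  show "A \<subseteq> hol_funs U p" using subgroup.subset[OF g] by simp
  show "(\<lambda>_. 0) \<in> A" using subgroup.one_closed[OF g] by simp
  show "(\<lambda>x. if x \<in> U then 1 else 0) \<in> A" using submonoid.one_closed[OF mon] by simp
  show "f \<in> A \<Longrightarrow> g \<in> A \<Longrightarrow> (\<lambda>x. f x + g x) \<in> A" using subgroup.m_closed[OF g, of f g] by simp
  show "f \<in> A \<Longrightarrow> g \<in> A \<Longrightarrow> (\<lambda>x. f x * g x) \<in> A" using submonoid.m_closed[OF mon, of f g] by simp
  show "f \<in> A \<Longrightarrow> (\<lambda>x. c * f x) \<in> A" using submodule.smult_closed[OF m, of c f] by simp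
  show "f \<in> A \<Longrightarrow> \<omega> \<in> regular_diffs C \<Longrightarrow> z0 \<in> U \<Longrightarrow> primitive f \<omega> z0 \<in> A" by (rule st)
qed

lemma stable_subalgebra_sum:
  assumes "stable_subalgebra C U p A" "\<And>k. k \<in> K \<Longrightarrow> f k \<in> A" shows "(\<lambda>x. \<Sum>k\<in>K. f k x) \<in> A"
  using assms(2)
  by (induction K rule: infinite_finite_induct) (auto intro: stable_subalgebraD[OF assms(1)])

text \<open>Integrating the unit against the differential of \<open>P\<close> gives \<open>P\<close>
  minus a constant, and constants belong to every unital subalgebra.\<close>

lemma stable_subalgebra_poly:
  assumes A: "stable_subalgebra C U p A" and P: "P \<in> poly_funs"
  shows "(\<lambda>z. if z \<in> U then P (p z) else 0) \<in> A"
proof -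
  obtain z0 where z0: "z0 \<in> U" using nonempty_U by blast
  let ?one = "\<lambda>x. if x \<in> U then 1 else 0"
  have "dform (\<lambda>z. P (p z)) (\<lambda>z v. ?one z * dpoly C P (p z) v)"
    by (rule dform_cong[OF dform_poly[OF P]]) (use p_in_C in \<open>auto simp: dpoly_def\<close>)
  then have "primitive ?one (dpoly C P) z0 = (\<lambda>z. if z \<in> U then P (p z) - P (p z0) else 0)"
    using P z0 by (intro primitive_eq dpoly_regular)
  moreover have "primitive ?one (dpoly C P) z0 \<in> A"
    by (rule stable_subalgebraD(7)[OF A stable_subalgebraD(3)[OF A] dpoly_regular[OF P] z0])
  ultimately have "(\<lambda>z. (if z \<in> U then P (p z) - P (p z0) else 0) + P (p z0) * ?one z) \<in> A"
    by (intro stable_subalgebraD(4)[OF A] stable_subalgebraD(6)[OF A] stable_subalgebraD(3)[OF A]) simp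
  moreover have "(\<lambda>z. (if z \<in> U then P (p z) - P (p z0) else 0) + P (p z0) * ?one z) = (\<lambda>z. if z \<in> U then P (p z) else 0)"
    by (simp add: fun_eq_iff)
  ultimately show ?thesis by simp
qed

end

section \<open>The span of the coefficients over the coordinate ring\<close>

context mc_curve
begin

text \<open>Adding one generator at a time gives an induction rule in place of explicit finite sums.
  The factor \<open>coeff\<close> supplies the extension by 0 outside \<open>U\<close>.\<close>

inductive_set hyperlogs :: "'u \<Rightarrow> ('u \<Rightarrow> complex) set" for x0 where
  zero: "(\<lambda>_. 0) \<in> hyperlogs x0"
| step: "g \<in> hyperlogs x0 \<Longrightarrow> P \<in> poly_funs \<Longrightarrow> w \<in> lists (carrier (H_space C)) \<Longrightarrow>
    (\<lambda>z. g z + P (p z) * coeff x0 w z) \<in> hyperlogs x0"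

lemma hyperlogs_add: 
  assumes "f \<in> hyperlogs x0" "g \<in> hyperlogs x0" shows "(\<lambda>z. f z + g z) \<in> hyperlogs x0"
  using assms(2)
proof induction
  case (step g P w)
  from hyperlogs.step[OF step.IH step.hyps(2,3)] show ?case by (simp add: add.assoc)
qed (simp add: assms(1))

lemma hyperlogs_gen: "P \<in> poly_funs \<Longrightarrow> w \<in> lists (carrier (H_space C)) \<Longrightarrow> (\<lambda>z. P (p z) * coeff x0 w z) \<in> hyperlogs x0"
  using hyperlogs.step[OF hyperlogs.zero] by simp

lemma hyperlogs_coeff: "w \<in> lists (carrier (H_space C)) \<Longrightarrow> coeff x0 w \<in> hyperlogs x0"
  using hyperlogs_gen[OF poly_funs.const[of 1]] by simp

lemma hyperlogs_poly_mult:
  assumes "f \<in> hyperlogs x0" "Q \<in> poly_funs" shows "(\<lambda>z. Q (p z) * f z) \<in> hyperlogs x0"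
  using assms(1)
proof induction
  case (step g P w)
  from hyperlogs.step[OF step.IH poly_funs.mult[OF assms(2) step.hyps(2)] step.hyps(3)]
  show ?case by (simp add: distrib_left mult.assoc)
qed (simp add: hyperlogs.zero)

lemma hyperlogs_cmult: "f \<in> hyperlogs x0 \<Longrightarrow> (\<lambda>z. c * f z) \<in> hyperlogs x0"
  using hyperlogs_poly_mult[OF _ poly_funs.const[of c]] .

lemma hyperlogs_diff: "f \<in> hyperlogs x0 \<Longrightarrow> g \<in> hyperlogs x0 \<Longrightarrow> (\<lambda>z. f z - g z) \<in> hyperlogs x0"
  using hyperlogs_add[of f x0 "\<lambda>z. (-1) * g z"] hyperlogs_cmult[of g x0 "-1"] by simp

lemma hyperlogs_sum: "(\<And>k. k \<in> K \<Longrightarrow> f k \<in> hyperlogs x0) \<Longrightarrow> (\<lambda>z. \<Sum>k\<in>K. f k z) \<in> hyperlogs x0"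
  by (induction K rule: infinite_finite_induct) (auto intro: hyperlogs.zero hyperlogs_add)

lemma hyperlogs_sum_list: "(\<And>k. k \<in> set ks \<Longrightarrow> f k \<in> hyperlogs x0) \<Longrightarrow> (\<lambda>z. \<Sum>k\<leftarrow>ks. f k z) \<in> hyperlogs x0"
  by (induction ks) (auto intro: hyperlogs.zero hyperlogs_add)

context
  fixes x0 assumes x0: "x0 \<in> U"
begin

lemma hyperlogs_outside: "f \<in> hyperlogs x0 \<Longrightarrow> z \<notin> U \<Longrightarrow> f z = 0"
  by (induction rule: hyperlogs.induct) (auto simp: coeff_outside[OF x0])

lemma hyperlogs_hol: "f \<in> hyperlogs x0 \<Longrightarrow> f \<in> hol_funs U p"
proof (induction rule: hyperlogs.induct)
  case (step g P w)
  have "(\<lambda>z. (if z \<in> U then P (p z) else 0) * coeff x0 w z) \<in> hol_funs U p"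
    by (rule hol_funs_mult[OF pullback_hol[OF step.hyps(2)] coeff_hol[OF x0]])
  moreover have "(\<lambda>z. (if z \<in> U then P (p z) else 0) * coeff x0 w z) = (\<lambda>z. P (p z) * coeff x0 w z)"
    using coeff_outside[OF x0] by (auto simp: fun_eq_iff)
  ultimately show ?case using hol_funs_add[OF step.IH] by simp
qed (rule hol_funs_zero)

lemma coeff_sh': "sh (\<lambda>w. coeff x0 w z) u v = coeff x0 u z * coeff x0 v z"
proof (cases "z \<in> U")
  case False
  then have "sh (\<lambda>w. coeff x0 w z) u v = sh (\<lambda>_. 0) u v" using coeff_outside[OF x0] by simp
  then show ?thesis using False coeff_outside[OF x0] by simp
qed (rule coeff_sh[OF x0])

text \<open>The product of two coefficients is the sum of the coefficients over the shuffles of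
  their words; the general case follows by induction in each factor.\<close>

lemma hyperlogs_mult:
  assumes f: "f \<in> hyperlogs x0" and g: "g \<in> hyperlogs x0" shows "(\<lambda>z. f z * g z) \<in> hyperlogs x0"
proof -
  have cc: "(\<lambda>z. coeff x0 u z * coeff x0 w z) \<in> hyperlogs x0"
    if "u \<in> lists (carrier (H_space C))" "w \<in> lists (carrier (H_space C))" for u w
    unfolding coeff_sh'[symmetric]
    by (intro hyperlogs_sum_list hyperlogs_coeff) (use that set_shuffle_list[of _ u w] in auto)
  have 1: "(\<lambda>z. coeff x0 u z * f z) \<in> hyperlogs x0" if u: "u \<in> lists (carrier (H_space C))" for u
    using f
  proof induction
    case (step g P w)
    from hyperlogs_add[OF step.IH hyperlogs_poly_mult[OF cc[OF u step.hyps(3)] step.hyps(2)]]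
    show ?case by (simp add: algebra_simps)
  qed (simp add: hyperlogs.zero)
  show ?thesis using g
  proof induction
    case (step g P w)
    from hyperlogs_add[OF step.IH hyperlogs_poly_mult[OF 1[OF step.hyps(3)] step.hyps(2)]]
    show ?case by (simp add: algebra_simps)
  qed (simp add: hyperlogs.zero)
qed

text \<open>
  Modulo exact forms every \<open>\<omega>\<close> is \<open>J [h]\<close> for its class \<open>h\<close>; the exact part is integrated by parts, and
  \<open>coeff x0 (w @ [h])\<close> is a primitive of \<open>coeff x0 w\<close> times \<open>J [h]\<close> up to shorter words.
\<close>

lemma hyperlogs_primitive_word:
  assumes "w \<in> lists (carrier (H_space C))" "\<omega> \<in> regular_diffs C"
  shows "\<exists>G\<in>hyperlogs x0. dform G (\<lambda>z v. coeff x0 w z * \<omega> (p z) v)"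
  using assms
proof (induction "length w" arbitrary: w \<omega> rule: less_induct)
  case less
  define h where "h = de_rham C \<omega>"
  obtain P where P: "P \<in> poly_funs" "\<omega> = (\<lambda>x v. dpoly C P x v + J [h] x v)"
    unfolding h_def by (rule J_nondegenerate[OF less.prems(2)])
  have h: "h \<in> carrier (H_space C)" using less.prems(2) by (auto simp: h_def carrier_H)
  have tk: "take k w \<in> lists (carrier (H_space C))" for k using less.prems(1) by (auto dest: in_set_takeD)
  \<comment> \<open>Integrating the exact part by parts leaves \<open>P\<close> times the
    differential of \<open>coeff x0 w\<close>, whose summands have shorter words and the regular
    differentials \<open>P\<close> times \<open>J (drop k w)\<close>.\<close>
  have "\<forall>k\<in>{..<length w}. \<exists>G. G \<in> hyperlogs x0 \<and> dform G (\<lambda>z v. coeff x0 (take k w) z * (P (p z) * J (drop k w) (p z) v))"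
  proof
    fix k assume "k \<in> {..<length w}"
    then have "length (take k w) < length w" by simp
    from less.hyps[OF this tk regular_diffs_mult[OF J_regular[of "drop k w"] P(1)]]
    show "\<exists>G. G \<in> hyperlogs x0 \<and> dform G (\<lambda>z v. coeff x0 (take k w) z * (P (p z) * J (drop k w) (p z) v))"
      by blast
  qed
  from bchoice[OF this] obtain G where G: "\<And>k. k < length w \<Longrightarrow> G k \<in> hyperlogs x0"
    "\<And>k. k < length w \<Longrightarrow> dform (G k) (\<lambda>z v. coeff x0 (take k w) z * (P (p z) * J (drop k w) (p z) v))" by blast
  \<comment> \<open>In the differential of \<open>coeff x0 (w @ [h])\<close> only the cut after
    \<open>w\<close> gives \<open>J [h]\<close>; the earlier cuts carry shorter words and are
    subtracted.\<close>
  have "\<forall>k\<in>{..<length w}. \<exists>G. G \<in> hyperlogs x0 \<and> dform G (\<lambda>z v. coeff x0 (take k w) z * J (drop k w @ [h]) (p z) v)"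
  proof
    fix k assume "k \<in> {..<length w}"
    then have "length (take k w) < length w" by simp
    from less.hyps[OF this tk J_regular[of "drop k w @ [h]"]]
    show "\<exists>G. G \<in> hyperlogs x0 \<and> dform G (\<lambda>z v. coeff x0 (take k w) z * J (drop k w @ [h]) (p z) v)"
      by blast
  qed
  from bchoice[OF this] obtain G' where G': "\<And>k. k < length w \<Longrightarrow> G' k \<in> hyperlogs x0"
    "\<And>k. k < length w \<Longrightarrow> dform (G' k) (\<lambda>z v. coeff x0 (take k w) z * J (drop k w @ [h]) (p z) v)" by blast
  let ?G = "\<lambda>z. (P (p z) * coeff x0 w z - (\<Sum>k<length w. G k z)) + (coeff x0 (w @ [h]) z - (\<Sum>k<length w. G' k z))"
  have "?G \<in> hyperlogs x0"
    by (intro hyperlogs_add hyperlogs_diff hyperlogs_sum hyperlogs_gen hyperlogs_coeff)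
       (use P(1) less.prems(1) h G(1) G'(1) in auto)
  moreover have "dform ?G (\<lambda>z v. coeff x0 w z * \<omega> (p z) v)"
  proof (rule dform_cong[OF _ refl])
    show "dform ?G (\<lambda>z v. ((dir_deriv P (p z) v * coeff x0 w z + (\<Sum>k<length w. coeff x0 (take k w) z * J (drop k w) (p z) v) * P (p z))
        - (\<Sum>k<length w. coeff x0 (take k w) z * (P (p z) * J (drop k w) (p z) v)))
        + ((\<Sum>k<length (w @ [h]). coeff x0 (take k (w @ [h])) z * J (drop k (w @ [h])) (p z) v)
        - (\<Sum>k<length w. coeff x0 (take k w) z * J (drop k w @ [h]) (p z) v)))"
      by (intro dform_add dform_diff dform_mult dform_sum dform_poly P(1) coeff_dform[OF x0] G(2) G'(2)) auto
    fix z v assume z: "z \<in> U" "v \<in> tangent_space C (p z)"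
    have "(\<Sum>k<length (w @ [h]). coeff x0 (take k (w @ [h])) z * J (drop k (w @ [h])) (p z) v) =
        (\<Sum>k<length w. coeff x0 (take k w) z * J (drop k w @ [h]) (p z) v) + coeff x0 w z * J [h] (p z) v"
      by simp
    moreover have "dpoly C P (p z) v = dir_deriv P (p z) v" using z p_in_C by (simp add: dpoly_def)
    ultimately show "((dir_deriv P (p z) v * coeff x0 w z + (\<Sum>k<length w. coeff x0 (take k w) z * J (drop k w) (p z) v) * P (p z))
        - (\<Sum>k<length w. coeff x0 (take k w) z * (P (p z) * J (drop k w) (p z) v)))
        + ((\<Sum>k<length (w @ [h]). coeff x0 (take k (w @ [h])) z * J (drop k (w @ [h])) (p z) v)
        - (\<Sum>k<length w. coeff x0 (take k w) z * J (drop k w @ [h]) (p z) v)) = coeff x0 w z * \<omega> (p z) v"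
      by (simp add: P(2) sum_distrib_left sum_distrib_right algebra_simps)
  qed
  ultimately show ?case by blast
qed

text \<open>The polynomial factor is moved into the differential, so only the case of a single word
  has to be integrated.\<close>

lemma hyperlogs_primitive:
  assumes "f \<in> hyperlogs x0" "\<omega> \<in> regular_diffs C"
  shows "\<exists>G\<in>hyperlogs x0. dform G (\<lambda>z v. f z * \<omega> (p z) v)"
  using assms(1)
proof induction
  case zero
  then show ?case using dform_const[of 0] hyperlogs.zero by auto
next
  case (step g P w)
  obtain G where G: "G \<in> hyperlogs x0" "dform G (\<lambda>z v. g z * \<omega> (p z) v)" using step.IH by blast
  obtain G' where G': "G' \<in> hyperlogs x0" "dform G' (\<lambda>z v. coeff x0 w z * (P (p z) * \<omega> (p z) v))"
    using hyperlogs_primitive_word[OF step.hyps(3) regular_diffs_mult[OF assms(2) step.hyps(2)]] by blast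
  have "dform (\<lambda>z. G z + G' z) (\<lambda>z v. (g z + P (p z) * coeff x0 w z) * \<omega> (p z) v)"
    by (rule dform_cong[OF dform_add[OF G(2) G'(2)]]) (auto simp: algebra_simps)
  then show ?case using hyperlogs_add[OF G(1) G'(1)] by blast
qed

theorem hyperlogs_stable: "stable_subalgebra C U p (hyperlogs x0)"
proof (rule stable_subalgebraI)
  show "(\<lambda>x. if x \<in> U then 1 else 0) \<in> hyperlogs x0"
    using hyperlogs_coeff[of "[]" x0] by (simp add: coeff_Nil)
  fix f \<omega> z0 assume f: "f \<in> hyperlogs x0" and \<omega>: "\<omega> \<in> regular_diffs C" and z0: "z0 \<in> U"
  obtain G where G: "G \<in> hyperlogs x0" "dform G (\<lambda>z v. f z * \<omega> (p z) v)" using hyperlogs_primitive[OF f \<omega>] by blast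
  have "primitive f \<omega> z0 = (\<lambda>z. if z \<in> U then G z - G z0 else 0)" by (rule primitive_eq[OF G(2) \<omega> z0])
  \<comment> \<open>\<open>coeff x0 []\<close> is the unit, so the constant of integration stays in
    the span.\<close>
  also have "\<dots> = (\<lambda>z. G z - G z0 * coeff x0 [] z)"
    using hyperlogs_outside[OF G(1)] by (auto simp: fun_eq_iff coeff_Nil)
  also have "\<dots> \<in> hyperlogs x0" by (intro hyperlogs_diff hyperlogs_cmult hyperlogs_coeff G(1)) simp
  finally show "primitive f \<omega> z0 \<in> hyperlogs x0" .
qed (auto intro: hyperlogs.zero hyperlogs_add hyperlogs_mult hyperlogs_cmult hyperlogs_hol)

text \<open>The recursion for \<open>coeff\<close> uses only integration against regular
  differentials, so every stable subalgebra contains all coefficients.\<close>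

theorem hyperlogs_minimal:
  assumes A: "stable_subalgebra C U p A" shows "hyperlogs x0 \<subseteq> A"
proof
  have c: "coeff x0 w \<in> A" for w
  proof (induction "length w" arbitrary: w rule: less_induct)
    case less
    show ?case
    proof (cases "w = []")
      case True
      then show ?thesis using stable_subalgebraD(3)[OF A] by (simp add: coeff_Nil)
    next
      case False
      have "(\<lambda>z. \<Sum>k<length w. primitive (coeff x0 (take k w)) (J (drop k w)) x0 z) \<in> A"
        using less.hyps x0
        by (intro stable_subalgebra_sum[OF A] stable_subalgebraD(7)[OF A] J_regular) auto
      then show ?thesis using False by (subst coeff.simps) simp
    qed
  qed
  fix f assume "f \<in> hyperlogs x0"
  then show "f \<in> A"
  proof induction
    case (step g P w)
    have "(\<lambda>z. (if z \<in> U then P (p z) else 0) * coeff x0 w z) \<in> A"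
      by (rule stable_subalgebraD(5)[OF A stable_subalgebra_poly[OF A step.hyps(2)] c])
    moreover have "(\<lambda>z. (if z \<in> U then P (p z) else 0) * coeff x0 w z) = (\<lambda>z. P (p z) * coeff x0 w z)"
      using coeff_outside[OF x0] by (auto simp: fun_eq_iff)
    ultimately show ?case using stable_subalgebraD(4)[OF A step.IH] by simp
  qed (rule stable_subalgebraD(2)[OF A])
qed

corollary min_stable_hyperlogs:
  "min_stable_subalgebra C U p = (O_hol U p)\<lparr>carrier := hyperlogs x0\<rparr>"
proof -
  have "\<Inter>{A. stable_subalgebra C U p A} = hyperlogs x0"
    using hyperlogs_stable hyperlogs_minimal by blast
  then show ?thesis by (simp add: min_stable_subalgebra_def)
qed

end

end

section \<open>The shuffle algebra of the first de Rham cohomology\<close>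

lemma free_alg_carrier_diff:
  "r \<in> carrier (free_alg X e m) \<Longrightarrow> s \<in> carrier (free_alg X e m) \<Longrightarrow> r - s \<in> carrier (free_alg X e m)"
proof -
  have "Poly_Mapping.keys (r - s) \<subseteq> Poly_Mapping.keys r \<union> Poly_Mapping.keys s"
    by (auto simp: in_keys_iff lookup_minus)
  then show "r \<in> carrier (free_alg X e m) \<Longrightarrow> s \<in> carrier (free_alg X e m) \<Longrightarrow> r - s \<in> carrier (free_alg X e m)"
    by auto
qed

lemma free_alg_carrier_single: "x \<in> X \<Longrightarrow> Poly_Mapping.single x c \<in> carrier (free_alg X e m)"
  by auto

lemma keys_sum_subset: "(\<And>i. i \<in> I \<Longrightarrow> Poly_Mapping.keys (r i) \<subseteq> X) \<Longrightarrow> Poly_Mapping.keys (\<Sum>i\<in>I. r i) \<subseteq> X"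
proof (induction I rule: infinite_finite_induct)
  case (insert i I)
  then show ?case using keys_add[of "r i" "\<Sum>i\<in>I. r i"] by auto
qed auto

lemma
  assumes S: "S \<subseteq> carrier (free_alg X e m)"
  shows lin_span_add: "r \<in> lin_span (free_alg X e m) S \<Longrightarrow> s \<in> lin_span (free_alg X e m) S \<Longrightarrow> r + s \<in> lin_span (free_alg X e m) S"
    and lin_span_scale: "r \<in> lin_span (free_alg X e m) S \<Longrightarrow> pm_scale c r \<in> lin_span (free_alg X e m) S"
    and lin_span_zero: "0 \<in> lin_span (free_alg X e m) S"
    and lin_span_diff: "r \<in> lin_span (free_alg X e m) S \<Longrightarrow> s \<in> lin_span (free_alg X e m) S \<Longrightarrow> r - s \<in> lin_span (free_alg X e m) S"
    and lin_span_sum: "(\<And>i. i \<in> I \<Longrightarrow> f i \<in> lin_span (free_alg X e m) S) \<Longrightarrow> sum f I \<in> lin_span (free_alg X e m) S"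
proof -
  interpret module complex_ring "free_alg X e m" by (rule module_free_alg)
  let ?N = "lin_span (free_alg X e m) S"
  note sm = submodule_lin_span[OF module_free_alg S]
  show add: "r \<in> ?N \<Longrightarrow> s \<in> ?N \<Longrightarrow> r + s \<in> ?N" for r s using submoduleE(5)[OF sm, of r s] by simp
  show sc: "r \<in> ?N \<Longrightarrow> pm_scale c r \<in> ?N" for r c using submoduleE(4)[OF sm, of c r] by simp
  show z: "0 \<in> ?N" using sm subgroup.one_closed[of ?N "add_monoid (free_alg X e m)"] by (simp add: submodule_def)
  show "r \<in> ?N \<Longrightarrow> s \<in> ?N \<Longrightarrow> r - s \<in> ?N" for r s using add[OF _ sc[of s "-1"], of r] by (simp add: pm_scale_algebra)
  show "(\<And>i. i \<in> I \<Longrightarrow> f i \<in> ?N) \<Longrightarrow> sum f I \<in> ?N"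
    by (induction I rule: infinite_finite_induct) (auto intro: add z)
qed

lemma H_add_closed: "x \<in> carrier (H_space C) \<Longrightarrow> y \<in> carrier (H_space C) \<Longrightarrow> x \<oplus>\<^bsub>H_space C\<^esub> y \<in> carrier (H_space C)"
  by (auto simp: carrier_H de_rham_add regular_diffs_add)

lemma H_smult_closed: "x \<in> carrier (H_space C) \<Longrightarrow> c \<odot>\<^bsub>H_space C\<^esub> x \<in> carrier (H_space C)"
  by (auto simp: carrier_H de_rham_smult regular_diffs_cmult)

text \<open>The generating set inside \<open>shuffle_rels\<close>, named so that the facts on
  \<open>lin_span\<close> can be instantiated with it.\<close>

definition shuffle_gens :: "(complex, 'v) module \<Rightarrow> ('v list \<Rightarrow>\<^sub>0 complex) set" where
  "shuffle_gens V =
    ({Poly_Mapping.single (u @ (x \<oplus>\<^bsub>V\<^esub> y) # w) 1 - Poly_Mapping.single (u @ x # w) 1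
        - Poly_Mapping.single (u @ y # w) 1 | u x y w.
        u \<in> lists (carrier V) \<and> w \<in> lists (carrier V) \<and> x \<in> carrier V \<and> y \<in> carrier V}
     \<union> {Poly_Mapping.single (u @ (c \<odot>\<^bsub>V\<^esub> x) # w) 1 - Poly_Mapping.single (u @ x # w) c | c u x w.
        u \<in> lists (carrier V) \<and> w \<in> lists (carrier V) \<and> x \<in> carrier V})"

lemma shuffle_rels_gens: "shuffle_rels V = lin_span (shuffle_free V) (shuffle_gens V)"
  by (simp add: shuffle_rels_def shuffle_gens_def)

lemma shuffle_gens_carrier: "shuffle_gens (H_space C) \<subseteq> carrier (shuffle_free (H_space C))"
proof -
  let ?V = "H_space C"
  have w: "u @ x # w \<in> lists (carrier ?V)"
    if "u \<in> lists (carrier ?V)" "w \<in> lists (carrier ?V)" "x \<in> carrier ?V" for u x w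
    using that by simp
  have "Poly_Mapping.single (u @ (x \<oplus>\<^bsub>?V\<^esub> y) # w) 1 - Poly_Mapping.single (u @ x # w) 1
        - Poly_Mapping.single (u @ y # w) 1 \<in> carrier (shuffle_free ?V)"
    if "u \<in> lists (carrier ?V)" "w \<in> lists (carrier ?V)" "x \<in> carrier ?V" "y \<in> carrier ?V" for u w x y
    unfolding shuffle_free_def using that
    by (intro free_alg_carrier_diff free_alg_carrier_single w H_add_closed)
  moreover have "Poly_Mapping.single (u @ (c \<odot>\<^bsub>?V\<^esub> x) # w) 1 - Poly_Mapping.single (u @ x # w) c \<in> carrier (shuffle_free ?V)"
    if "u \<in> lists (carrier ?V)" "w \<in> lists (carrier ?V)" "x \<in> carrier ?V" for u w x c
    unfolding shuffle_free_def using that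
    by (intro free_alg_carrier_diff free_alg_carrier_single w H_smult_closed)
  ultimately show ?thesis unfolding shuffle_gens_def by blast
qed

definition shuffle_class :: "(complex ^ 'n) set \<Rightarrow> ('n differential set list \<Rightarrow>\<^sub>0 complex) \<Rightarrow> ('n differential set list \<Rightarrow>\<^sub>0 complex) set" where
  "shuffle_class C r = shuffle_rels (H_space C) +>\<^bsub>shuffle_free (H_space C)\<^esub> r"

context
  fixes C :: "(complex ^ 'n) set"
begin

lemma module_shuffle_free: "module complex_ring (shuffle_free (H_space C))"
  unfolding shuffle_free_def by (rule module_free_alg)

lemma submodule_shuffle_rels: "submodule (shuffle_rels (H_space C)) complex_ring (shuffle_free (H_space C))"
  unfolding shuffle_rels_gens by (rule submodule_lin_span[OF module_shuffle_free shuffle_gens_carrier])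

lemma shuffle_free_simps [simp]:
  "carrier (shuffle_free (H_space C)) = {r. Poly_Mapping.keys r \<subseteq> lists (carrier (H_space C))}"
  "add (shuffle_free (H_space C)) = (+)" "smult (shuffle_free (H_space C)) = pm_scale"
  by (simp_all add: shuffle_free_def)

lemmas shuffle_rels_closed =
  lin_span_add[OF shuffle_gens_carrier[of C, unfolded shuffle_free_def], folded shuffle_free_def, folded shuffle_rels_gens]
  lin_span_scale[OF shuffle_gens_carrier[of C, unfolded shuffle_free_def], folded shuffle_free_def, folded shuffle_rels_gens]
  lin_span_zero[OF shuffle_gens_carrier[of C, unfolded shuffle_free_def], folded shuffle_free_def, folded shuffle_rels_gens]
  lin_span_diff[OF shuffle_gens_carrier[of C, unfolded shuffle_free_def], folded shuffle_free_def, folded shuffle_rels_gens]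
  lin_span_sum[OF shuffle_gens_carrier[of C, unfolded shuffle_free_def], folded shuffle_free_def, folded shuffle_rels_gens]

lemma carrier_Sh: "carrier (Sh (H_space C)) = {shuffle_class C r | r. Poly_Mapping.keys r \<subseteq> lists (carrier (H_space C))}"
  using quot_carrier[OF module_shuffle_free submodule_shuffle_rels]
  by (simp add: Sh_def shuffle_class_def)

lemma shuffle_class_add:
  "Poly_Mapping.keys r \<subseteq> lists (carrier (H_space C)) \<Longrightarrow> Poly_Mapping.keys s \<subseteq> lists (carrier (H_space C)) \<Longrightarrow>
    shuffle_class C r \<oplus>\<^bsub>Sh (H_space C)\<^esub> shuffle_class C s = shuffle_class C (r + s)"
  using quot_add[OF module_shuffle_free submodule_shuffle_rels, of r s] by (simp add: Sh_def shuffle_class_def)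

lemma shuffle_class_smult:
  "Poly_Mapping.keys r \<subseteq> lists (carrier (H_space C)) \<Longrightarrow>
    c \<odot>\<^bsub>Sh (H_space C)\<^esub> shuffle_class C r = shuffle_class C (pm_scale c r)"
  using quot_smult[OF module_shuffle_free submodule_shuffle_rels, of r c] by (simp add: Sh_def shuffle_class_def)

lemma shuffle_class_eqI:
  assumes "r - s \<in> shuffle_rels (H_space C)" "Poly_Mapping.keys s \<subseteq> lists (carrier (H_space C))"
  shows "shuffle_class C r = shuffle_class C s"
  using quot_class_add[OF module_shuffle_free submodule_shuffle_rels assms(1), of s] assms(2)
  by (simp add: shuffle_class_def)

lemma shuffle_class_mem:
  assumes "Poly_Mapping.keys r \<subseteq> lists (carrier (H_space C))"
  shows "r \<in> shuffle_class C r" "s \<in> shuffle_class C r \<Longrightarrow> Poly_Mapping.keys s \<subseteq> lists (carrier (H_space C))"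
  using quot_rep_mem[OF module_shuffle_free submodule_shuffle_rels, of r]
    quot_mem_carrier[OF module_shuffle_free submodule_shuffle_rels, of r s] assms
  by (simp_all add: shuffle_class_def)

lemma Sh_one: "\<one>\<^bsub>Sh (H_space C)\<^esub> = shuffle_class C (Poly_Mapping.single [] 1)"
  by (simp add: Sh_def quot_alg_def shuffle_class_def shuffle_free_def)

lemma Sh_mult: "a \<otimes>\<^bsub>Sh (H_space C)\<^esub> b = (\<Union>r\<in>a. \<Union>s\<in>b. shuffle_class C (r \<otimes>\<^bsub>shuffle_free (H_space C)\<^esub> s))"
  by (simp add: Sh_def quot_alg_def rcoset_mult_def shuffle_class_def)

lemma lin_ext_shuffle_class:
  assumes ml: "multilinear (H_space C) \<phi>" and s: "s \<in> shuffle_class C r"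
  shows "lin_ext \<phi> s = lin_ext \<phi> r"
proof (rule lin_ext_class)
  show "shuffle_gens (H_space C) \<subseteq> carrier (free_alg (lists (carrier (H_space C))) [] (\<lambda>u v. \<Sum>w\<leftarrow>shuffle_list u v. Poly_Mapping.single w 1))"
    using shuffle_gens_carrier[of C] by (simp add: shuffle_free_def)
  show "lin_ext \<phi> g = 0" if "g \<in> shuffle_gens (H_space C)" for g
    using that ml unfolding shuffle_gens_def multilinear_def by auto
  show "s \<in> lin_span (free_alg (lists (carrier (H_space C))) [] (\<lambda>u v. \<Sum>w\<leftarrow>shuffle_list u v. Poly_Mapping.single w 1)) (shuffle_gens (H_space C)) +>\<^bsub>free_alg (lists (carrier (H_space C))) [] (\<lambda>u v. \<Sum>w\<leftarrow>shuffle_list u v. Poly_Mapping.single w 1)\<^esub> r"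
    using s by (simp add: shuffle_class_def shuffle_rels_gens shuffle_free_def)
qed

end

lemma pairing_eqI:
  assumes "r \<in> a" "\<And>s. s \<in> a \<Longrightarrow> lin_ext \<phi> s = c" shows "pairing a \<phi> = c"
  unfolding pairing_def lin_ext_def[symmetric] by (rule the_equality) (use assms in auto)

section \<open>The image of the shuffle algebra\<close>

context mc_curve
begin

section \<open>A finite basis of the cohomology\<close>

lemma de_rham_J: "h \<in> carrier (H_space C) \<Longrightarrow> de_rham C (J [h]) = h"
  using J by (simp add: MC_nd_def de_rham_def)

text \<open>Linear span of classes, phrased with differentials modulo exact ones instead of
  cosets.\<close>

definition spanned :: "'n differential set set \<Rightarrow> 'n differential \<Rightarrow> bool" where
  "spanned B \<omega> \<longleftrightarrow> (\<exists>c. \<exists>P\<in>poly_funs. \<omega> = (\<lambda>x v. (\<Sum>b\<in>B. c b * J [b] x v) + dpoly C P x v))"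

lemma spannedI: "P \<in> poly_funs \<Longrightarrow> (\<And>x v. \<omega> x v = (\<Sum>b\<in>B. c b * J [b] x v) + dpoly C P x v) \<Longrightarrow> spanned B \<omega>"
  unfolding spanned_def by (intro exI[of _ c] bexI[of _ P] ext) auto

lemma spanned_add:
  assumes "spanned B \<omega>" "spanned B \<eta>" shows "spanned B (\<lambda>x v. \<omega> x v + \<eta> x v)"
proof -
  obtain c P where P: "P \<in> poly_funs" "\<omega> = (\<lambda>x v. (\<Sum>b\<in>B. c b * J [b] x v) + dpoly C P x v)"
    using assms(1) unfolding spanned_def by blast
  obtain d Q where Q: "Q \<in> poly_funs" "\<eta> = (\<lambda>x v. (\<Sum>b\<in>B. d b * J [b] x v) + dpoly C Q x v)"
    using assms(2) unfolding spanned_def by blast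
  show ?thesis
    by (rule spannedI[where P = "\<lambda>x. P x + Q x" and c = "\<lambda>b. c b + d b"])
       (use P Q in \<open>auto simp: poly_funs.add dpoly_add distrib_right sum.distrib\<close>)
qed

lemma spanned_cmult:
  assumes "spanned B \<omega>" shows "spanned B (\<lambda>x v. a * \<omega> x v)"
proof -
  obtain c P where P: "P \<in> poly_funs" "\<omega> = (\<lambda>x v. (\<Sum>b\<in>B. c b * J [b] x v) + dpoly C P x v)"
    using assms(1) unfolding spanned_def by blast
  show ?thesis
    by (rule spannedI[where P = "\<lambda>x. a * P x" and c = "\<lambda>b. a * c b"])
       (use P in \<open>auto simp: poly_funs.intros dpoly_cmult distrib_left sum_distrib_left mult.assoc\<close>)
qed

lemma spanned_dpoly: "P \<in> poly_funs \<Longrightarrow> spanned B (dpoly C P)"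
  by (rule spannedI[where P = P and c = "\<lambda>_. 0"]) auto

lemma spanned_sum: "(\<And>k. k \<in> K \<Longrightarrow> spanned B (\<omega> k)) \<Longrightarrow> spanned B (\<lambda>x v. \<Sum>k\<in>K. c k * \<omega> k x v)"
proof (induction K rule: infinite_finite_induct)
  case (insert k K)
  then show ?case using spanned_add[OF spanned_cmult[of B "\<omega> k" "c k"]] by simp
qed (use spanned_dpoly[OF poly_funs.const[of 0]] in \<open>auto simp: dpoly_zero\<close>)

lemma spanned_J: "finite B \<Longrightarrow> b \<in> B \<Longrightarrow> spanned B (J [b])"
proof (rule spannedI[OF poly_funs.const[of 0], where c = "\<lambda>b'. if b' = b then 1 else 0"])
  fix x v assume B: "finite B" "b \<in> B"
  have "(\<Sum>b'\<in>B. (if b' = b then 1 else 0) * J [b'] x v) = (\<Sum>b'\<in>B. if b' = b then J [b'] x v else 0)"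
    by (rule sum.cong) auto
  then show "J [b] x v = (\<Sum>b'\<in>B. (if b' = b then 1 else 0) * J [b'] x v) + dpoly C (\<lambda>_. 0) x v"
    using B by (simp add: dpoly_zero)
qed

lemma spanned_trans:
  assumes "spanned B \<omega>" "\<And>b. b \<in> B \<Longrightarrow> spanned B' (J [b])" shows "spanned B' \<omega>"
proof -
  obtain c P where P: "P \<in> poly_funs" "\<omega> = (\<lambda>x v. (\<Sum>b\<in>B. c b * J [b] x v) + dpoly C P x v)"
    using assms(1) unfolding spanned_def by blast
  show ?thesis unfolding P(2) by (intro spanned_add spanned_sum spanned_dpoly P(1) assms(2))
qed

text \<open>The degree 1 component of \<open>J\<close> is a finite sum of differentials times linear
  forms, and \<open>J [h]\<close> represents \<open>h\<close>; hence the classes of these finitely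
  many differentials generate the cohomology.\<close>

lemma basis_exists:
  obtains B where "finite B" "B \<subseteq> carrier (H_space C)"
    "\<And>h. h \<in> carrier (H_space C) \<Longrightarrow> \<exists>c. h = de_rham C (\<lambda>x v. \<Sum>b\<in>B. c b * J [b] x v)"
    "\<And>c. (\<lambda>x v. \<Sum>b\<in>B. c b * J [b] x v) \<in> exact_diffs C \<Longrightarrow> \<forall>b\<in>B. c b = 0"
proof -
  define gen where "gen B \<longleftrightarrow> finite B \<and> B \<subseteq> carrier (H_space C) \<and> (\<forall>h. spanned B (J [h]))" for B
  have one: "(1::nat) \<ge> 1" by simp
  obtain m :: nat and \<omega> \<phi> where m: "\<And>k. k < m \<Longrightarrow> \<omega> k \<in> regular_diffs C"
    "\<And>k. k < m \<Longrightarrow> free_lie (H_space C) 1 (\<phi> k)"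
    "\<And>hs x v. length hs = 1 \<Longrightarrow> J hs x v = (\<Sum>k<m. \<omega> k x v * \<phi> k hs)"
    by (rule MC_expansion[OF J_MC one]) (rule that; assumption)
  define B0 where "B0 = (\<lambda>k. de_rham C (\<omega> k)) ` {..<m}"
  have B0: "finite B0" "B0 \<subseteq> carrier (H_space C)" using m(1) by (auto simp: B0_def carrier_H)
  have s\<omega>: "spanned B0 (\<omega> k)" if k: "k < m" for k
  proof -
    obtain P where P: "P \<in> poly_funs" "\<omega> k = (\<lambda>x v. dpoly C P x v + J [de_rham C (\<omega> k)] x v)"
      by (rule J_nondegenerate[OF m(1)[OF k]])
    have "spanned B0 (J [de_rham C (\<omega> k)])" using B0(1) k by (intro spanned_J) (auto simp: B0_def)
    from spanned_add[OF spanned_dpoly[OF P(1)] this] show ?thesis using P(2) by simp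
  qed
  have "spanned B0 (J [h])" for h
  proof -
    have "J [h] = (\<lambda>x v. \<Sum>k\<in>{..<m}. \<phi> k [h] * \<omega> k x v)" using m(3)[of "[h]"] by (simp add: fun_eq_iff mult.commute)
    then show ?thesis using spanned_sum[of "{..<m}" B0 \<omega> "\<lambda>k. \<phi> k [h]"] s\<omega> by simp
  qed
  then have "gen B0" using B0 by (simp add: gen_def)
  \<comment> \<open>A generating set of least cardinality is independent: an exact combination with
    a nonzero coefficient at \<open>b0\<close> would allow \<open>b0\<close> to be removed.\<close>
  from ex_has_least_nat[where P = gen and m = card, OF this]
  obtain B where B: "gen B" "\<And>B'. gen B' \<Longrightarrow> card B \<le> card B'" by blast
  have fin: "finite B" and sub: "B \<subseteq> carrier (H_space C)" and sp: "\<And>h. spanned B (J [h])"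
    using B(1) by (auto simp: gen_def)
  show thesis
  proof (rule that[OF fin sub])
    fix h assume h: "h \<in> carrier (H_space C)"
    obtain c P where P: "P \<in> poly_funs" "J [h] = (\<lambda>x v. (\<Sum>b\<in>B. c b * J [b] x v) + dpoly C P x v)"
      using sp unfolding spanned_def by blast
    have "J [h] = (\<lambda>x v. dpoly C P x v + (\<Sum>b\<in>B. c b * J [b] x v))" using P(2) by (simp add: add.commute)
    then have "h = de_rham C (\<lambda>x v. \<Sum>b\<in>B. c b * J [b] x v)"
      using de_rham_J[OF h] de_rham_add_exact[OF P(1) regular_diffs_sum[of B "\<lambda>b. J [b]" C c]] J_regular by simp
    then show "\<exists>c. h = de_rham C (\<lambda>x v. \<Sum>b\<in>B. c b * J [b] x v)" by blast
  next
    fix c assume ex: "(\<lambda>x v. \<Sum>b\<in>B. c b * J [b] x v) \<in> exact_diffs C"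
    show "\<forall>b\<in>B. c b = 0"
    proof (rule ccontr)
      assume "\<not> (\<forall>b\<in>B. c b = 0)"
      then obtain b0 where b0: "b0 \<in> B" "c b0 \<noteq> 0" by blast
      obtain Q where Q: "Q \<in> poly_funs" "(\<lambda>x v. \<Sum>b\<in>B. c b * J [b] x v) = dpoly C Q"
        using ex by (auto simp: exact_diffs_dpoly)
      have "spanned (B - {b0}) (J [b0])"
      proof (rule spannedI[where P = "\<lambda>x. (1 / c b0) * Q x" and c = "\<lambda>b. - (c b / c b0)"])
        show "(\<lambda>x. (1 / c b0) * Q x) \<in> poly_funs" using Q(1) by (intro poly_funs.intros)
        fix x v
        have "dpoly C Q x v = c b0 * J [b0] x v + (\<Sum>b\<in>B - {b0}. c b * J [b] x v)"
          unfolding Q(2)[symmetric] by (rule sum.remove[OF fin b0(1)])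
        then have "J [b0] x v = (1 / c b0) * dpoly C Q x v - (1 / c b0) * (\<Sum>b\<in>B - {b0}. c b * J [b] x v)"
          using b0(2) by (simp add: field_simps)
        then show "J [b0] x v = (\<Sum>b\<in>B - {b0}. - (c b / c b0) * J [b] x v) + dpoly C (\<lambda>x. (1 / c b0) * Q x) x v"
          unfolding dpoly_cmult[OF Q(1)] by (simp add: sum_distrib_left sum_negf sum_divide_distrib)
      qed
      then have "spanned (B - {b0}) (J [b])" if "b \<in> B" for b
        using spanned_J[of "B - {b0}" b] fin that by (cases "b = b0") auto
      then have "gen (B - {b0})" using fin sub sp spanned_trans[of B] by (auto simp: gen_def)
      then have "card B \<le> card (B - {b0})" by (rule B(2))
      then show False using fin b0(1) by (metis card_Diff1_less not_le)
    qed
  qed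
qed

section \<open>Evaluation of shuffle classes\<close>

lemma multilinear_coeff: "x0 \<in> U \<Longrightarrow> z \<in> U \<Longrightarrow> multilinear (H_space C) (\<lambda>hs. coeff x0 hs z)"
  using coeff_group_like[of x0 z] by (intro multilinear_completed) (auto simp: group_likes_def)

text \<open>Stated for any set on which evaluation is constant, so that it covers classes as well as
  products of classes, which are unions over representatives.\<close>

lemma f_tilde_class:
  assumes x0: "x0 \<in> U" and a: "r \<in> a" "\<And>s z. z \<in> U \<Longrightarrow> s \<in> a \<Longrightarrow> lin_ext (\<lambda>w. coeff x0 w z) s = lin_ext (\<lambda>w. coeff x0 w z) r"
  shows "f_tilde C U p J x0 a = (\<lambda>z. lin_ext (\<lambda>w. coeff x0 w z) r)"
proof
  fix z
  show "f_tilde C U p J x0 a z = lin_ext (\<lambda>w. coeff x0 w z) r"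
  proof (cases "z \<in> U")
    case True
    have "pairing a (\<lambda>w. coeff x0 w z) = lin_ext (\<lambda>w. coeff x0 w z) r"
      by (rule pairing_eqI[OF a(1) a(2)[OF True]])
    then show ?thesis using True by (simp add: f_tilde_def L_series_eq[OF x0])
  next
    case False
    then show ?thesis using coeff_outside[OF x0 False] by (simp add: f_tilde_def lin_ext_def)
  qed
qed

lemma f_tilde_shuffle_class:
  assumes "x0 \<in> U" "Poly_Mapping.keys r \<subseteq> lists (carrier (H_space C))"
  shows "f_tilde C U p J x0 (shuffle_class C r) = (\<lambda>z. lin_ext (\<lambda>w. coeff x0 w z) r)"
  by (rule f_tilde_class[OF assms(1) shuffle_class_mem(1)[OF assms(2)]])
     (rule lin_ext_shuffle_class[OF multilinear_coeff[OF assms(1)]])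

lemma f_tilde_image:
  "x0 \<in> U \<Longrightarrow> f_tilde C U p J x0 ` carrier (Sh (H_space C)) =
    {\<lambda>z. lin_ext (\<lambda>w. coeff x0 w z) r | r. Poly_Mapping.keys r \<subseteq> lists (carrier (H_space C))}"
proof (intro equalityI subsetI)
  fix f assume x0: "x0 \<in> U" and "f \<in> f_tilde C U p J x0 ` carrier (Sh (H_space C))"
  then obtain r where "f = f_tilde C U p J x0 (shuffle_class C r)" "Poly_Mapping.keys r \<subseteq> lists (carrier (H_space C))"
    unfolding carrier_Sh by blast
  with f_tilde_shuffle_class[OF x0 this(2)]
  show "f \<in> {\<lambda>z. lin_ext (\<lambda>w. coeff x0 w z) r | r. Poly_Mapping.keys r \<subseteq> lists (carrier (H_space C))}" by auto
next
  fix f assume x0: "x0 \<in> U" and "f \<in> {\<lambda>z. lin_ext (\<lambda>w. coeff x0 w z) r | r. Poly_Mapping.keys r \<subseteq> lists (carrier (H_space C))}"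
  then obtain r where r: "f = (\<lambda>z. lin_ext (\<lambda>w. coeff x0 w z) r)" "Poly_Mapping.keys r \<subseteq> lists (carrier (H_space C))"
    by blast
  have "shuffle_class C r \<in> carrier (Sh (H_space C))" using r(2) unfolding carrier_Sh by blast
  then show "f \<in> f_tilde C U p J x0 ` carrier (Sh (H_space C))"
    by (rule rev_image_eqI) (simp only: r(1) f_tilde_shuffle_class[OF x0 r(2)])
qed

lemma f_tilde_image_subset:
  assumes x0: "x0 \<in> U" and x1: "x1 \<in> U"
  shows "f_tilde C U p J x0 ` carrier (Sh (H_space C)) \<subseteq> f_tilde C U p J x1 ` carrier (Sh (H_space C))"
  unfolding f_tilde_image[OF x0] f_tilde_image[OF x1]
proof clarify
  fix r :: "'n differential set list \<Rightarrow>\<^sub>0 complex"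
  assume r: "Poly_Mapping.keys r \<subseteq> lists (carrier (H_space C))"
  \<comment> \<open>Deconcatenation of \<open>r\<close>, with each prefix replaced by its value at
    \<open>x1\<close> for the base point \<open>x0\<close>.\<close>
  define s where "s = (\<Sum>w\<in>Poly_Mapping.keys r. \<Sum>k\<le>length w.
      Poly_Mapping.single (drop k w) (Poly_Mapping.lookup r w * coeff x0 (take k w) x1))"
  have "Poly_Mapping.keys s \<subseteq> lists (carrier (H_space C))"
    unfolding s_def using r by (intro keys_sum_subset) (auto dest: in_set_dropD)
  moreover have "lin_ext (\<lambda>w. coeff x0 w z) r = lin_ext (\<lambda>w. coeff x1 w z) s" for z
  proof -
    have c: "coeff x0 w z = (\<Sum>k\<le>length w. coeff x0 (take k w) x1 * coeff x1 (drop k w) z)" for w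
      using coeff_change_base[OF x0 x1] coeff_outside[OF x0] coeff_outside[OF x1] by (cases "z \<in> U") auto
    show ?thesis unfolding s_def lin_ext_sum lin_ext_single lin_ext_def[of _ r]
      by (subst c) (simp add: sum_distrib_left mult.assoc)
  qed
  ultimately show "\<exists>s. (\<lambda>z. lin_ext (\<lambda>w. coeff x0 w z) r) = (\<lambda>z. lin_ext (\<lambda>w. coeff x1 w z) s) \<and>
      Poly_Mapping.keys s \<subseteq> lists (carrier (H_space C))" by blast
qed

context
  fixes x0 assumes x0: "x0 \<in> U"
begin

abbreviation ft where "ft \<equiv> f_tilde C U p J x0"
abbreviation S where "S \<equiv> Sh (H_space C)"
abbreviation HL where "HL \<equiv> lists (carrier (H_space C))"

lemma ft_add: "a \<in> carrier S \<Longrightarrow> b \<in> carrier S \<Longrightarrow> ft (a \<oplus>\<^bsub>S\<^esub> b) z = ft a z + ft b z"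
proof -
  assume "a \<in> carrier S" "b \<in> carrier S"
  then obtain r s where rs: "a = shuffle_class C r" "b = shuffle_class C s" "Poly_Mapping.keys r \<subseteq> HL" "Poly_Mapping.keys s \<subseteq> HL"
    unfolding carrier_Sh by blast
  have "Poly_Mapping.keys (r + s) \<subseteq> HL" using keys_add[of r s] rs by blast
  then show ?thesis by (simp add: rs shuffle_class_add f_tilde_shuffle_class[OF x0])
qed

lemma ft_smult: "a \<in> carrier S \<Longrightarrow> ft (c \<odot>\<^bsub>S\<^esub> a) z = c * ft a z"
proof -
  assume "a \<in> carrier S"
  then obtain r where r: "a = shuffle_class C r" "Poly_Mapping.keys r \<subseteq> HL" unfolding carrier_Sh by blast
  have "Poly_Mapping.keys (pm_scale c r) \<subseteq> HL" using keys_pm_scale[of c r] r by blast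
  then show ?thesis by (simp add: r shuffle_class_smult f_tilde_shuffle_class[OF x0])
qed

lemma ft_one: "ft \<one>\<^bsub>S\<^esub> z = (if z \<in> U then 1 else 0)"
  by (simp add: Sh_one f_tilde_shuffle_class[OF x0] coeff_Nil)

text \<open>On representatives \<open>coeff_sh'\<close> turns the shuffle product into the pointwise
  one. As evaluation depends only on the classes of the factors, it is constant on the union that
  defines the product.\<close>

lemma ft_mult:
  assumes "a \<in> carrier S" "b \<in> carrier S" shows "ft (a \<otimes>\<^bsub>S\<^esub> b) z = ft a z * ft b z"
proof -
  obtain r s where rs: "a = shuffle_class C r" "b = shuffle_class C s" "Poly_Mapping.keys r \<subseteq> HL" "Poly_Mapping.keys s \<subseteq> HL"
    using assms unfolding carrier_Sh by blast
  let ?m = "mult (shuffle_free (H_space C))"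
  have prod: "lin_ext (\<lambda>w. coeff x0 w z) (?m x y) = lin_ext (\<lambda>w. coeff x0 w z) x * lin_ext (\<lambda>w. coeff x0 w z) y" for x y z
    unfolding shuffle_free_def by (rule lin_ext_mult) (simp add: o_def coeff_sh'[OF x0])
  have ml: "lin_ext (\<lambda>w. coeff x0 w z) y = lin_ext (\<lambda>w. coeff x0 w z) x" if "z \<in> U" "y \<in> shuffle_class C x" for x y z
    by (rule lin_ext_shuffle_class[OF multilinear_coeff[OF x0 that(1)] that(2)])
  have "ft (a \<otimes>\<^bsub>S\<^esub> b) = (\<lambda>z. lin_ext (\<lambda>w. coeff x0 w z) (?m r s))"
  proof (rule f_tilde_class[OF x0])
    have "Poly_Mapping.keys (?m r s) \<subseteq> HL"
      unfolding shuffle_free_def free_alg_def monoid.select_convs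
    proof (intro keys_sum_subset)
      fix x y assume xy: "x \<in> Poly_Mapping.keys r" "y \<in> Poly_Mapping.keys s"
      have ws: "Poly_Mapping.keys (\<Sum>w\<leftarrow>ws. Poly_Mapping.single w (1::complex)) \<subseteq> HL" if "set ws \<subseteq> HL" for ws
        using that
      proof (induction ws)
        case (Cons w ws)
        then show ?case using keys_add[of "Poly_Mapping.single w (1::complex)" "\<Sum>w\<leftarrow>ws. Poly_Mapping.single w 1"] by auto
      qed auto
      have "x \<in> HL" "y \<in> HL" using xy rs(3,4) by auto
      then have "set (shuffle_list x y) \<subseteq> HL" using set_shuffle_list[of _ x y] by (auto simp: in_lists_conv_set)
      from ws[OF this] show "Poly_Mapping.keys (pm_scale (Poly_Mapping.lookup r x * Poly_Mapping.lookup s y)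
          (\<Sum>w\<leftarrow>shuffle_list x y. Poly_Mapping.single w 1)) \<subseteq> HL"
        by (rule order_trans[OF keys_pm_scale])
    qed
    then show "?m r s \<in> a \<otimes>\<^bsub>S\<^esub> b"
      unfolding Sh_mult using shuffle_class_mem(1)[of _ C] rs by blast
    fix y z assume z: "z \<in> U" and "y \<in> a \<otimes>\<^bsub>S\<^esub> b"
    then obtain r' s' where "r' \<in> a" "s' \<in> b" "y \<in> shuffle_class C (?m r' s')" unfolding Sh_mult by blast
    then show "lin_ext (\<lambda>w. coeff x0 w z) y = lin_ext (\<lambda>w. coeff x0 w z) (?m r s)"
      using ml[OF z] rs by (simp add: prod)
  qed
  then show ?thesis using rs by (simp add: prod f_tilde_shuffle_class[OF x0])
qed

lemma ft_hyperlogs: "a \<in> carrier S \<Longrightarrow> ft a \<in> hyperlogs x0"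
proof -
  assume "a \<in> carrier S"
  then obtain r where r: "a = shuffle_class C r" "Poly_Mapping.keys r \<subseteq> HL" unfolding carrier_Sh by blast
  have "(\<lambda>z. \<Sum>w\<in>Poly_Mapping.keys r. Poly_Mapping.lookup r w * coeff x0 w z) \<in> hyperlogs x0"
    using r by (intro hyperlogs_sum hyperlogs_cmult hyperlogs_coeff) auto
  then show ?thesis using r by (simp add: f_tilde_shuffle_class[OF x0] lin_ext_def)
qed

end

end

section \<open>The tensor product with the coordinate ring\<close>

definition tensor_gens ::
    "(complex, 'a) module \<Rightarrow> (complex, 'b) module \<Rightarrow> ('a \<times> 'b \<Rightarrow>\<^sub>0 complex) set" where
  "tensor_gens A B =
    ({Poly_Mapping.single (a \<oplus>\<^bsub>A\<^esub> a', b) 1 - Poly_Mapping.single (a, b) 1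
        - Poly_Mapping.single (a', b) 1 | a a' b.
        a \<in> carrier A \<and> a' \<in> carrier A \<and> b \<in> carrier B}
     \<union> {Poly_Mapping.single (a, b \<oplus>\<^bsub>B\<^esub> b') 1 - Poly_Mapping.single (a, b) 1
        - Poly_Mapping.single (a, b') 1 | a b b'.
        a \<in> carrier A \<and> b \<in> carrier B \<and> b' \<in> carrier B}
     \<union> {Poly_Mapping.single (c \<odot>\<^bsub>A\<^esub> a, b) 1 - Poly_Mapping.single (a, b) c | c a b.
        a \<in> carrier A \<and> b \<in> carrier B}
     \<union> {Poly_Mapping.single (a, c \<odot>\<^bsub>B\<^esub> b) 1 - Poly_Mapping.single (a, b) c | c a b.
        a \<in> carrier A \<and> b \<in> carrier B})"

lemma tensor_rels_gens: "tensor_rels A B = lin_span (tensor_free A B) (tensor_gens A B)"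
  by (simp add: tensor_rels_def tensor_gens_def)

lemma tensor_free_simps [simp]:
  "carrier (tensor_free A B) = {r. Poly_Mapping.keys r \<subseteq> carrier A \<times> carrier B}"
  "add (tensor_free A B) = (+)" "smult (tensor_free A B) = pm_scale"
  "one (tensor_free A B) = Poly_Mapping.single (\<one>\<^bsub>A\<^esub>, \<one>\<^bsub>B\<^esub>) 1"
  by (simp_all add: tensor_free_def)

lemma tensor_free_diff:
  "r \<in> carrier (tensor_free A B) \<Longrightarrow> s \<in> carrier (tensor_free A B) \<Longrightarrow> r - s \<in> carrier (tensor_free A B)"
  unfolding tensor_free_def by (rule free_alg_carrier_diff)

text \<open>Closure under these operations is what places the bilinearity relations inside the free
  space on pairs.\<close>

locale tensor_product =
  fixes A :: "(complex, 'a) module" and B :: "(complex, 'b) module"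
  assumes A_add: "a \<in> carrier A \<Longrightarrow> a' \<in> carrier A \<Longrightarrow> a \<oplus>\<^bsub>A\<^esub> a' \<in> carrier A"
    and A_smult: "a \<in> carrier A \<Longrightarrow> c \<odot>\<^bsub>A\<^esub> a \<in> carrier A"
    and B_add: "b \<in> carrier B \<Longrightarrow> b' \<in> carrier B \<Longrightarrow> b \<oplus>\<^bsub>B\<^esub> b' \<in> carrier B"
    and B_smult: "b \<in> carrier B \<Longrightarrow> c \<odot>\<^bsub>B\<^esub> b \<in> carrier B"
begin

lemma tensor_gens_carrier: "tensor_gens A B \<subseteq> carrier (tensor_free A B)"
proof -
  have s: "Poly_Mapping.single (a, b) c \<in> carrier (tensor_free A B)" if "a \<in> carrier A" "b \<in> carrier B" for a b c
    using that by simp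
  show ?thesis
    unfolding tensor_gens_def
    by (intro Un_least subsetI; elim CollectE exE conjE; hypsubst;
        intro tensor_free_diff s A_add A_smult B_add B_smult; assumption)
qed

lemmas tensor_rels_closed =
  lin_span_add[OF tensor_gens_carrier[unfolded tensor_free_def], folded tensor_free_def, folded tensor_rels_gens]
  lin_span_scale[OF tensor_gens_carrier[unfolded tensor_free_def], folded tensor_free_def, folded tensor_rels_gens]
  lin_span_zero[OF tensor_gens_carrier[unfolded tensor_free_def], folded tensor_free_def, folded tensor_rels_gens]
  lin_span_diff[OF tensor_gens_carrier[unfolded tensor_free_def], folded tensor_free_def, folded tensor_rels_gens]
  lin_span_sum[OF tensor_gens_carrier[unfolded tensor_free_def], folded tensor_free_def, folded tensor_rels_gens]

lemma module_tensor_free: "module complex_ring (tensor_free A B)"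
  unfolding tensor_free_def by (rule module_free_alg)

lemma submodule_tensor_rels: "submodule (tensor_rels A B) complex_ring (tensor_free A B)"
  unfolding tensor_rels_gens by (rule submodule_lin_span[OF module_tensor_free tensor_gens_carrier])

lemma tensor_rels_mem:
  "a \<in> carrier A \<Longrightarrow> a' \<in> carrier A \<Longrightarrow> b \<in> carrier B \<Longrightarrow>
    Poly_Mapping.single (a \<oplus>\<^bsub>A\<^esub> a', b) 1 - Poly_Mapping.single (a, b) 1 - Poly_Mapping.single (a', b) 1 \<in> tensor_rels A B"
  "a \<in> carrier A \<Longrightarrow> b \<in> carrier B \<Longrightarrow> b' \<in> carrier B \<Longrightarrow>
    Poly_Mapping.single (a, b \<oplus>\<^bsub>B\<^esub> b') 1 - Poly_Mapping.single (a, b) 1 - Poly_Mapping.single (a, b') 1 \<in> tensor_rels A B"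
  "a \<in> carrier A \<Longrightarrow> b \<in> carrier B \<Longrightarrow>
    Poly_Mapping.single (c \<odot>\<^bsub>A\<^esub> a, b) 1 - Poly_Mapping.single (a, b) c \<in> tensor_rels A B"
  "a \<in> carrier A \<Longrightarrow> b \<in> carrier B \<Longrightarrow>
    Poly_Mapping.single (a, c \<odot>\<^bsub>B\<^esub> b) 1 - Poly_Mapping.single (a, b) c \<in> tensor_rels A B"
  unfolding tensor_rels_gens
  by (rule subsetD[OF lin_span_superset], (unfold tensor_gens_def, blast)[1])+

text \<open>The universal property for scalar-valued bilinear maps; it is applied separately at each
  point of \<open>U\<close>.\<close>

lemma lin_ext_tensor_class:
  assumes t: "\<And>a a' b. a \<in> carrier A \<Longrightarrow> a' \<in> carrier A \<Longrightarrow> b \<in> carrier B \<Longrightarrow> t (a \<oplus>\<^bsub>A\<^esub> a', b) = t (a, b) + t (a', b)"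
    "\<And>a b b'. a \<in> carrier A \<Longrightarrow> b \<in> carrier B \<Longrightarrow> b' \<in> carrier B \<Longrightarrow> t (a, b \<oplus>\<^bsub>B\<^esub> b') = t (a, b) + t (a, b')"
    "\<And>c a b. a \<in> carrier A \<Longrightarrow> b \<in> carrier B \<Longrightarrow> t (c \<odot>\<^bsub>A\<^esub> a, b) = c * t (a, b)"
    "\<And>c a b. a \<in> carrier A \<Longrightarrow> b \<in> carrier B \<Longrightarrow> t (a, c \<odot>\<^bsub>B\<^esub> b) = c * t (a, b)"
    and s: "s \<in> tensor_rels A B +>\<^bsub>tensor_free A B\<^esub> r"
  shows "lin_ext t s = lin_ext t r"
proof (rule lin_ext_class[OF tensor_gens_carrier[unfolded tensor_free_def]])
  show "lin_ext t g = 0" if "g \<in> tensor_gens A B" for g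
    using that unfolding tensor_gens_def by (elim UnE) (auto simp: t)
  show "s \<in> lin_span (free_alg (carrier A \<times> carrier B) (\<one>\<^bsub>A\<^esub>, \<one>\<^bsub>B\<^esub>) (\<lambda>(a, b) (a', b'). Poly_Mapping.single (a \<otimes>\<^bsub>A\<^esub> a', b \<otimes>\<^bsub>B\<^esub> b') 1))
     (tensor_gens A B) +>\<^bsub>free_alg (carrier A \<times> carrier B) (\<one>\<^bsub>A\<^esub>, \<one>\<^bsub>B\<^esub>) (\<lambda>(a, b) (a', b'). Poly_Mapping.single (a \<otimes>\<^bsub>A\<^esub> a', b \<otimes>\<^bsub>B\<^esub> b') 1)\<^esub> r"
    using s by (simp add: tensor_rels_gens tensor_free_def)
qed

end

section \<open>Normal forms in the tensor product\<close>

context mc_curve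
begin

sublocale tp: tensor_product "Sh (H_space C)" "O_alg C"
proof
  show "a \<oplus>\<^bsub>Sh (H_space C)\<^esub> a' \<in> carrier (Sh (H_space C))"
    if "a \<in> carrier (Sh (H_space C))" "a' \<in> carrier (Sh (H_space C))" for a a'
  proof -
    obtain r s where rs: "a = shuffle_class C r" "a' = shuffle_class C s"
      "Poly_Mapping.keys r \<subseteq> lists (carrier (H_space C))" "Poly_Mapping.keys s \<subseteq> lists (carrier (H_space C))"
      using \<open>a \<in> _\<close> \<open>a' \<in> _\<close> unfolding carrier_Sh by blast
    then show ?thesis using keys_add[of r s] unfolding carrier_Sh by (auto simp: shuffle_class_add)
  qed
  show "c \<odot>\<^bsub>Sh (H_space C)\<^esub> a \<in> carrier (Sh (H_space C))" if "a \<in> carrier (Sh (H_space C))" for a c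
  proof -
    obtain r where r: "a = shuffle_class C r" "Poly_Mapping.keys r \<subseteq> lists (carrier (H_space C))"
      using \<open>a \<in> _\<close> unfolding carrier_Sh by blast
    then show ?thesis using keys_pm_scale[of c r] unfolding carrier_Sh by (auto simp: shuffle_class_smult)
  qed
  fix f g assume "f \<in> carrier (O_alg C)" "g \<in> carrier (O_alg C)"
  then obtain P Q where "f = (\<lambda>x. if x \<in> C then P x else 0)" "g = (\<lambda>x. if x \<in> C then Q x else 0)" "P \<in> poly_funs" "Q \<in> poly_funs"
    by (auto simp: regular_funs_def)
  then show "f \<oplus>\<^bsub>O_alg C\<^esub> g \<in> carrier (O_alg C)"
    by (auto simp: regular_funs_def fun_eq_iff intro!: exI[of _ "\<lambda>x. P x + Q x"] poly_funs.add)
next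
  fix f c assume "f \<in> carrier (O_alg C)"
  then obtain P where "f = (\<lambda>x. if x \<in> C then P x else 0)" "P \<in> poly_funs"
    by (auto simp: regular_funs_def)
  then show "c \<odot>\<^bsub>O_alg C\<^esub> f \<in> carrier (O_alg C)"
    by (auto simp: regular_funs_def fun_eq_iff intro!: exI[of _ "\<lambda>x. c * P x"] poly_funs.intros)
qed

abbreviation "TR \<equiv> tensor_rels (Sh (H_space C)) (O_alg C)"
abbreviation "TF \<equiv> tensor_free (Sh (H_space C)) (O_alg C)"
abbreviation "SR \<equiv> shuffle_rels (H_space C)"

lemma regular_zero: "(\<lambda>_. 0) \<in> regular_funs C"
  unfolding regular_funs_def by (intro CollectI exI[of _ "\<lambda>_. 0"]) (auto intro: poly_funs.const)

lemma regular_add: "f \<in> regular_funs C \<Longrightarrow> g \<in> regular_funs C \<Longrightarrow> (\<lambda>x. f x + g x) \<in> regular_funs C"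
  using tp.B_add by simp

lemma regular_cmult: "f \<in> regular_funs C \<Longrightarrow> (\<lambda>x. c * f x) \<in> regular_funs C"
  using tp.B_smult by simp

lemma shuffle_rels_mem:
  assumes "u \<in> lists (carrier (H_space C))" "w \<in> lists (carrier (H_space C))" "x \<in> carrier (H_space C)" "y \<in> carrier (H_space C)"
  shows "Poly_Mapping.single (u @ (x \<oplus>\<^bsub>H_space C\<^esub> y) # w) 1 - Poly_Mapping.single (u @ x # w) 1
        - Poly_Mapping.single (u @ y # w) 1 \<in> SR"
    "Poly_Mapping.single (u @ (c \<odot>\<^bsub>H_space C\<^esub> x) # w) 1 - Poly_Mapping.single (u @ x # w) c \<in> SR"
  unfolding shuffle_rels_gens
  using assms by - (rule subsetD[OF lin_span_superset], (unfold shuffle_gens_def, blast)[1])+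

definition word_class :: "'n differential set list \<Rightarrow> ('n differential set list \<Rightarrow>\<^sub>0 complex) set" where
  "word_class w = shuffle_class C (Poly_Mapping.single w 1)"

lemma words_lists: "w \<in> words B n \<Longrightarrow> w \<in> lists B"
  by (auto simp: words_def)

lemma single_zero_TR: "a \<in> carrier (Sh (H_space C)) \<Longrightarrow> Poly_Mapping.single (a, \<lambda>_. 0) 1 \<in> TR"
  using tp.tensor_rels_mem(4)[of a "\<lambda>_. 0" 0] regular_zero by simp

context
  fixes B
  assumes finB: "finite B" and subB: "B \<subseteq> carrier (H_space C)"
    and spanB: "\<And>h. h \<in> carrier (H_space C) \<Longrightarrow> \<exists>c. h = de_rham C (\<lambda>x v. \<Sum>b\<in>B. c b * J [b] x v)"
begin

text \<open>Multilinearity in one letter, by splitting off one basis class at a time.\<close>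

lemma letter_expansion:
  assumes uw: "u \<in> lists (carrier (H_space C))" "w \<in> lists (carrier (H_space C))" and K: "finite K" "K \<subseteq> B"
  shows "Poly_Mapping.single (u @ de_rham C (\<lambda>x v. \<Sum>b\<in>K. c b * J [b] x v) # w) 1
      - (\<Sum>b\<in>K. Poly_Mapping.single (u @ b # w) (c b)) \<in> SR"
  using K
proof (induction K rule: finite_induct)
  case empty
  \<comment> \<open>The empty combination is the zero class, which equals 0 times itself; scaling by
    0 therefore puts its word into the relations.\<close>
  have "0 \<odot>\<^bsub>H_space C\<^esub> de_rham C (\<lambda>_ _. 0) = de_rham C (\<lambda>_ _. 0)"
    using de_rham_smult[OF regular_diffs_zero[of C], of 0] by simp
  moreover have "de_rham C (\<lambda>_ _. 0) \<in> carrier (H_space C)" by (simp add: carrier_H regular_diffs_zero)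
  ultimately show ?case using shuffle_rels_mem(2)[OF uw, of "de_rham C (\<lambda>_ _. 0)" _ 0] by simp
next
  case (insert b K)
  let ?hK = "de_rham C (\<lambda>x v. \<Sum>b\<in>K. c b * J [b] x v)"
  have b: "b \<in> carrier (H_space C)" using insert.prems subB by auto
  have rK: "(\<lambda>x v. \<Sum>b\<in>K. c b * J [b] x v) \<in> regular_diffs C"
    by (rule regular_diffs_sum) (rule J_regular)
  then have hK: "?hK \<in> carrier (H_space C)" by (simp add: carrier_H)
  have cb: "c b \<odot>\<^bsub>H_space C\<^esub> b = de_rham C (\<lambda>x v. c b * J [b] x v)"
    using de_rham_smult[OF J_regular[of "[b]"], of "c b"] de_rham_J[OF b] by simp
  have "de_rham C (\<lambda>x v. \<Sum>b\<in>insert b K. c b * J [b] x v) = (c b \<odot>\<^bsub>H_space C\<^esub> b) \<oplus>\<^bsub>H_space C\<^esub> ?hK"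
    using de_rham_add[OF regular_diffs_cmult[OF J_regular[of "[b]"]] rK, of "c b"] insert.hyps by (simp add: cb)
  moreover have "Poly_Mapping.single (u @ ((c b \<odot>\<^bsub>H_space C\<^esub> b) \<oplus>\<^bsub>H_space C\<^esub> ?hK) # w) 1
      - Poly_Mapping.single (u @ (c b \<odot>\<^bsub>H_space C\<^esub> b) # w) 1 - Poly_Mapping.single (u @ ?hK # w) 1 \<in> SR"
    by (rule shuffle_rels_mem(1)[OF uw H_smult_closed[OF b] hK])
  moreover have "Poly_Mapping.single (u @ (c b \<odot>\<^bsub>H_space C\<^esub> b) # w) 1 - Poly_Mapping.single (u @ b # w) (c b) \<in> SR"
    by (rule shuffle_rels_mem(2)[OF uw b b])
  moreover have "Poly_Mapping.single (u @ ?hK # w) 1 - (\<Sum>b\<in>K. Poly_Mapping.single (u @ b # w) (c b)) \<in> SR"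
    using insert by auto
  ultimately show ?case
    using shuffle_rels_closed(1)[OF shuffle_rels_closed(1)] insert.hyps by (fastforce simp: algebra_simps)
qed

text \<open>The prefix \<open>u\<close> already consists of basis classes; the letters of
  \<open>v\<close> are expanded from left to right and moved into it.\<close>

lemma word_normal_form:
  assumes "u \<in> lists B" "v \<in> lists (carrier (H_space C))"
  shows "\<exists>s. Poly_Mapping.keys s \<subseteq> lists B \<and> Poly_Mapping.single (u @ v) 1 - s \<in> SR"
  using assms(2,1)
proof (induction v arbitrary: u rule: lists.induct)
  case Nil
  then show ?case by (intro exI[of _ "Poly_Mapping.single u 1"]) (simp add: shuffle_rels_closed(3))
next
  case (Cons h v)
  obtain c where c: "h = de_rham C (\<lambda>x v. \<Sum>b\<in>B. c b * J [b] x v)" using spanB[OF Cons.hyps(1)] by blast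
  have u: "u \<in> lists (carrier (H_space C))" using Cons.prems subB by auto
  have "\<forall>b\<in>B. \<exists>s. Poly_Mapping.keys s \<subseteq> lists B \<and> Poly_Mapping.single (u @ b # v) 1 - s \<in> SR"
  proof
    fix b assume "b \<in> B"
    then have "u @ [b] \<in> lists B" using Cons.prems by simp
    from Cons.IH[OF this] show "\<exists>s. Poly_Mapping.keys s \<subseteq> lists B \<and> Poly_Mapping.single (u @ b # v) 1 - s \<in> SR" by simp
  qed
  from bchoice[OF this] obtain s where s: "\<And>b. b \<in> B \<Longrightarrow> Poly_Mapping.keys (s b) \<subseteq> lists B"
    "\<And>b. b \<in> B \<Longrightarrow> Poly_Mapping.single (u @ b # v) 1 - s b \<in> SR" by blast
  have 1: "Poly_Mapping.single (u @ h # v) 1 - (\<Sum>b\<in>B. Poly_Mapping.single (u @ b # v) (c b)) \<in> SR"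
    unfolding c by (rule letter_expansion[OF u Cons.hyps(2) finB order_refl])
  have 2: "(\<Sum>b\<in>B. pm_scale (c b) (Poly_Mapping.single (u @ b # v) 1 - s b)) \<in> SR"
    by (intro shuffle_rels_closed(5) shuffle_rels_closed(2) s(2))
  have "Poly_Mapping.single (u @ h # v) 1 - (\<Sum>b\<in>B. pm_scale (c b) (s b)) \<in> SR"
    using shuffle_rels_closed(1)[OF 1 2] by (simp add: pm_scale_algebra sum_subtractf)
  moreover have "Poly_Mapping.keys (\<Sum>b\<in>B. pm_scale (c b) (s b)) \<subseteq> lists B"
    by (intro keys_sum_subset order_trans[OF keys_pm_scale] s(1))
  ultimately show ?case by blast
qed

lemma shuffle_normal_form:
  assumes r: "Poly_Mapping.keys r \<subseteq> lists (carrier (H_space C))"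
  shows "\<exists>s. Poly_Mapping.keys s \<subseteq> lists B \<and> r - s \<in> SR"
proof -
  have "\<forall>w\<in>Poly_Mapping.keys r. \<exists>s. Poly_Mapping.keys s \<subseteq> lists B \<and> Poly_Mapping.single w 1 - s \<in> SR"
    using word_normal_form[of "[]"] r by auto
  from bchoice[OF this] obtain s where s: "\<And>w. w \<in> Poly_Mapping.keys r \<Longrightarrow> Poly_Mapping.keys (s w) \<subseteq> lists B"
    "\<And>w. w \<in> Poly_Mapping.keys r \<Longrightarrow> Poly_Mapping.single w 1 - s w \<in> SR" by blast
  let ?s = "\<Sum>w\<in>Poly_Mapping.keys r. pm_scale (Poly_Mapping.lookup r w) (s w)"
  have "(\<Sum>w\<in>Poly_Mapping.keys r. pm_scale (Poly_Mapping.lookup r w) (Poly_Mapping.single w 1 - s w)) \<in> SR"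
    by (intro shuffle_rels_closed(5) shuffle_rels_closed(2) s(2))
  then have "r - ?s \<in> SR" by (simp add: pm_scale_algebra sum_subtractf poly_mapping_sum_single)
  moreover have "Poly_Mapping.keys ?s \<subseteq> lists B"
    by (intro keys_sum_subset order_trans[OF keys_pm_scale] s(1))
  ultimately show ?thesis by blast
qed

lemma word_class_carrier: "w \<in> lists B \<Longrightarrow> word_class w \<in> carrier (Sh (H_space C))"
  unfolding carrier_Sh word_class_def using subB by (intro CollectI exI[of _ "Poly_Mapping.single w 1"]) auto

text \<open>An element of the free module over the coordinate ring on the words in \<open>B\<close>
  of length at most \<open>n\<close>, with coefficients \<open>g\<close>.\<close>

definition normal_form where
  "normal_form n g = (\<Sum>w\<in>words B n. Poly_Mapping.single (word_class w, g w :: complex ^ 'n \<Rightarrow> complex) (1::complex))"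

text \<open>The bound \<open>n\<close> on the length makes the index set of the sum finite; it may
  be raised when elements with different bounds are added.\<close>

definition reducible where
  "reducible n r \<longleftrightarrow> (\<exists>g. (\<forall>w. g w \<in> regular_funs C) \<and> r - normal_form n g \<in> TR)"

lemma reducible_cong: "reducible n s \<Longrightarrow> r - s \<in> TR \<Longrightarrow> reducible n r"
  unfolding reducible_def using tp.tensor_rels_closed(1)[of "r - s" "s - normal_form n _"] by fastforce

lemma reducible_add:
  assumes "reducible n r" "reducible n s" shows "reducible n (r + s)"
proof -
  obtain g h where g: "\<And>w. g w \<in> regular_funs C" "r - normal_form n g \<in> TR"
    and h: "\<And>w. h w \<in> regular_funs C" "s - normal_form n h \<in> TR"
    using assms unfolding reducible_def by blast
  let ?gh = "\<lambda>w x. g w x + h w x"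
  have "(\<Sum>w\<in>words B n. Poly_Mapping.single (word_class w, ?gh w) 1 - Poly_Mapping.single (word_class w, g w) 1
      - Poly_Mapping.single (word_class w, h w) 1) \<in> TR"
    using tp.tensor_rels_mem(2)[OF word_class_carrier[OF words_lists], of _ _ "g _" "h _"] g(1) h(1)
    by (intro tp.tensor_rels_closed(5)) simp
  then have n: "normal_form n ?gh - normal_form n g - normal_form n h \<in> TR"
    by (simp add: normal_form_def sum_subtractf)
  have "(r - normal_form n g) + (s - normal_form n h) - (normal_form n ?gh - normal_form n g - normal_form n h) \<in> TR"
    by (rule tp.tensor_rels_closed(4)[OF tp.tensor_rels_closed(1)[OF g(2) h(2)] n])
  then have "r + s - normal_form n ?gh \<in> TR" by (simp add: algebra_simps)
  then show ?thesis unfolding reducible_def using regular_add[OF g(1) h(1)] by (intro exI[of _ ?gh]) simp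
qed

lemma reducible_scale:
  assumes "reducible n r" shows "reducible n (pm_scale c r)"
proof -
  obtain g where g: "\<And>w. g w \<in> regular_funs C" "r - normal_form n g \<in> TR"
    using assms unfolding reducible_def by blast
  let ?g = "\<lambda>w x. c * g w x"
  have "(\<Sum>w\<in>words B n. Poly_Mapping.single (word_class w, ?g w) 1 - Poly_Mapping.single (word_class w, g w) c) \<in> TR"
    using tp.tensor_rels_mem(4)[OF word_class_carrier[OF words_lists], of _ _ "g _" c] g(1)
    by (intro tp.tensor_rels_closed(5)) simp
  then have n: "normal_form n ?g - pm_scale c (normal_form n g) \<in> TR"
    by (simp add: normal_form_def sum_subtractf pm_scale_sum)
  have "pm_scale c (r - normal_form n g) - (normal_form n ?g - pm_scale c (normal_form n g)) \<in> TR"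
    by (rule tp.tensor_rels_closed(4)[OF tp.tensor_rels_closed(2)[OF g(2)] n])
  then have "pm_scale c r - normal_form n ?g \<in> TR" by (simp add: pm_scale_algebra)
  then show ?thesis unfolding reducible_def using regular_cmult[OF g(1)] by (intro exI[of _ ?g]) simp
qed

text \<open>Words outside \<open>K\<close> are given the coefficient 0, and tensors with zero second
  factor are relations.\<close>

lemma reducible_normal_form:
  assumes K: "K \<subseteq> words B n" and g: "\<And>w. g w \<in> regular_funs C"
  shows "reducible n (\<Sum>w\<in>K. Poly_Mapping.single (word_class w, g w) 1)"
proof -
  let ?g = "\<lambda>w. if w \<in> K then g w else (\<lambda>_. 0)"
  have fin: "finite (words B n)" by (rule finite_words[OF finB])
  have "(\<Sum>w\<in>words B n - K. Poly_Mapping.single (word_class w, \<lambda>_. 0) 1) \<in> TR"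
    by (intro tp.tensor_rels_closed(5) single_zero_TR word_class_carrier words_lists[of _ B n]) simp
  then have "0 - (\<Sum>w\<in>words B n - K. Poly_Mapping.single (word_class w, ?g w) 1) \<in> TR"
    by (intro tp.tensor_rels_closed(4)[OF tp.tensor_rels_closed(3)]) simp
  moreover have "normal_form n ?g = (\<Sum>w\<in>words B n - K. Poly_Mapping.single (word_class w, ?g w) 1)
      + (\<Sum>w\<in>K. Poly_Mapping.single (word_class w, ?g w) 1)"
    unfolding normal_form_def by (rule sum.subset_diff[OF K fin])
  ultimately have "(\<Sum>w\<in>K. Poly_Mapping.single (word_class w, g w) 1) - normal_form n ?g \<in> TR" by simp
  then show ?thesis
    unfolding reducible_def using g regular_zero by (intro exI[of _ ?g]) auto
qed

lemma reducible_mono: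
  assumes "reducible n r" "n \<le> n'" shows "reducible n' r"
proof -
  obtain g where g: "\<And>w. g w \<in> regular_funs C" "r - normal_form n g \<in> TR"
    using assms unfolding reducible_def by blast
  have "words B n \<subseteq> words B n'" using assms(2) by (auto simp: words_def)
  then have "reducible n' (normal_form n g)" unfolding normal_form_def by (rule reducible_normal_form) (rule g(1))
  then show ?thesis using g(2) by (rule reducible_cong)
qed

lemma reducible_zero: "reducible n 0"
  using reducible_normal_form[of "{}" n "\<lambda>_ _. 0"] regular_zero by simp

text \<open>The class \<open>a\<close> is rewritten as a combination of words in \<open>B\<close>;
  bilinearity then distributes it over the function \<open>f\<close>.\<close>

lemma reducible_pure:
  assumes a: "a \<in> carrier (Sh (H_space C))" and f: "f \<in> regular_funs C"
  shows "\<exists>n. reducible n (Poly_Mapping.single (a, f) 1)"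
proof -
  obtain r where r: "a = shuffle_class C r" "Poly_Mapping.keys r \<subseteq> lists (carrier (H_space C))"
    using a unfolding carrier_Sh by blast
  obtain s where s: "Poly_Mapping.keys s \<subseteq> lists B" "r - s \<in> SR" using shuffle_normal_form[OF r(2)] by blast
  have LB: "lists B \<subseteq> lists (carrier (H_space C))" using subB by auto
  have main: "\<exists>n. reducible n (Poly_Mapping.single (shuffle_class C (\<Sum>w\<in>K. Poly_Mapping.single w (c w)), f) 1)"
    if K: "finite K" "K \<subseteq> lists B" for K c
    using K
  proof (induction K rule: finite_induct)
    case empty
    have 0: "shuffle_class C 0 \<in> carrier (Sh (H_space C))" unfolding carrier_Sh by (intro CollectI exI[of _ 0]) auto
    have "0 \<odot>\<^bsub>Sh (H_space C)\<^esub> shuffle_class C 0 = shuffle_class C 0"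
      using shuffle_class_smult[of 0 C 0] by (simp add: pm_scale_algebra)
    then have "Poly_Mapping.single (shuffle_class C 0, f) 1 - 0 \<in> TR"
      using tp.tensor_rels_mem(3)[OF 0, of f 0] f by simp
    then show ?case using reducible_cong[OF reducible_zero] by auto
  next
    case (insert w K)
    let ?s = "\<Sum>w\<in>K. Poly_Mapping.single w (c w)"
    have w: "w \<in> lists B" "w \<in> lists (carrier (H_space C))" using insert.prems LB by auto
    have ks: "Poly_Mapping.keys ?s \<subseteq> lists (carrier (H_space C))"
      using insert.prems LB by (intro keys_sum_subset) auto
    then have sc: "shuffle_class C ?s \<in> carrier (Sh (H_space C))" unfolding carrier_Sh by blast
    have wc: "word_class w \<in> carrier (Sh (H_space C))" by (rule word_class_carrier[OF w(1)])
    have k1: "Poly_Mapping.keys (Poly_Mapping.single w x) \<subseteq> lists (carrier (H_space C))" for x :: complex using w by auto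
    have "c w \<odot>\<^bsub>Sh (H_space C)\<^esub> word_class w = shuffle_class C (Poly_Mapping.single w (c w))"
      unfolding word_class_def using shuffle_class_smult[OF k1[of 1], of "c w"] by simp
    then have eq: "shuffle_class C (\<Sum>w\<in>insert w K. Poly_Mapping.single w (c w)) =
        (c w \<odot>\<^bsub>Sh (H_space C)\<^esub> word_class w) \<oplus>\<^bsub>Sh (H_space C)\<^esub> shuffle_class C ?s"
      using shuffle_class_add[OF k1 ks, of "c w"] insert.hyps by simp
    obtain n where n: "reducible n (Poly_Mapping.single (shuffle_class C ?s, f) 1)" using insert by auto
    have "reducible (length w) (\<Sum>w\<in>{w}. Poly_Mapping.single (word_class w, f) 1)"
      by (rule reducible_normal_form) (use w f in \<open>auto simp: words_def\<close>)
    then have rw: "reducible (length w) (Poly_Mapping.single (word_class w, f) 1)" by simp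
    from reducible_scale[OF rw, of "c w"] have "reducible (length w) (Poly_Mapping.single (word_class w, f) (c w))" by simp
    then have "reducible (max n (length w)) (Poly_Mapping.single (shuffle_class C ?s, f) 1 + Poly_Mapping.single (word_class w, f) (c w))"
      by (intro reducible_add reducible_mono[OF n]) (auto intro: reducible_mono)
    moreover have "Poly_Mapping.single ((c w \<odot>\<^bsub>Sh (H_space C)\<^esub> word_class w) \<oplus>\<^bsub>Sh (H_space C)\<^esub> shuffle_class C ?s, f) 1
        - (Poly_Mapping.single (shuffle_class C ?s, f) 1 + Poly_Mapping.single (word_class w, f) (c w)) \<in> TR"
      using tp.tensor_rels_closed(1)[OF tp.tensor_rels_mem(1)[OF tp.A_smult[OF wc, of "c w"] sc, of f] tp.tensor_rels_mem(3)[OF wc, of f "c w"]] f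
      by (simp add: algebra_simps)
    ultimately show ?case unfolding eq using reducible_cong by blast
  qed
  \<comment> \<open>Only the shuffle class enters the tensor, so the representative may be replaced
    by one with letters in \<open>B\<close>.\<close>
  have "a = shuffle_class C s" unfolding r(1) by (rule shuffle_class_eqI[OF s(2)]) (use s(1) LB in blast)
  also have "s = (\<Sum>w\<in>Poly_Mapping.keys s. Poly_Mapping.single w (Poly_Mapping.lookup s w))"
    by (rule poly_mapping_sum_single[symmetric])
  finally have "a = shuffle_class C (\<Sum>w\<in>Poly_Mapping.keys s. Poly_Mapping.single w (Poly_Mapping.lookup s w))" .
  then show ?thesis using main[OF finite_keys s(1), of "Poly_Mapping.lookup s"] by simp
qed

lemma reducible_all:
  assumes r: "r \<in> carrier TF" shows "\<exists>n. reducible n r"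
proof -
  have "\<exists>n. reducible n (\<Sum>x\<in>K. Poly_Mapping.single x (Poly_Mapping.lookup r x))"
    if "finite K" "K \<subseteq> Poly_Mapping.keys r" for K
    using that
  proof (induction K rule: finite_induct)
    case (insert x K)
    obtain a f where x: "x = (a, f)" "a \<in> carrier (Sh (H_space C))" "f \<in> regular_funs C"
      using insert.prems r by (cases x) auto
    obtain n where n: "reducible n (\<Sum>x\<in>K. Poly_Mapping.single x (Poly_Mapping.lookup r x))" using insert by auto
    obtain n' where n': "reducible n' (Poly_Mapping.single x 1)" using reducible_pure[OF x(2,3)] x(1) by blast
    from reducible_scale[OF n', of "Poly_Mapping.lookup r x"]
    have "reducible n' (Poly_Mapping.single x (Poly_Mapping.lookup r x))" by simp
    then have "reducible (max n n') (Poly_Mapping.single x (Poly_Mapping.lookup r x) + (\<Sum>x\<in>K. Poly_Mapping.single x (Poly_Mapping.lookup r x)))"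
      by (intro reducible_add reducible_mono[OF n]) (auto intro: reducible_mono)
    then show ?case using insert.hyps by auto
  qed (use reducible_zero in auto)
  from this[OF finite_keys order_refl] show ?thesis by (simp only: poly_mapping_sum_single)
qed

end

section \<open>Evaluation of tensors as functions on the cover\<close>

definition ev :: "'u \<Rightarrow> 'u \<Rightarrow> ('n differential set list \<Rightarrow>\<^sub>0 complex) set \<times> (complex ^ 'n \<Rightarrow> complex) \<Rightarrow> complex" where
  "ev x0 z af = pullback U p (snd af) z * f_tilde C U p J x0 (fst af) z"

context
  fixes x0 assumes x0: "x0 \<in> U"
begin

lemma ev_class:
  assumes "s \<in> TR +>\<^bsub>TF\<^esub> r" shows "lin_ext (ev x0 z) s = lin_ext (ev x0 z) r"
  by (rule tp.lin_ext_tensor_class[OF _ _ _ _ assms])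
     (simp_all add: ev_def ft_add[OF x0] ft_smult[OF x0] pullback_def distrib_left distrib_right)

lemma ev_mult:
  assumes "r \<in> carrier TF" "s \<in> carrier TF"
  shows "lin_ext (ev x0 z) (r \<otimes>\<^bsub>TF\<^esub> s) = lin_ext (ev x0 z) r * lin_ext (ev x0 z) s"
  unfolding tensor_free_def
proof (rule lin_ext_mult)
  fix x y assume "x \<in> Poly_Mapping.keys r" "y \<in> Poly_Mapping.keys s"
  then have "x \<in> carrier (Sh (H_space C)) \<times> carrier (O_alg C)" "y \<in> carrier (Sh (H_space C)) \<times> carrier (O_alg C)"
    using assms unfolding tensor_free_simps by blast+
  then show "lin_ext (ev x0 z) ((case x of (a, b) \<Rightarrow> \<lambda>(a', b').
      Poly_Mapping.single (a \<otimes>\<^bsub>Sh (H_space C)\<^esub> a', b \<otimes>\<^bsub>O_alg C\<^esub> b') 1) y) = ev x0 z x * ev x0 z y"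
    by (auto simp: ev_def ft_mult[OF x0] pullback_def)
qed

lemma ev_hyperlogs:
  assumes "r \<in> carrier TF" shows "(\<lambda>z. lin_ext (ev x0 z) r) \<in> hyperlogs x0"
  unfolding lin_ext_def
proof (intro hyperlogs_sum hyperlogs_cmult)
  fix x assume "x \<in> Poly_Mapping.keys r"
  then have "x \<in> carrier (Sh (H_space C)) \<times> regular_funs C" using assms by auto
  then obtain a f where af: "x = (a, f)" "a \<in> carrier (Sh (H_space C))" "f \<in> regular_funs C" by (elim SigmaE) (rule that)
  then obtain P where P: "P \<in> poly_funs" "f = (\<lambda>x. if x \<in> C then P x else 0)" unfolding regular_funs_def by auto
  with af have x: "x = (a, \<lambda>x. if x \<in> C then P x else 0)" "a \<in> carrier (Sh (H_space C))" "P \<in> poly_funs" by simp_all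
  have "ev x0 z x = P (p z) * f_tilde C U p J x0 a z" for z
    using hyperlogs_outside[OF x0 ft_hyperlogs[OF x0 x(2)]] p_in_C by (auto simp: ev_def x(1) pullback_def)
  then show "(\<lambda>z. ev x0 z x) \<in> hyperlogs x0"
    using hyperlogs_poly_mult[OF ft_hyperlogs[OF x0 x(2)] x(3)] by simp
qed

lemma hyperlogs_eval:
  assumes "f \<in> hyperlogs x0" shows "\<exists>r\<in>carrier TF. f = (\<lambda>z. lin_ext (ev x0 z) r)"
  using assms
proof induction
  case zero
  then show ?case by (intro bexI[of _ 0]) auto
next
  case (step g P w)
  then obtain r where r: "r \<in> carrier TF" "g = (\<lambda>z. lin_ext (ev x0 z) r)" by blast
  let ?a = "shuffle_class C (Poly_Mapping.single w 1)" and ?f = "\<lambda>x. if x \<in> C then P x else 0"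
  let ?s = "Poly_Mapping.single (?a, ?f) (1::complex)"
  have kw: "Poly_Mapping.keys (Poly_Mapping.single w (1::complex)) \<subseteq> lists (carrier (H_space C))" using step.hyps(3) by auto
  then have a: "?a \<in> carrier (Sh (H_space C))" unfolding carrier_Sh by blast
  have "?f \<in> regular_funs C" using step.hyps(2) by (auto simp: regular_funs_def)
  then have "r + ?s \<in> carrier TF" using a r(1) keys_add[of r ?s] by auto
  moreover have "lin_ext (ev x0 z) (r + ?s) = g z + P (p z) * coeff x0 w z" for z
    using p_in_C coeff_outside[OF x0] by (auto simp: r(2) ev_def f_tilde_shuffle_class[OF x0 kw] pullback_def)
  ultimately show ?case by (intro bexI[of _ "r + ?s"]) auto
qed

text \<open>Modulo relations \<open>r\<close> is a normal form over a basis. Its vanishing as a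
  function is a relation between the coefficients of \<open>L\<close>, whose coefficients are zero
  on \<open>C\<close> by \<open>coeff_independent\<close>.\<close>

lemma ev_kernel:
  assumes r: "r \<in> carrier TF" and z: "\<And>z. lin_ext (ev x0 z) r = 0"
  shows "r \<in> TR"
proof -
  obtain B where B: "finite B" "B \<subseteq> carrier (H_space C)"
    "\<And>h. h \<in> carrier (H_space C) \<Longrightarrow> \<exists>c. h = de_rham C (\<lambda>x v. \<Sum>b\<in>B. c b * J [b] x v)"
    "\<And>c. (\<lambda>x v. \<Sum>b\<in>B. c b * J [b] x v) \<in> exact_diffs C \<Longrightarrow> \<forall>b\<in>B. c b = 0"
    by (rule basis_exists) (rule that; assumption)
  obtain n where "reducible B n r" using reducible_all[OF B(1,2) _ r] B(3) by blast
  moreover have "reducible B n r \<longleftrightarrow> (\<exists>g. (\<forall>w. g w \<in> regular_funs C) \<and> r - normal_form B n g \<in> TR)"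
    by (rule reducible_def[OF B(1,2)]) (rule B(3); assumption)
  ultimately obtain g where g: "\<And>w. g w \<in> regular_funs C" "r - normal_form B n g \<in> TR" by blast
  have nf: "normal_form B n g = (\<Sum>w\<in>words B n. Poly_Mapping.single (word_class w, g w) 1)"
    by (rule normal_form_def[OF B(1,2)]) (rule B(3); assumption)
  have wc: "word_class w = shuffle_class C (Poly_Mapping.single w 1)" for w
    by (rule word_class_def)
  have "\<forall>w. \<exists>P. P \<in> poly_funs \<and> g w = (\<lambda>x. if x \<in> C then P x else 0)"
    using g(1) by (auto simp: regular_funs_def)
  from choice[OF this] obtain G where G: "\<And>w. G w \<in> poly_funs" "\<And>w. g w = (\<lambda>x. if x \<in> C then G w x else 0)" by blast
  have "relation B x0 n G \<longleftrightarrow> (\<forall>w. G w \<in> poly_funs) \<and> (\<forall>z\<in>U. (\<Sum>w\<in>words B n. G w (p z) * coeff x0 w z) = 0)"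
    by (rule relation_def[OF B(1) x0]) (rule B(4); assumption)
  moreover have "(\<forall>w. G w \<in> poly_funs) \<and> (\<forall>z\<in>U. (\<Sum>w\<in>words B n. G w (p z) * coeff x0 w z) = 0)"
  proof (intro conjI allI ballI G(1))
    fix z assume zU: "z \<in> U"
    \<comment> \<open>The coset of 0 consists of the relations themselves, so evaluation does not
      see the passage to the normal form.\<close>
    have "r - normal_form B n g \<in> TR +>\<^bsub>TF\<^esub> 0" using g(2) by (auto simp: a_r_coset_def')
    from ev_class[OF this, of z] have "lin_ext (ev x0 z) (normal_form B n g) = 0" using z by simp
    moreover have "lin_ext (ev x0 z) (normal_form B n g) = (\<Sum>w\<in>words B n. G w (p z) * coeff x0 w z)"
      unfolding nf lin_ext_sum
    proof (rule sum.cong[OF refl])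
      fix w assume "w \<in> words B n"
      then have kw: "Poly_Mapping.keys (Poly_Mapping.single w (1::complex)) \<subseteq> lists (carrier (H_space C))"
        using B(2) by (auto simp: words_def)
      show "lin_ext (ev x0 z) (Poly_Mapping.single (word_class w, g w) 1) = G w (p z) * coeff x0 w z"
        using zU p_in_C by (simp add: ev_def wc f_tilde_shuffle_class[OF x0 kw] pullback_def G(2))
    qed
    ultimately show "(\<Sum>w\<in>words B n. G w (p z) * coeff x0 w z) = 0" by simp
  qed
  ultimately have rel: "relation B x0 n G" by simp
  have "G w \<in> vanishing C" if w: "w \<in> words B n" for w
    by (rule coeff_independent[OF B(1) x0 _ rel w]) (rule B(4); assumption)
  then have g0: "g w = (\<lambda>_. 0)" if "w \<in> words B n" for w
    using vanishingD(2) that by (auto simp: G(2) fun_eq_iff)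
  \<comment> \<open>All its second factors are the zero function.\<close>
  have "normal_form B n g \<in> TR"
    unfolding nf
  proof (rule tp.tensor_rels_closed(5))
    fix w assume w: "w \<in> words B n"
    have "word_class w \<in> carrier (Sh (H_space C))"
      by (rule word_class_carrier[OF B(1,2) _ words_lists[OF w]]) (rule B(3); assumption)
    from single_zero_TR[OF this] show "Poly_Mapping.single (word_class w, g w) 1 \<in> TR" using g0[OF w] by simp
  qed
  from tp.tensor_rels_closed(1)[OF g(2) this] show ?thesis by simp
qed

text \<open>Evaluates a chosen representative; \<open>tensor_eval_eq\<close> removes the choice on
  sets where evaluation is constant.\<close>

definition tensor_eval where
  "tensor_eval X = (\<lambda>z. lin_ext (ev x0 z) (SOME r. r \<in> X))"

lemma tensor_eval_eq:
  assumes "r \<in> X" "\<And>s z. s \<in> X \<Longrightarrow> lin_ext (ev x0 z) s = lin_ext (ev x0 z) r"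
  shows "tensor_eval X = (\<lambda>z. lin_ext (ev x0 z) r)"
proof -
  have "(SOME r. r \<in> X) \<in> X" using assms(1) by (rule someI)
  then show ?thesis unfolding tensor_eval_def by (intro ext assms(2))
qed

lemma tensor_eval_class: "r \<in> carrier TF \<Longrightarrow> tensor_eval (TR +>\<^bsub>TF\<^esub> r) = (\<lambda>z. lin_ext (ev x0 z) r)"
  by (rule tensor_eval_eq[OF quot_rep_mem[OF tp.module_tensor_free tp.submodule_tensor_rels]]) (auto intro: ev_class)

lemma carrier_tensor: "carrier (tensor_alg (Sh (H_space C)) (O_alg C)) = {TR +>\<^bsub>TF\<^esub> r | r. r \<in> carrier TF}"
  unfolding tensor_alg_def by (rule quot_carrier[OF tp.module_tensor_free tp.submodule_tensor_rels])

lemma ones_carrier: "Poly_Mapping.single (\<one>\<^bsub>Sh (H_space C)\<^esub>, \<one>\<^bsub>O_alg C\<^esub>) 1 \<in> carrier TF"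
proof -
  have "\<one>\<^bsub>Sh (H_space C)\<^esub> \<in> carrier (Sh (H_space C))"
    unfolding Sh_one carrier_Sh by (intro CollectI exI[of _ "Poly_Mapping.single [] 1"]) auto
  moreover have "\<one>\<^bsub>O_alg C\<^esub> \<in> regular_funs C"
    unfolding regular_funs_def by (intro CollectI exI[of _ "\<lambda>_. 1"]) (auto intro: poly_funs.const)
  ultimately show ?thesis by (simp del: fun_alg_simps(3))
qed

text \<open>The target is \<open>hyperlogs x0\<close>: it is reached by
  \<open>hyperlogs_eval\<close>, and \<open>ev_kernel\<close> gives injectivity.\<close>

lemma tensor_eval_iso:
  "tensor_eval \<in> alg_iso (tensor_alg (Sh (H_space C)) (O_alg C)) (min_stable_subalgebra C U p)"
proof -
  let ?T = "tensor_alg (Sh (H_space C)) (O_alg C)" and ?M = "min_stable_subalgebra C U p"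
  note min = min_stable_hyperlogs[OF x0]
  have M: "carrier ?M = hyperlogs x0" "mult ?M = (\<lambda>f g x. f x * g x)" "one ?M = (\<lambda>x. if x \<in> U then 1 else 0)"
    "add ?M = (\<lambda>f g x. f x + g x)" "smult ?M = (\<lambda>c f x. c * f x)"
    unfolding min by simp_all
  have carrE: "\<exists>r. r \<in> carrier TF \<and> X = TR +>\<^bsub>TF\<^esub> r" if "X \<in> carrier ?T" for X
    using that unfolding carrier_tensor by blast
  have "tensor_eval \<in> ring_hom ?T ?M"
  proof (rule ring_hom_memI)
    fix X assume "X \<in> carrier ?T"
    then obtain r where "r \<in> carrier TF" "X = TR +>\<^bsub>TF\<^esub> r" using carrE by blast
    then show "tensor_eval X \<in> carrier ?M" using ev_hyperlogs by (simp only: M tensor_eval_class)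
  next
    fix X Y assume "X \<in> carrier ?T" "Y \<in> carrier ?T"
    then obtain r s where r: "r \<in> carrier TF" "X = TR +>\<^bsub>TF\<^esub> r" and s: "s \<in> carrier TF" "Y = TR +>\<^bsub>TF\<^esub> s"
      using carrE by blast
    \<comment> \<open>The product is a union over representatives, so evaluation has to be shown
      constant on the whole union.\<close>
    have XY: "X \<otimes>\<^bsub>?T\<^esub> Y = (\<Union>x\<in>X. \<Union>y\<in>Y. TR +>\<^bsub>TF\<^esub> (x \<otimes>\<^bsub>TF\<^esub> y))"
      by (simp add: tensor_alg_def quot_alg_def rcoset_mult_def)
    note rep = quot_rep_mem[OF tp.module_tensor_free tp.submodule_tensor_rels]
    have TR0: "y \<in> TR +>\<^bsub>TF\<^esub> y" for y using tp.tensor_rels_closed(3) by (auto simp: a_r_coset_def')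
    have "tensor_eval (X \<otimes>\<^bsub>?T\<^esub> Y) = (\<lambda>z. lin_ext (ev x0 z) (r \<otimes>\<^bsub>TF\<^esub> s))"
    proof (rule tensor_eval_eq)
      show "r \<otimes>\<^bsub>TF\<^esub> s \<in> X \<otimes>\<^bsub>?T\<^esub> Y" unfolding XY unfolding r(2) s(2) using rep[OF r(1)] rep[OF s(1)] TR0 by blast
      fix t z assume "t \<in> X \<otimes>\<^bsub>?T\<^esub> Y"
      then obtain x y where xy: "x \<in> X" "y \<in> Y" "t \<in> TR +>\<^bsub>TF\<^esub> (x \<otimes>\<^bsub>TF\<^esub> y)" unfolding XY by blast
      have c: "x \<in> carrier TF" "y \<in> carrier TF"
        using quot_mem_carrier[OF tp.module_tensor_free tp.submodule_tensor_rels] r s xy(1,2) by blast+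
      have "lin_ext (ev x0 z) t = lin_ext (ev x0 z) x * lin_ext (ev x0 z) y"
        using ev_class[OF xy(3)] ev_mult[OF c] by simp
      also have "\<dots> = lin_ext (ev x0 z) (r \<otimes>\<^bsub>TF\<^esub> s)"
        using ev_class xy(1,2) r(2) s(2) ev_mult[OF r(1) s(1)] by metis
      finally show "lin_ext (ev x0 z) t = lin_ext (ev x0 z) (r \<otimes>\<^bsub>TF\<^esub> s)" .
    qed
    then show "tensor_eval (X \<otimes>\<^bsub>?T\<^esub> Y) = tensor_eval X \<otimes>\<^bsub>?M\<^esub> tensor_eval Y"
      by (simp only: M r(2) s(2) tensor_eval_class[OF r(1)] tensor_eval_class[OF s(1)] ev_mult[OF r(1) s(1)])
    have rs: "r + s \<in> carrier TF" using r(1) s(1) keys_add[of r s] by auto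
    have "X \<oplus>\<^bsub>?T\<^esub> Y = TR +>\<^bsub>TF\<^esub> (r + s)"
      using quot_add[OF tp.module_tensor_free tp.submodule_tensor_rels r(1) s(1)]
      by (simp only: tensor_alg_def r(2) s(2) tensor_free_simps)
    then show "tensor_eval (X \<oplus>\<^bsub>?T\<^esub> Y) = tensor_eval X \<oplus>\<^bsub>?M\<^esub> tensor_eval Y"
      by (simp only: M r(2) s(2) tensor_eval_class[OF r(1)] tensor_eval_class[OF s(1)] tensor_eval_class[OF rs] lin_ext_add)
  next
    have "\<one>\<^bsub>?T\<^esub> = TR +>\<^bsub>TF\<^esub> Poly_Mapping.single (\<one>\<^bsub>Sh (H_space C)\<^esub>, \<one>\<^bsub>O_alg C\<^esub>) 1"
      by (simp add: tensor_alg_def quot_alg_def)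
    then have "tensor_eval \<one>\<^bsub>?T\<^esub> = (\<lambda>z. ev x0 z (\<one>\<^bsub>Sh (H_space C)\<^esub>, \<one>\<^bsub>O_alg C\<^esub>))"
      by (simp only: tensor_eval_class[OF ones_carrier]) simp
    then show "tensor_eval \<one>\<^bsub>?T\<^esub> = \<one>\<^bsub>?M\<^esub>"
      using p_in_C by (auto simp: M ev_def ft_one[OF x0] pullback_def fun_eq_iff)
  qed
  moreover have "inj_on tensor_eval (carrier ?T)"
  proof (rule inj_onI)
    fix X Y assume "X \<in> carrier ?T" "Y \<in> carrier ?T" and eq: "tensor_eval X = tensor_eval Y"
    then obtain r s where r: "r \<in> carrier TF" "X = TR +>\<^bsub>TF\<^esub> r" and s: "s \<in> carrier TF" "Y = TR +>\<^bsub>TF\<^esub> s"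
      using carrE by blast
    have rs: "r - s \<in> carrier TF" by (rule tensor_free_diff[OF r(1) s(1)])
    have "lin_ext (ev x0 z) (r - s) = 0" for z
      using fun_cong[OF eq, of z] by (simp add: r(2) s(2) tensor_eval_class[OF r(1)] tensor_eval_class[OF s(1)])
    then have "r - s \<in> TR" by (rule ev_kernel[OF rs])
    from quot_class_add[OF tp.module_tensor_free tp.submodule_tensor_rels this s(1)]
    show "X = Y" by (simp add: r(2) s(2))
  qed
  moreover have "tensor_eval ` carrier ?T = carrier ?M"
  proof (intro equalityI subsetI)
    fix f assume "f \<in> tensor_eval ` carrier ?T"
    then obtain r where "r \<in> carrier TF" "f = tensor_eval (TR +>\<^bsub>TF\<^esub> r)" using carrE by blast
    then show "f \<in> carrier ?M" using ev_hyperlogs by (simp only: M tensor_eval_class)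
  next
    fix f assume "f \<in> carrier ?M"
    then obtain r where r: "r \<in> carrier TF" "f = (\<lambda>z. lin_ext (ev x0 z) r)" using hyperlogs_eval M(1) by blast
    then have "f = tensor_eval (TR +>\<^bsub>TF\<^esub> r)" by (simp only: tensor_eval_class)
    moreover have "TR +>\<^bsub>TF\<^esub> r \<in> carrier ?T" unfolding carrier_tensor using r(1) by blast
    ultimately show "f \<in> tensor_eval ` carrier ?T" by blast
  qed
  moreover have "tensor_eval (c \<odot>\<^bsub>?T\<^esub> X) = c \<odot>\<^bsub>?M\<^esub> tensor_eval X" if X: "X \<in> carrier ?T" for c X
  proof -
    obtain r where r: "r \<in> carrier TF" "X = TR +>\<^bsub>TF\<^esub> r" using carrE[OF X] by blast
    have cr: "pm_scale c r \<in> carrier TF" using r(1) keys_pm_scale[of c r] by auto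
    have "c \<odot>\<^bsub>?T\<^esub> X = TR +>\<^bsub>TF\<^esub> pm_scale c r"
      using quot_smult[OF tp.module_tensor_free tp.submodule_tensor_rels r(1)]
      by (simp only: tensor_alg_def r(2) tensor_free_simps)
    then show ?thesis by (simp only: M r(2) tensor_eval_class[OF r(1)] tensor_eval_class[OF cr] lin_ext_scale)
  qed
  ultimately show ?thesis by (simp add: alg_iso_def ring_iso_def bij_betw_def)
qed

lemma tensor_eval_pure:
  assumes "a \<in> carrier (Sh (H_space C))" "f \<in> carrier (O_alg C)"
  shows "tensor_eval (pure_tensor (Sh (H_space C)) (O_alg C) a f) = (\<lambda>x. pullback U p f x * f_tilde C U p J x0 a x)"
proof -
  have "Poly_Mapping.single (a, f) 1 \<in> carrier TF" using assms by simp
  from tensor_eval_class[OF this] show ?thesis by (simp add: pure_tensor_def ev_def)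
qed

end

end

theorem theoremA:
  fixes C :: "(complex ^ 'n) set"
    and U :: "'u::topological_space set"
    and p :: "'u \<Rightarrow> complex ^ 'n"
  assumes "smooth_affine_curve C"
    and "universal_cover U p C"
  shows
    "(\<forall>J \<in> MC_nd C. \<forall>x0 \<in> U. \<forall>x1 \<in> U.
        f_tilde C U p J x0 ` carrier (Sh (H_space C)) = f_tilde C U p J x1 ` carrier (Sh (H_space C)))
     \<and>
     (\<forall>J \<in> MC_nd C. \<forall>x0 \<in> U.
        \<exists>F \<in> alg_iso (tensor_alg (Sh (H_space C)) (O_alg C)) (min_stable_subalgebra C U p).
          \<forall>a \<in> carrier (Sh (H_space C)). \<forall>f \<in> carrier (O_alg C).
            F (pure_tensor (Sh (H_space C)) (O_alg C) a f)
              = (\<lambda>x. pullback U p f x * f_tilde C U p J x0 a x))"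
proof (intro conjI ballI)
  fix J x0 x1 assume J: "J \<in> MC_nd C" and x: "x0 \<in> U" "x1 \<in> U"
  interpret mc_curve C U p J by unfold_locales (rule assms J)+
  show "f_tilde C U p J x0 ` carrier (Sh (H_space C)) = f_tilde C U p J x1 ` carrier (Sh (H_space C))"
    by (intro equalityI f_tilde_image_subset x)
next
  fix J x0 assume J: "J \<in> MC_nd C" and x0: "x0 \<in> U"
  interpret mc_curve C U p J by unfold_locales (rule assms J)+
  show "\<exists>F \<in> alg_iso (tensor_alg (Sh (H_space C)) (O_alg C)) (min_stable_subalgebra C U p).
          \<forall>a \<in> carrier (Sh (H_space C)). \<forall>f \<in> carrier (O_alg C).
            F (pure_tensor (Sh (H_space C)) (O_alg C) a f)
              = (\<lambda>x. pullback U p f x * f_tilde C U p J x0 a x)"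
    using tensor_eval_iso[OF x0] tensor_eval_pure[OF x0] by blast
qed

end
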